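(* Let $d\in\{2,3\}$, $T>0$, $\varepsilon>0$, $\sigma>0$. Let $v_n$ ($n\in\mathbb N$) and $v$ be $\mathbb R^d$-valued coefficients on $(0,T)\times\mathbb T^d$ such that $$\sup_n\|v_n\|_{L^2(0,T;L^\infty(\mathbb T^d))}+\|v\|_{L^2(0,T;L^\infty(\mathbb T^d))}<\infty,$$ $$\lim_{M\to\infty}\Big[\sup_n\|(I-P_M)v_n\|_{L^2(0,T;L^\infty(\mathbb T^d))}+\|(I-P_M)v\|_{L^2(0,T;L^\infty(\mathbb T^d))}\Big]=0,$$ and, for every fixed $k\in\mathbb Z^d$, $\widehat v_n(k)\rightharpoonup\widehat v(k)$ weakly in $L^2(0,T)$, where $\widehat v_n(k)$ is the $k$-th spatial Fourier coefficient as a function of $t$. Let $X_n=(E_n,B_{d,n})$ and $X=(E,B_d)$ be Maxwell--Ohm energy solutions with coefficients $v_n$ and $v$ respectively, with currents $j_n=\sigma(E_n+G_d(v_n,B_{d,n}))$ and $j=\sigma(E+G_d(v,B_d))$, and assume $X_n(0)\to X(0)$ strongly in $\mathcal H_d$. Then: 1. $X_n\to X$ strongly in $C([0,T];\mathcal H_d)$; 2. $j_n\rightharpoonup j$ weakly in $L^2((0,T)\times\mathbb T^d)$; 3. the Lorentz forces converge in the sense of distributions: $b_nRj_n\to bRj$ if $d=2$ (where $B_{2,n}=b_n$, $B_2=b$), and $j_n\times B_n\to j\times B$ if $d=3$ (where $B_{3,n}=B_n$, $B_3=B$). In particular, if $v_n\rightharpoonup v$ weakly in $L^2(0,T;H^s(\mathbb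 T^d))$ for some $s>d/2$ (and $X_n(0)\to X(0)$ strongly in $\mathcal H_d$), then conclusions 1--3 hold.
   Context: $\mathbb T^d=(\mathbb R/2\pi\mathbb Z)^d$ with Lebesgue measure; Fourier characters are $e^{ik\cdot x}$, $k\in\mathbb Z^d$; $P_M$ is the spatial Fourier projection onto $|k|\le M$. States are $X=(E,B_d)$, with $E$ taking values in $\mathbb R^d$, $B_2=b$ real-valued (for $d=2$), and $B_3=B$ taking values in $\mathbb R^3$ (for $d=3$). The energy space $\mathcal H_d$ consists of square-integrable states on $\mathbb T^d$ with norm $\|X\|_{\mathcal H_d}^2=\varepsilon\|E\|_{L^2}^2+\|B_d\|_{L^2}^2$. (No divergence constraint is imposed.) Set $R(z_1,z_2)=(z_2,-z_1)$. For $d=3$, $\operatorname{curl}=\nabla\times$. For $d=2$, $\operatorname{curl}b=R\nabla b$ for scalar $b$ and $\operatorname{curl}E=\partial_1E_2-\partial_2E_1$ for vector $E$. Define $G_2(v,b)=bRv$ and $G_3(v,B)=v\times B$. The Maxwell--Ohm system with prescribed velocity coefficient $v$ is $$\varepsilon\partial_tE-\operatorname{curl}B_d=-j,\qquad \partial_tB_d+\operatorname{curl}E=0,\qquad j=\sigma\bigl(E+G_d(v,B_d)\bigr).$$ For $v\in L^2(0,T;L^\infty(\mathbb T^d))$ and $X_0\in\mathcal H_d$, the (mild) energy solution with $X(0)=X_0$ is the unique $X\in C([0,T];\mathcal H_d)$ with $$X(t)=S_d(t)X_0+\int_0^tS_d(t-s)\mathcal B_v(s)X(s)\,ds,$$ where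 $S_d$ is the contraction semigroup on $\mathcal H_d$ generated by $A_{\sigma,d}(E,B_d)=(\varepsilon^{-1}\operatorname{curl}B_d-\sigma\varepsilon^{-1}E,\,-\operatorname{curl}E)$ on its maximal domain, and $\mathcal B_v(t)X=(-\sigma\varepsilon^{-1}G_d(v(t),B_d),0)$. *)

theory Defs
  imports "HOL-Analysis.Analysis" "HOL-Probability.Essential_Supremum"
begin

subsection \<open>The torus, square-integrable functions, weak convergence\<close>

text \<open>
  Functions on the torus are represented by functions on \<^typ>\<open>real^'d\<close>, of which only the values on
  the fundamental cube matter for Lebesgue classes. Classes are handled through Borel
  representatives, and equality in a Lebesgue space is equality almost everywhere.
\<close>

definition torus :: "(real^'d) measure" where
  "torus = restrict_space lborel {x. \<forall>i. 0 \<le> x $ i \<and> x $ i < 2 * pi}"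

definition time :: "real \<Rightarrow> real measure" where
  "time T = restrict_space lborel {0<..<T}"

abbreviation spacetime :: "real \<Rightarrow> (real \<times> (real^'d)) measure" where
  "spacetime T \<equiv> time T \<Otimes>\<^sub>M torus"

definition L2 :: "'a measure \<Rightarrow> ('a \<Rightarrow> 'c::euclidean_space) \<Rightarrow> bool" where
  "L2 M f \<longleftrightarrow> f \<in> borel_measurable M \<and> integrable M (\<lambda>x. (norm (f x))\<^sup>2)"

text \<open>
  The real inner product is used throughout. For complex-valued functions it is the real part of the
  Hermitian one; testing with \<open>g\<close> and \<open>\<i> g\<close> shows that the resulting weak convergence is the usual one.
\<close>

definition weak_L2_tendsto ::
    "'a measure \<Rightarrow> (nat \<Rightarrow> 'a \<Rightarrow> 'c::euclidean_space) \<Rightarrow> ('a \<Rightarrow> 'c) \<Rightarrow> bool" where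
  "weak_L2_tendsto M fs f \<longleftrightarrow>
     (\<forall>n. L2 M (fs n)) \<and> L2 M f \<and>
     (\<forall>g. L2 M g \<longrightarrow> (\<lambda>n. \<integral>x. fs n x \<bullet> g x \<partial>M) \<longlonglongrightarrow> (\<integral>x. f x \<bullet> g x \<partial>M))"

subsection \<open>Fourier series\<close>

definition freq :: "int^'d \<Rightarrow> real^'d" where
  "freq k = (\<chi> i. of_int (k $ i))"

definition cvec :: "real^'d \<Rightarrow> complex^'d" where
  "cvec x = (\<chi> i. of_real (x $ i))"

definition fourier :: "(real^'d \<Rightarrow> real^'d) \<Rightarrow> int^'d \<Rightarrow> complex^'d" where
  "fourier f k = (1 / (2 * pi) ^ CARD('d)) *\<^sub>R (\<integral>x. cis (- (freq k \<bullet> x)) *s cvec (f x) \<partial>torus)"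

definition fourier_proj :: "real \<Rightarrow> (real^'d \<Rightarrow> real^'d) \<Rightarrow> real^'d \<Rightarrow> complex^'d" where
  "fourier_proj M f x = (\<Sum>k | norm (freq k) \<le> M. cis (freq k \<bullet> x) *s fourier f k)"

definition fourier_tail :: "real \<Rightarrow> (real^'d \<Rightarrow> real^'d) \<Rightarrow> real^'d \<Rightarrow> complex^'d" where
  "fourier_tail M f x = cvec (f x) - fourier_proj M f x"

subsection \<open>Velocity coefficients\<close>

definition coefficient :: "real \<Rightarrow> (real \<Rightarrow> real^'d \<Rightarrow> real^'d) \<Rightarrow> bool" where
  "coefficient T v \<longleftrightarrow> (\<lambda>(t, x). v t x) \<in> borel_measurable (spacetime T)"

definition ennreal_sqrt :: "ennreal \<Rightarrow> ennreal" where
  "ennreal_sqrt a = (if a = \<infinity> then \<infinity> else ennreal (sqrt (enn2real a)))"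

definition L2Linf_norm :: "real \<Rightarrow> (real \<Rightarrow> real^'d \<Rightarrow> 'c::real_normed_vector) \<Rightarrow> ennreal" where
  "L2Linf_norm T f =
     ennreal_sqrt (\<integral>\<^sup>+ t. (esssup torus (\<lambda>x. ennreal (norm (f t x))))\<^sup>2 \<partial>time T)"

text \<open>
  \<open>H\<^sup>s\<close> carries the Fourier norm with weights \<open>(1 + |k|\<^sup>2)\<^sup>s\<close>. The slices are required to be
  square integrable, since otherwise the Fourier coefficients above would be meaningless.
\<close>

definition L2Hs :: "real \<Rightarrow> real \<Rightarrow> (real \<Rightarrow> real^'d \<Rightarrow> real^'d) \<Rightarrow> bool" where
  "L2Hs T s v \<longleftrightarrow> coefficient T v \<and> (AE t in time T. L2 torus (v t)) \<and>
     (\<integral>\<^sup>+ t. (\<Sum>\<^sub>\<infinity>k. ennreal ((1 + (norm (freq k))\<^sup>2) powr s * (norm (fourier (v t) k))\<^sup>2)) \<partial>time T) < \<infinity>"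

definition Hs_inner :: "real \<Rightarrow> (real^'d \<Rightarrow> real^'d) \<Rightarrow> (real^'d \<Rightarrow> real^'d) \<Rightarrow> real" where
  "Hs_inner s f g = (\<Sum>\<^sub>\<infinity>k. (1 + (norm (freq k))\<^sup>2) powr s * (fourier f k \<bullet> fourier g k))"

definition weak_L2Hs_tendsto ::
    "real \<Rightarrow> real \<Rightarrow> (nat \<Rightarrow> real \<Rightarrow> real^'d \<Rightarrow> real^'d) \<Rightarrow> (real \<Rightarrow> real^'d \<Rightarrow> real^'d) \<Rightarrow> bool" where
  "weak_L2Hs_tendsto T s vs v \<longleftrightarrow>
     (\<forall>n. L2Hs T s (vs n)) \<and> L2Hs T s v \<and>
     (\<forall>w. L2Hs T s w \<longrightarrow>
        (\<lambda>n. \<integral>t. Hs_inner s (vs n t) (w t) \<partial>time T) \<longlonglongrightarrow> (\<integral>t. Hs_inner s (v t) (w t) \<partial>time T))"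

subsection \<open>Test functions and curl operators\<close>

text \<open>\<open>C\<^sup>\<infinity>\<close>: all iterated directional derivatives exist and are Frechet differentiable.\<close>

primrec iter_deriv ::
    "'a list \<Rightarrow> ('a::euclidean_space \<Rightarrow> 'c::euclidean_space) \<Rightarrow> 'a \<Rightarrow> 'c" where
  "iter_deriv [] f = f"
| "iter_deriv (u # us) f = (\<lambda>x. frechet_derivative (iter_deriv us f) (at x) u)"

definition smooth :: "('a::euclidean_space \<Rightarrow> 'c::euclidean_space) \<Rightarrow> bool" where
  "smooth f \<longleftrightarrow> (\<forall>us x. iter_deriv us f differentiable (at x))"

definition periodic :: "(real^'d \<Rightarrow> 'c) \<Rightarrow> bool" where
  "periodic f \<longleftrightarrow> (\<forall>x i. f (x + axis i (2 * pi)) = f x)"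

definition spacetime_test :: "real \<Rightarrow> (real \<times> (real^'d) \<Rightarrow> 'c::euclidean_space) \<Rightarrow> bool" where
  "spacetime_test T \<phi> \<longleftrightarrow> smooth \<phi> \<and> (\<forall>t. periodic (\<lambda>x. \<phi> (t, x))) \<and>
     (\<exists>a b. 0 < a \<and> b < T \<and> (\<forall>t x. \<phi> (t, x) \<noteq> 0 \<longrightarrow> a \<le> t \<and> t \<le> b))"

text \<open>The integrability clauses below make each function a distribution on \<open>(0,T) \<times> \<T>\<^sup>d\<close>.\<close>

definition distr_tendsto ::
    "real \<Rightarrow> (nat \<Rightarrow> real \<times> (real^'d) \<Rightarrow> 'c::euclidean_space) \<Rightarrow> (real \<times> (real^'d) \<Rightarrow> 'c) \<Rightarrow> bool" where
  "distr_tendsto T Fs F \<longleftrightarrow> (\<forall>\<phi>. spacetime_test T \<phi> \<longrightarrow>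
     (\<forall>n. integrable (spacetime T) (\<lambda>z. Fs n z \<bullet> \<phi> z)) \<and> integrable (spacetime T) (\<lambda>z. F z \<bullet> \<phi> z) \<and>
     (\<lambda>n. \<integral>z. Fs n z \<bullet> \<phi> z \<partial>spacetime T) \<longlonglongrightarrow> (\<integral>z. F z \<bullet> \<phi> z \<partial>spacetime T))"

definition partial :: "'d \<Rightarrow> (real^'d \<Rightarrow> real) \<Rightarrow> real^'d \<Rightarrow> real" where
  "partial i f x = frechet_derivative f (at x) (axis i 1)"

definition rot :: "real^2 \<Rightarrow> real^2" where
  "rot z = vector [z $ 2, - z $ 1]"

definition curl_scalar :: "(real^2 \<Rightarrow> real) \<Rightarrow> real^2 \<Rightarrow> real^2" where
  "curl_scalar b x = rot (vector [partial 1 b x, partial 2 b x])"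

definition curl_planar :: "(real^2 \<Rightarrow> real^2) \<Rightarrow> real^2 \<Rightarrow> real" where
  "curl_planar E x = partial 1 (\<lambda>y. E y $ 2) x - partial 2 (\<lambda>y. E y $ 1) x"

definition curl3 :: "(real^3 \<Rightarrow> real^3) \<Rightarrow> real^3 \<Rightarrow> real^3" where
  "curl3 F x = vector
     [partial 2 (\<lambda>y. F y $ 3) x - partial 3 (\<lambda>y. F y $ 2) x,
      partial 3 (\<lambda>y. F y $ 1) x - partial 1 (\<lambda>y. F y $ 3) x,
      partial 1 (\<lambda>y. F y $ 2) x - partial 2 (\<lambda>y. F y $ 1) x]"

text \<open>
  \<open>distributional L' f g\<close> says that \<open>g\<close> is the distributional image of \<open>f\<close> under the first-order
  operator whose formal adjoint is \<open>L'\<close>. No sign appears for curls: \<^const>\<open>curl_scalar\<close> and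
  \<^const>\<open>curl_planar\<close> are formal adjoints of each other, and \<^const>\<open>curl3\<close> is formally self-adjoint.
\<close>

definition distributional ::
    "((real^'d \<Rightarrow> 'b::euclidean_space) \<Rightarrow> real^'d \<Rightarrow> 'a::euclidean_space) \<Rightarrow>
     (real^'d \<Rightarrow> 'a) \<Rightarrow> (real^'d \<Rightarrow> 'b) \<Rightarrow> bool" where
  "distributional L' f g \<longleftrightarrow> (\<forall>\<phi>. smooth \<phi> \<and> periodic \<phi> \<longrightarrow>
     (\<integral>x. g x \<bullet> \<phi> x \<partial>torus) = (\<integral>x. f x \<bullet> L' \<phi> x \<partial>torus))"

subsection \<open>Energy space, Maxwell operator and semigroup\<close>

text \<open>
  A state \<open>(E, B)\<close> is a function into a product. The type \<open>'b\<close> of magnetic values is \<^typ>\<open>real\<close> for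
  \<open>d = 2\<close> and \<^typ>\<open>real^3\<close> for \<open>d = 3\<close>. The two cases differ only in the curls and in \<open>G\<close>, which are
  parameters below: \<open>curlE\<close> acts on electric and \<open>curlB\<close> on magnetic fields.
\<close>

type_synonym ('d, 'b) state = "real^'d \<Rightarrow> (real^'d) \<times> 'b"

definition energy_space :: "('d::finite, 'b::euclidean_space) state set" where
  "energy_space = {X. L2 torus X}"

definition energy_norm :: "real \<Rightarrow> ('d::finite, 'b::euclidean_space) state \<Rightarrow> real" where
  "energy_norm \<epsilon> X =
     sqrt (\<epsilon> * (\<integral>x. (norm (fst (X x)))\<^sup>2 \<partial>torus) + (\<integral>x. (norm (snd (X x)))\<^sup>2 \<partial>torus))"

abbreviation energy_dist ::
    "real \<Rightarrow> ('d::finite, 'b::euclidean_space) state \<Rightarrow> ('d, 'b) state \<Rightarrow> real" where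
  "energy_dist \<epsilon> X Y \<equiv> energy_norm \<epsilon> (\<lambda>x. X x - Y x)"

text \<open>The graph of \<open>A\<^bsub>\<sigma>,d\<^esub>\<close> on its maximal domain; \<open>C\<close> is \<open>curl B\<close> and \<open>D\<close> is \<open>curl E\<close>.\<close>

definition maxwell_graph ::
    "((real^'d \<Rightarrow> real^'d) \<Rightarrow> real^'d \<Rightarrow> 'b) \<Rightarrow> ((real^'d \<Rightarrow> 'b) \<Rightarrow> real^'d \<Rightarrow> real^'d) \<Rightarrow> real \<Rightarrow> real \<Rightarrow>
     ('d::finite, 'b::euclidean_space) state \<Rightarrow> ('d, 'b) state \<Rightarrow> bool" where
  "maxwell_graph curlE curlB \<epsilon> \<sigma> X Y \<longleftrightarrow> X \<in> energy_space \<and> Y \<in> energy_space \<and>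
     (\<exists>C D. L2 torus C \<and> L2 torus D \<and>
        distributional curlE (\<lambda>x. snd (X x)) C \<and> distributional curlB (\<lambda>x. fst (X x)) D \<and>
        (AE x in torus. Y x = ((1 / \<epsilon>) *\<^sub>R C x - (\<sigma> / \<epsilon>) *\<^sub>R fst (X x), - D x)))"

definition contraction_semigroup ::
    "real \<Rightarrow> (real \<Rightarrow> ('d::finite, 'b::euclidean_space) state \<Rightarrow> ('d, 'b) state) \<Rightarrow> bool" where
  "contraction_semigroup \<epsilon> S \<longleftrightarrow>
     (\<forall>t\<ge>0. \<forall>X\<in>energy_space. S t X \<in> energy_space \<and> energy_norm \<epsilon> (S t X) \<le> energy_norm \<epsilon> X) \<and>
     (\<forall>t\<ge>0. \<forall>X\<in>energy_space. \<forall>Y\<in>energy_space. \<forall>a b.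
        AE x in torus. S t (\<lambda>x. a *\<^sub>R X x + b *\<^sub>R Y x) x = a *\<^sub>R S t X x + b *\<^sub>R S t Y x) \<and>
     (\<forall>X\<in>energy_space. AE x in torus. S 0 X x = X x) \<and>
     (\<forall>s\<ge>0. \<forall>t\<ge>0. \<forall>X\<in>energy_space. AE x in torus. S (s + t) X x = S s (S t X) x) \<and>
     (\<forall>X\<in>energy_space. ((\<lambda>t. energy_dist \<epsilon> (S t X) X) \<longlongrightarrow> 0) (at_right 0))"

definition generator_graph ::
    "real \<Rightarrow> (real \<Rightarrow> ('d::finite, 'b::euclidean_space) state \<Rightarrow> ('d, 'b) state) \<Rightarrow>
     ('d, 'b) state \<Rightarrow> ('d, 'b) state \<Rightarrow> bool" where
  "generator_graph \<epsilon> S X Y \<longleftrightarrow> X \<in> energy_space \<and> Y \<in> energy_space \<and>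
     ((\<lambda>h. energy_dist \<epsilon> (\<lambda>x. (1 / h) *\<^sub>R (S h X x - X x)) Y) \<longlongrightarrow> 0) (at_right 0)"

definition maxwell_semigroup ::
    "((real^'d \<Rightarrow> real^'d) \<Rightarrow> real^'d \<Rightarrow> 'b) \<Rightarrow> ((real^'d \<Rightarrow> 'b) \<Rightarrow> real^'d \<Rightarrow> real^'d) \<Rightarrow> real \<Rightarrow> real \<Rightarrow>
     (real \<Rightarrow> ('d::finite, 'b::euclidean_space) state \<Rightarrow> ('d, 'b) state) \<Rightarrow> bool" where
  "maxwell_semigroup curlE curlB \<epsilon> \<sigma> S \<longleftrightarrow>
     contraction_semigroup \<epsilon> S \<and> generator_graph \<epsilon> S = maxwell_graph curlE curlB \<epsilon> \<sigma>"

text \<open>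
  The Bochner integral in the energy space. The library's \<^const>\<open>has_bochner_integral\<close> needs a Banach
  space type, whereas states are representatives; the definition is otherwise the usual one.
\<close>

definition state_simple_integral ::
    "real measure \<Rightarrow> (real \<Rightarrow> ('d::finite, 'b::euclidean_space) state) \<Rightarrow> ('d, 'b) state" where
  "state_simple_integral M f =
     (\<lambda>x. \<Sum>Y\<in>f ` space M. measure M (f -` {Y} \<inter> space M) *\<^sub>R Y x)"

definition has_state_integral ::
    "real \<Rightarrow> real measure \<Rightarrow> (real \<Rightarrow> ('d::finite, 'b::euclidean_space) state) \<Rightarrow> ('d, 'b) state \<Rightarrow> bool" where
  "has_state_integral \<epsilon> M f I \<longleftrightarrow> I \<in> energy_space \<and> (AE t in M. f t \<in> energy_space) \<and>
     (\<exists>g. (\<forall>i. simple_function M (g i) \<and> g i ` space M \<subseteq> energy_space) \<and>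
          (AE t in M. (\<lambda>i. energy_dist \<epsilon> (g i t) (f t)) \<longlonglongrightarrow> 0) \<and>
          (\<lambda>i. \<integral>\<^sup>+ t. ennreal (energy_dist \<epsilon> (g i t) (f t)) \<partial>M) \<longlonglongrightarrow> 0 \<and>
          (\<lambda>i. energy_dist \<epsilon> (state_simple_integral M (g i)) I) \<longlonglongrightarrow> 0)"

subsection \<open>The Maxwell--Ohm system\<close>

definition G2 :: "real^2 \<Rightarrow> real \<Rightarrow> real^2" where
  "G2 v b = b *\<^sub>R rot v"

definition G3 :: "real^3 \<Rightarrow> real^3 \<Rightarrow> real^3" where
  "G3 v B = cross3 v B"

definition coupling ::
    "(real^'d \<Rightarrow> 'b \<Rightarrow> real^'d) \<Rightarrow> real \<Rightarrow> real \<Rightarrow> (real^'d \<Rightarrow> real^'d) \<Rightarrow>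
     ('d::finite, 'b::euclidean_space) state \<Rightarrow> ('d, 'b) state" where
  "coupling G \<epsilon> \<sigma> u X = (\<lambda>x. (- (\<sigma> / \<epsilon>) *\<^sub>R G (u x) (snd (X x)), 0))"

text \<open>
  An element of \<open>C([0,T]; \<H>)\<close> always has a representative that is jointly Borel in \<open>(t, x)\<close> and
  represents the right class for every \<open>t\<close>; solutions are taken in this form, so that currents and
  forces are functions on space-time. The initial datum is \<open>X 0\<close>.
\<close>

definition energy_solution ::
    "((real^'d \<Rightarrow> real^'d) \<Rightarrow> real^'d \<Rightarrow> 'b) \<Rightarrow> ((real^'d \<Rightarrow> 'b) \<Rightarrow> real^'d \<Rightarrow> real^'d) \<Rightarrow>
     (real^'d \<Rightarrow> 'b \<Rightarrow> real^'d) \<Rightarrow> real \<Rightarrow> real \<Rightarrow> real \<Rightarrow> (real \<Rightarrow> real^'d \<Rightarrow> real^'d) \<Rightarrow>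
     (real \<Rightarrow> ('d::finite, 'b::euclidean_space) state) \<Rightarrow> bool" where
  "energy_solution curlE curlB G T \<epsilon> \<sigma> v X \<longleftrightarrow>
     (\<lambda>(t, x). X t x) \<in> borel_measurable (restrict_space lborel {0..T} \<Otimes>\<^sub>M torus) \<and>
     (\<forall>t\<in>{0..T}. X t \<in> energy_space) \<and>
     (\<forall>t\<in>{0..T}. ((\<lambda>s. energy_dist \<epsilon> (X s) (X t)) \<longlongrightarrow> 0) (at t within {0..T})) \<and>
     (\<exists>S. maxwell_semigroup curlE curlB \<epsilon> \<sigma> S \<and>
       (\<forall>t\<in>{0..T}. \<exists>I.
          has_state_integral \<epsilon> (time t) (\<lambda>s. S (t - s) (coupling G \<epsilon> \<sigma> (v s) (X s))) I \<and>
          (AE x in torus. X t x = S t (X 0) x + I x)))"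

abbreviation energy_solution2 ::
    "real \<Rightarrow> real \<Rightarrow> real \<Rightarrow> (real \<Rightarrow> real^2 \<Rightarrow> real^2) \<Rightarrow> (real \<Rightarrow> (2, real) state) \<Rightarrow> bool" where
  "energy_solution2 \<equiv> energy_solution curl_planar curl_scalar G2"

abbreviation energy_solution3 ::
    "real \<Rightarrow> real \<Rightarrow> real \<Rightarrow> (real \<Rightarrow> real^3 \<Rightarrow> real^3) \<Rightarrow> (real \<Rightarrow> (3, real^3) state) \<Rightarrow> bool" where
  "energy_solution3 \<equiv> energy_solution curl3 curl3 G3"

definition current ::
    "(real^'d \<Rightarrow> 'b \<Rightarrow> real^'d) \<Rightarrow> real \<Rightarrow> (real \<Rightarrow> real^'d \<Rightarrow> real^'d) \<Rightarrow>
     (real \<Rightarrow> ('d::finite, 'b) state) \<Rightarrow> real \<times> (real^'d) \<Rightarrow> real^'d" where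
  "current G \<sigma> v X = (\<lambda>(t, x). \<sigma> *\<^sub>R (fst (X t x) + G (v t x) (snd (X t x))))"

definition lorentz2 ::
    "real \<Rightarrow> (real \<Rightarrow> real^2 \<Rightarrow> real^2) \<Rightarrow> (real \<Rightarrow> (2, real) state) \<Rightarrow> real \<times> (real^2) \<Rightarrow> real^2" where
  "lorentz2 \<sigma> v X = (\<lambda>(t, x). snd (X t x) *\<^sub>R rot (current G2 \<sigma> v X (t, x)))"

definition lorentz3 ::
    "real \<Rightarrow> (real \<Rightarrow> real^3 \<Rightarrow> real^3) \<Rightarrow> (real \<Rightarrow> (3, real^3) state) \<Rightarrow> real \<times> (real^3) \<Rightarrow> real^3" where
  "lorentz3 \<sigma> v X = (\<lambda>(t, x). cross3 (current G3 \<sigma> v X (t, x)) (snd (X t x)))"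

subsection \<open>Convergence of coefficients\<close>

text \<open>
  Suprema over \<open>n\<close> are taken in \<^typ>\<open>ennreal\<close>, so they are meaningful without a prior bound.
\<close>

definition spectral_convergence ::
    "real \<Rightarrow> (nat \<Rightarrow> real \<Rightarrow> real^'d \<Rightarrow> real^'d) \<Rightarrow> (real \<Rightarrow> real^'d \<Rightarrow> real^'d) \<Rightarrow> bool" where
  "spectral_convergence T vs v \<longleftrightarrow>
     (\<forall>n. coefficient T (vs n)) \<and> coefficient T v \<and>
     (SUP n. L2Linf_norm T (vs n)) + L2Linf_norm T v < \<infinity> \<and>
     (\<lambda>M::nat. (SUP n. L2Linf_norm T (\<lambda>t. fourier_tail (real M) (vs n t))) +
               L2Linf_norm T (\<lambda>t. fourier_tail (real M) (v t))) \<longlonglongrightarrow> 0 \<and>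
     (\<forall>k. weak_L2_tendsto (time T) (\<lambda>n t. fourier (vs n t) k) (\<lambda>t. fourier (v t) k))"

end

theory Submission
  imports Defs "HOL-Analysis.Analysis"
begin

text \<open>
  The states are compared in the Hilbert space of $L^2$ classes with the energy inner product, where
  the Maxwell--Ohm system becomes $x(t) = S_t x(0) + \int_0^t S_{t-s} b(s)\,ds$ with a contraction
  semigroup $S$ and the forcing $b = \mathcal{B}_v X$. Each solution comes with its own semigroup, but
  a contraction semigroup is determined by its generator, so all of them share one $S$. It suffices to
  have the integral equation tested against fixed vectors: then only real integrals occur, and no
  vector-valued integration is needed.

  The forcings differ by
  \[ \mathcal{B}_{v_n} X_n - \mathcal{B}_v X
     = \mathcal{B}_{v_n} (X_n - X) + \mathcal{B}_{v_n - v} X. \]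
  The first term is at most $m_n(s)\,\|X_n(s) - X(s)\|$ with $m_n$ bounded in $L^2(0,T)$, so Gronwall's
  inequality absorbs it. In the second one, $v_n - v$ is split into finitely many Fourier modes
  $\alpha_i^n(t) \varphi_i(x)$ and a remainder that is uniformly small in $L^2(0,T;L^\infty)$. The
  coefficients $\alpha_i^n$ tend to $0$ only weakly in $L^2(0,T)$, but each of them multiplies the
  fixed continuous curve $s \mapsto \mathcal{B}_{\varphi_i} X(s)$. Duhamel's integral is a
  compact operator in this situation: weakly null $\alpha^n$ give
  $\int_0^t \alpha^n(s) S_{t-s} F(s)\,ds \to 0$ uniformly in $t$ and in norm
  (\<open>weak_null_convolution\<close>). This gives strong convergence of the states
  (\<open>mild_solution_stability\<close>, \<open>classes_uniform_limit\<close>).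

  The same splitting of $v_n - v$ shows that the currents converge weakly (\<open>currents_weak\<close>). The
  Lorentz force is a bilinear expression in a weakly and a strongly convergent factor, hence it
  converges in the sense of distributions (\<open>force_distr_tendsto\<close>).

  The case of weak convergence in $L^2(0,T;H^s)$ with $s > d/2$ is reduced to the spectral
  hypotheses. A weakly convergent sequence is bounded (\<open>weak_L2_bounded\<close>), and by the Cauchy--Schwarz
  inequality a bound in $H^s$ controls the high frequencies in $L^\infty$ uniformly, because
  $\sum_k (1+|k|^2)^{-s} < \infty$ (\<open>sobolev_embedding\<close>). This uses that a square-integrable function
  with summable Fourier coefficients is almost everywhere the sum of its Fourier series
  (\<open>fourier_inversion\<close>), which rests on the Stone--Weierstrass theorem. Weak convergence of each
  single Fourier coefficient follows by testing with a single frequency, after the space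
  $L^2(0,T;H^s)$ has been identified with the square-integrable functions of time and frequency that
  have the symmetry $\overline{u(k)} = u(-k)$ (\<open>weak_sobolev\<close>).
\<close>

section \<open>Contraction semigroups and their generators\<close>

text \<open>
  A function whose upper right derivative is nowhere positive does not increase. The limit in the
  uniqueness proof below exists from the right only, so the mean value theorem is not available.
\<close>

lemma right_derivative_zero_imp_le:
  fixes \<phi> :: "real \<Rightarrow> real"
  assumes cont: "continuous_on {0..t} \<phi>" and t: "0 \<le> t"
    and deriv: "\<And>s \<eta>. 0 \<le> s \<Longrightarrow> s < t \<Longrightarrow> 0 < \<eta> \<Longrightarrow> \<forall>\<^sub>F h in at_right 0. \<phi> (s + h) \<le> \<phi> s + \<eta> * h"
  shows "\<phi> t \<le> \<phi> 0"
proof (rule field_le_epsilon)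
  fix e :: real assume e: "0 < e"
  \<comment> \<open>The slope \<open>\<eta>\<close> is allowed; it contributes at most \<open>e\<close> over \<open>[0,t]\<close>. The bound \<open>\<phi> r \<le> \<phi> 0 + \<eta> r\<close>
    is pushed to the right: the supremum \<open>m\<close> of all times up to which it holds must be \<open>t\<close>.\<close>
  define \<eta> where "\<eta> = e / (t + 1)"
  have \<eta>: "0 < \<eta>" using e t by (simp add: \<eta>_def)
  define A where "A = {s \<in> {0..t}. \<forall>r\<in>{0..s}. \<phi> r \<le> \<phi> 0 + \<eta> * r}"
  have A0: "0 \<in> A" using t by (auto simp: A_def)
  have bdd: "bdd_above A" by (rule bdd_aboveI[of _ t]) (auto simp: A_def)
  define m where "m = Sup A"
  have m0: "0 \<le> m" using cSup_upper[OF A0 bdd] by (simp add: m_def)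
  have mt: "m \<le> t" unfolding m_def by (rule cSup_least) (use A0 in \<open>auto simp: A_def\<close>)
  have below: "\<phi> r \<le> \<phi> 0 + \<eta> * r" if r: "0 \<le> r" "r < m" for r
  proof -
    obtain a where "a \<in> A" "r < a"
      using r(2) A0 less_cSup_iff[of A r] bdd unfolding m_def by blast
    with r(1) show ?thesis by (auto simp: A_def)
  qed
  have at_m: "\<phi> m \<le> \<phi> 0 + \<eta> * m"
  proof (cases "m = 0")
    case False
    hence "0 < m" using m0 by simp
    have "continuous_on {0..m} \<phi>" by (rule continuous_on_subset[OF cont]) (use mt in auto)
    hence c: "continuous_on {0..m} (\<lambda>r. \<phi> 0 + \<eta> * r - \<phi> r)" by (intro continuous_intros)
    have "0 \<le> \<phi> 0 + \<eta> * m - \<phi> m"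
    proof (rule continuous_ge_on_closure[where S = "{0..<m}" and f = "\<lambda>r. \<phi> 0 + \<eta> * r - \<phi> r" and x = m])
      show "continuous_on (closure {0..<m}) (\<lambda>r. \<phi> 0 + \<eta> * r - \<phi> r)"
        using c \<open>0 < m\<close> by simp
      show "m \<in> closure {0..<m}" using \<open>0 < m\<close> by simp
    qed (use below in auto)
    thus ?thesis by simp
  qed simp
  have "m = t"
  proof (rule ccontr)
    assume "m \<noteq> t"
    hence "m < t" using mt by simp
    from deriv[OF m0 this \<eta>] obtain b where b: "0 < b"
      and bb: "\<And>h. 0 < h \<Longrightarrow> h < b \<Longrightarrow> \<phi> (m + h) \<le> \<phi> m + \<eta> * h"
      by (auto simp: eventually_at_right_field)
    define c where "c = min (b / 2) (t - m)"
    have c: "0 < c" "c < b" "m + c \<le> t" using b \<open>m < t\<close> by (auto simp: c_def min_def)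
    have "m + c \<in> A"
      unfolding A_def
    proof (intro CollectI conjI ballI)
      show "m + c \<in> {0..t}" using c m0 by auto
      fix r assume r: "r \<in> {0..m + c}"
      show "\<phi> r \<le> \<phi> 0 + \<eta> * r"
      proof (cases "r \<le> m")
        case True
        then show ?thesis using below[of r] at_m r by (cases "r = m") auto
      next
        case False
        then have "\<phi> (m + (r - m)) \<le> \<phi> m + \<eta> * (r - m)" using r c by (intro bb) auto
        then show ?thesis using at_m by (simp add: algebra_simps)
      qed
    qed
    hence "m + c \<le> m" unfolding m_def by (rule cSup_upper[OF _ bdd])
    with c show False by simp
  qed
  have "\<eta> * t \<le> e" using e t by (simp add: \<eta>_def field_simps)
  with at_m \<open>m = t\<close> show "\<phi> t \<le> \<phi> 0 + e" by simp
qed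

locale contraction_flow =
  fixes S :: "real \<Rightarrow> 'a::banach \<Rightarrow> 'a"
  assumes linear: "0 \<le> t \<Longrightarrow> linear (S t)"
    and contraction: "0 \<le> t \<Longrightarrow> norm (S t x) \<le> norm x"
    and zero: "S 0 x = x"
    and add: "0 \<le> s \<Longrightarrow> 0 \<le> t \<Longrightarrow> S (s + t) x = S s (S t x)"
    and right_continuous: "((\<lambda>t. S t x) \<longlongrightarrow> x) (at_right 0)"
begin

lemma diff: "0 \<le> t \<Longrightarrow> S t (x - y) = S t x - S t y"
  using linear by (simp add: linear_diff)

lemma scaleR: "0 \<le> t \<Longrightarrow> S t (c *\<^sub>R x) = c *\<^sub>R S t x"
  using linear by (simp add: linear_cmul)

lemma bounded_linear: "0 \<le> t \<Longrightarrow> bounded_linear (S t)"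
  using linear contraction
  by (intro bounded_linear.intro bounded_linear_axioms.intro exI[of _ 1]) auto

lemma dist_le: "0 \<le> t \<Longrightarrow> dist (S t x) (S t y) \<le> dist x y"
  by (simp add: dist_norm flip: diff) (rule contraction)

text \<open>
  By the semigroup law and contractivity, increments at any time are dominated by increments at
  time zero. This turns right continuity at zero into continuity everywhere.
\<close>

lemma increment_le:
  assumes "0 \<le> s" "0 \<le> t" shows "dist (S s x) (S t x) \<le> dist (S \<bar>s - t\<bar> x) x"
proof -
  have *: "dist (S (a + b) x) (S a x) \<le> dist (S b x) x" if "0 \<le> a" "0 \<le> b" for a b
    using dist_le[OF that(1), of "S b x" x] that by (simp add: add)
  show ?thesis
  proof (cases "s \<le> t")
    case True with *[of s "t - s"] assms show ?thesis by (simp add: dist_commute)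
  next
    case False with *[of t "s - t"] assms show ?thesis by simp
  qed
qed

lemma continuous_on_flow:
  assumes \<tau>: "continuous_on A \<tau>" and F: "continuous_on A F" and nn: "\<And>p. p \<in> A \<Longrightarrow> 0 \<le> \<tau> p"
  shows "continuous_on A (\<lambda>p. S (\<tau> p) (F p))"
proof -
  have bd: "dist (S (\<tau> q) (F q)) (S (\<tau> p) (F p)) \<le> dist (F q) (F p) + dist (S \<bar>\<tau> q - \<tau> p\<bar> (F p)) (F p)"
    if "p \<in> A" "q \<in> A" for p q
    using dist_triangle[of "S (\<tau> q) (F q)" "S (\<tau> p) (F p)" "S (\<tau> q) (F p)"]
      dist_le[of "\<tau> q" "F q" "F p"] increment_le[of "\<tau> q" "\<tau> p" "F p"] nn[OF that(1)] nn[OF that(2)]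
    by simp
  have "((\<lambda>q. S (\<tau> q) (F q)) \<longlongrightarrow> S (\<tau> p) (F p)) (at p within A)" if p: "p \<in> A" for p
  proof -
    have "((\<lambda>q. \<bar>\<tau> q - \<tau> p\<bar>) \<longlongrightarrow> 0) (at p within A)"
      using \<tau> p unfolding continuous_on_def tendsto_rabs_zero_iff by (intro LIM_zero) blast
    moreover have "continuous (at 0 within {0..}) (\<lambda>r. dist (S r (F p)) (F p))"
      using right_continuous[of "F p"] by (simp add: continuous_within zero at_within_Ici_at_right tendsto_dist_iff[symmetric])
    ultimately have "((\<lambda>q. dist (S \<bar>\<tau> q - \<tau> p\<bar> (F p)) (F p)) \<longlongrightarrow> dist (S 0 (F p)) (F p)) (at p within A)"
      by (rule continuous_within_tendsto_compose'[rotated 2]) auto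
    hence "((\<lambda>q. dist (S \<bar>\<tau> q - \<tau> p\<bar> (F p)) (F p)) \<longlongrightarrow> 0) (at p within A)"
      by (simp add: zero)
    moreover have "((\<lambda>q. dist (F q) (F p)) \<longlongrightarrow> 0) (at p within A)"
      using F p unfolding continuous_on_def by (subst tendsto_dist_iff[symmetric]) blast
    ultimately have "((\<lambda>q. dist (F q) (F p) + dist (S \<bar>\<tau> q - \<tau> p\<bar> (F p)) (F p)) \<longlongrightarrow> 0 + 0) (at p within A)"
      by (rule tendsto_add[rotated])
    hence lim: "((\<lambda>q. dist (F q) (F p) + dist (S \<bar>\<tau> q - \<tau> p\<bar> (F p)) (F p)) \<longlongrightarrow> 0) (at p within A)"
      by simp
    have "((\<lambda>q. dist (S (\<tau> q) (F q)) (S (\<tau> p) (F p))) \<longlongrightarrow> 0) (at p within A)"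
    proof (rule tendsto_sandwich[OF _ _ tendsto_const lim])
      show "\<forall>\<^sub>F q in at p within A. dist (S (\<tau> q) (F q)) (S (\<tau> p) (F p))
          \<le> dist (F q) (F p) + dist (S \<bar>\<tau> q - \<tau> p\<bar> (F p)) (F p)"
        unfolding eventually_at_filter by (intro always_eventually allI impI bd p)
    qed (auto intro: always_eventually)
    thus ?thesis by (subst tendsto_dist_iff)
  qed
  thus ?thesis by (simp add: continuous_on_def)
qed

lemma continuous_on_orbit: "continuous_on {0..} (\<lambda>t. S t x)"
  by (rule continuous_on_flow) (auto intro: continuous_intros)

end

definition generator :: "(real \<Rightarrow> 'a::banach \<Rightarrow> 'a) \<Rightarrow> 'a \<Rightarrow> 'a \<Rightarrow> bool" where
  "generator S x y \<longleftrightarrow> ((\<lambda>h. (1 / h) *\<^sub>R (S h x - x)) \<longlongrightarrow> y) (at_right 0)"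

context contraction_flow
begin

text \<open>
  The domain of the generator is invariant, and the generator commutes with the semigroup.
\<close>

lemma generator_flow:
  assumes "generator S x y" "0 \<le> t" shows "generator S (S t x) (S t y)"
proof -
  have "((\<lambda>h. S t ((1 / h) *\<^sub>R (S h x - x))) \<longlongrightarrow> S t y) (at_right 0)"
    using assms by (intro bounded_linear.tendsto[OF bounded_linear]) (auto simp: generator_def)
  moreover have "\<forall>\<^sub>F h in at_right 0. S t ((1 / h) *\<^sub>R (S h x - x)) = (1 / h) *\<^sub>R (S h (S t x) - S t x)"
    using assms(2) by (auto simp: eventually_at_filter scaleR diff add[symmetric] add.commute intro!: always_eventually)
  ultimately show ?thesis unfolding generator_def by (rule Lim_transform_eventually)
qed

text \<open>
  Averages \<open>(1/h) integral {0..h} (\<lambda>r. S r x)\<close> over short times approximate \<open>x\<close>, and they lie in the domain: the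
  difference quotients of the averages telescope to boundary terms.
\<close>

lemma domain_dense:
  assumes "0 < e" shows "\<exists>y z. generator S y z \<and> dist y x < e"
proof -
  define \<Phi> where "\<Phi> t = integral {0..t} (\<lambda>r. S r x)" for t
  have cont: "continuous_on {0..t} (\<lambda>r. S r x)" for t
    by (rule continuous_on_subset[OF continuous_on_orbit]) auto
  have \<Phi>': "((\<lambda>r. (1 / r) *\<^sub>R (\<Phi> (t + r) - \<Phi> t)) \<longlongrightarrow> S t x) (at_right 0)" if t: "0 \<le> t" for t
  proof -
    have "(\<Phi> has_vector_derivative S t x) (at t within {0..t + 1})"
      unfolding \<Phi>_def by (rule integral_has_vector_derivative[OF cont]) (use t in auto)
    hence "(\<Phi> has_vector_derivative S t x) (at t within {t..t + 1})"
      by (rule has_vector_derivative_within_subset) (use t in auto)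
    hence "((\<lambda>u. (1 / norm (u - t)) *\<^sub>R (\<Phi> u - (\<Phi> t + (u - t) *\<^sub>R S t x))) \<longlongrightarrow> 0) (at_right t)"
      by (simp add: has_vector_derivative_def has_derivative_within at_within_Icc_at_right)
    hence "((\<lambda>r. (1 / norm r) *\<^sub>R (\<Phi> (t + r) - (\<Phi> t + r *\<^sub>R S t x)) + S t x) \<longlongrightarrow> 0 + S t x) (at_right 0)"
      by (subst (asm) filterlim_at_right_to_0) (intro tendsto_intros, simp add: add.commute)
    moreover have "\<forall>\<^sub>F r in at_right 0. (1 / norm r) *\<^sub>R (\<Phi> (t + r) - (\<Phi> t + r *\<^sub>R S t x)) + S t x
        = (1 / r) *\<^sub>R (\<Phi> (t + r) - \<Phi> t)"
      by (auto simp: eventually_at_filter algebra_simps intro!: always_eventually)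
    ultimately have "((\<lambda>r. (1 / r) *\<^sub>R (\<Phi> (t + r) - \<Phi> t)) \<longlongrightarrow> 0 + S t x) (at_right 0)"
      by (rule Lim_transform_eventually)
    thus ?thesis by simp
  qed
  have \<Phi>0: "\<Phi> 0 = 0" by (simp add: \<Phi>_def)
  have gen: "generator S (\<Phi> h) (S h x - x)" if h: "0 < h" for h
  proof -
    have eq: "S r (\<Phi> h) = \<Phi> (h + r) - \<Phi> r" if r: "0 < r" for r
    proof -
      have "S r (\<Phi> h) = integral {0..h} (\<lambda>q. S r (S q x))"
        unfolding \<Phi>_def using r
        by (subst integral_linear[symmetric, OF _ bounded_linear])
           (auto simp: o_def intro!: integrable_continuous_interval cont)
      also have "\<dots> = integral {0..h} (\<lambda>q. S (q + r) x)"
        using r by (intro integral_cong) (auto simp: add[symmetric] add.commute)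
      also have "\<dots> = integral {r..h + r} (\<lambda>q. S q x)"
        using integral_shift_Icc_real[of 0 h "\<lambda>q. S q x" r] by (simp add: o_def add.commute)
      also have "\<dots> = \<Phi> (h + r) - \<Phi> r"
        unfolding \<Phi>_def using r h
        by (subst Henstock_Kurzweil_Integration.integral_combine[symmetric, of 0 r "h + r"])
           (auto intro!: integrable_continuous_interval cont)
      finally show ?thesis .
    qed
    have "((\<lambda>r. (1 / r) *\<^sub>R (\<Phi> (h + r) - \<Phi> h) - (1 / r) *\<^sub>R (\<Phi> (0 + r) - \<Phi> 0)) \<longlongrightarrow> S h x - S 0 x) (at_right 0)"
      using h by (intro tendsto_diff \<Phi>') auto
    moreover have "\<forall>\<^sub>F r in at_right 0. (1 / r) *\<^sub>R (\<Phi> (h + r) - \<Phi> h) - (1 / r) *\<^sub>R (\<Phi> (0 + r) - \<Phi> 0)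
        = (1 / r) *\<^sub>R (S r (\<Phi> h) - \<Phi> h)"
      by (auto simp: eventually_at_filter eq algebra_simps \<Phi>0 intro!: always_eventually)
    ultimately show ?thesis
      unfolding generator_def zero by (rule Lim_transform_eventually)
  qed
  have "((\<lambda>h. (1 / h) *\<^sub>R \<Phi> h) \<longlongrightarrow> x) (at_right 0)"
    using \<Phi>'[of 0] by (simp add: zero \<Phi>0)
  hence "\<forall>\<^sub>F h in at_right 0. dist ((1 / h) *\<^sub>R \<Phi> h) x < e"
    using assms by (rule tendstoD)
  hence "\<forall>\<^sub>F h in at_right 0. dist ((1 / h) *\<^sub>R \<Phi> h) x < e \<and> 0 < h"
    by (intro eventually_conj) (auto simp: eventually_at_filter)
  from eventually_happens'[OF trivial_limit_at_right_real this]
  obtain h where h: "0 < h" "dist ((1 / h) *\<^sub>R \<Phi> h) x < e" by blast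
  have "generator S ((1 / h) *\<^sub>R \<Phi> h) ((1 / h) *\<^sub>R (S h x - x))"
  proof -
    have "((\<lambda>r. (1 / h) *\<^sub>R ((1 / r) *\<^sub>R (S r (\<Phi> h) - \<Phi> h))) \<longlongrightarrow> (1 / h) *\<^sub>R (S h x - x)) (at_right 0)"
      using gen[OF h(1)] by (intro tendsto_intros) (simp add: generator_def)
    moreover have "\<forall>\<^sub>F r in at_right 0. (1 / h) *\<^sub>R ((1 / r) *\<^sub>R (S r (\<Phi> h) - \<Phi> h))
       = (1 / r) *\<^sub>R (S r ((1 / h) *\<^sub>R \<Phi> h) - (1 / h) *\<^sub>R \<Phi> h)"
      by (auto simp: eventually_at_filter scaleR algebra_simps intro!: always_eventually)
    ultimately show ?thesis unfolding generator_def by (rule Lim_transform_eventually)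
  qed
  with h show ?thesis by blast
qed

end

text \<open>
  For \<open>y\<close> in the domain, \<open>s \<mapsto> S (t - s) (S' s y)\<close> has right derivative zero, because the two generators
  cancel. Hence its values at \<open>0\<close> and \<open>t\<close> agree. The domain is dense and both semigroups contract, so
  the equality extends to all vectors.
\<close>

lemma contraction_flow_unique:
  assumes S: "contraction_flow S" and S': "contraction_flow S'"
    and gen: "generator S = generator S'" and t: "0 \<le> t"
  shows "S t x = S' t x"
proof -
  interpret S: contraction_flow S by fact
  interpret S': contraction_flow S' by fact
  have dom: "S' t y = S t y" if y: "generator S y z" for y z
  proof -
    define \<phi> where "\<phi> s = dist (S (t - s) (S' s y)) (S t y)" for s
    have "\<phi> t \<le> \<phi> 0"
    proof (rule right_derivative_zero_imp_le[OF _ t])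
      show "continuous_on {0..t} \<phi>" unfolding \<phi>_def
        by (intro continuous_on_dist S.continuous_on_flow continuous_on_const continuous_intros
             continuous_on_subset[OF S'.continuous_on_orbit]) auto
      fix s \<eta> :: real assume s: "0 \<le> s" "s < t" and \<eta>: "0 < \<eta>"
      define u where "u = S' s y"
      have "generator S' u (S' s z)" using S'.generator_flow y s by (simp add: u_def gen)
      moreover from this have "generator S u (S' s z)" by (simp add: gen)
      ultimately have "((\<lambda>h. (1 / h) *\<^sub>R (S' h u - u) - (1 / h) *\<^sub>R (S h u - u)) \<longlongrightarrow> S' s z - S' s z) (at_right 0)"
        unfolding generator_def by (rule tendsto_diff)
      hence "\<forall>\<^sub>F h in at_right 0. dist ((1 / h) *\<^sub>R (S' h u - u) - (1 / h) *\<^sub>R (S h u - u)) (S' s z - S' s z) < \<eta>"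
        using \<eta> by (rule tendstoD)
      moreover have "\<forall>\<^sub>F h in at_right 0. 0 < h \<and> h < t - s"
        using s by (auto simp: eventually_at_right_field intro!: exI[of _ "t - s"])
      ultimately show "\<forall>\<^sub>F h in at_right 0. \<phi> (s + h) \<le> \<phi> s + \<eta> * h"
      proof eventually_elim
        case (elim h)
        have "norm (S' h u - S h u) \<le> \<eta> * h"
        proof -
          have "(1 / h) *\<^sub>R (S' h u - u) - (1 / h) *\<^sub>R (S h u - u) - (S' s z - S' s z)
              = (1 / h) *\<^sub>R (S' h u - S h u)"
            by (simp add: algebra_simps)
          hence "norm ((1 / h) *\<^sub>R (S' h u - S h u)) < \<eta>" using elim by (simp only: dist_norm)
          moreover have "norm ((1 / h) *\<^sub>R (S' h u - S h u)) = norm (S' h u - S h u) / h"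
            using elim by simp
          ultimately show ?thesis using elim by (simp add: pos_divide_less_eq)
        qed
        moreover have "S' (s + h) y = S' h u" using s elim by (simp add: u_def add.commute S'.add[symmetric])
        moreover have "S (t - s) u = S (t - (s + h)) (S h u)"
          using s elim by (simp add: S.add[symmetric])
        ultimately have "dist (S (t - (s + h)) (S' (s + h) y)) (S (t - s) (S' s y)) \<le> \<eta> * h"
          using S.dist_le[of "t - (s + h)" "S' h u" "S h u"] elim by (simp add: u_def dist_norm)
        thus ?case unfolding \<phi>_def
          using dist_triangle[of "S (t - (s + h)) (S' (s + h) y)" "S t y" "S (t - s) (S' s y)"] by simp
      qed
    qed
    thus ?thesis by (simp add: \<phi>_def S.zero S'.zero)
  qed
  have "dist (S t x) (S' t x) \<le> 0 + e" if e: "0 < e" for e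
  proof -
    obtain y z where y: "generator S y z" "dist y x < e / 2"
      using S.domain_dense[of "e / 2" x] e by auto
    have "dist (S t x) (S' t x) \<le> dist (S t x) (S t y) + dist (S' t y) (S' t x)"
      using dist_triangle[of "S t x" "S' t x" "S t y"] dom[OF y(1)] by simp
    also have "\<dots> \<le> dist x y + dist y x"
      by (intro add_mono S.dist_le S'.dist_le t)
    also have "\<dots> \<le> e" using y(2) by (simp add: dist_commute)
    finally show ?thesis by simp
  qed
  hence "dist (S t x) (S' t x) \<le> 0" by (rule field_le_epsilon)
  thus ?thesis by simp
qed

section \<open>Square-integrable functions\<close>

definition L2_norm :: "'a measure \<Rightarrow> ('a \<Rightarrow> 'c::euclidean_space) \<Rightarrow> real" where
  "L2_norm M f = sqrt (\<integral>x. (norm (f x))\<^sup>2 \<partial>M)"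

lemma L2_norm_nonneg [simp]: "0 \<le> L2_norm M f"
  by (simp add: L2_norm_def)

lemma L2_norm_power2: "(L2_norm M f)\<^sup>2 = (\<integral>x. (norm (f x))\<^sup>2 \<partial>M)"
  by (simp add: L2_norm_def)

lemma L2_measurable [measurable_dest]: "L2 M f \<Longrightarrow> f \<in> borel_measurable M"
  by (simp add: L2_def)

lemma L2_integrable: "L2 M f \<Longrightarrow> integrable M (\<lambda>x. (norm (f x))\<^sup>2)"
  by (simp add: L2_def)

lemma L2_bound:
  assumes g: "L2 M g" and f: "f \<in> borel_measurable M" and le: "AE x in M. norm (f x) \<le> norm (g x)"
  shows "L2 M f"
  unfolding L2_def
proof (intro conjI f)
  show "integrable M (\<lambda>x. (norm (f x))\<^sup>2)"
    using L2_integrable[OF g]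
  proof (rule Bochner_Integration.integrable_bound)
    show "AE x in M. norm ((norm (f x))\<^sup>2) \<le> norm ((norm (g x))\<^sup>2)"
      using le by eventually_elim (simp add: power_mono)
  qed (use f in measurable)
qed

lemma L2_norm_mono:
  assumes g: "L2 M g" and le: "AE x in M. norm (f x) \<le> norm (g x)"
  shows "L2_norm M f \<le> L2_norm M g"
proof -
  have "(\<integral>x. (norm (f x))\<^sup>2 \<partial>M) \<le> (\<integral>x. (norm (g x))\<^sup>2 \<partial>M)"
    by (rule integral_mono_AE'[OF L2_integrable[OF g]])
       (use le in \<open>auto elim!: eventually_mono intro!: power_mono\<close>)
  thus ?thesis by (simp add: L2_norm_def)
qed

lemma L2_zero [simp]: "L2 M (\<lambda>x. 0)"
  by (simp add: L2_def)

lemma L2_add: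
  assumes f: "L2 M f" and g: "L2 M g" shows "L2 M (\<lambda>x. f x + g x)"
  unfolding L2_def
proof
  show "(\<lambda>x. f x + g x) \<in> borel_measurable M" using f g by measurable
  have "integrable M (\<lambda>x. 2 * ((norm (f x))\<^sup>2 + (norm (g x))\<^sup>2))"
    using f g by (intro integrable_mult_right Bochner_Integration.integrable_add L2_integrable)
  thus "integrable M (\<lambda>x. (norm (f x + g x))\<^sup>2)"
  proof (rule Bochner_Integration.integrable_bound)
    have "(norm (a + b))\<^sup>2 \<le> 2 * ((norm a)\<^sup>2 + (norm b)\<^sup>2)" for a b :: 'b
      using inner_ge_zero[of "a - b"] by (simp add: power2_norm_eq_inner inner_add inner_diff inner_commute)
    thus "AE x in M. norm ((norm (f x + g x))\<^sup>2) \<le> norm (2 * ((norm (f x))\<^sup>2 + (norm (g x))\<^sup>2))"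
      by simp
  qed (use f g in measurable)
qed

lemma L2_scaleR: "L2 M f \<Longrightarrow> L2 M (\<lambda>x. c *\<^sub>R f x)"
  by (auto simp: L2_def power_mult_distrib)

lemma L2_diff: "L2 M f \<Longrightarrow> L2 M g \<Longrightarrow> L2 M (\<lambda>x. f x - g x)"
  using L2_add[of M f "\<lambda>x. (-1) *\<^sub>R g x"] L2_scaleR[of M g "-1"] by simp

lemma L2_sum: "(\<And>i. i \<in> I \<Longrightarrow> L2 M (f i)) \<Longrightarrow> L2 M (\<lambda>x. \<Sum>i\<in>I. f i x)"
  by (induction I rule: infinite_finite_induct) (auto intro: L2_add)

lemma L2_norm_fun: "L2 M f \<Longrightarrow> L2 M (\<lambda>x. norm (f x))"
  by (auto simp: L2_def)

lemma L2_norm_norm [simp]: "L2_norm M (\<lambda>x. norm (f x)) = L2_norm M f"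
  by (simp add: L2_norm_def)

lemma L2_bounded_linear:
  assumes h: "bounded_linear h" and f: "L2 M f" shows "L2 M (\<lambda>x. h (f x))"
proof -
  obtain K where K: "\<And>x. norm (h x) \<le> norm x * K" using bounded_linear.bounded[OF h] by blast
  have "norm (h x) \<le> norm (K *\<^sub>R x)" for x
    using K[of x] mult_right_mono[OF abs_ge_self[of K] norm_ge_zero[of x]] by (simp add: mult.commute)
  moreover have "h \<in> borel_measurable borel"
    using h by (simp add: borel_measurable_continuous_onI linear_continuous_on)
  ultimately show ?thesis
    using f by (intro L2_bound[OF L2_scaleR[OF f, of K]]) (auto intro: measurable_compose L2_measurable)
qed

lemma L2_mult_integrable:
  assumes f: "L2 M f" and g: "L2 M g" shows "integrable M (\<lambda>x. norm (f x) * norm (g x))"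
proof (rule Bochner_Integration.integrable_bound)
  show "integrable M (\<lambda>x. (norm (f x))\<^sup>2 + (norm (g x))\<^sup>2)"
    using f g by (intro Bochner_Integration.integrable_add L2_integrable)
  have "a * b \<le> a\<^sup>2 + b\<^sup>2" if "0 \<le> a" "0 \<le> b" for a b :: real
  proof -
    have "2 * a * b \<le> a\<^sup>2 + b\<^sup>2" by (rule sum_squares_bound)
    moreover have "0 \<le> a * b" using that by simp
    ultimately show ?thesis by simp
  qed
  thus "AE x in M. norm (norm (f x) * norm (g x)) \<le> norm ((norm (f x))\<^sup>2 + (norm (g x))\<^sup>2)"
    by (auto simp: abs_mult)
qed (use f g in measurable)

lemma L2_inner_integrable:
  assumes "L2 M f" "L2 M g" shows "integrable M (\<lambda>x. f x \<bullet> g x)"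
  by (rule Bochner_Integration.integrable_bound[OF L2_mult_integrable[OF assms]])
     (use assms in \<open>auto simp: Cauchy_Schwarz_ineq2 abs_mult\<close>)

lemma L2_norm_nn_integral:
  assumes "L2 M f" shows "(\<integral>\<^sup>+ x. ennreal ((norm (f x))\<^sup>2) \<partial>M) = ennreal ((L2_norm M f)\<^sup>2)"
  unfolding L2_norm_power2 by (rule nn_integral_eq_integral[OF L2_integrable[OF assms]]) simp

lemma L2_mult_Cauchy_Schwarz:
  assumes f: "L2 M f" and g: "L2 M g"
  shows "(\<integral>x. norm (f x) * norm (g x) \<partial>M) \<le> L2_norm M f * L2_norm M g"
proof -
  have [measurable]: "f \<in> borel_measurable M" "g \<in> borel_measurable M"
    using f g by (auto intro: L2_measurable)
  have int: "(\<integral>\<^sup>+x. ennreal (norm (f x)) * ennreal (norm (g x)) \<partial>M) = ennreal (\<integral>x. norm (f x) * norm (g x) \<partial>M)"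
    unfolding ennreal_mult''[symmetric, OF norm_ge_zero]
    by (rule nn_integral_eq_integral[OF L2_mult_integrable[OF f g]]) simp
  have "ennreal ((\<integral>x. norm (f x) * norm (g x) \<partial>M)\<^sup>2) \<le> ennreal ((L2_norm M f)\<^sup>2) * ennreal ((L2_norm M g)\<^sup>2)"
    using Cauchy_Schwarz_nn_integral[of "\<lambda>x. ennreal (norm (f x))" M "\<lambda>x. ennreal (norm (g x))"]
      L2_norm_nn_integral[OF f] L2_norm_nn_integral[OF g]
    by (simp add: int ennreal_power)
  hence "(\<integral>x. norm (f x) * norm (g x) \<partial>M)\<^sup>2 \<le> (L2_norm M f * L2_norm M g)\<^sup>2"
    by (simp add: ennreal_mult''[symmetric] power_mult_distrib)
  thus ?thesis by (rule power2_le_imp_le) simp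
qed

lemma L2_Cauchy_Schwarz:
  assumes f: "L2 M f" and g: "L2 M g"
  shows "\<bar>\<integral>x. f x \<bullet> g x \<partial>M\<bar> \<le> L2_norm M f * L2_norm M g"
proof -
  have "\<bar>\<integral>x. f x \<bullet> g x \<partial>M\<bar> \<le> (\<integral>x. norm (f x) * norm (g x) \<partial>M)"
    by (rule integral_abs_bound[THEN order_trans], rule integral_mono_AE')
       (auto intro: L2_mult_integrable f g Cauchy_Schwarz_ineq2)
  with L2_mult_Cauchy_Schwarz[OF f g] show ?thesis by simp
qed

lemma L2_norm_triangle:
  assumes f: "L2 M f" and g: "L2 M g"
  shows "L2_norm M (\<lambda>x. f x + g x) \<le> L2_norm M f + L2_norm M g"
proof -
  have "(L2_norm M (\<lambda>x. f x + g x))\<^sup>2 = (\<integral>x. (norm (f x))\<^sup>2 + 2 * (f x \<bullet> g x) + (norm (g x))\<^sup>2 \<partial>M)"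
    unfolding L2_norm_power2
    by (intro Bochner_Integration.integral_cong) (auto simp: power2_norm_eq_inner inner_add inner_commute)
  also have "\<dots> = (L2_norm M f)\<^sup>2 + 2 * (\<integral>x. f x \<bullet> g x \<partial>M) + (L2_norm M g)\<^sup>2"
    using f g by (simp add: L2_norm_power2 L2_integrable L2_inner_integrable)
  also have "\<dots> \<le> (L2_norm M f + L2_norm M g)\<^sup>2"
    using L2_Cauchy_Schwarz[OF f g] by (simp add: power2_sum)
  finally show ?thesis by (rule power2_le_imp_le) simp
qed

lemma L2_norm_scaleR: "L2_norm M (\<lambda>x. c *\<^sub>R f x) = \<bar>c\<bar> * L2_norm M f"
  by (simp add: L2_norm_def power_mult_distrib real_sqrt_mult)

lemma L2_norm_sum_le:
  "(\<And>i. i \<in> I \<Longrightarrow> L2 M (f i)) \<Longrightarrow> L2_norm M (\<lambda>x. \<Sum>i\<in>I. f i x) \<le> (\<Sum>i\<in>I. L2_norm M (f i))"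
proof (induction I rule: infinite_finite_induct)
  case (insert i I)
  then show ?case using L2_norm_triangle[of M "f i" "\<lambda>x. \<Sum>i\<in>I. f i x"] by (force intro: L2_sum)
qed (auto simp: L2_norm_def)

lemma L2_I_nn_integral:
  assumes f: "f \<in> borel_measurable M" and le: "(\<integral>\<^sup>+ x. ennreal ((norm (f x))\<^sup>2) \<partial>M) \<le> ennreal (c\<^sup>2)" and c: "0 \<le> c"
  shows "L2 M f" and "L2_norm M f \<le> c"
proof -
  show "L2 M f" unfolding L2_def
    using f le by (auto intro!: integrableI_bounded simp: le_less_trans)
  from L2_norm_nn_integral[OF this] le have "(L2_norm M f)\<^sup>2 \<le> c\<^sup>2" by simp
  thus "L2_norm M f \<le> c" using c by (rule power2_le_imp_le)
qed

text \<open>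
  The Riesz--Fischer theorem in the form of absolutely convergent series. The partial sums of
  \<open>norm (f i x)\<close> increase to a majorant \<open>H\<close>, which is square integrable by monotone convergence; then
  the series converges almost everywhere, and in the mean by dominated convergence.
\<close>

lemma L2_series:
  fixes f :: "nat \<Rightarrow> 'a \<Rightarrow> 'c::euclidean_space"
  assumes f: "\<And>i. L2 M (f i)" and summ: "summable (\<lambda>i. L2_norm M (f i))"
  shows "\<exists>g. L2 M g \<and> (\<lambda>n. L2_norm M (\<lambda>x. (\<Sum>i<n. f i x) - g x)) \<longlonglongrightarrow> 0"
proof -
  have [measurable]: "f i \<in> borel_measurable M" for i using f by (rule L2_measurable)
  define C where "C = (\<Sum>i. L2_norm M (f i))"
  have C0: "0 \<le> C" unfolding C_def using summ by (rule suminf_nonneg) simp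
  define G where "G n x = (\<Sum>i<n. norm (f i x))" for n x
  have [measurable]: "G n \<in> borel_measurable M" for n unfolding G_def by measurable
  have GL2: "L2 M (G n)" for n unfolding G_def using f by (intro L2_sum L2_norm_fun)
  have GC: "L2_norm M (G n) \<le> C" for n
  proof -
    have "L2_norm M (G n) \<le> (\<Sum>i<n. L2_norm M (f i))"
      unfolding G_def using L2_norm_sum_le[of "{..<n}" M "\<lambda>i x. norm (f i x)"] f by (simp add: L2_norm_fun)
    also have "\<dots> \<le> C" unfolding C_def using summ by (rule sum_le_suminf) auto
    finally show ?thesis .
  qed
  have G0: "0 \<le> G n x" for n x by (simp add: G_def sum_nonneg)
  have Gmono: "G m x \<le> G n x" if "m \<le> n" for m n x
    unfolding G_def by (rule sum_mono2) (use that in auto)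
  have "(\<integral>\<^sup>+ x. (SUP n. ennreal ((G n x)\<^sup>2)) \<partial>M) = (SUP n. \<integral>\<^sup>+ x. ennreal ((G n x)\<^sup>2) \<partial>M)"
    by (rule nn_integral_monotone_convergence_SUP)
       (auto simp: incseq_def le_fun_def intro!: ennreal_leI power_mono Gmono G0)
  also have "\<dots> \<le> ennreal (C\<^sup>2)"
  proof (rule SUP_least)
    fix n
    have "(\<integral>\<^sup>+ x. ennreal ((G n x)\<^sup>2) \<partial>M) = ennreal ((L2_norm M (G n))\<^sup>2)"
      using L2_norm_nn_integral[OF GL2, of n] by simp
    also have "\<dots> \<le> ennreal (C\<^sup>2)" using GC[of n] by (intro ennreal_leI power_mono) auto
    finally show "(\<integral>\<^sup>+ x. ennreal ((G n x)\<^sup>2) \<partial>M) \<le> ennreal (C\<^sup>2)" .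
  qed
  finally have SUPle: "(\<integral>\<^sup>+ x. (SUP n. ennreal ((G n x)\<^sup>2)) \<partial>M) \<le> ennreal (C\<^sup>2)" .
  have "AE x in M. (SUP n. ennreal ((G n x)\<^sup>2)) \<noteq> \<infinity>"
    by (rule nn_integral_noteq_infinite) (use SUPle in \<open>auto simp: top_unique\<close>)
  hence summAE: "AE x in M. summable (\<lambda>i. norm (f i x))"
  proof eventually_elim
    case (elim x)
    then obtain r where r: "0 \<le> r" "(SUP n. ennreal ((G n x)\<^sup>2)) = ennreal r"
      by (metis enn2real_nonneg ennreal_enn2real infinity_ennreal_def less_top)
    show ?case
    proof (rule bounded_imp_summable[where B = "sqrt r"])
      fix n
      have "ennreal ((G (Suc n) x)\<^sup>2) \<le> ennreal r" unfolding r(2)[symmetric] by (rule SUP_upper) simp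
      hence "(G (Suc n) x)\<^sup>2 \<le> r" using r(1) by simp
      hence "G (Suc n) x \<le> sqrt r" by (rule real_le_rsqrt)
      thus "(\<Sum>k\<le>n. norm (f k x)) \<le> sqrt r" by (simp add: G_def lessThan_Suc_atMost)
    qed simp
  qed
  define H where "H x = lim (\<lambda>n. G n x)" for x
  define g where "g x = lim (\<lambda>n. \<Sum>i<n. f i x)" for x
  have [measurable]: "H \<in> borel_measurable M" "g \<in> borel_measurable M"
    unfolding H_def g_def by measurable
  have lims: "AE x in M. (\<lambda>n. G n x) \<longlonglongrightarrow> H x \<and> (\<lambda>n. \<Sum>i<n. f i x) \<longlonglongrightarrow> g x \<and> (\<forall>n. G n x \<le> H x)"
    using summAE
  proof eventually_elim
    case (elim x)
    have a: "(\<lambda>n. G n x) \<longlonglongrightarrow> (\<Sum>i. norm (f i x))" unfolding G_def using elim by (rule summable_LIMSEQ)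
    have b: "(\<lambda>n. \<Sum>i<n. f i x) \<longlonglongrightarrow> (\<Sum>i. f i x)"
      using summable_norm_cancel[OF elim] by (rule summable_LIMSEQ)
    have "G n x \<le> (\<Sum>i. norm (f i x))" for n unfolding G_def using elim by (rule sum_le_suminf) auto
    with a b show ?case unfolding H_def g_def by (simp add: limI)
  qed
  have HL2: "L2 M H"
  proof (rule L2_I_nn_integral(1)[OF _ _ C0])
    have "(\<integral>\<^sup>+ x. ennreal ((norm (H x))\<^sup>2) \<partial>M) \<le> (\<integral>\<^sup>+ x. (SUP n. ennreal ((G n x)\<^sup>2)) \<partial>M)"
    proof (rule nn_integral_mono_AE, use lims in eventually_elim)
      case (elim x)
      have "(\<lambda>n. ennreal ((G n x)\<^sup>2)) \<longlonglongrightarrow> ennreal ((H x)\<^sup>2)"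
        using elim by (intro tendsto_ennrealI tendsto_power) auto
      hence "ennreal ((H x)\<^sup>2) \<le> (SUP n. ennreal ((G n x)\<^sup>2))"
        by (rule LIMSEQ_le_const2) (auto intro!: SUP_upper)
      thus ?case by simp
    qed
    with SUPle show "(\<integral>\<^sup>+ x. ennreal ((norm (H x))\<^sup>2) \<partial>M) \<le> ennreal (C\<^sup>2)" by simp
  qed simp
  have le1: "AE x in M. norm (g x) \<le> norm (H x)"
    using lims
  proof eventually_elim
    case (elim x)
    have "norm (\<Sum>i<n. f i x) \<le> H x" for n
      using norm_sum[of "\<lambda>i. f i x" "{..<n}"] elim by (auto simp: G_def intro: order_trans)
    hence "norm (g x) \<le> H x" using elim by (intro LIMSEQ_le_const2[OF tendsto_norm]) auto
    thus ?case by simp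
  qed
  have gL2: "L2 M g" by (rule L2_bound[OF HL2]) (use le1 in auto)
  have "(\<lambda>n. \<integral>x. (norm ((\<Sum>i<n. f i x) - g x))\<^sup>2 \<partial>M) \<longlonglongrightarrow> (\<integral>x. 0 \<partial>M)"
  proof (rule integral_dominated_convergence[where w = "\<lambda>x. 4 * (norm (H x))\<^sup>2"])
    show "integrable M (\<lambda>x. 4 * (norm (H x))\<^sup>2)" using L2_integrable[OF HL2] by simp
    show "AE x in M. (\<lambda>n. (norm ((\<Sum>i<n. f i x) - g x))\<^sup>2) \<longlonglongrightarrow> 0"
      using lims
    proof eventually_elim
      case (elim x)
      hence "(\<lambda>n. (norm ((\<Sum>i<n. f i x) - g x))\<^sup>2) \<longlonglongrightarrow> (norm (g x - g x))\<^sup>2" by (intro tendsto_intros) auto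
      thus ?case by simp
    qed
    show "AE x in M. norm ((norm ((\<Sum>i<n. f i x) - g x))\<^sup>2) \<le> 4 * (norm (H x))\<^sup>2" for n
      using lims le1
    proof eventually_elim
      case (elim x)
      have "norm (\<Sum>i<n. f i x) \<le> H x"
        using norm_sum[of "\<lambda>i. f i x" "{..<n}"] elim by (auto simp: G_def intro: order_trans)
      hence "norm ((\<Sum>i<n. f i x) - g x) \<le> 2 * norm (H x)"
        using elim norm_triangle_ineq4[of "\<Sum>i<n. f i x" "g x"] by auto
      hence "(norm ((\<Sum>i<n. f i x) - g x))\<^sup>2 \<le> (2 * norm (H x))\<^sup>2" by (rule power_mono) simp
      thus ?case by (simp add: power_mult_distrib)
    qed
  qed auto
  hence "(\<lambda>n. sqrt (\<integral>x. (norm ((\<Sum>i<n. f i x) - g x))\<^sup>2 \<partial>M)) \<longlonglongrightarrow> sqrt (\<integral>x. 0 \<partial>M)"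
    by (rule tendsto_real_sqrt)
  with gL2 show ?thesis by (auto simp: L2_norm_def)
qed

section \<open>The Hilbert space of square-integrable functions on the torus\<close>

text \<open>
  Square-integrable functions are given by representatives. A quotient type makes the classes a genuine
  Hilbert space, so that continuity, uniform limits and contraction semigroups are available in
  their usual form.
\<close>

quotient_type (overloaded) ('d, 'c) torus_L2 =
    "real^'d::finite \<Rightarrow> 'c::euclidean_space" / partial: "\<lambda>f g. L2 torus f \<and> L2 torus g \<and> (AE x in torus. f x = g x)"
  morphisms rep_torus_L2 class_of
proof (rule part_equivpI)
  show "\<exists>f. L2 torus f \<and> L2 torus f \<and> (AE x in torus. f x = f x)" by (rule exI[of _ "\<lambda>_. 0"]) simp
  show "symp (\<lambda>f g. L2 torus f \<and> L2 torus g \<and> (AE x in torus. f x = g x))"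
    by (rule sympI) (auto simp: eq_commute)
  show "transp (\<lambda>f g. L2 torus f \<and> L2 torus g \<and> (AE x in torus. f x = g x))"
    by (rule transpI) (elim conjE, intro conjI, assumption, assumption, erule (1) eventually_elim2, simp)
qed

instantiation torus_L2 :: (finite, euclidean_space) real_inner
begin

lift_definition zero_torus_L2 :: "('a, 'b) torus_L2" is "\<lambda>x. 0" by simp

lift_definition plus_torus_L2 :: "('a, 'b) torus_L2 \<Rightarrow> ('a, 'b) torus_L2 \<Rightarrow> ('a, 'b) torus_L2"
  is "\<lambda>f g x. f x + g x" by (intro conjI; (blast intro: L2_add | (elim conjE, erule (1) eventually_elim2, simp)))

lift_definition minus_torus_L2 :: "('a, 'b) torus_L2 \<Rightarrow> ('a, 'b) torus_L2 \<Rightarrow> ('a, 'b) torus_L2"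
  is "\<lambda>f g x. f x - g x" by (intro conjI; (blast intro: L2_diff | (elim conjE, erule (1) eventually_elim2, simp)))

lift_definition scaleR_torus_L2 :: "real \<Rightarrow> ('a, 'b) torus_L2 \<Rightarrow> ('a, 'b) torus_L2"
  is "\<lambda>c f x. c *\<^sub>R f x" by (intro conjI; (blast intro: L2_scaleR | (elim conjE, erule eventually_mono, simp)))

lift_definition inner_torus_L2 :: "('a, 'b) torus_L2 \<Rightarrow> ('a, 'b) torus_L2 \<Rightarrow> real"
  is "\<lambda>f g. \<integral>x. f x \<bullet> g x \<partial>torus"
proof -
  fix f f' g g' :: "real^'a \<Rightarrow> 'b"
  assume *: "L2 torus f \<and> L2 torus f' \<and> (AE x in torus. f x = f' x)"
    "L2 torus g \<and> L2 torus g' \<and> (AE x in torus. g x = g' x)"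
  hence "AE x in torus. f x = f' x" "AE x in torus. g x = g' x" by auto
  hence "AE x in torus. f x \<bullet> g x = f' x \<bullet> g' x" by eventually_elim simp
  thus "(\<integral>x. f x \<bullet> g x \<partial>torus) = (\<integral>x. f' x \<bullet> g' x \<partial>torus)"
    using * by (intro integral_cong_AE borel_measurable_inner L2_measurable) auto
qed

definition uminus_torus_L2 :: "('a, 'b) torus_L2 \<Rightarrow> ('a, 'b) torus_L2"
  where "uminus_torus_L2 f = (-1) *\<^sub>R f"

definition norm_torus_L2 :: "('a, 'b) torus_L2 \<Rightarrow> real"
  where "norm_torus_L2 f = sqrt (f \<bullet> f)"

definition sgn_torus_L2 :: "('a, 'b) torus_L2 \<Rightarrow> ('a, 'b) torus_L2"
  where "sgn_torus_L2 f = inverse (norm f) *\<^sub>R f"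

definition dist_torus_L2 :: "('a, 'b) torus_L2 \<Rightarrow> ('a, 'b) torus_L2 \<Rightarrow> real"
  where "dist_torus_L2 f g = norm (f - g)"

definition uniformity_torus_L2 :: "(('a, 'b) torus_L2 \<times> ('a, 'b) torus_L2) filter"
  where "uniformity_torus_L2 = (INF e\<in>{0<..}. principal {(x, y). dist x y < e})"

definition open_torus_L2 :: "('a, 'b) torus_L2 set \<Rightarrow> bool"
  where "open_torus_L2 U \<longleftrightarrow> (\<forall>x\<in>U. eventually (\<lambda>(x', y). x' = x \<longrightarrow> y \<in> U) uniformity)"

lemma torus_L2_inner_axioms:
  fixes f g h :: "('a, 'b) torus_L2" and a b :: real
  shows "f + g + h = f + (g + h)" and "f + g = g + f" and "0 + f = f"
    and "- f + f = 0" and "f - g = f + - g"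
    and "a *\<^sub>R (f + g) = a *\<^sub>R f + a *\<^sub>R g" and "(a + b) *\<^sub>R f = a *\<^sub>R f + b *\<^sub>R f"
    and "a *\<^sub>R b *\<^sub>R f = (a * b) *\<^sub>R f" and "1 *\<^sub>R f = f"
    and "f \<bullet> g = g \<bullet> f" and "(f + g) \<bullet> h = f \<bullet> h + g \<bullet> h"
    and "a *\<^sub>R f \<bullet> g = a * (f \<bullet> g)" and "0 \<le> f \<bullet> f" and "f \<bullet> f = 0 \<longleftrightarrow> f = 0"
proof -
  show "f + g + h = f + (g + h)" by transfer (auto intro: L2_add simp: add.assoc)
  show "f + g = g + f" by transfer (auto intro: L2_add simp: add.commute)
  show "0 + f = f" by transfer auto
  show "- f + f = 0" unfolding uminus_torus_L2_def by transfer (auto intro!: L2_add L2_scaleR)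
  show "f - g = f + - g" unfolding uminus_torus_L2_def by transfer (auto intro!: L2_add L2_diff L2_scaleR)
  show "a *\<^sub>R (f + g) = a *\<^sub>R f + a *\<^sub>R g" by transfer (auto intro: L2_add L2_scaleR simp: scaleR_add_right)
  show "(a + b) *\<^sub>R f = a *\<^sub>R f + b *\<^sub>R f" by transfer (auto intro: L2_add L2_scaleR simp: scaleR_add_left)
  show "a *\<^sub>R b *\<^sub>R f = (a * b) *\<^sub>R f" by transfer (auto intro: L2_scaleR)
  show "1 *\<^sub>R f = f" by transfer auto
  show "f \<bullet> g = g \<bullet> f" by transfer (simp add: inner_commute)
  show "(f + g) \<bullet> h = f \<bullet> h + g \<bullet> h"
    by transfer (simp add: inner_add_left L2_inner_integrable)
  show "a *\<^sub>R f \<bullet> g = a * (f \<bullet> g)" by transfer simp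
  show "0 \<le> f \<bullet> f" by transfer simp
  show "f \<bullet> f = 0 \<longleftrightarrow> f = 0"
  proof transfer
    fix f :: "real^'a \<Rightarrow> 'b"
    assume "L2 torus f \<and> L2 torus f \<and> (AE x in torus. f x = f x)"
    hence f: "L2 torus f" by simp
    have "(\<integral>x. f x \<bullet> f x \<partial>torus) = 0 \<longleftrightarrow> (AE x in torus. f x \<bullet> f x = 0)"
      by (rule integral_nonneg_eq_0_iff_AE[OF L2_inner_integrable[OF f f]]) simp
    thus "(\<integral>x. f x \<bullet> f x \<partial>torus) = 0 \<longleftrightarrow>
        L2 torus f \<and> L2 torus (\<lambda>x. 0 :: 'b) \<and> (AE x in torus. f x = 0)"
      using f by simp
  qed
qed

instance
  by intro_classes (rule torus_L2_inner_axioms sgn_torus_L2_def dist_torus_L2_def norm_torus_L2_def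
      uniformity_torus_L2_def open_torus_L2_def)+

end

lemma norm_class_of: "L2 torus f \<Longrightarrow> norm (class_of f) = L2_norm torus f"
  by (simp add: norm_torus_L2_def inner_torus_L2.abs_eq L2_norm_def power2_norm_eq_inner)

lemma class_of_add: "L2 torus f \<Longrightarrow> L2 torus g \<Longrightarrow> class_of (\<lambda>x. f x + g x) = class_of f + class_of g"
  by (simp add: plus_torus_L2.abs_eq)

lemma class_of_diff: "L2 torus f \<Longrightarrow> L2 torus g \<Longrightarrow> class_of (\<lambda>x. f x - g x) = class_of f - class_of g"
  by (simp add: minus_torus_L2.abs_eq)

lemma class_of_scaleR: "L2 torus f \<Longrightarrow> class_of (\<lambda>x. c *\<^sub>R f x) = c *\<^sub>R class_of f"
  by (simp add: scaleR_torus_L2.abs_eq)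

lemma class_of_zero: "class_of (\<lambda>x. 0) = 0"
  by (simp add: zero_torus_L2_def)

lemma class_of_eq_iff:
  "L2 torus f \<Longrightarrow> L2 torus g \<Longrightarrow> class_of f = class_of g \<longleftrightarrow> (AE x in torus. f x = g x)"
  using Quotient_rel[OF Quotient_torus_L2, of f g] by simp

lemma class_of_sum:
  "(\<And>i. i \<in> I \<Longrightarrow> L2 torus (f i)) \<Longrightarrow> class_of (\<lambda>x. \<Sum>i\<in>I. f i x) = (\<Sum>i\<in>I. class_of (f i))"
  by (induction I rule: infinite_finite_induct) (auto simp: class_of_zero class_of_add L2_sum)

lemma rep_torus_L2: "L2 torus (rep_torus_L2 x)" "class_of (rep_torus_L2 x) = x"
  using Quotient_rep_reflp[OF Quotient_torus_L2] Quotient_abs_rep[OF Quotient_torus_L2] by auto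

text \<open>
  From a Cauchy sequence a subsequence with increments at most \<open>(1/2) ^ i\<close> is selected; its increments form an
  absolutely convergent series.
\<close>

lemma complete_if_absolutely_summable_imp_summable:
  fixes X :: "nat \<Rightarrow> 'a::real_normed_vector"
  assumes summ: "\<And>f :: nat \<Rightarrow> 'a. summable (\<lambda>n. norm (f n)) \<Longrightarrow> summable f" and X: "Cauchy X"
  shows "convergent X"
proof -
  have "\<exists>N. \<forall>m\<ge>N. \<forall>n\<ge>N. norm (X m - X n) < (1/2) ^ i" for i :: nat
    using CauchyD[OF X, of "(1/2) ^ i"] by simp
  hence "\<forall>i::nat. \<exists>N. \<forall>m\<ge>N. \<forall>n\<ge>N. norm (X m - X n) < (1/2) ^ i" by blast
  from choice[OF this] obtain N :: "nat \<Rightarrow> nat"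
    where N: "\<And>i m n. N i \<le> m \<Longrightarrow> N i \<le> n \<Longrightarrow> norm (X m - X n) < (1/2) ^ i"
    by blast
  define r where "r = rec_nat (N 0) (\<lambda>i ri. max (Suc ri) (N (Suc i)))"
  have r_Suc: "r (Suc i) = max (Suc (r i)) (N (Suc i))" for i by (simp add: r_def)
  have r: "strict_mono r" unfolding strict_mono_Suc_iff by (simp add: r_Suc less_max_iff_disj)
  have Nr: "N i \<le> r i" for i by (cases i) (simp_all add: r_Suc, simp add: r_def)
  define f where "f i = X (r (Suc i)) - X (r i)" for i
  have "norm (f i) \<le> (1/2) ^ i" for i
    unfolding f_def using Nr[of i] strict_mono_less_eq[OF r, of i "Suc i"]
    by (intro less_imp_le[OF N]) auto
  hence "summable (\<lambda>i. norm (f i))"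
    by (intro summable_comparison_test'[OF summable_geometric[of "1/2::real"], of 0]) auto
  hence "(\<lambda>n. \<Sum>i<n. f i) \<longlonglongrightarrow> suminf f" by (intro summable_LIMSEQ summ)
  moreover have "(\<Sum>i<n. f i) = X (r n) - X (r 0)" for n
    unfolding f_def by (rule sum_lessThan_telescope)
  ultimately have "(\<lambda>n. (X (r n) - X (r 0)) + X (r 0)) \<longlonglongrightarrow> suminf f + X (r 0)"
    by (intro tendsto_intros) simp
  hence "(X \<circ> r) \<longlonglongrightarrow> suminf f + X (r 0)" by (simp add: o_def)
  hence "X \<longlonglongrightarrow> suminf f + X (r 0)"
    using X r by (rule Cauchy_converges_subseq[rotated 2])
  thus ?thesis by (rule convergentI)
qed

lemma torus_L2_Cauchy_convergent:
  fixes X :: "nat \<Rightarrow> ('d::finite, 'c::euclidean_space) torus_L2"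
  assumes "Cauchy X" shows "convergent X"
  using assms
proof (rule complete_if_absolutely_summable_imp_summable[rotated])
    fix F :: "nat \<Rightarrow> ('d, 'c) torus_L2"
    assume summ: "summable (\<lambda>n. norm (F n))"
    define f where "f n = rep_torus_L2 (F n)" for n
    have f: "L2 torus (f n)" "F n = class_of (f n)" for n by (simp_all add: f_def rep_torus_L2)
    from summ obtain g where g: "L2 torus g"
        "(\<lambda>n. L2_norm torus (\<lambda>x. (\<Sum>i<n. f i x) - g x)) \<longlonglongrightarrow> 0"
      using L2_series[of torus f] f by (auto simp: norm_class_of)
    have "norm ((\<Sum>i<n. F i) - class_of g) = L2_norm torus (\<lambda>x. (\<Sum>i<n. f i x) - g x)" for n
      using f g by (simp add: norm_class_of[symmetric] class_of_diff class_of_sum L2_sum L2_diff)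
    with g(2) have "(\<lambda>n. (\<Sum>i<n. F i) - class_of g) \<longlonglongrightarrow> 0"
      by (subst tendsto_norm_zero_iff[symmetric]) simp
    hence "(\<lambda>n. \<Sum>i<n. F i) \<longlonglongrightarrow> class_of g" by (rule LIM_zero_cancel)
    thus "summable F" by (auto simp: summable_def sums_def)
qed

instance torus_L2 :: (finite, euclidean_space) banach
  by intro_classes (rule torus_L2_Cauchy_convergent)

section \<open>States as elements of a Hilbert space\<close>

text \<open>
  The factor \<open>sqrt \<epsilon>\<close> moves the weight of the energy norm into the function, so that the energy norm
  becomes the plain norm of \<open>torus_L2\<close>.
\<close>

definition energy_class :: "real \<Rightarrow> ('d::finite, 'b::euclidean_space) state \<Rightarrow> ('d, (real^'d) \<times> 'b) torus_L2" where
  "energy_class \<epsilon> X = class_of (\<lambda>x. (sqrt \<epsilon> *\<^sub>R fst (X x), snd (X x)))"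

definition state_of :: "real \<Rightarrow> ('d::finite, (real^'d) \<times> 'b::euclidean_space) torus_L2 \<Rightarrow> ('d, 'b) state" where
  "state_of \<epsilon> h = (\<lambda>x. ((1 / sqrt \<epsilon>) *\<^sub>R fst (rep_torus_L2 h x), snd (rep_torus_L2 h x)))"

lemma energy_spaceI: "L2 torus X \<Longrightarrow> X \<in> energy_space"
  and energy_spaceD: "X \<in> energy_space \<Longrightarrow> L2 torus X"
  by (auto simp: energy_space_def)

lemma energy_space_linear:
  "X \<in> energy_space \<Longrightarrow> Y \<in> energy_space \<Longrightarrow> (\<lambda>x. X x + Y x) \<in> energy_space"
  "X \<in> energy_space \<Longrightarrow> Y \<in> energy_space \<Longrightarrow> (\<lambda>x. X x - Y x) \<in> energy_space"
  "X \<in> energy_space \<Longrightarrow> (\<lambda>x. c *\<^sub>R X x) \<in> energy_space"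
  by (auto simp: energy_space_def intro: L2_add L2_diff L2_scaleR)

lemma L2_scaled_pair: "L2 M X \<Longrightarrow> L2 M (\<lambda>x. (c *\<^sub>R fst (X x), snd (X x)))"
  by (rule L2_bounded_linear[where h = "\<lambda>p. (c *\<^sub>R fst p, snd p)"])
     (intro bounded_linear_Pair bounded_linear_scaleR_right[THEN bounded_linear_compose] bounded_linear_fst bounded_linear_snd)

lemma L2_fst: "L2 M X \<Longrightarrow> L2 M (\<lambda>x. fst (X x))"
  and L2_snd: "L2 M X \<Longrightarrow> L2 M (\<lambda>x. snd (X x))"
  by (auto intro: L2_bounded_linear bounded_linear_fst bounded_linear_snd)

context
  fixes \<epsilon> :: real
  assumes \<epsilon>: "0 < \<epsilon>"
begin

lemma norm_energy_class:
  assumes "X \<in> energy_space" shows "norm (energy_class \<epsilon> X) = energy_norm \<epsilon> X"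
proof -
  note X = energy_spaceD[OF assms]
  have "(\<integral>x. (norm (sqrt \<epsilon> *\<^sub>R fst (X x), snd (X x)))\<^sup>2 \<partial>torus)
      = (\<integral>x. \<epsilon> * (norm (fst (X x)))\<^sup>2 + (norm (snd (X x)))\<^sup>2 \<partial>torus)"
    using \<epsilon> by (intro Bochner_Integration.integral_cong) (auto simp: norm_Pair power_mult_distrib)
  also have "\<dots> = \<epsilon> * (\<integral>x. (norm (fst (X x)))\<^sup>2 \<partial>torus) + (\<integral>x. (norm (snd (X x)))\<^sup>2 \<partial>torus)"
    using L2_integrable[OF L2_fst[OF X]] L2_integrable[OF L2_snd[OF X]] by simp
  finally show ?thesis
    unfolding energy_class_def using L2_scaled_pair[OF X]
    by (simp add: norm_class_of L2_norm_def energy_norm_def)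
qed

lemma energy_class_diff:
  assumes "X \<in> energy_space" "Y \<in> energy_space"
  shows "energy_class \<epsilon> (\<lambda>x. X x - Y x) = energy_class \<epsilon> X - energy_class \<epsilon> Y"
  using class_of_diff[OF L2_scaled_pair[OF energy_spaceD[OF assms(1)]] L2_scaled_pair[OF energy_spaceD[OF assms(2)]],
      of "sqrt \<epsilon>" "sqrt \<epsilon>"]
  by (simp add: energy_class_def algebra_simps)

lemma energy_class_scaleR:
  assumes "X \<in> energy_space"
  shows "energy_class \<epsilon> (\<lambda>x. c *\<^sub>R X x) = c *\<^sub>R energy_class \<epsilon> X"
  using class_of_scaleR[OF L2_scaled_pair[OF energy_spaceD[OF assms]], of c "sqrt \<epsilon>"]
  by (simp add: energy_class_def mult.commute)

lemma energy_class_add: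
  assumes "X \<in> energy_space" "Y \<in> energy_space"
  shows "energy_class \<epsilon> (\<lambda>x. X x + Y x) = energy_class \<epsilon> X + energy_class \<epsilon> Y"
  using class_of_add[OF L2_scaled_pair[OF energy_spaceD[OF assms(1)]] L2_scaled_pair[OF energy_spaceD[OF assms(2)]],
      of "sqrt \<epsilon>" "sqrt \<epsilon>"]
  by (simp add: energy_class_def algebra_simps)

lemma energy_class_sum:
  assumes "\<And>i. i \<in> I \<Longrightarrow> X i \<in> energy_space"
  shows "energy_class \<epsilon> (\<lambda>x. \<Sum>i\<in>I. X i x) = (\<Sum>i\<in>I. energy_class \<epsilon> (X i))"
  using assms
proof (induction I rule: infinite_finite_induct)
  case (insert i I)
  then have "(\<lambda>x. \<Sum>i\<in>I. X i x) \<in> energy_space"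
    by (auto intro!: energy_spaceI L2_sum dest: energy_spaceD)
  with insert show ?case by (simp add: energy_class_add)
qed (auto simp: energy_class_def class_of_zero zero_prod_def[symmetric])

lemma energy_dist_eq_dist:
  assumes "X \<in> energy_space" "Y \<in> energy_space"
  shows "energy_dist \<epsilon> X Y = dist (energy_class \<epsilon> X) (energy_class \<epsilon> Y)"
  using assms by (simp add: dist_norm energy_class_diff[symmetric] norm_energy_class energy_space_linear)

lemma energy_class_eq_iff:
  assumes "X \<in> energy_space" "Y \<in> energy_space"
  shows "energy_class \<epsilon> X = energy_class \<epsilon> Y \<longleftrightarrow> (AE x in torus. X x = Y x)"
  using assms \<epsilon> unfolding energy_class_def
  by (subst class_of_eq_iff) (auto intro: L2_scaled_pair energy_spaceD simp: prod_eq_iff)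

lemma state_of: "state_of \<epsilon> h \<in> energy_space" "energy_class \<epsilon> (state_of \<epsilon> h) = h"
  using \<epsilon> L2_scaled_pair[OF rep_torus_L2(1)[of h], of "1 / sqrt \<epsilon>"]
  by (auto simp: energy_class_def state_of_def energy_space_def rep_torus_L2)

end

definition flow :: "real \<Rightarrow> (real \<Rightarrow> ('d::finite, 'b::euclidean_space) state \<Rightarrow> ('d, 'b) state) \<Rightarrow>
    real \<Rightarrow> ('d, (real^'d) \<times> 'b) torus_L2 \<Rightarrow> ('d, (real^'d) \<times> 'b) torus_L2" where
  "flow \<epsilon> S t h = energy_class \<epsilon> (S t (state_of \<epsilon> h))"

context
  fixes \<epsilon> :: real and S :: "real \<Rightarrow> ('d::finite, 'b::euclidean_space) state \<Rightarrow> ('d, 'b) state"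
  assumes \<epsilon>: "0 < \<epsilon>" and S: "contraction_semigroup \<epsilon> S"
begin

lemmas semigroup_parts = S[unfolded contraction_semigroup_def]

lemma semigroup_in_energy_space: "0 \<le> t \<Longrightarrow> X \<in> energy_space \<Longrightarrow> S t X \<in> energy_space"
  by (rule semigroup_parts[THEN conjunct1, rule_format, THEN conjunct1])

lemma energy_class_semigroup_linear:
  assumes t: "0 \<le> t" and X: "X \<in> energy_space" and Y: "Y \<in> energy_space"
  shows "energy_class \<epsilon> (S t (\<lambda>x. a *\<^sub>R X x + b *\<^sub>R Y x))
    = a *\<^sub>R energy_class \<epsilon> (S t X) + b *\<^sub>R energy_class \<epsilon> (S t Y)"
proof -
  have "AE x in torus. S t (\<lambda>x. a *\<^sub>R X x + b *\<^sub>R Y x) x = a *\<^sub>R S t X x + b *\<^sub>R S t Y x"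
    by (rule semigroup_parts[THEN conjunct2, THEN conjunct1, rule_format, OF t X Y])
  hence "energy_class \<epsilon> (S t (\<lambda>x. a *\<^sub>R X x + b *\<^sub>R Y x)) = energy_class \<epsilon> (\<lambda>x. a *\<^sub>R S t X x + b *\<^sub>R S t Y x)"
    using t X Y by (subst energy_class_eq_iff[OF \<epsilon>]) (auto intro!: semigroup_in_energy_space energy_space_linear)
  thus ?thesis
    using t X Y by (simp add: energy_class_add[OF \<epsilon>] energy_class_scaleR[OF \<epsilon>] energy_space_linear semigroup_in_energy_space)
qed

lemma norm_semigroup_le:
  assumes "0 \<le> t" "X \<in> energy_space"
  shows "norm (energy_class \<epsilon> (S t X)) \<le> norm (energy_class \<epsilon> X)"
proof -
  have "energy_norm \<epsilon> (S t X) \<le> energy_norm \<epsilon> X"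
    by (rule semigroup_parts[THEN conjunct1, rule_format, OF assms, THEN conjunct2])
  thus ?thesis using assms semigroup_in_energy_space by (simp add: norm_energy_class[OF \<epsilon>])
qed

text \<open>
  A semigroup on representatives respects almost everywhere equality: it is linear up to null sets
  and contracts, so it maps the difference of two representatives to a null function.
\<close>

lemma flow_energy_class:
  assumes t: "0 \<le> t" and X: "X \<in> energy_space"
  shows "flow \<epsilon> S t (energy_class \<epsilon> X) = energy_class \<epsilon> (S t X)"
proof -
  define Y where "Y = state_of \<epsilon> (energy_class \<epsilon> X)"
  have Y: "Y \<in> energy_space" "energy_class \<epsilon> Y = energy_class \<epsilon> X" using state_of[OF \<epsilon>] by (auto simp: Y_def)
  have "energy_class \<epsilon> (S t (\<lambda>x. 1 *\<^sub>R Y x + (-1) *\<^sub>R X x)) = energy_class \<epsilon> (S t Y) - energy_class \<epsilon> (S t X)"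
    using energy_class_semigroup_linear[OF t Y(1) X, of 1 "-1"] by simp
  moreover have "norm (energy_class \<epsilon> (S t (\<lambda>x. 1 *\<^sub>R Y x + (-1) *\<^sub>R X x)))
      \<le> norm (energy_class \<epsilon> (\<lambda>x. 1 *\<^sub>R Y x + (-1) *\<^sub>R X x))"
    by (rule norm_semigroup_le[OF t]) (intro energy_space_linear Y X)
  moreover have "energy_class \<epsilon> (\<lambda>x. 1 *\<^sub>R Y x + (-1) *\<^sub>R X x) = 0"
    using Y X by (simp add: energy_class_diff[OF \<epsilon>])
  ultimately show ?thesis by (simp add: flow_def Y_def)
qed

lemma contraction_flow: "contraction_flow (flow \<epsilon> S)"
proof (rule contraction_flow.intro)
  note st = state_of[OF \<epsilon>]
  show "linear (flow \<epsilon> S t)" if t: "0 \<le> t" for t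
  proof (rule linearI)
    fix g h :: "('d, (real^'d) \<times> 'b) torus_L2" and c :: real
    have lin: "energy_class \<epsilon> (\<lambda>x. a *\<^sub>R state_of \<epsilon> g x + b *\<^sub>R state_of \<epsilon> h x) = a *\<^sub>R g + b *\<^sub>R h" for a b
      by (simp add: energy_class_add[OF \<epsilon>] energy_class_scaleR[OF \<epsilon>] energy_space_linear st)
    have *: "flow \<epsilon> S t (a *\<^sub>R g + b *\<^sub>R h) = a *\<^sub>R flow \<epsilon> S t g + b *\<^sub>R flow \<epsilon> S t h" for a b
    proof -
      have "(\<lambda>x. a *\<^sub>R state_of \<epsilon> g x + b *\<^sub>R state_of \<epsilon> h x) \<in> energy_space"
        by (intro energy_space_linear st)
      from flow_energy_class[OF t this] show ?thesis
        by (simp only: lin energy_class_semigroup_linear[OF t st(1) st(1)] flow_def[of \<epsilon> S t g] flow_def[of \<epsilon> S t h])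
    qed
    show "flow \<epsilon> S t (g + h) = flow \<epsilon> S t g + flow \<epsilon> S t h" using *[of 1 1] by simp
    show "flow \<epsilon> S t (c *\<^sub>R g) = c *\<^sub>R flow \<epsilon> S t g" using *[of c 0] by simp
  qed
  show "norm (flow \<epsilon> S t h) \<le> norm h" if "0 \<le> t" for t h
    using norm_semigroup_le[OF that st(1)] by (simp add: flow_def st)
  show "flow \<epsilon> S 0 h = h" for h
  proof -
    have "AE x in torus. S 0 (state_of \<epsilon> h) x = state_of \<epsilon> h x"
      by (rule semigroup_parts[THEN conjunct2, THEN conjunct2, THEN conjunct1, rule_format, OF st(1)])
    hence "energy_class \<epsilon> (S 0 (state_of \<epsilon> h)) = energy_class \<epsilon> (state_of \<epsilon> h)"
      by (subst energy_class_eq_iff[OF \<epsilon>]) (auto intro: st semigroup_in_energy_space)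
    thus ?thesis by (simp add: flow_def st)
  qed
  show "flow \<epsilon> S (s + t) h = flow \<epsilon> S s (flow \<epsilon> S t h)" if "0 \<le> s" "0 \<le> t" for s t h
  proof -
    have "AE x in torus. S (s + t) (state_of \<epsilon> h) x = S s (S t (state_of \<epsilon> h)) x"
      by (rule semigroup_parts[THEN conjunct2, THEN conjunct2, THEN conjunct2, THEN conjunct1, rule_format, OF that st(1)])
    hence "energy_class \<epsilon> (S (s + t) (state_of \<epsilon> h)) = energy_class \<epsilon> (S s (S t (state_of \<epsilon> h)))"
      using that by (subst energy_class_eq_iff[OF \<epsilon>]) (auto intro: st semigroup_in_energy_space)
    thus ?thesis
      using flow_energy_class[OF that(1) semigroup_in_energy_space[OF that(2) st(1), of h]]
      by (simp only: flow_def[of \<epsilon> S t h] flow_def[of \<epsilon> S "s + t" h])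
  qed
  show "((\<lambda>t. flow \<epsilon> S t h) \<longlongrightarrow> h) (at_right 0)" for h
  proof -
    have "((\<lambda>t. energy_dist \<epsilon> (S t (state_of \<epsilon> h)) (state_of \<epsilon> h)) \<longlongrightarrow> 0) (at_right 0)"
      by (rule semigroup_parts[THEN conjunct2, THEN conjunct2, THEN conjunct2, THEN conjunct2, rule_format, OF st(1)])
    moreover have "\<forall>\<^sub>F t in at_right 0. energy_dist \<epsilon> (S t (state_of \<epsilon> h)) (state_of \<epsilon> h) = dist (flow \<epsilon> S t h) h"
      unfolding eventually_at_filter
      by (intro always_eventually allI impI) (simp add: energy_dist_eq_dist[OF \<epsilon>] semigroup_in_energy_space st flow_def)
    ultimately have "((\<lambda>t. dist (flow \<epsilon> S t h) h) \<longlongrightarrow> 0) (at_right 0)"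
      by (rule Lim_transform_eventually)
    thus ?thesis by (subst tendsto_dist_iff)
  qed
qed

lemma generator_flow_iff:
  assumes X: "X \<in> energy_space" and Y: "Y \<in> energy_space"
  shows "generator (flow \<epsilon> S) (energy_class \<epsilon> X) (energy_class \<epsilon> Y) \<longleftrightarrow> generator_graph \<epsilon> S X Y"
proof -
  have eq: "energy_dist \<epsilon> (\<lambda>x. (1 / h) *\<^sub>R (S h X x - X x)) Y
      = dist ((1 / h) *\<^sub>R (flow \<epsilon> S h (energy_class \<epsilon> X) - energy_class \<epsilon> X)) (energy_class \<epsilon> Y)" if "0 < h" for h
  proof -
    have "energy_class \<epsilon> (\<lambda>x. (1 / h) *\<^sub>R (S h X x - X x))
        = (1 / h) *\<^sub>R (flow \<epsilon> S h (energy_class \<epsilon> X) - energy_class \<epsilon> X)"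
      using that X by (subst energy_class_scaleR[OF \<epsilon>])
        (simp_all add: energy_class_diff[OF \<epsilon>] energy_space_linear semigroup_in_energy_space flow_energy_class)
    moreover have "(\<lambda>x. (1 / h) *\<^sub>R (S h X x - X x)) \<in> energy_space"
      using that X by (intro energy_space_linear semigroup_in_energy_space) auto
    ultimately show ?thesis using Y by (simp only: energy_dist_eq_dist[OF \<epsilon>])
  qed
  have "generator (flow \<epsilon> S) (energy_class \<epsilon> X) (energy_class \<epsilon> Y) \<longleftrightarrow>
     ((\<lambda>h. dist ((1 / h) *\<^sub>R (flow \<epsilon> S h (energy_class \<epsilon> X) - energy_class \<epsilon> X)) (energy_class \<epsilon> Y)) \<longlongrightarrow> 0) (at_right 0)"
    unfolding generator_def by (subst tendsto_dist_iff) rule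
  also have "\<dots> \<longleftrightarrow> ((\<lambda>h. energy_dist \<epsilon> (\<lambda>x. (1 / h) *\<^sub>R (S h X x - X x)) Y) \<longlongrightarrow> 0) (at_right 0)"
    by (rule filterlim_cong) (auto simp: eventually_at_filter eq intro!: always_eventually)
  finally show ?thesis using X Y by (simp add: generator_graph_def)
qed

end

text \<open>
  Every energy solution carries its own semigroup. All of them have the Maxwell operator as their
  generator, so on classes they coincide.
\<close>

lemma maxwell_semigroup_flow_unique:
  assumes \<epsilon>: "0 < \<epsilon>" and S: "maxwell_semigroup curlE curlB \<epsilon> \<sigma> S" and S': "maxwell_semigroup curlE curlB \<epsilon> \<sigma> S'"
    and t: "0 \<le> t"
  shows "flow \<epsilon> S t = flow \<epsilon> S' t"
proof
  fix h
  have c: "contraction_semigroup \<epsilon> S" "contraction_semigroup \<epsilon> S'"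
    and g: "generator_graph \<epsilon> S = generator_graph \<epsilon> S'"
    using S S' by (auto simp: maxwell_semigroup_def)
  have "generator (flow \<epsilon> S) x y = generator (flow \<epsilon> S') x y" for x y
    using generator_flow_iff[OF \<epsilon> c(1) state_of(1)[OF \<epsilon>] state_of(1)[OF \<epsilon>], of x y]
      generator_flow_iff[OF \<epsilon> c(2) state_of(1)[OF \<epsilon>] state_of(1)[OF \<epsilon>], of x y] g
    by (simp add: state_of[OF \<epsilon>])
  hence "generator (flow \<epsilon> S) = generator (flow \<epsilon> S')" by blast
  thus "flow \<epsilon> S t h = flow \<epsilon> S' t h"
    by (rule contraction_flow_unique[OF contraction_flow[OF \<epsilon> c(1)] contraction_flow[OF \<epsilon> c(2)] _ t])
qed

text \<open>
  Pairing with a vector \<open>y\<close> turns the Bochner integral of states into a Lebesgue integral of real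
  functions. The function \<open>h\<close> is only almost everywhere equal to the pairing, because the integrand
  itself need not be Borel measurable; it is the limit of the pairings of the simple
  approximations.
\<close>

lemma has_state_integral_inner:
  fixes f :: "real \<Rightarrow> ('d::finite, 'b::euclidean_space) state"
  assumes \<epsilon>: "0 < \<epsilon>" and M: "finite_measure M" and int: "has_state_integral \<epsilon> M f I"
  shows "\<exists>h. integrable M h \<and> (AE s in M. h s = energy_class \<epsilon> (f s) \<bullet> y) \<and>
    (\<integral>s. h s \<partial>M) = energy_class \<epsilon> I \<bullet> y"
proof -
  interpret finite_measure M by fact
  from int obtain g where I: "I \<in> energy_space" and f: "AE s in M. f s \<in> energy_space"
    and g: "\<And>i. simple_function M (g i)" "\<And>i s. s \<in> space M \<Longrightarrow> g i s \<in> energy_space"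
    and ptw: "AE s in M. (\<lambda>i. energy_dist \<epsilon> (g i s) (f s)) \<longlonglongrightarrow> 0"
    and L1: "(\<lambda>i. \<integral>\<^sup>+ s. ennreal (energy_dist \<epsilon> (g i s) (f s)) \<partial>M) \<longlonglongrightarrow> 0"
    and conv: "(\<lambda>i. energy_dist \<epsilon> (state_simple_integral M (g i)) I) \<longlonglongrightarrow> 0"
    unfolding has_state_integral_def by blast
  define u where "u i s = energy_class \<epsilon> (g i s) \<bullet> y" for i s
  have simple: "simple_function M (u i)" for i
    unfolding u_def using simple_function_compose1[OF g(1), of "\<lambda>X. energy_class \<epsilon> X \<bullet> y"] by simp
  have u_meas [measurable]: "u i \<in> borel_measurable M" for i using simple by (rule borel_measurable_simple_function)
  have u_int: "integrable M (u i)" for i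
  proof -
    have "finite (u i ` space M)" using simple by (rule simple_functionD)
    then obtain B where "\<And>s. s \<in> space M \<Longrightarrow> norm (u i s) \<le> B"
      using finite_imp_bounded[of "u i ` space M"] by (auto simp: bounded_iff)
    thus ?thesis by (intro integrable_const_bound[of _ B]) auto
  qed
  have sums: "(\<integral>s. u i s \<partial>M) = energy_class \<epsilon> (state_simple_integral M (g i)) \<bullet> y" for i
  proof -
    have fin: "finite (g i ` space M)" using g(1) by (rule simple_functionD)
    have sets: "g i -` {Y} \<inter> space M \<in> sets M" for Y using g(1) by (rule simple_functionD)
    have "u i s = (\<Sum>Y\<in>g i ` space M. (energy_class \<epsilon> Y \<bullet> y) * indicator (g i -` {Y} \<inter> space M) s)" if "s \<in> space M" for s
    proof -
      have "(\<Sum>Y\<in>g i ` space M. (energy_class \<epsilon> Y \<bullet> y) * indicator (g i -` {Y} \<inter> space M) s)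
          = (\<Sum>Y\<in>{g i s}. (energy_class \<epsilon> Y \<bullet> y) * indicator (g i -` {Y} \<inter> space M) s)"
        using that fin by (intro sum.mono_neutral_right) (auto simp: indicator_def)
      thus ?thesis using that by (simp add: u_def)
    qed
    hence "(\<integral>s. u i s \<partial>M) = (\<integral>s. (\<Sum>Y\<in>g i ` space M. (energy_class \<epsilon> Y \<bullet> y) * indicator (g i -` {Y} \<inter> space M) s) \<partial>M)"
      by (intro Bochner_Integration.integral_cong) auto
    also have "\<dots> = (\<Sum>Y\<in>g i ` space M. (energy_class \<epsilon> Y \<bullet> y) * measure M (g i -` {Y} \<inter> space M))"
      using sets by (subst Bochner_Integration.integral_sum) (auto simp: emeasure_eq_measure)
    also have "\<dots> = energy_class \<epsilon> (state_simple_integral M (g i)) \<bullet> y"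
      unfolding state_simple_integral_def using g(2)
      by (subst energy_class_sum[OF \<epsilon>])
         (auto simp: energy_space_linear energy_class_scaleR[OF \<epsilon>] inner_sum_left mult.commute intro!: sum.cong)
    finally show ?thesis .
  qed
  \<comment> \<open>The summand \<open>1\<close> keeps \<open>c\<close> positive, so that one may divide by it when \<open>y = 0\<close>.\<close>
  define c where "c = norm y + 1"
  have c: "0 < c" unfolding c_def by (rule add_nonneg_pos) auto
  have diff_le: "\<bar>u i s - energy_class \<epsilon> (f s) \<bullet> y\<bar> \<le> c * energy_dist \<epsilon> (g i s) (f s)"
    if "s \<in> space M" "f s \<in> energy_space" for i s
  proof -
    have "\<bar>u i s - energy_class \<epsilon> (f s) \<bullet> y\<bar> \<le> energy_dist \<epsilon> (g i s) (f s) * norm y"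
      using Cauchy_Schwarz_ineq2[of "energy_class \<epsilon> (g i s) - energy_class \<epsilon> (f s)" y] that g(2)[of s i]
      by (simp add: energy_dist_eq_dist[OF \<epsilon>] u_def dist_norm inner_diff_left)
    also have "\<dots> \<le> energy_dist \<epsilon> (g i s) (f s) * c"
      using that g(2)[of s i] by (intro mult_left_mono) (auto simp: c_def energy_dist_eq_dist[OF \<epsilon>])
    finally show ?thesis by (simp add: mult.commute)
  qed
  define h where "h s = lim (\<lambda>i. u i s)" for s
  have [measurable]: "h \<in> borel_measurable M" unfolding h_def by measurable
  have h_eq: "AE s in M. h s = energy_class \<epsilon> (f s) \<bullet> y"
    using ptw f AE_space
  proof eventually_elim
    case (elim s)
    have "(\<lambda>i. c * energy_dist \<epsilon> (g i s) (f s)) \<longlonglongrightarrow> 0"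
      by (rule tendsto_mult_right_zero[OF elim(1)])
    hence "(\<lambda>i. u i s - energy_class \<epsilon> (f s) \<bullet> y) \<longlonglongrightarrow> 0"
      by (rule Lim_null_comparison[rotated]) (use diff_le elim in auto)
    hence "(\<lambda>i. u i s) \<longlonglongrightarrow> energy_class \<epsilon> (f s) \<bullet> y" by (rule LIM_zero_cancel)
    thus ?case unfolding h_def by (rule limI)
  qed
  have lim0: "(\<lambda>i. \<integral>\<^sup>+ s. ennreal (norm (u i s - h s)) \<partial>M) \<longlonglongrightarrow> 0"
  proof (rule tendsto_sandwich[OF _ _ tendsto_const])
    show "(\<lambda>i. ennreal c * (\<integral>\<^sup>+ s. ennreal (energy_dist \<epsilon> (g i s) (f s)) \<partial>M)) \<longlonglongrightarrow> 0"
      using ennreal_tendsto_cmult[OF _ L1, of "ennreal c"] by simp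
    have "(\<integral>\<^sup>+ s. ennreal (norm (u i s - h s)) \<partial>M) \<le> ennreal c * (\<integral>\<^sup>+ s. ennreal (energy_dist \<epsilon> (g i s) (f s)) \<partial>M)" for i
    proof -
      have "(\<integral>\<^sup>+ s. ennreal (norm (u i s - h s)) \<partial>M) = (\<integral>\<^sup>+ s. ennreal c * ennreal (norm (u i s - h s) / c) \<partial>M)"
        using c by (simp add: ennreal_mult''[symmetric])
      also have "\<dots> = ennreal c * (\<integral>\<^sup>+ s. ennreal (norm (u i s - h s) / c) \<partial>M)"
        by (rule nn_integral_cmult) simp
      also have "\<dots> \<le> ennreal c * (\<integral>\<^sup>+ s. ennreal (energy_dist \<epsilon> (g i s) (f s)) \<partial>M)"
      proof (rule mult_left_mono[OF nn_integral_mono_AE])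
        show "AE s in M. ennreal (norm (u i s - h s) / c) \<le> ennreal (energy_dist \<epsilon> (g i s) (f s))"
          using h_eq f AE_space
        proof eventually_elim
          case (elim s)
          then show ?case using diff_le[of s i] c
            by (intro ennreal_leI) (simp add: pos_divide_le_eq mult.commute)
        qed
      qed simp
      finally show ?thesis .
    qed
    thus "\<forall>\<^sub>F i in sequentially. (\<integral>\<^sup>+ s. ennreal (norm (u i s - h s)) \<partial>M)
        \<le> ennreal c * (\<integral>\<^sup>+ s. ennreal (energy_dist \<epsilon> (g i s) (f s)) \<partial>M)" by simp
  qed auto
  have h_int: "integrable M h"
  proof -
    from order_tendstoD(2)[OF lim0, of 1] obtain i where "(\<integral>\<^sup>+ s. ennreal (norm (u i s - h s)) \<partial>M) < 1"
      by (auto simp: eventually_sequentially)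
    hence "(\<integral>\<^sup>+ s. ennreal (norm (u i s - h s)) \<partial>M) < \<infinity>" by (rule less_trans) simp
    hence "integrable M (\<lambda>s. u i s - h s)" by (intro integrableI_bounded) simp_all
    from Bochner_Integration.integrable_diff[OF u_int[of i] this] show ?thesis by simp
  qed
  have "(\<lambda>i. \<integral>s. u i s \<partial>M) \<longlonglongrightarrow> (\<integral>s. h s \<partial>M)"
    by (rule tendsto_L1_int[OF u_int h_int lim0])
  moreover have "(\<lambda>i. \<integral>s. u i s \<partial>M) \<longlonglongrightarrow> energy_class \<epsilon> I \<bullet> y"
  proof -
    have "state_simple_integral M (g i) \<in> energy_space" for i
      unfolding state_simple_integral_def using g(2)
      by (auto intro!: energy_spaceI L2_sum L2_scaleR dest!: energy_spaceD)
    hence "(\<lambda>i. dist (energy_class \<epsilon> (state_simple_integral M (g i))) (energy_class \<epsilon> I)) \<longlonglongrightarrow> 0"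
      using conv I by (simp add: energy_dist_eq_dist[OF \<epsilon>])
    hence "(\<lambda>i. energy_class \<epsilon> (state_simple_integral M (g i))) \<longlonglongrightarrow> energy_class \<epsilon> I"
      by (subst tendsto_dist_iff)
    thus ?thesis unfolding sums by (intro tendsto_intros)
  qed
  ultimately have "(\<integral>s. h s \<partial>M) = energy_class \<epsilon> I \<bullet> y" by (rule LIMSEQ_unique)
  with h_int h_eq show ?thesis by blast
qed

section \<open>Integrals over time and convolution with weakly null coefficients\<close>

lemma space_time [simp]: "space (time T) = {0<..<T}"
  by (simp add: time_def space_restrict_space)

lemma sets_time: "sets (time T) = sets (restrict_space borel {0<..<T})"
  by (simp add: time_def sets_restrict_space)

lemma emeasure_time: "A \<in> sets borel \<Longrightarrow> A \<subseteq> {0<..<T} \<Longrightarrow> emeasure (time T) A = emeasure lborel A"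
  by (simp add: time_def emeasure_restrict_space)

lemma finite_measure_time: "finite_measure (time T)"
  by (rule finite_measureI, cases "0 \<le> T") (simp_all add: emeasure_time)

lemma sets_time_Int: "A \<in> sets borel \<Longrightarrow> A \<inter> space (time T) \<in> sets (time T)"
  unfolding sets_time sets_restrict_space space_time by (subst Int_commute) (rule imageI)

lemma time_restrict: "t \<le> T \<Longrightarrow> time t = restrict_space (time T) {0<..<t}"
  unfolding time_def by (subst restrict_restrict_space) (auto simp: min_def Int_def intro!: arg_cong2[where f = restrict_space])

lemma AE_time_mono:
  assumes t: "t \<le> T" and P: "AE s in time T. P s" shows "AE s in time t. P s"
  unfolding time_restrict[OF t]
  by (subst AE_restrict_space_iff[OF sets_time_Int]) (use P in \<open>auto elim: eventually_mono\<close>)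

lemma integral_time_restrict:
  fixes f :: "real \<Rightarrow> real"
  assumes t: "t \<le> T"
  shows "integrable (time t) f \<longleftrightarrow> integrable (time T) (\<lambda>s. indicator {0<..<t} s * f s)"
    and "(\<integral>s. f s \<partial>time t) = (\<integral>s. indicator {0<..<t} s * f s \<partial>time T)"
proof -
  have S: "{0<..<t} \<inter> space (time T) \<in> sets (time T)" by (rule sets_time_Int) simp
  show "integrable (time t) f \<longleftrightarrow> integrable (time T) (\<lambda>s. indicator {0<..<t} s * f s)"
    "(\<integral>s. f s \<partial>time t) = (\<integral>s. indicator {0<..<t} s * f s \<partial>time T)"
    unfolding time_restrict[OF t] integrable_restrict_space[OF S] integral_restrict_space[OF S] by simp_all
qed

lemma L2_time_mono:
  assumes f: "L2 (time T) f" and t: "t \<le> T"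
  shows "L2 (time t) f" "L2_norm (time t) f \<le> L2_norm (time T) f"
proof -
  have "{0<..<t} \<inter> space (time T) = {0<..<t}" using t by auto
  hence sets: "{0<..<t} \<in> sets (time T)" using sets_time_Int[of "{0<..<t}" T] by simp
  have int: "integrable (time T) (\<lambda>s. (norm (f s))\<^sup>2)" using f by (rule L2_integrable)
  have int': "integrable (time T) (\<lambda>s. indicator {0<..<t} s * (norm (f s))\<^sup>2)"
    using integrable_mult_indicator[OF sets int] by simp
  show "L2 (time t) f"
    unfolding L2_def
  proof
    show "f \<in> borel_measurable (time t)"
      unfolding time_restrict[OF t] by (intro measurable_restrict_space1 L2_measurable f)
    show "integrable (time t) (\<lambda>s. (norm (f s))\<^sup>2)"
      using int' by (simp add: integral_time_restrict(1)[OF t])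
  qed
  have "(\<integral>s. (norm (f s))\<^sup>2 \<partial>time t) \<le> (\<integral>s. (norm (f s))\<^sup>2 \<partial>time T)"
    unfolding integral_time_restrict(2)[OF t]
    by (rule integral_mono[OF int' int]) (auto simp: indicator_def)
  thus "L2_norm (time t) f \<le> L2_norm (time T) f" by (simp add: L2_norm_def)
qed

lemma continuous_time_measurable:
  assumes "continuous_on {0..T} f" shows "f \<in> borel_measurable (time T)"
proof -
  have "f \<in> borel_measurable (restrict_space borel {0<..<T})"
    by (intro borel_measurable_continuous_on_restrict continuous_on_subset[OF assms]) auto
  thus ?thesis by (simp cong: measurable_cong_sets add: sets_time)
qed

lemma continuous_time_integral:
  fixes f :: "real \<Rightarrow> real"
  assumes "continuous_on {0..t} f"
  shows "integrable (time t) f" "(\<integral>s. f s \<partial>time t) = integral {0..t} f"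
proof -
  have "set_integrable lborel {0<..<t} f"
    using borel_integrable_atLeastAtMost'[OF assms] by (rule set_integrable_subset) auto
  thus "integrable (time t) f" "(\<integral>s. f s \<partial>time t) = integral {0..t} f"
    using set_borel_integral_eq_integral(2)[of "{0<..<t}" f]
    by (simp_all add: time_def integrable_restrict_space integral_restrict_space set_integrable_def
        set_lebesgue_integral_def integral_open_interval_real)
qed

lemma continuous_L2_time:
  fixes f :: "real \<Rightarrow> real"
  assumes f: "continuous_on {0..t} f" shows "L2 (time t) f"
  unfolding L2_def using continuous_time_integral(1)[of t "\<lambda>s. (norm (f s))\<^sup>2"] continuous_time_measurable[OF f]
  by (auto intro!: continuous_intros f)

lemma integral_abs_le_L2_time:
  fixes f :: "real \<Rightarrow> real"
  assumes f: "L2 (time T) f" and T: "0 \<le> T"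
  shows "integrable (time T) (\<lambda>s. \<bar>f s\<bar>)" "(\<integral>s. \<bar>f s\<bar> \<partial>time T) \<le> sqrt T * L2_norm (time T) f"
proof -
  interpret finite_measure "time T" by (rule finite_measure_time)
  have one: "L2 (time T) (\<lambda>_. 1 :: real)" by (simp add: L2_def)
  have n1: "L2_norm (time T) (\<lambda>_. 1 :: real) = sqrt T"
    using T by (simp add: L2_norm_def measure_def emeasure_time)
  show "integrable (time T) (\<lambda>s. \<bar>f s\<bar>)" using L2_mult_integrable[OF one f] by simp
  show "(\<integral>s. \<bar>f s\<bar> \<partial>time T) \<le> sqrt T * L2_norm (time T) f"
    using L2_mult_Cauchy_Schwarz[OF one f] by (simp add: n1)
qed

lemma gronwall:
  fixes f :: "real \<Rightarrow> real"
  assumes f: "continuous_on {0..T} f" and b: "0 \<le> b"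
    and le: "\<And>t. 0 \<le> t \<Longrightarrow> t \<le> T \<Longrightarrow> f t \<le> a + b * integral {0..t} f"
    and t: "0 \<le> t" "t \<le> T"
  shows "f t \<le> a * exp (b * t)"
proof -
  define \<Phi> where "\<Phi> s = exp (- b * s) * (a + b * integral {0..s} f)" for s
  have deriv: "(\<Phi> has_real_derivative exp (- b * s) * (b * f s) - b * exp (- b * s) * (a + b * integral {0..s} f)) (at s within {0..T})"
    if s: "s \<in> {0..T}" for s
  proof -
    have "((\<lambda>s. integral {0..s} f) has_real_derivative f s) (at s within {0..T})"
      using integral_has_vector_derivative[OF f s] by (simp add: has_real_derivative_iff_has_vector_derivative)
    thus ?thesis unfolding \<Phi>_def by (auto intro!: derivative_eq_intros)
  qed
  have "\<Phi> t \<le> \<Phi> 0"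
  proof (rule DERIV_nonpos_imp_decreasing_open[OF t(1)])
    have "continuous_on {0..T} \<Phi>"
      using deriv by (rule DERIV_continuous_on)
    thus "continuous_on {0..t} \<Phi>" by (rule continuous_on_subset) (use t in auto)
    fix s assume s: "0 < s" "s < t"
    have "exp (- b * s) * (b * (f s - (a + b * integral {0..s} f))) \<le> 0"
      using le[of s] s t b by (intro mult_nonneg_nonpos) auto
    moreover have "at s within {0..T} = at s" using s t by (intro at_within_Icc_at) auto
    ultimately show "\<exists>y. (\<Phi> has_real_derivative y) (at s) \<and> y \<le> 0"
      using deriv[of s] s t by (intro exI conjI) (auto simp: algebra_simps)
  qed
  hence "exp (b * t) * \<Phi> t \<le> exp (b * t) * a"
    by (intro mult_left_mono) (auto simp: \<Phi>_def)
  hence "a + b * integral {0..t} f \<le> exp (b * t) * a"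
    by (simp add: \<Phi>_def mult.assoc[symmetric] exp_add[symmetric])
  with le[OF t] show ?thesis by (simp add: mult.commute)
qed

text \<open>
  The kernel \<open>K (r, s) = S r (F s)\<close> is uniformly continuous on a square, so on a fine grid
  \<open>s \<mapsto> S (t - s) (F s)\<close> is close to a step function, uniformly in \<open>t\<close>. The step functions only take
  values at grid points, so for all \<open>t\<close> at once only finitely many cell integrals of \<open>\<alpha> n\<close> occur, and these
  tend to zero by weak convergence. Testing with an arbitrary \<open>y\<close> and a bound proportional to \<open>norm y\<close>
  expresses smallness in norm.
\<close>

lemma weak_null_convolution:
  fixes S :: "real \<Rightarrow> 'h::{real_inner, banach} \<Rightarrow> 'h" and \<alpha> :: "nat \<Rightarrow> real \<Rightarrow> real"
  assumes S: "contraction_flow S" and T: "0 < T" and F: "continuous_on {0..T} F"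
    and weak: "weak_L2_tendsto (time T) \<alpha> (\<lambda>_. 0)" and bdd: "\<And>n. L2_norm (time T) (\<alpha> n) \<le> A"
    and e: "0 < e"
  shows "\<forall>\<^sub>F n in sequentially. \<forall>t\<in>{0..T}. \<forall>y.
    integrable (time t) (\<lambda>s. \<alpha> n s * (S (t - s) (F s) \<bullet> y)) \<and>
    \<bar>\<integral>s. \<alpha> n s * (S (t - s) (F s) \<bullet> y) \<partial>time t\<bar> \<le> e * norm y"
proof -
  interpret S: contraction_flow S by fact
  have \<alpha>: "L2 (time T) (\<alpha> n)" for n using weak by (simp add: weak_L2_tendsto_def)
  have A: "0 \<le> A" using bdd[of 0] L2_norm_nonneg[of "time T" "\<alpha> 0"] by linarith
  obtain C where C: "0 < C" "\<And>s. s \<in> {0..T} \<Longrightarrow> norm (F s) \<le> C"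
    using compact_imp_bounded[OF compact_continuous_image[OF F compact_Icc]] unfolding bounded_pos by auto
  define K where "K p = S (fst p) (F (snd p))" for p
  have K: "continuous_on ({0..T} \<times> {0..T}) K"
    unfolding K_def by (intro S.continuous_on_flow continuous_on_compose2[OF F] continuous_intros) auto
  have KC: "norm (K p) \<le> C" if "p \<in> {0..T} \<times> {0..T}" for p
    using S.contraction[of "fst p" "F (snd p)"] C(2)[of "snd p"] that by (auto simp: K_def)
  \<comment> \<open>The error \<open>e\<close> has three parts: the oscillation \<open>\<eta>\<close> of \<open>K\<close> within the cells, the incomplete last cell
    of length \<open>h\<close>, and the cell integrals.\<close>
  define \<eta> where "\<eta> = (e / 3) / (A * sqrt T + 1)"
  have den: "0 < A * sqrt T + 1" using A T by (intro add_nonneg_pos) auto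
  have cancel: "(x / D) * D = x" if "0 < D" for x D :: real using that by simp
  have \<eta>: "0 < \<eta>" using e den by (simp add: \<eta>_def)
  have \<eta>A: "\<eta> * (sqrt T * A) \<le> e / 3"
  proof -
    have "\<eta> * (A * sqrt T) \<le> \<eta> * (A * sqrt T + 1)" using \<eta> by simp
    also have "\<dots> = e / 3" unfolding \<eta>_def by (rule cancel[OF den])
    finally show ?thesis by (simp add: mult.commute)
  qed
  have "uniformly_continuous_on ({0..T} \<times> {0..T}) K"
    by (rule compact_uniformly_continuous[OF K]) (intro compact_Times compact_Icc)
  then obtain \<delta> where \<delta>: "0 < \<delta>"
    and unif: "\<And>p q. p \<in> {0..T} \<times> {0..T} \<Longrightarrow> q \<in> {0..T} \<times> {0..T} \<Longrightarrow> dist q p < \<delta> \<Longrightarrow> dist (K q) (K p) < \<eta>"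
    using \<eta> unfolding uniformly_continuous_on_def by metis
  define r where "r = ((e / 3) / (C * A + 1))\<^sup>2"
  have CA: "0 < C * A + 1" using C(1) A by (intro add_nonneg_pos) auto
  have r: "0 < r" using e CA by (simp add: r_def)
  \<comment> \<open>The mesh \<open>h\<close> is below \<open>\<delta> / 3\<close> for uniform continuity, where both arguments of \<open>K\<close> move by at most \<open>h\<close>.
    It is below \<open>r\<close> for the last cell, on which \<open>\<alpha> n\<close> has integral at most \<open>A * sqrt h\<close>.\<close>
  obtain N where N: "T / min (\<delta> / 3) r < real N" using reals_Archimedean2 by blast
  have N0: "0 < N" using N T \<delta> r by (cases N) (auto simp: divide_less_0_iff not_less[symmetric])
  define h where "h = T / real N"
  have h: "0 < h" "h < \<delta> / 3" "h < r"
  proof -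
    have "0 < min (\<delta> / 3) r" using \<delta> r by simp
    hence "h < min (\<delta> / 3) r"
      using N N0 by (simp only: h_def pos_divide_less_eq of_nat_0_less_iff mult.commute)
    thus "0 < h" "h < \<delta> / 3" "h < r" using T N0 by (simp_all add: h_def)
  qed
  have hC: "C * (sqrt h * A) \<le> e / 3"
  proof -
    have "sqrt h \<le> (e / 3) / (C * A + 1)"
      using h CA e real_sqrt_less_mono[OF h(3)] by (simp add: r_def)
    hence "(C * A) * sqrt h \<le> (C * A) * ((e / 3) / (C * A + 1))"
      using C(1) A by (intro mult_left_mono) auto
    also have "\<dots> \<le> (C * A + 1) * ((e / 3) / (C * A + 1))"
      using e CA by (intro mult_right_mono) auto
    also have "\<dots> = e / 3" using cancel[OF CA] by (simp only: mult.commute)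
    finally show ?thesis by (simp add: algebra_simps)
  qed
  define \<tau> where "\<tau> q = real q * h" for q :: nat
  define Q where "Q q = {\<tau> q..<\<tau> (Suc q)}" for q
  have \<tau>N: "\<tau> N = T" using N0 by (simp add: \<tau>_def h_def)
  have \<tau>mono: "\<tau> p \<le> \<tau> q \<longleftrightarrow> p \<le> q" for p q using h by (simp add: \<tau>_def)
  have \<tau>Suc: "\<tau> (Suc q) = \<tau> q + h" for q by (simp add: \<tau>_def algebra_simps)
  have \<tau>0: "0 \<le> \<tau> q" for q using h by (simp add: \<tau>_def)
  have ind_L2: "L2 (time T) (indicator (Q q) :: real \<Rightarrow> real)" for q
  proof -
    interpret finite_measure "time T" by (rule finite_measure_time)
    have m: "(indicator (Q q) :: real \<Rightarrow> real) \<in> borel_measurable (time T)"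
      unfolding Q_def time_def by (intro measurable_restrict_space1) simp
    show ?thesis unfolding L2_def
    proof (intro conjI m integrable_const_bound[of _ 1])
      show "AE s in time T. norm ((norm (indicator (Q q) s :: real))\<^sup>2) \<le> 1" by (simp add: indicator_def)
      show "(\<lambda>s. (norm (indicator (Q q) s :: real))\<^sup>2) \<in> borel_measurable (time T)"
        using m by measurable
    qed
  qed
  have ind_norm: "L2_norm (time T) (indicator (Q q) :: real \<Rightarrow> real) \<le> sqrt h" for q
  proof -
    have "(\<integral>s. (norm (indicator (Q q) s :: real))\<^sup>2 \<partial>time T) = (\<integral>s. indicator ({0<..<T} \<inter> Q q) s \<partial>lborel)"
      unfolding time_def by (subst integral_restrict_space)
        (simp, rule Bochner_Integration.integral_cong, simp, simp add: indicator_def)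
    also have "\<dots> = measure lborel ({0<..<T} \<inter> Q q)" by simp
    also have "\<dots> \<le> measure lborel (Q q)"
      unfolding Q_def using h by (intro measure_mono_fmeasurable fmeasurableI) (auto simp: \<tau>Suc)
    also have "\<dots> = h" using h by (simp add: Q_def \<tau>Suc)
    finally show ?thesis by (simp add: L2_norm_def)
  qed
  define c where "c n q = (\<integral>s. \<alpha> n s * indicator (Q q) s \<partial>time T)" for n q
  have cell_int: "integrable (time T) (\<lambda>s. \<alpha> n s * indicator (Q q) s)" for n q
    using L2_inner_integrable[OF \<alpha> ind_L2, of n q] by simp
  have "(\<lambda>n. c n q) \<longlonglongrightarrow> 0" for q
    using weak ind_L2[of q] unfolding weak_L2_tendsto_def c_def by (auto simp: inner_real_def)
  hence "(\<lambda>n. C * (\<Sum>q<N. \<bar>c n q\<bar>)) \<longlonglongrightarrow> C * (\<Sum>q<N. \<bar>0\<bar>)"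
    by (intro tendsto_intros)
  hence "\<forall>\<^sub>F n in sequentially. C * (\<Sum>q<N. \<bar>c n q\<bar>) < e / 3"
    using e by (intro order_tendstoD(2)[where y = 0]) auto
  thus ?thesis
  proof (rule eventually_mono, intro ballI allI)
    fix n t y assume small: "C * (\<Sum>q<N. \<bar>c n q\<bar>) < e / 3" and t: "t \<in> {0..T}"
    define p where "p = nat \<lfloor>t / h\<rfloor>"
    have pt: "\<tau> p \<le> t" "t < \<tau> p + h"
    proof -
      have "real p = of_int \<lfloor>t / h\<rfloor>" using t h by (simp add: p_def)
      hence "real p \<le> t / h" "t / h < real p + 1" by linarith+
      thus "\<tau> p \<le> t" "t < \<tau> p + h" using h by (simp_all add: \<tau>_def field_simps)
    qed
    have pN: "p \<le> N" using pt(1) t \<tau>N \<tau>mono[of p N] by auto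
    \<comment> \<open>\<open>D1\<close> is the kernel cut off at \<open>t\<close>, and \<open>D2\<close> its step approximation on the \<open>p\<close> full cells below \<open>t\<close>,
      with \<open>t\<close> rounded down to a grid point as well.\<close>
    define D1 where "D1 s = indicator {0<..<t} s * (K (t - s, s) \<bullet> y)" for s
    define D2 where "D2 s = (\<Sum>q<p. indicator (Q q) s * (K (\<tau> p - \<tau> q, \<tau> q) \<bullet> y))" for s
    have Kcont: "continuous_on {0..t} (\<lambda>s. K (t - s, s) \<bullet> y)"
      using t by (intro continuous_on_inner continuous_on_compose2[OF K] continuous_intros) auto
    have int1: "integrable (time t) (\<lambda>s. \<alpha> n s * (K (t - s, s) \<bullet> y))"
      using L2_inner_integrable[OF L2_time_mono(1)[OF \<alpha>] continuous_L2_time[OF Kcont], of n] t by simp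
    hence int1': "integrable (time T) (\<lambda>s. \<alpha> n s * D1 s)"
      using t by (subst (asm) integral_time_restrict(1)[of t T]) (auto simp: D1_def algebra_simps)
    have eq1: "(\<integral>s. \<alpha> n s * (K (t - s, s) \<bullet> y) \<partial>time t) = (\<integral>s. \<alpha> n s * D1 s \<partial>time T)"
      using t by (subst integral_time_restrict(2)[of t T]) (auto simp: D1_def algebra_simps)
    have D2_alt: "\<alpha> n s * D2 s = (\<Sum>q<p. (K (\<tau> p - \<tau> q, \<tau> q) \<bullet> y) * (\<alpha> n s * indicator (Q q) s))" for s
      unfolding D2_def sum_distrib_left by (intro sum.cong) auto
    have int2: "integrable (time T) (\<lambda>s. \<alpha> n s * D2 s)"
      unfolding D2_alt by (intro Bochner_Integration.integrable_sum integrable_mult_right cell_int)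
    have eq2: "(\<integral>s. \<alpha> n s * D2 s \<partial>time T) = (\<Sum>q<p. (K (\<tau> p - \<tau> q, \<tau> q) \<bullet> y) * c n q)"
      unfolding D2_alt c_def using cell_int by simp
    have b2: "\<bar>\<integral>s. \<alpha> n s * D2 s \<partial>time T\<bar> \<le> e / 3 * norm y"
    proof -
      have "\<bar>\<integral>s. \<alpha> n s * D2 s \<partial>time T\<bar> \<le> (\<Sum>q<p. \<bar>(K (\<tau> p - \<tau> q, \<tau> q) \<bullet> y) * c n q\<bar>)"
        unfolding eq2 by (rule sum_abs)
      also have "\<dots> \<le> (\<Sum>q<p. (C * norm y) * \<bar>c n q\<bar>)"
      proof (rule sum_mono)
        fix q assume q: "q \<in> {..<p}"
        hence "\<tau> q \<le> \<tau> p" "\<tau> p \<le> T" using \<tau>mono \<tau>N pN by (auto simp flip: \<tau>N)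
        hence "norm (K (\<tau> p - \<tau> q, \<tau> q)) \<le> C" using \<tau>0[of q] by (intro KC) auto
        hence "\<bar>K (\<tau> p - \<tau> q, \<tau> q) \<bullet> y\<bar> \<le> C * norm y"
          by (intro order_trans[OF Cauchy_Schwarz_ineq2] mult_right_mono) auto
        thus "\<bar>(K (\<tau> p - \<tau> q, \<tau> q) \<bullet> y) * c n q\<bar> \<le> (C * norm y) * \<bar>c n q\<bar>"
          unfolding abs_mult by (rule mult_right_mono) simp
      qed
      also have "\<dots> \<le> (\<Sum>q<N. (C * norm y) * \<bar>c n q\<bar>)"
        using pN C(1) by (intro sum_mono2) auto
      also have "\<dots> = C * (\<Sum>q<N. \<bar>c n q\<bar>) * norm y" by (simp add: sum_distrib_left sum_distrib_right algebra_simps)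
      also have "\<dots> \<le> e / 3 * norm y" using small by (intro mult_right_mono) auto
      finally show ?thesis .
    qed
    have pt_le: "\<bar>D1 s - D2 s\<bar> \<le> norm y * (\<eta> + C * indicator (Q p) s)" if s: "s \<in> {0<..<T}" for s
    proof -
      \<comment> \<open>Either \<open>s\<close> lies in a full cell below \<open>t\<close>, or in the cell of \<open>t\<close>, where the trivial bound \<open>C\<close> is
        used, or beyond it, where both functions vanish.\<close>
      consider q where "q < p" "s \<in> Q q" | "s \<in> Q p" | "\<tau> (Suc p) \<le> s"
      proof -
        define q where "q = nat \<lfloor>s / h\<rfloor>"
        have "real q = of_int \<lfloor>s / h\<rfloor>" using s h by (simp add: q_def)
        hence "real q \<le> s / h" "s / h < real q + 1" by linarith+
        hence "\<tau> q \<le> s" "s < \<tau> (Suc q)" using h by (simp_all add: \<tau>_def field_simps)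
        moreover have "\<tau> (Suc p) \<le> s" if "p < q" using that \<tau>mono[of "Suc p" q] \<open>\<tau> q \<le> s\<close> by simp
        ultimately show ?thesis using that by (cases "q < p"; cases "q = p") (auto simp: Q_def)
      qed
      then show ?thesis
      proof cases
        case (1 q)
        have other: "s \<notin> Q q'" if "q' \<noteq> q" for q'
          using that 1(2) \<tau>mono[of "Suc q'" q] \<tau>mono[of "Suc q" q'] by (cases "q' < q") (auto simp: Q_def)
        have D2: "D2 s = K (\<tau> p - \<tau> q, \<tau> q) \<bullet> y"
        proof -
          have "D2 s = (\<Sum>q'\<in>{q}. indicator (Q q') s * (K (\<tau> p - \<tau> q', \<tau> q') \<bullet> y))"
            unfolding D2_def using 1 other by (intro sum.mono_neutral_right) auto
          thus ?thesis using 1 by simp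
        qed
        have "\<tau> (Suc q) \<le> \<tau> p" using 1(1) \<tau>mono by simp
        hence st: "s < t" "\<tau> q \<le> s" "s < \<tau> q + h" "\<tau> q + h \<le> \<tau> p" using 1(2) pt by (auto simp: Q_def \<tau>Suc)
        have D1: "D1 s = K (t - s, s) \<bullet> y" using st s by (simp add: D1_def)
        have "dist (t - s, s) (\<tau> p - \<tau> q, \<tau> q) \<le> \<bar>(t - s) - (\<tau> p - \<tau> q)\<bar> + \<bar>s - \<tau> q\<bar>"
          unfolding dist_Pair_Pair dist_real_def by (rule sqrt_sum_squares_le_sum_abs[THEN order_trans]) simp
        also have "\<dots> \<le> h + h" using st pt by (intro add_mono) (auto simp: abs_le_iff)
        also have "\<dots> < \<delta>" using h \<delta> by simp
        finally have "dist (K (t - s, s)) (K (\<tau> p - \<tau> q, \<tau> q)) < \<eta>"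
          using st s t pt \<tau>0[of q] by (intro unif) auto
        hence "\<bar>D1 s - D2 s\<bar> \<le> \<eta> * norm y"
          unfolding D1 D2 inner_diff_left[symmetric]
          by (intro order_trans[OF Cauchy_Schwarz_ineq2] mult_right_mono) (auto simp: dist_norm)
        also have "\<dots> \<le> norm y * (\<eta> + C * indicator (Q p) s)"
          using C(1) by (simp add: algebra_simps indicator_def)
        finally show ?thesis .
      next
        case 2
        have "D2 s = 0"
          unfolding D2_def
        proof (rule sum.neutral, rule ballI)
          fix q assume "q \<in> {..<p}"
          hence "s \<notin> Q q" using 2 \<tau>mono[of "Suc q" p] by (auto simp: Q_def)
          thus "indicator (Q q) s * (K (\<tau> p - \<tau> q, \<tau> q) \<bullet> y) = 0" by simp
        qed
        moreover have "\<bar>D1 s\<bar> \<le> C * norm y"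
        proof (cases "s < t")
          case True
          hence "norm (K (t - s, s)) \<le> C" using s t by (intro KC) auto
          hence "\<bar>K (t - s, s) \<bullet> y\<bar> \<le> C * norm y"
            by (intro order_trans[OF Cauchy_Schwarz_ineq2] mult_right_mono) auto
          thus ?thesis using True s by (simp add: D1_def)
        qed (use C(1) in \<open>simp add: D1_def\<close>)
        moreover have "C * norm y \<le> norm y * (\<eta> + C * indicator (Q p) s)"
          using 2 \<eta> by (simp add: algebra_simps)
        ultimately show ?thesis by simp
      next
        case 3
        hence "t < s" using pt by (simp add: \<tau>Suc)
        have "D2 s = 0"
          unfolding D2_def
        proof (rule sum.neutral, rule ballI)
          fix q assume "q \<in> {..<p}"
          hence "s \<notin> Q q" using 3 \<tau>mono[of "Suc q" "Suc p"] by (auto simp: Q_def)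
          thus "indicator (Q q) s * (K (\<tau> p - \<tau> q, \<tau> q) \<bullet> y) = 0" by simp
        qed
        moreover have "D1 s = 0" using \<open>t < s\<close> by (simp add: D1_def)
        ultimately show ?thesis using \<eta> C(1) by simp
      qed
    qed
    have b1: "\<bar>\<integral>s. \<alpha> n s * (D1 s - D2 s) \<partial>time T\<bar> \<le> 2 * e / 3 * norm y"
    proof -
      have i1: "integrable (time T) (\<lambda>s. \<bar>\<alpha> n s\<bar>)" "(\<integral>s. \<bar>\<alpha> n s\<bar> \<partial>time T) \<le> sqrt T * A"
      proof -
        show "integrable (time T) (\<lambda>s. \<bar>\<alpha> n s\<bar>)" using integral_abs_le_L2_time(1)[OF \<alpha>] T by simp
        have "sqrt T * L2_norm (time T) (\<alpha> n) \<le> sqrt T * A" using T by (intro mult_left_mono bdd) simp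
        with integral_abs_le_L2_time(2)[OF \<alpha>, of n] T show "(\<integral>s. \<bar>\<alpha> n s\<bar> \<partial>time T) \<le> sqrt T * A" by linarith
      qed
      have i2: "integrable (time T) (\<lambda>s. \<bar>\<alpha> n s\<bar> * indicator (Q p) s)"
        "(\<integral>s. \<bar>\<alpha> n s\<bar> * indicator (Q p) s \<partial>time T) \<le> A * sqrt h"
      proof -
        show "integrable (time T) (\<lambda>s. \<bar>\<alpha> n s\<bar> * indicator (Q p) s)"
          using L2_mult_integrable[OF \<alpha> ind_L2, of n p] by simp
        have "(\<integral>s. \<bar>\<alpha> n s\<bar> * indicator (Q p) s \<partial>time T) \<le> L2_norm (time T) (\<alpha> n) * L2_norm (time T) (indicator (Q p) :: real \<Rightarrow> real)"
          using L2_mult_Cauchy_Schwarz[OF \<alpha> ind_L2, of n p] by simp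
        also have "\<dots> \<le> A * sqrt h" using bdd ind_norm A by (intro mult_mono) auto
        finally show "(\<integral>s. \<bar>\<alpha> n s\<bar> * indicator (Q p) s \<partial>time T) \<le> A * sqrt h" .
      qed
      have "\<bar>\<integral>s. \<alpha> n s * (D1 s - D2 s) \<partial>time T\<bar> \<le> (\<integral>s. norm y * (\<eta> * \<bar>\<alpha> n s\<bar> + C * (\<bar>\<alpha> n s\<bar> * indicator (Q p) s)) \<partial>time T)"
      proof (rule integral_abs_bound[THEN order_trans], rule integral_mono_AE')
        show "integrable (time T) (\<lambda>s. norm y * (\<eta> * \<bar>\<alpha> n s\<bar> + C * (\<bar>\<alpha> n s\<bar> * indicator (Q p) s)))"
          using i1(1) i2(1) by simp
        show "AE s in time T. \<bar>\<alpha> n s * (D1 s - D2 s)\<bar> \<le> norm y * (\<eta> * \<bar>\<alpha> n s\<bar> + C * (\<bar>\<alpha> n s\<bar> * indicator (Q p) s))"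
        proof (rule AE_I2)
          fix s assume "s \<in> space (time T)"
          hence "\<bar>\<alpha> n s\<bar> * \<bar>D1 s - D2 s\<bar> \<le> \<bar>\<alpha> n s\<bar> * (norm y * (\<eta> + C * indicator (Q p) s))"
            by (intro mult_left_mono pt_le) auto
          thus "\<bar>\<alpha> n s * (D1 s - D2 s)\<bar> \<le> norm y * (\<eta> * \<bar>\<alpha> n s\<bar> + C * (\<bar>\<alpha> n s\<bar> * indicator (Q p) s))"
            unfolding abs_mult by (simp add: algebra_simps)
        qed
        show "AE s in time T. 0 \<le> norm y * (\<eta> * \<bar>\<alpha> n s\<bar> + C * (\<bar>\<alpha> n s\<bar> * indicator (Q p) s))"
          using \<eta> C(1) by (intro AE_I2 mult_nonneg_nonneg add_nonneg_nonneg) auto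
      qed
      also have "\<dots> = norm y * (\<eta> * (\<integral>s. \<bar>\<alpha> n s\<bar> \<partial>time T) + C * (\<integral>s. \<bar>\<alpha> n s\<bar> * indicator (Q p) s \<partial>time T))"
        using i1(1) i2(1) by simp
      also have "\<dots> \<le> norm y * (\<eta> * (sqrt T * A) + C * (sqrt h * A))"
        using i1(2) i2(2) \<eta> C(1) by (intro mult_left_mono add_mono) (auto simp: mult.commute)
      also have "\<dots> \<le> norm y * (e / 3 + e / 3)"
        by (intro mult_left_mono add_mono \<eta>A hC) simp
      finally show ?thesis by (simp add: algebra_simps)
    qed
    have "(\<integral>s. \<alpha> n s * D1 s \<partial>time T) = (\<integral>s. \<alpha> n s * (D1 s - D2 s) \<partial>time T) + (\<integral>s. \<alpha> n s * D2 s \<partial>time T)"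
      using int1' int2 by (simp add: right_diff_distrib)
    hence "\<bar>\<integral>s. \<alpha> n s * (K (t - s, s) \<bullet> y) \<partial>time t\<bar> \<le> e * norm y"
      unfolding eq1 using b1 b2 by simp
    with int1 show "integrable (time t) (\<lambda>s. \<alpha> n s * (S (t - s) (F s) \<bullet> y)) \<and>
      \<bar>\<integral>s. \<alpha> n s * (S (t - s) (F s) \<bullet> y) \<partial>time t\<bar> \<le> e * norm y"
      by (simp add: K_def)
  qed
qed

section \<open>Stability of mild solutions\<close>

text \<open>
  The integral equation in weak form. The function \<open>h\<close> stands for the pairing of the integrand, from
  which it may differ on a null set.
\<close>

definition mild_solution ::
    "real \<Rightarrow> (real \<Rightarrow> 'h::{real_inner, banach} \<Rightarrow> 'h) \<Rightarrow> (real \<Rightarrow> 'h) \<Rightarrow> (real \<Rightarrow> 'h) \<Rightarrow> bool" where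
  "mild_solution T S b x \<longleftrightarrow> continuous_on {0..T} x \<and>
     (\<forall>t\<in>{0..T}. \<forall>y. \<exists>h. integrable (time t) h \<and> (AE s in time t. h s = S (t - s) (b s) \<bullet> y) \<and>
        x t \<bullet> y = S t (x 0) \<bullet> y + (\<integral>s. h s \<partial>time t))"

lemma norm_le_of_inner_le:
  fixes w :: "'a::real_inner"
  assumes "w \<bullet> w \<le> c * norm w" "0 \<le> c" shows "norm w \<le> c"
proof (cases "w = 0")
  case False
  thus ?thesis using assms by (simp add: dot_square_norm power2_eq_square)
qed (use assms in simp)

text \<open>
  The forcings may differ by a part controlled by the difference of the solutions, a finite sum of
  weakly null coefficients times fixed continuous curves, and a small remainder. The second part
  contributes little by \<open>weak_null_convolution\<close>, so the difference \<open>w\<close> of the solutions satisfies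
  \<open>norm (w t) \<le> \<gamma> + A * L2_norm (time t) (\<lambda>s. norm (w s))\<close>. Squaring makes this a Gronwall inequality for
  \<open>(norm (w t))\<^sup>2\<close>.
\<close>

lemma mild_solution_stability:
  fixes S :: "real \<Rightarrow> 'h::{real_inner, banach} \<Rightarrow> 'h"
  assumes S: "contraction_flow S" and T: "0 < T"
    and xs: "\<And>n. mild_solution T S (bs n) (xs n)" and x: "mild_solution T S b x"
    and init: "(\<lambda>n. xs n 0) \<longlonglongrightarrow> x 0"
    and m: "\<And>n. L2 (time T) (m n)" "\<And>n. L2_norm (time T) (m n) \<le> A"
    and split: "\<And>\<eta>::real. 0 < \<eta> \<Longrightarrow> \<exists>(J::'i set) \<alpha> F \<rho>. finite J \<and>
      (\<forall>i\<in>J. weak_L2_tendsto (time T) (\<alpha> i) (\<lambda>_. 0 :: real) \<and> (\<exists>K. \<forall>n. L2_norm (time T) (\<alpha> i n) \<le> K) \<and>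
        continuous_on {0..T} (F i)) \<and>
      (\<forall>n. L2 (time T) (\<rho> n) \<and> L2_norm (time T) (\<rho> n :: real \<Rightarrow> real) \<le> \<eta> \<and>
        (AE s in time T. norm (bs n s - b s - (\<Sum>i\<in>J. \<alpha> i n s *\<^sub>R F i s)) \<le> m n s * norm (xs n s - x s) + \<rho> n s))"
  shows "uniform_limit {0..T} xs x sequentially"
proof (rule uniform_limitI)
  interpret S: contraction_flow S by fact
  fix e :: real assume e: "0 < e"
  have A: "0 \<le> A" using m(2)[of 0] L2_norm_nonneg[of "time T" "m 0"] by linarith
  define B where "B = 2 * A\<^sup>2"
  \<comment> \<open>Gronwall turns the total perturbation \<open>\<gamma>\<close> into \<open>2 * \<gamma>\<^sup>2 * exp (B * T)\<close> for the squared norm. One third of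
    \<open>\<gamma>\<close> each is spent on the remainder, the modes and the initial data.\<close>
  define \<gamma> where "\<gamma> = e / (2 * exp (B * T))"
  have \<gamma>: "0 < \<gamma>" using e by (simp add: \<gamma>_def)
  define \<eta> where "\<eta> = \<gamma> / (3 * sqrt T)"
  have \<eta>: "0 < \<eta>" "sqrt T * \<eta> = \<gamma> / 3" using \<gamma> T by (simp_all add: \<eta>_def)
  obtain J :: "'i set" and \<alpha> F \<rho> where split\<eta>: "finite J \<and>
      (\<forall>i\<in>J. weak_L2_tendsto (time T) (\<alpha> i) (\<lambda>_. 0 :: real) \<and> (\<exists>K. \<forall>n. L2_norm (time T) (\<alpha> i n) \<le> K) \<and>
        continuous_on {0..T} (F i)) \<and>
      (\<forall>n. L2 (time T) (\<rho> n) \<and> L2_norm (time T) (\<rho> n :: real \<Rightarrow> real) \<le> \<eta> \<and>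
        (AE s in time T. norm (bs n s - b s - (\<Sum>i\<in>J. \<alpha> i n s *\<^sub>R F i s)) \<le> m n s * norm (xs n s - x s) + \<rho> n s))"
    using split[OF \<eta>(1)] by (elim exE) (rule that)
  note J = split\<eta>[THEN conjunct1]
    and \<alpha>F = split\<eta>[THEN conjunct2, THEN conjunct1, rule_format]
    and \<rho>rest = split\<eta>[THEN conjunct2, THEN conjunct2, rule_format]
  note \<alpha> = \<alpha>F[THEN conjunct1] \<alpha>F[THEN conjunct2, THEN conjunct1]
    and F = \<alpha>F[THEN conjunct2, THEN conjunct2]
    and \<rho> = \<rho>rest[THEN conjunct1] \<rho>rest[THEN conjunct2, THEN conjunct1]
    and rest = \<rho>rest[THEN conjunct2, THEN conjunct2]
  define \<kappa> where "\<kappa> = \<gamma> / (3 * (real (card J) + 1))"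
  have \<kappa>: "0 < \<kappa>" "real (card J) * \<kappa> \<le> \<gamma> / 3"
    using \<gamma> by (simp_all add: \<kappa>_def field_simps)
  have xcont: "continuous_on {0..T} (xs n)" "continuous_on {0..T} x" for n
    using xs x by (auto simp: mild_solution_def)
  have "\<forall>\<^sub>F n in sequentially. \<forall>i\<in>J. \<forall>t\<in>{0..T}. \<forall>y.
    integrable (time t) (\<lambda>s. \<alpha> i n s * (S (t - s) (F i s) \<bullet> y)) \<and>
    \<bar>\<integral>s. \<alpha> i n s * (S (t - s) (F i s) \<bullet> y) \<partial>time t\<bar> \<le> \<kappa> * norm y"
  proof (rule eventually_ball_finite[OF J], rule ballI)
    fix i assume i: "i \<in> J"
    obtain K where "\<And>n. L2_norm (time T) (\<alpha> i n) \<le> K" using \<alpha>(2)[OF i] by blast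
    from weak_null_convolution[OF S T F[OF i] \<alpha>(1)[OF i] this \<kappa>(1)]
    show "\<forall>\<^sub>F n in sequentially. \<forall>t\<in>{0..T}. \<forall>y.
      integrable (time t) (\<lambda>s. \<alpha> i n s * (S (t - s) (F i s) \<bullet> y)) \<and>
      \<bar>\<integral>s. \<alpha> i n s * (S (t - s) (F i s) \<bullet> y) \<partial>time t\<bar> \<le> \<kappa> * norm y" .
  qed
  moreover have "\<forall>\<^sub>F n in sequentially. dist (xs n 0) (x 0) < \<gamma> / 3"
    using init \<gamma> by (intro tendstoD) auto
  ultimately show "\<forall>\<^sub>F n in sequentially. \<forall>t\<in>{0..T}. dist (xs n t) (x t) < e"
  proof eventually_elim
    case (elim n)
    define w where "w t = xs n t - x t" for t
    have wcont: "continuous_on {0..T} w" unfolding w_def by (intro continuous_intros xcont)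
    have wcont': "continuous_on {0..t} (\<lambda>s. norm (w s))" if "t \<le> T" for t
      using that by (intro continuous_on_norm continuous_on_subset[OF wcont]) auto
    have est: "norm (w t) \<le> \<gamma> + A * L2_norm (time t) (\<lambda>s. norm (w s))" if t: "t \<in> {0..T}" for t
    proof (rule norm_le_of_inner_le)
      \<comment> \<open>Testing with the difference itself recovers its norm from the weak formulation.\<close>
      let ?y = "w t"
      obtain h1 where h1: "integrable (time t) h1" "AE s in time t. h1 s = S (t - s) (bs n s) \<bullet> ?y"
        "xs n t \<bullet> ?y = S t (xs n 0) \<bullet> ?y + (\<integral>s. h1 s \<partial>time t)"
        using xs[of n, unfolded mild_solution_def, THEN conjunct2, rule_format, OF t, of ?y] by blast
      obtain h2 where h2: "integrable (time t) h2" "AE s in time t. h2 s = S (t - s) (b s) \<bullet> ?y"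
        "x t \<bullet> ?y = S t (x 0) \<bullet> ?y + (\<integral>s. h2 s \<partial>time t)"
        using x[unfolded mild_solution_def, THEN conjunct2, rule_format, OF t, of ?y] by blast
      define k where "k i s = \<alpha> i n s * (S (t - s) (F i s) \<bullet> ?y)" for i s
      have k: "integrable (time t) (k i)" "\<bar>\<integral>s. k i s \<partial>time t\<bar> \<le> \<kappa> * norm ?y" if "i \<in> J" for i
        using elim(1) that t unfolding k_def by blast+
      have L2s: "L2 (time t) (m n)" "L2 (time t) (\<rho> n)" "L2 (time t) (\<lambda>s. norm (w s))"
        using t L2_time_mono(1)[OF m(1)] L2_time_mono(1)[OF \<rho>(1)] continuous_L2_time[OF wcont'] by auto
      define maj where "maj s = (\<bar>m n s\<bar> * norm (w s) + \<bar>\<rho> n s\<bar>) * norm ?y" for s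
      have i1: "integrable (time t) (\<lambda>s. \<bar>m n s\<bar> * norm (w s))"
        "(\<integral>s. \<bar>m n s\<bar> * norm (w s) \<partial>time t) \<le> A * L2_norm (time t) (\<lambda>s. norm (w s))"
      proof -
        show "integrable (time t) (\<lambda>s. \<bar>m n s\<bar> * norm (w s))"
          using L2_mult_integrable[OF L2s(1,3)] by simp
        have "(\<integral>s. \<bar>m n s\<bar> * norm (w s) \<partial>time t) \<le> L2_norm (time t) (m n) * L2_norm (time t) (\<lambda>s. norm (w s))"
          using L2_mult_Cauchy_Schwarz[OF L2s(1,3)] by simp
        also have "\<dots> \<le> A * L2_norm (time t) (\<lambda>s. norm (w s))"
          using L2_time_mono(2)[OF m(1)[of n], of t] m(2)[of n] t by (intro mult_right_mono) auto
        finally show "(\<integral>s. \<bar>m n s\<bar> * norm (w s) \<partial>time t) \<le> A * L2_norm (time t) (\<lambda>s. norm (w s))" .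
      qed
      have i2: "integrable (time t) (\<lambda>s. \<bar>\<rho> n s\<bar>)" "(\<integral>s. \<bar>\<rho> n s\<bar> \<partial>time t) \<le> \<gamma> / 3"
      proof -
        show "integrable (time t) (\<lambda>s. \<bar>\<rho> n s\<bar>)" using integral_abs_le_L2_time(1)[OF L2s(2)] t by simp
        have "(\<integral>s. \<bar>\<rho> n s\<bar> \<partial>time t) \<le> sqrt t * L2_norm (time t) (\<rho> n)"
          using integral_abs_le_L2_time(2)[OF L2s(2)] t by simp
        also have "\<dots> \<le> sqrt T * \<eta>"
          using L2_time_mono(2)[OF \<rho>(1)[of n], of t] \<rho>(2)[of n] t T by (intro mult_mono) auto
        finally show "(\<integral>s. \<bar>\<rho> n s\<bar> \<partial>time t) \<le> \<gamma> / 3" using \<eta>(2) by simp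
      qed
      have maj_int: "integrable (time t) maj" unfolding maj_def using i1(1) i2(1) by simp
      have rest_t: "AE s in time t. norm (bs n s - b s - (\<Sum>i\<in>J. \<alpha> i n s *\<^sub>R F i s)) \<le> m n s * norm (xs n s - x s) + \<rho> n s"
        by (rule AE_time_mono[OF _ rest]) (use t in auto)
      have bound: "AE s in time t. \<bar>h1 s - h2 s - (\<Sum>i\<in>J. k i s)\<bar> \<le> maj s"
        using h1(2) h2(2) rest_t AE_space
      proof eventually_elim
        case (elim s)
        define v where "v = bs n s - b s - (\<Sum>i\<in>J. \<alpha> i n s *\<^sub>R F i s)"
        have st: "0 \<le> t - s" using elim by simp
        interpret L: Real_Vector_Spaces.bounded_linear "S (t - s)" by (rule S.bounded_linear[OF st])
        have "S (t - s) v = S (t - s) (bs n s) - S (t - s) (b s) - (\<Sum>i\<in>J. \<alpha> i n s *\<^sub>R S (t - s) (F i s))"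
          unfolding v_def by (simp add: L.diff L.sum L.scaleR)
        hence "S (t - s) v \<bullet> ?y = h1 s - h2 s - (\<Sum>i\<in>J. k i s)"
          using elim by (simp add: inner_diff_left inner_sum_left k_def)
        hence "\<bar>h1 s - h2 s - (\<Sum>i\<in>J. k i s)\<bar> \<le> norm (S (t - s) v) * norm ?y"
          using Cauchy_Schwarz_ineq2[of "S (t - s) v" ?y] by simp
        also have "\<dots> \<le> (\<bar>m n s\<bar> * norm (w s) + \<bar>\<rho> n s\<bar>) * norm ?y"
        proof (rule mult_right_mono)
          have "norm (S (t - s) v) \<le> norm v" by (rule S.contraction[OF st])
          also have "\<dots> \<le> m n s * norm (w s) + \<rho> n s" using elim by (simp add: v_def w_def)
          also have "\<dots> \<le> \<bar>m n s\<bar> * norm (w s) + \<bar>\<rho> n s\<bar>" by (intro add_mono mult_right_mono) auto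
          finally show "norm (S (t - s) v) \<le> \<bar>m n s\<bar> * norm (w s) + \<bar>\<rho> n s\<bar>" .
        qed simp
        finally show ?case by (simp add: maj_def)
      qed
      have ksum: "integrable (time t) (\<lambda>s. \<Sum>i\<in>J. k i s)" using k(1) by simp
      have "\<bar>\<integral>s. h1 s - h2 s - (\<Sum>i\<in>J. k i s) \<partial>time t\<bar> \<le> (\<integral>s. maj s \<partial>time t)"
        by (rule integral_abs_bound[THEN order_trans], rule integral_mono_AE)
           (use h1(1) h2(1) ksum maj_int bound in auto)
      also have "\<dots> = ((\<integral>s. \<bar>m n s\<bar> * norm (w s) \<partial>time t) + (\<integral>s. \<bar>\<rho> n s\<bar> \<partial>time t)) * norm ?y"
        unfolding maj_def using i1(1) i2(1) by simp
      also have "\<dots> \<le> (A * L2_norm (time t) (\<lambda>s. norm (w s)) + \<gamma> / 3) * norm ?y"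
        using i1(2) i2(2) by (intro mult_right_mono add_mono) auto
      finally have e1: "\<bar>(\<integral>s. h1 s \<partial>time t) - (\<integral>s. h2 s \<partial>time t) - (\<Sum>i\<in>J. \<integral>s. k i s \<partial>time t)\<bar>
          \<le> (A * L2_norm (time t) (\<lambda>s. norm (w s)) + \<gamma> / 3) * norm ?y"
        using h1(1) h2(1) ksum k(1) by simp
      have "\<bar>\<Sum>i\<in>J. \<integral>s. k i s \<partial>time t\<bar> \<le> (\<Sum>i\<in>J. \<kappa> * norm ?y)"
        by (intro order_trans[OF sum_abs] sum_mono k(2))
      also have "\<dots> = (real (card J) * \<kappa>) * norm ?y" by simp
      also have "\<dots> \<le> \<gamma> / 3 * norm ?y" using \<kappa>(2) by (intro mult_right_mono) auto
      finally have e2: "\<bar>\<Sum>i\<in>J. \<integral>s. k i s \<partial>time t\<bar> \<le> \<gamma> / 3 * norm ?y" .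
      have "\<bar>S t (w 0) \<bullet> ?y\<bar> \<le> norm (S t (w 0)) * norm ?y" by (rule Cauchy_Schwarz_ineq2)
      also have "\<dots> \<le> \<gamma> / 3 * norm ?y"
        using S.contraction[of t "w 0"] elim(2) t by (intro mult_right_mono) (auto simp: w_def dist_norm)
      finally have e3: "\<bar>S t (w 0) \<bullet> ?y\<bar> \<le> \<gamma> / 3 * norm ?y" .
      have "?y \<bullet> ?y = S t (w 0) \<bullet> ?y + ((\<integral>s. h1 s \<partial>time t) - (\<integral>s. h2 s \<partial>time t))"
      proof -
        have "?y \<bullet> ?y = xs n t \<bullet> ?y - x t \<bullet> ?y" by (simp add: w_def inner_diff_left)
        moreover have "S t (w 0) = S t (xs n 0) - S t (x 0)" using t by (simp add: w_def S.diff)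
        ultimately show ?thesis by (simp only: h1(3) h2(3) inner_diff_left)
      qed
      thus "?y \<bullet> ?y \<le> (\<gamma> + A * L2_norm (time t) (\<lambda>s. norm (w s))) * norm ?y"
        using e1 e2 e3 by (simp add: algebra_simps)
      show "0 \<le> \<gamma> + A * L2_norm (time t) (\<lambda>s. norm (w s))" using \<gamma> A by simp
    qed
    define f where "f t = (norm (w t))\<^sup>2" for t
    have fcont: "continuous_on {0..T} f" unfolding f_def by (intro continuous_intros wcont)
    have f_le: "f t \<le> 2 * \<gamma>\<^sup>2 + B * integral {0..t} f" if t: "0 \<le> t" "t \<le> T" for t
    proof -
      have "f t \<le> (\<gamma> + A * L2_norm (time t) (\<lambda>s. norm (w s)))\<^sup>2"
        unfolding f_def using est[of t] t by (intro power_mono) auto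
      also have "\<dots> \<le> 2 * \<gamma>\<^sup>2 + 2 * (A * L2_norm (time t) (\<lambda>s. norm (w s)))\<^sup>2"
        using sum_squares_bound[of \<gamma> "A * L2_norm (time t) (\<lambda>s. norm (w s))"] by (simp add: power2_sum)
      also have "(A * L2_norm (time t) (\<lambda>s. norm (w s)))\<^sup>2 = A\<^sup>2 * integral {0..t} f"
        unfolding power_mult_distrib L2_norm_power2
        using continuous_time_integral(2)[of t f] continuous_on_subset[OF fcont, of "{0..t}"] t
        by (simp add: f_def)
      finally show ?thesis by (simp add: B_def)
    qed
    show ?case
    proof
      fix t assume t: "t \<in> {0..T}"
      have "f t \<le> 2 * \<gamma>\<^sup>2 * exp (B * t)"
        by (rule gronwall[OF fcont _ f_le]) (use t in \<open>auto simp: B_def\<close>)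
      also have "\<dots> \<le> 2 * \<gamma>\<^sup>2 * exp (B * T)"
        using t by (intro mult_left_mono) (auto simp: B_def intro!: mult_left_mono)
      also have "\<dots> \<le> 2 * \<gamma>\<^sup>2 * (exp (B * T))\<^sup>2"
      proof (intro mult_left_mono)
        have "1 \<le> exp (B * T)" using T by (simp add: B_def)
        thus "exp (B * T) \<le> (exp (B * T))\<^sup>2" by (simp add: power2_eq_square)
      qed simp
      also have "\<dots> = 2 * (e / 2)\<^sup>2" by (simp add: \<gamma>_def power_divide power_mult_distrib)
      also have "\<dots> < e\<^sup>2" using e by (simp add: power_divide)
      finally have "norm (w t) < e" using e by (intro power2_less_imp_less[of "norm (w t)" e]) (auto simp: f_def)
      thus "dist (xs n t) (x t) < e" by (simp add: w_def dist_norm)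
    qed
  qed
qed

section \<open>Uniform boundedness and the Ohmic coupling\<close>

text \<open>
  The uniform boundedness principle for this notion of weak convergence. A gliding hump without
  Baire's theorem: along a rapidly growing subsequence \<open>u j\<close>, a test function is built as a series of
  pieces \<open>\<plusminus> e j\<close> of norm \<open>inverse (3 ^ j)\<close>, each in the direction of \<open>u j\<close>. The sign is chosen so that the piece does
  not cancel the pairing with the earlier ones.
\<close>

lemma weak_L2_bounded:
  fixes fs :: "nat \<Rightarrow> 'a \<Rightarrow> 'c::euclidean_space"
  assumes weak: "weak_L2_tendsto M fs f"
  shows "\<exists>K. \<forall>n. L2_norm M (fs n) \<le> K"
proof (rule ccontr)
  assume "\<not> (\<exists>K. \<forall>n. L2_norm M (fs n) \<le> K)"
  hence ex: "\<exists>n. 2 * 3 ^ j * (real j + 1) < L2_norm M (fs n)" for j :: nat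
    by (meson not_le)
  define \<nu> where "\<nu> j = (SOME n. 2 * 3 ^ j * (real j + 1) < L2_norm M (fs n))" for j :: nat
  have \<nu>: "2 * 3 ^ j * (real j + 1) < L2_norm M (fs (\<nu> j))" for j
    unfolding \<nu>_def by (rule someI_ex[OF ex])
  define u where "u j = fs (\<nu> j)" for j
  define N where "N j = L2_norm M (u j)" for j
  have N: "2 * 3 ^ j * (real j + 1) < N j" for j using \<nu> by (simp add: N_def u_def)
  have N0: "0 < N j" for j by (rule le_less_trans[OF _ N]) simp
  have u: "L2 M (u j)" for j using weak by (simp add: weak_L2_tendsto_def u_def)
  define P where "P g h = (\<integral>x. g x \<bullet> h x \<partial>M)" for g h :: "'a \<Rightarrow> 'c"
  define e where "e j = (\<lambda>x. (inverse (3 ^ j) / N j) *\<^sub>R u j x)" for j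
  have e: "L2 M (e j)" "L2_norm M (e j) = inverse (3 ^ j)" for j
    using u N0[of j] by (auto simp: e_def L2_norm_scaleR N_def[symmetric] intro: L2_scaleR)
  have Pe: "P (u j) (e j) = inverse (3 ^ j) * N j" for j
  proof -
    have "P (u j) (e j) = inverse (3 ^ j) / N j * (N j)\<^sup>2"
      by (simp add: P_def e_def N_def L2_norm_power2 power2_norm_eq_inner)
    thus ?thesis using N0[of j] by (simp add: power2_eq_square)
  qed
  define sg where "sg j X = (if inverse (3 ^ j) * N j \<le> \<bar>P (u j) X + P (u j) (e j)\<bar> then 1 else -1 :: real)" for j X
  define X where "X = rec_nat (\<lambda>x. 0) (\<lambda>j Xj x. Xj x + sg j Xj *\<^sub>R e j x)"
  have X0: "X 0 = (\<lambda>x. 0)" and XS: "X (Suc j) = (\<lambda>x. X j x + sg j (X j) *\<^sub>R e j x)" for j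
    by (simp_all add: X_def)
  have X: "L2 M (X j)" for j by (induction j) (simp_all add: X0 XS L2_add L2_scaleR e)
  define d where "d j = (\<lambda>x. sg j (X j) *\<^sub>R e j x)" for j
  have d: "L2 M (d j)" "L2_norm M (d j) = inverse (3 ^ j)" for j
    unfolding d_def by (intro L2_scaleR e) (simp add: L2_norm_scaleR e sg_def)
  have X_sum: "X n = (\<lambda>x. \<Sum>j<n. d j x)" for n
    by (induction n) (simp_all add: X0 XS d_def)
  have large: "inverse (3 ^ j) * N j \<le> \<bar>P (u j) (X (Suc j))\<bar>" for j
  proof -
    have "P (u j) (X (Suc j)) = P (u j) (X j) + sg j (X j) * P (u j) (e j)"
      using L2_inner_integrable[OF u X, of j j] L2_inner_integrable[OF u e(1), of j j]
      by (simp add: P_def XS inner_add_right)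
    moreover have "inverse (3 ^ j) * N j \<le> \<bar>p + P (u j) (e j)\<bar> \<or> inverse (3 ^ j) * N j \<le> \<bar>p - P (u j) (e j)\<bar>" for p
      unfolding Pe by arith
    ultimately show ?thesis by (auto simp: sg_def)
  qed
  have geo: "summable (\<lambda>j. inverse (3 ^ j) :: real)"
    using summable_geometric[of "1/3 :: real"] by (simp add: power_one_over inverse_eq_divide)
  then obtain g where g: "L2 M g" "(\<lambda>n. L2_norm M (\<lambda>x. (\<Sum>j<n. d j x) - g x)) \<longlonglongrightarrow> 0"
    using L2_series[of M d, OF d(1)] by (auto simp: d(2))
  \<comment> \<open>The ratio \<open>1/3\<close> makes the sum of all later pieces half as large as the current one, so they cannot
    destroy more than half of the pairing with \<open>u j\<close>.\<close>
  have tail: "L2_norm M (\<lambda>x. X (Suc j) x - g x) \<le> inverse (3 ^ j) / 2" for j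
  proof (rule LIMSEQ_le_const)
    show "(\<lambda>n. inverse (3 ^ j) / 2 + L2_norm M (\<lambda>x. X n x - g x)) \<longlonglongrightarrow> inverse (3 ^ j) / 2"
      using tendsto_add[OF tendsto_const g(2)] by (simp add: X_sum)
    show "\<exists>n0. \<forall>n\<ge>n0. L2_norm M (\<lambda>x. X (Suc j) x - g x) \<le> inverse (3 ^ j) / 2 + L2_norm M (\<lambda>x. X n x - g x)"
    proof (intro exI[of _ "Suc j"] allI impI)
      fix n assume n: "Suc j \<le> n"
      have *: "L2_norm M (\<lambda>x. X (Suc j) x - X n x) \<le> inverse (3 ^ j) / 2 - inverse (3 ^ (n - 1)) / 2" if "Suc j \<le> n" for n
        using that
      proof (induction n rule: dec_induct)
        case base
        then show ?case by (simp add: L2_norm_def)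
      next
        case (step n)
        have "L2_norm M (\<lambda>x. X (Suc j) x - X (Suc n) x) = L2_norm M (\<lambda>x. (X (Suc j) x - X n x) + (-1) *\<^sub>R d n x)"
          by (simp add: XS d_def algebra_simps)
        also have "\<dots> \<le> L2_norm M (\<lambda>x. X (Suc j) x - X n x) + L2_norm M (\<lambda>x. (-1) *\<^sub>R d n x)"
          by (intro L2_norm_triangle L2_diff L2_scaleR X d)
        also have "L2_norm M (\<lambda>x. (-1) *\<^sub>R d n x) = inverse (3 ^ n)"
          unfolding L2_norm_scaleR d(2) by simp
        finally have "L2_norm M (\<lambda>x. X (Suc j) x - X (Suc n) x) \<le> inverse (3 ^ j) / 2 - inverse (3 ^ (n - 1)) / 2 + inverse (3 ^ n)"
          using step.IH by simp
        moreover have "inverse (3 ^ (n - 1)) = 3 * inverse (3 ^ n :: real)"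
          using step.hyps by (cases n) (auto simp: field_simps)
        ultimately show ?case by simp
      qed
      have "L2_norm M (\<lambda>x. X (Suc j) x - g x) = L2_norm M (\<lambda>x. (X (Suc j) x - X n x) + (X n x - g x))" by simp
      also have "\<dots> \<le> L2_norm M (\<lambda>x. X (Suc j) x - X n x) + L2_norm M (\<lambda>x. X n x - g x)"
        by (intro L2_norm_triangle L2_diff X g(1))
      also have "L2_norm M (\<lambda>x. X (Suc j) x - X n x) \<le> inverse (3 ^ j) / 2"
        using *[OF n] zero_le_power[of "3::real" "n - 1"] by (smt (verit) divide_nonneg_nonneg inverse_nonnegative_iff_nonnegative)
      finally show "L2_norm M (\<lambda>x. X (Suc j) x - g x) \<le> inverse (3 ^ j) / 2 + L2_norm M (\<lambda>x. X n x - g x)" by simp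
    qed
  qed
  have big: "real j + 1 \<le> \<bar>P (u j) g\<bar>" for j
  proof -
    have "P (u j) (X (Suc j)) = P (u j) g + P (u j) (\<lambda>x. X (Suc j) x - g x)"
      using L2_inner_integrable[OF u g(1), of j] L2_inner_integrable[OF u X, of j "Suc j"]
      by (simp add: P_def inner_diff_right)
    moreover have "\<bar>P (u j) (\<lambda>x. X (Suc j) x - g x)\<bar> \<le> N j * (inverse (3 ^ j) / 2)"
      unfolding P_def N_def
      by (rule order_trans[OF L2_Cauchy_Schwarz[OF u L2_diff[OF X g(1)]]]) (intro mult_left_mono tail, simp)
    ultimately have "inverse (3 ^ j) * N j / 2 \<le> \<bar>P (u j) g\<bar>" using large[of j] by (simp add: algebra_simps)
    moreover have "real j + 1 \<le> inverse (3 ^ j) * N j / 2" using N[of j] by (simp add: field_simps)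
    ultimately show ?thesis by linarith
  qed
  have "(\<lambda>n. P (fs n) g) \<longlonglongrightarrow> P f g" using weak g(1) by (simp add: weak_L2_tendsto_def P_def)
  hence "Bseq (\<lambda>n. P (fs n) g)" by (intro convergent_imp_Bseq convergentI)
  then obtain B where "\<And>n. \<bar>P (fs n) g\<bar> \<le> B" by (auto simp: Bseq_def)
  moreover obtain j where "B < real j" using reals_Archimedean2 by blast
  ultimately have "\<bar>P (u j) g\<bar> < real j" unfolding u_def by (rule le_less_trans)
  with big[of j] show False by simp
qed

lemma space_torus: "space torus = {x. \<forall>i. 0 \<le> x $ i \<and> x $ i < 2 * pi}"
  by (simp add: torus_def space_restrict_space)

lemma borel_torus_set: "{x :: real^'d. \<forall>i. 0 \<le> x $ i \<and> x $ i < 2 * pi} \<in> sets borel"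
  by measurable

lemma finite_measure_torus: "finite_measure (torus :: (real^'d) measure)"
proof (rule finite_measureI)
  have sub: "{x :: real^'d. \<forall>i. 0 \<le> x $ i \<and> x $ i < 2 * pi} \<subseteq> cbox 0 (\<chi> i. 2 * pi)"
    by (auto simp: mem_box_cart less_imp_le)
  have "emeasure torus (space (torus :: (real^'d) measure)) = emeasure lborel {x :: real^'d. \<forall>i. 0 \<le> x $ i \<and> x $ i < 2 * pi}"
    unfolding torus_def using borel_torus_set by (subst emeasure_restrict_space) (auto simp: space_restrict_space)
  also have "\<dots> \<le> emeasure lborel (cbox 0 (\<chi> i. 2 * pi) :: (real^'d) set)"
    by (rule emeasure_mono[OF sub]) simp
  also have "\<dots> < \<infinity>" by (rule emeasure_lborel_cbox_finite)
  finally show "emeasure torus (space (torus :: (real^'d) measure)) \<noteq> \<infinity>" by simp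
qed

interpretation torus: finite_measure torus by (rule finite_measure_torus)
interpretation time: finite_measure "time T" for T by (rule finite_measure_time)
interpretation spacetime: pair_sigma_finite "time T" torus for T
  by (rule pair_sigma_finite.intro) unfold_locales

lemma borel_measurable_bilinear:
  fixes f :: "'x \<Rightarrow> 'a::euclidean_space" and g :: "'x \<Rightarrow> 'b::euclidean_space" and G :: "'a \<Rightarrow> 'b \<Rightarrow> 'c::euclidean_space"
  assumes "bounded_bilinear G" "f \<in> borel_measurable M" "g \<in> borel_measurable M"
  shows "(\<lambda>x. G (f x) (g x)) \<in> borel_measurable M"
  using assms(2,3)
  by (rule borel_measurable_continuous_Pair)
     (intro bounded_bilinear.continuous_on[OF assms(1)] continuous_intros)

lemma coefficient_section:
  "coefficient T v \<Longrightarrow> s \<in> {0<..<T} \<Longrightarrow> v s \<in> borel_measurable torus"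
  unfolding coefficient_def using measurable_compose[OF measurable_Pair1'[of s "time T" torus]] by force

lemma measurable_torusI: "f \<in> borel_measurable borel \<Longrightarrow> f \<in> borel_measurable torus"
  unfolding torus_def by (intro measurable_restrict_space1) simp

lemma energy_components:
  assumes \<epsilon>: "0 < \<epsilon>" and X: "X \<in> energy_space"
  shows "L2_norm torus (\<lambda>x. fst (X x)) \<le> norm (energy_class \<epsilon> X) / sqrt \<epsilon>"
    and "L2_norm torus (\<lambda>x. snd (X x)) \<le> norm (energy_class \<epsilon> X)"
proof -
  note X' = energy_spaceD[OF X]
  define e b where "e = (\<integral>x. (norm (fst (X x)))\<^sup>2 \<partial>torus)" and "b = (\<integral>x. (norm (snd (X x)))\<^sup>2 \<partial>torus)"
  have nn: "0 \<le> e" "0 \<le> b" by (auto simp: e_def b_def)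
  have N: "norm (energy_class \<epsilon> X) = sqrt (\<epsilon> * e + b)"
    using norm_energy_class[OF \<epsilon> X] by (simp add: energy_norm_def e_def b_def)
  show "L2_norm torus (\<lambda>x. snd (X x)) \<le> norm (energy_class \<epsilon> X)"
    unfolding N using nn \<epsilon> by (simp add: L2_norm_def b_def[symmetric])
  have "sqrt e * sqrt \<epsilon> \<le> sqrt (\<epsilon> * e + b)"
    using nn by (simp add: real_sqrt_mult[symmetric] mult.commute)
  thus "L2_norm torus (\<lambda>x. fst (X x)) \<le> norm (energy_class \<epsilon> X) / sqrt \<epsilon>"
    unfolding N using \<epsilon> by (simp add: L2_norm_def e_def[symmetric] pos_le_divide_eq)
qed

lemma bilinear_L2_bound:
  fixes G :: "'a::euclidean_space \<Rightarrow> 'b::euclidean_space \<Rightarrow> 'c::euclidean_space"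
  assumes G: "bounded_bilinear G" and K: "\<And>u b. norm (G u b) \<le> norm u * norm b * K" "0 \<le> K"
    and u: "u \<in> borel_measurable M" "AE x in M. norm (u x) \<le> c" and b: "L2 M b"
  shows "L2 M (\<lambda>x. G (u x) (b x))" and "L2_norm M (\<lambda>x. G (u x) (b x)) \<le> K * \<bar>c\<bar> * L2_norm M b"
proof -
  have B: "L2 M (\<lambda>x. (K * \<bar>c\<bar>) *\<^sub>R b x)" using b by (rule L2_scaleR)
  have le: "AE x in M. norm (G (u x) (b x)) \<le> norm ((K * \<bar>c\<bar>) *\<^sub>R b x)"
    using u(2)
  proof eventually_elim
    case (elim x)
    have "norm (G (u x) (b x)) \<le> norm (u x) * norm (b x) * K" by (rule K)
    also have "\<dots> \<le> \<bar>c\<bar> * norm (b x) * K" using elim K(2) by (intro mult_right_mono) auto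
    finally show ?case using K(2) by (simp add: abs_mult algebra_simps)
  qed
  show "L2 M (\<lambda>x. G (u x) (b x))"
    by (rule L2_bound[OF B borel_measurable_bilinear[OF G u(1) L2_measurable[OF b]] le])
  show "L2_norm M (\<lambda>x. G (u x) (b x)) \<le> K * \<bar>c\<bar> * L2_norm M b"
    using L2_norm_mono[OF B le] K(2) by (simp add: L2_norm_scaleR abs_mult)
qed

text \<open>
  The magnetic part of the energy norm is unweighted, and the electric one has weight \<open>sqrt \<epsilon>\<close>. This
  turns the factor \<open>\<sigma> / \<epsilon>\<close> of the coupling into \<open>\<sigma> / sqrt \<epsilon>\<close>.
\<close>

lemma coupling_bound:
  fixes G :: "real^'d::finite \<Rightarrow> 'b::euclidean_space \<Rightarrow> real^'d"
  assumes \<epsilon>: "0 < \<epsilon>" and \<sigma>: "0 < \<sigma>" and G: "bounded_bilinear G" and K: "\<And>u b. norm (G u b) \<le> norm u * norm b * K" "0 \<le> K"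
    and u: "u \<in> borel_measurable torus" "AE x in torus. norm (u x) \<le> c" and X: "X \<in> energy_space"
  shows "coupling G \<epsilon> \<sigma> u X \<in> energy_space"
    and "norm (energy_class \<epsilon> (coupling G \<epsilon> \<sigma> u X)) \<le> \<sigma> / sqrt \<epsilon> * K * c * norm (energy_class \<epsilon> X)"
proof -
  note X' = energy_spaceD[OF X]
  note GL2 = bilinear_L2_bound(1)[OF G K u L2_snd[OF X']] and Gn = bilinear_L2_bound(2)[OF G K u L2_snd[OF X']]
  have "L2 torus (\<lambda>x. (- (\<sigma> / \<epsilon>) *\<^sub>R G (u x) (snd (X x)), 0 :: 'b))"
    by (rule L2_bounded_linear[OF _ GL2, of "\<lambda>g. (- (\<sigma> / \<epsilon>) *\<^sub>R g, 0)"])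
       (intro bounded_linear_Pair bounded_linear_scaleR_right bounded_linear_zero)
  thus C: "coupling G \<epsilon> \<sigma> u X \<in> energy_space" by (auto simp: coupling_def intro: energy_spaceI)
  show "norm (energy_class \<epsilon> (coupling G \<epsilon> \<sigma> u X)) \<le> \<sigma> / sqrt \<epsilon> * K * c * norm (energy_class \<epsilon> X)"
  proof (cases "0 \<le> c")
    case True
    have sq: "(norm (- (\<sigma> / \<epsilon>) *\<^sub>R z))\<^sup>2 = (\<sigma> / \<epsilon>)\<^sup>2 * (norm z)\<^sup>2" for z :: "real^'d"
      unfolding norm_scaleR power_mult_distrib by (simp add: power_divide)
    have "norm (energy_class \<epsilon> (coupling G \<epsilon> \<sigma> u X)) = sqrt (\<epsilon> * (\<sigma> / \<epsilon>)\<^sup>2 * (L2_norm torus (\<lambda>x. G (u x) (snd (X x))))\<^sup>2)"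
      unfolding norm_energy_class[OF \<epsilon> C] unfolding energy_norm_def L2_norm_power2 coupling_def fst_conv snd_conv sq
      by simp
    also have "\<dots> = sqrt \<epsilon> * (\<sigma> / \<epsilon>) * L2_norm torus (\<lambda>x. G (u x) (snd (X x)))"
      using \<epsilon> \<sigma> by (simp add: real_sqrt_mult)
    also have "sqrt \<epsilon> * (\<sigma> / \<epsilon>) = \<sigma> / sqrt \<epsilon>" using \<epsilon> by (simp add: field_simps)
    also have "\<sigma> / sqrt \<epsilon> * L2_norm torus (\<lambda>x. G (u x) (snd (X x))) \<le> \<sigma> / sqrt \<epsilon> * (K * c * norm (energy_class \<epsilon> X))"
      using Gn energy_components(2)[OF \<epsilon> X] True K(2) \<sigma> \<epsilon>
      by (intro mult_left_mono order_trans[OF Gn]) (auto intro!: mult_left_mono)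
    finally show ?thesis by (simp add: mult.assoc)
  next
    case False
    have "AE x in (torus :: (real^'d) measure). False"
      using u(2)
    proof (rule eventually_mono)
      fix x assume "norm (u x) \<le> c"
      with False norm_ge_zero[of "u x"] show False by linarith
    qed
    \<comment> \<open>A negative essential bound forces the measure to vanish, and then both sides are zero.\<close>
    hence "AE x in torus. coupling G \<epsilon> \<sigma> u X x = 0" "AE x in torus. X x = 0" by auto
    hence "energy_class \<epsilon> (coupling G \<epsilon> \<sigma> u X) = energy_class \<epsilon> (\<lambda>x. 0)" "energy_class \<epsilon> X = energy_class \<epsilon> (\<lambda>x. 0)"
      using C X by (auto simp: energy_class_eq_iff[OF \<epsilon>] energy_space_def)
    moreover have "energy_class \<epsilon> (\<lambda>x. 0 :: (real^'d) \<times> 'b) = 0"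
      by (simp add: energy_class_def class_of_zero zero_prod_def[symmetric])
    ultimately show ?thesis by simp
  qed
qed

lemma energy_solution_mild:
  fixes G :: "real^'d::finite \<Rightarrow> 'b::euclidean_space \<Rightarrow> real^'d"
  assumes \<epsilon>: "0 < \<epsilon>" and sol: "energy_solution curlE curlB G T \<epsilon> \<sigma> v X"
    and S: "maxwell_semigroup curlE curlB \<epsilon> \<sigma> S"
    and cpl: "AE s in time T. coupling G \<epsilon> \<sigma> (v s) (X s) \<in> energy_space"
  shows "mild_solution T (flow \<epsilon> S) (\<lambda>s. energy_class \<epsilon> (coupling G \<epsilon> \<sigma> (v s) (X s))) (\<lambda>t. energy_class \<epsilon> (X t))"
proof -
  have X: "X t \<in> energy_space" if "t \<in> {0..T}" for t
    using sol that by (simp add: energy_solution_def)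
  have lim: "((\<lambda>s. energy_dist \<epsilon> (X s) (X t)) \<longlongrightarrow> 0) (at t within {0..T})" if "t \<in> {0..T}" for t
    using sol that by (simp add: energy_solution_def)
  obtain S' where S': "maxwell_semigroup curlE curlB \<epsilon> \<sigma> S'"
    and duhamel: "\<And>t. t \<in> {0..T} \<Longrightarrow> \<exists>I. has_state_integral \<epsilon> (time t) (\<lambda>s. S' (t - s) (coupling G \<epsilon> \<sigma> (v s) (X s))) I \<and>
          (AE x in torus. X t x = S' t (X 0) x + I x)"
    using sol by (auto simp: energy_solution_def)
  have c': "contraction_semigroup \<epsilon> S'" using S' by (simp add: maxwell_semigroup_def)
  have flow_eq: "flow \<epsilon> S' t = flow \<epsilon> S t" if "0 \<le> t" for t
    by (rule maxwell_semigroup_flow_unique[OF \<epsilon> S' S that])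
  show ?thesis
    unfolding mild_solution_def
  proof (intro conjI ballI allI)
    show "continuous_on {0..T} (\<lambda>t. energy_class \<epsilon> (X t))"
      unfolding continuous_on_def
    proof
      fix t assume t: "t \<in> {0..T}"
      have "\<forall>\<^sub>F s in at t within {0..T}. energy_dist \<epsilon> (X s) (X t) = dist (energy_class \<epsilon> (X s)) (energy_class \<epsilon> (X t))"
        unfolding eventually_at_filter
        by (intro always_eventually allI impI energy_dist_eq_dist[OF \<epsilon>] X t)
      from Lim_transform_eventually[OF lim[OF t] this]
      show "((\<lambda>t. energy_class \<epsilon> (X t)) \<longlongrightarrow> energy_class \<epsilon> (X t)) (at t within {0..T})"
        by (subst tendsto_dist_iff)
    qed
    fix t y assume t: "t \<in> {0..T}"
    obtain I where I: "has_state_integral \<epsilon> (time t) (\<lambda>s. S' (t - s) (coupling G \<epsilon> \<sigma> (v s) (X s))) I"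
      and eq: "AE x in torus. X t x = S' t (X 0) x + I x"
      using duhamel[OF t] by blast
    obtain h where h: "integrable (time t) h"
      "AE s in time t. h s = energy_class \<epsilon> (S' (t - s) (coupling G \<epsilon> \<sigma> (v s) (X s))) \<bullet> y"
      "(\<integral>s. h s \<partial>time t) = energy_class \<epsilon> I \<bullet> y"
      using has_state_integral_inner[OF \<epsilon> finite_measure_time I, of y] by blast
    have Ies: "I \<in> energy_space" using I by (simp add: has_state_integral_def)
    have cpl_t: "AE s in time t. coupling G \<epsilon> \<sigma> (v s) (X s) \<in> energy_space"
      by (rule AE_time_mono[OF _ cpl]) (use t in auto)
    have "AE s in time t. h s = flow \<epsilon> S (t - s) (energy_class \<epsilon> (coupling G \<epsilon> \<sigma> (v s) (X s))) \<bullet> y"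
      using h(2) cpl_t AE_space
    proof eventually_elim
      case (elim s)
      hence "0 \<le> t - s" by simp
      thus ?case using elim by (simp add: flow_eq[symmetric] flow_energy_class[OF \<epsilon> c'])
    qed
    moreover have "energy_class \<epsilon> (X t) \<bullet> y = flow \<epsilon> S t (energy_class \<epsilon> (X 0)) \<bullet> y + (\<integral>s. h s \<partial>time t)"
    proof -
      have t0: "0 \<le> t" "0 \<in> {0..T}" using t by auto
      have S'X: "S' t (X 0) \<in> energy_space" by (rule semigroup_in_energy_space[OF \<epsilon> c' t0(1) X[OF t0(2)]])
      have "energy_class \<epsilon> (X t) = energy_class \<epsilon> (\<lambda>x. S' t (X 0) x + I x)"
        using eq by (subst energy_class_eq_iff[OF \<epsilon> X[OF t] energy_space_linear(1)[OF S'X Ies]])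
      also have "\<dots> = flow \<epsilon> S t (energy_class \<epsilon> (X 0)) + energy_class \<epsilon> I"
        using flow_energy_class[OF \<epsilon> c' t0(1) X[OF t0(2)]] flow_eq[OF t0(1)]
        by (simp add: energy_class_add[OF \<epsilon> S'X Ies])
      finally show ?thesis by (simp add: inner_add_left h(3))
    qed
    ultimately show "\<exists>h. integrable (time t) h \<and>
        (AE s in time t. h s = flow \<epsilon> S (t - s) (energy_class \<epsilon> (coupling G \<epsilon> \<sigma> (v s) (X s))) \<bullet> y) \<and>
        energy_class \<epsilon> (X t) \<bullet> y = flow \<epsilon> S t (energy_class \<epsilon> (X 0)) \<bullet> y + (\<integral>s. h s \<partial>time t)"
      using h(1) by blast
  qed
qed

section \<open>Strong convergence of the states\<close>

text \<open>
  A square-integrable majorant in time represents membership in \<open>L\<^sup>2(0,T;L\<^sup>\<infinity>)\<close>. It avoids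
  essential suprema in all estimates.
\<close>

definition essentially_bounded :: "real \<Rightarrow> (real \<Rightarrow> real^'d \<Rightarrow> real^'d) \<Rightarrow> (real \<Rightarrow> real) \<Rightarrow> bool" where
  "essentially_bounded T v m \<longleftrightarrow> coefficient T v \<and> L2 (time T) m \<and> (AE s in time T. AE x in torus. norm (v s x) \<le> m s)"

text \<open>
  What the convergence proof uses of the coefficients: up to a remainder that is uniformly small in
  \<open>L\<^sup>2(0,T;L\<^sup>\<infinity>)\<close>, the difference is a finite sum of products of weakly null functions of time and bounded
  functions of space. The index type fits Fourier modes: a frequency and a coordinate of the
  coefficient.
\<close>

definition finite_mode_convergence ::
    "real \<Rightarrow> (nat \<Rightarrow> real \<Rightarrow> real^'d::finite \<Rightarrow> real^'d) \<Rightarrow> (real \<Rightarrow> real^'d \<Rightarrow> real^'d) \<Rightarrow> bool" where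
  "finite_mode_convergence T vs v \<longleftrightarrow>
     (\<exists>m A. (\<forall>n. essentially_bounded T (vs n) (m n) \<and> L2_norm (time T) (m n) \<le> A)) \<and>
     (\<exists>m. essentially_bounded T v m) \<and>
     (\<forall>\<eta>>0. \<exists>(J :: ((int^'d) \<times> (complex^'d)) set) \<phi> \<alpha> \<rho>. finite J \<and>
        (\<forall>i\<in>J. \<phi> i \<in> borel_measurable torus \<and> (\<forall>x. norm (\<phi> i x) \<le> 1) \<and> weak_L2_tendsto (time T) (\<alpha> i) (\<lambda>_. 0 :: real)) \<and>
        (\<forall>n. L2 (time T) (\<rho> n) \<and> L2_norm (time T) (\<rho> n :: real \<Rightarrow> real) \<le> \<eta> \<and>
           (AE s in time T. AE x in torus. norm (vs n s x - v s x - (\<Sum>i\<in>J. \<alpha> i n s *\<^sub>R \<phi> i x)) \<le> \<rho> n s)))"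

lemma coupling_decomposition:
  fixes G :: "real^'d::finite \<Rightarrow> 'b::euclidean_space \<Rightarrow> real^'d"
  assumes G: "bounded_bilinear G"
  shows "coupling G \<epsilon> \<sigma> u X x - coupling G \<epsilon> \<sigma> u' X' x - (\<Sum>i\<in>J. a i *\<^sub>R coupling G \<epsilon> \<sigma> (\<phi> i) X' x)
    = coupling G \<epsilon> \<sigma> u (\<lambda>x. X x - X' x) x + coupling G \<epsilon> \<sigma> (\<lambda>x. u x - u' x - (\<Sum>i\<in>J. a i *\<^sub>R \<phi> i x)) X' x"
proof -
  interpret G: bounded_bilinear G by fact
  have "(\<Sum>i\<in>J. a i *\<^sub>R coupling G \<epsilon> \<sigma> (\<phi> i) X' x) = (- (\<sigma> / \<epsilon>) *\<^sub>R G (\<Sum>i\<in>J. a i *\<^sub>R \<phi> i x) (snd (X' x)), 0)"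
    by (simp add: coupling_def prod_eq_iff fst_sum snd_sum G.sum_left G.scaleR_left scaleR_sum_right mult.commute)
  thus ?thesis
    unfolding coupling_def by (simp add: G.diff_left G.diff_right G.add_left algebra_simps)
qed

text \<open>
  Both space dimensions are instances. The curl operators enter through the semigroup that they
  generate, the product of velocity and magnetic field through the bilinear map \<open>G\<close>.
\<close>

locale convergent_solutions =
  fixes curlE :: "(real^'d::finite \<Rightarrow> real^'d) \<Rightarrow> real^'d \<Rightarrow> 'b::euclidean_space"
    and curlB :: "(real^'d \<Rightarrow> 'b) \<Rightarrow> real^'d \<Rightarrow> real^'d"
    and G :: "real^'d \<Rightarrow> 'b \<Rightarrow> real^'d" and T \<epsilon> \<sigma> :: real and vs v Xs X
  assumes T: "0 < T" and \<epsilon>: "0 < \<epsilon>" and \<sigma>: "0 < \<sigma>" and G: "bounded_bilinear G"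
    and conv: "finite_mode_convergence T vs v"
    and sols: "\<And>n. energy_solution curlE curlB G T \<epsilon> \<sigma> (vs n) (Xs n)"
    and sol: "energy_solution curlE curlB G T \<epsilon> \<sigma> v X"
    and init: "(\<lambda>n. energy_dist \<epsilon> (Xs n 0) (X 0)) \<longlonglongrightarrow> 0"
begin

sublocale G: bounded_bilinear G by (rule G)

lemma solution_in_energy_space: "t \<in> {0..T} \<Longrightarrow> Xs n t \<in> energy_space" "t \<in> {0..T} \<Longrightarrow> X t \<in> energy_space"
  using sols sol by (auto simp: energy_solution_def)

lemma coupling_in_energy_space:
  assumes u: "essentially_bounded T u m" and Y: "\<And>t. t \<in> {0..T} \<Longrightarrow> Y t \<in> energy_space"
  shows "AE s in time T. coupling G \<epsilon> \<sigma> (u s) (Y s) \<in> energy_space"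
proof -
  obtain K where K: "\<And>a b. norm (G a b) \<le> norm a * norm b * K" "0 \<le> K" using G.nonneg_bounded by blast
  have "AE s in time T. AE x in torus. norm (u s x) \<le> m s" using u by (simp add: essentially_bounded_def)
  thus ?thesis
    using AE_space
  proof eventually_elim
    case (elim s)
    have "u s \<in> borel_measurable torus" using u elim by (intro coefficient_section) (auto simp: essentially_bounded_def)
    from coupling_bound(1)[OF \<epsilon> \<sigma> G K this elim(1)] Y[of s] elim show ?case by auto
  qed
qed

lemma solutions_mild:
  "\<exists>S. contraction_flow (flow \<epsilon> S) \<and>
    (\<forall>n. mild_solution T (flow \<epsilon> S) (\<lambda>s. energy_class \<epsilon> (coupling G \<epsilon> \<sigma> (vs n s) (Xs n s))) (\<lambda>t. energy_class \<epsilon> (Xs n t))) \<and>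
    mild_solution T (flow \<epsilon> S) (\<lambda>s. energy_class \<epsilon> (coupling G \<epsilon> \<sigma> (v s) (X s))) (\<lambda>t. energy_class \<epsilon> (X t))"
proof -
  obtain S where S: "maxwell_semigroup curlE curlB \<epsilon> \<sigma> S" using sol by (auto simp: energy_solution_def)
  hence flow: "contraction_flow (flow \<epsilon> S)" by (intro contraction_flow[OF \<epsilon>]) (simp add: maxwell_semigroup_def)
  have "mild_solution T (flow \<epsilon> S) (\<lambda>s. energy_class \<epsilon> (coupling G \<epsilon> \<sigma> (vs n s) (Xs n s))) (\<lambda>t. energy_class \<epsilon> (Xs n t))" for n
  proof -
    obtain m where "essentially_bounded T (vs n) m" using conv unfolding finite_mode_convergence_def by blast
    from coupling_in_energy_space[OF this solution_in_energy_space(1)]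
    show ?thesis by (rule energy_solution_mild[OF \<epsilon> sols S])
  qed
  moreover have "mild_solution T (flow \<epsilon> S) (\<lambda>s. energy_class \<epsilon> (coupling G \<epsilon> \<sigma> (v s) (X s))) (\<lambda>t. energy_class \<epsilon> (X t))"
  proof -
    obtain m where "essentially_bounded T v m" using conv unfolding finite_mode_convergence_def by blast
    from coupling_in_energy_space[OF this solution_in_energy_space(2)]
    show ?thesis by (rule energy_solution_mild[OF \<epsilon> sol S])
  qed
  ultimately show ?thesis using flow by blast
qed

lemma classes_continuous:
  "continuous_on {0..T} (\<lambda>t. energy_class \<epsilon> (Xs n t))" "continuous_on {0..T} (\<lambda>t. energy_class \<epsilon> (X t))"
  using solutions_mild by (auto simp: mild_solution_def)

text \<open>
  The difference of the couplings splits as the coupling of \<open>vs n\<close> with the difference of the states, plus the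
  coupling of \<open>vs n - v\<close> with the limit state. Its modes give the continuous curves \<open>F i\<close>, so \<open>mild_solution_stability\<close>
  applies.
\<close>

lemma classes_uniform_limit:
  "uniform_limit {0..T} (\<lambda>n t. energy_class \<epsilon> (Xs n t)) (\<lambda>t. energy_class \<epsilon> (X t)) sequentially"
proof -
  obtain K where K: "\<And>a b. norm (G a b) \<le> norm a * norm b * K" "0 \<le> K" using G.nonneg_bounded by blast
  define \<kappa> where "\<kappa> = \<sigma> / sqrt \<epsilon> * K"
  have \<kappa>: "0 \<le> \<kappa>" using K(2) \<sigma> \<epsilon> by (simp add: \<kappa>_def)
  note bound = coupling_bound[OF \<epsilon> \<sigma> G K, folded \<kappa>_def]
  note XS = solution_in_energy_space
  obtain S where S: "contraction_flow (flow \<epsilon> S)"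
    and ms: "\<And>n. mild_solution T (flow \<epsilon> S) (\<lambda>s. energy_class \<epsilon> (coupling G \<epsilon> \<sigma> (vs n s) (Xs n s))) (\<lambda>t. energy_class \<epsilon> (Xs n t))"
    and m: "mild_solution T (flow \<epsilon> S) (\<lambda>s. energy_class \<epsilon> (coupling G \<epsilon> \<sigma> (v s) (X s))) (\<lambda>t. energy_class \<epsilon> (X t))"
    using solutions_mild by blast
  obtain \<mu> A where \<mu>: "\<And>n. essentially_bounded T (vs n) (\<mu> n)" "\<And>n. L2_norm (time T) (\<mu> n) \<le> A"
    using conv unfolding finite_mode_convergence_def by blast
  obtain \<mu>' where \<mu>': "essentially_bounded T v \<mu>'" using conv unfolding finite_mode_convergence_def by blast
  obtain C where C: "0 < C" "\<And>s. s \<in> {0..T} \<Longrightarrow> norm (energy_class \<epsilon> (X s)) \<le> C"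
    using compact_imp_bounded[OF compact_continuous_image[OF classes_continuous(2) compact_Icc]]
    unfolding bounded_pos by auto
  show ?thesis
  proof (rule mild_solution_stability[OF S T ms m, where 'i = "(int^'d) \<times> (complex^'d)" and m = "\<lambda>n s. \<kappa> * \<mu> n s" and A = "\<kappa> * A"])
    show "(\<lambda>n. energy_class \<epsilon> (Xs n 0)) \<longlonglongrightarrow> energy_class \<epsilon> (X 0)"
      using init T by (subst tendsto_dist_iff) (simp add: energy_dist_eq_dist[OF \<epsilon>] XS)
    fix n
    show "L2 (time T) (\<lambda>s. \<kappa> * \<mu> n s)"
      using L2_scaleR[of "time T" "\<mu> n" \<kappa>] \<mu>(1)[of n] by (simp add: essentially_bounded_def)
    show "L2_norm (time T) (\<lambda>s. \<kappa> * \<mu> n s) \<le> \<kappa> * A"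
      using L2_norm_scaleR[of "time T" \<kappa> "\<mu> n"] \<mu>(2)[of n] \<kappa> by (simp add: mult_left_mono)
  next
    fix \<eta> :: real assume \<eta>: "0 < \<eta>"
    define \<eta>' where "\<eta>' = \<eta> / (\<kappa> * C + 1)"
    have den: "0 < \<kappa> * C + 1" using \<kappa> C(1) by (intro add_nonneg_pos) auto
    have \<eta>': "0 < \<eta>'" "\<kappa> * C * \<eta>' \<le> \<eta>"
    proof -
      show p: "0 < \<eta>'" using \<eta> den by (simp add: \<eta>'_def)
      have "\<kappa> * C * \<eta>' \<le> (\<kappa> * C + 1) * \<eta>'" using p by (intro mult_right_mono) auto
      also have "\<dots> = \<eta>" using den by (simp add: \<eta>'_def)
      finally show "\<kappa> * C * \<eta>' \<le> \<eta>" .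
    qed
    obtain J :: "((int^'d) \<times> (complex^'d)) set" and \<phi> \<alpha> \<rho> where split: "finite J \<and>
        (\<forall>i\<in>J. \<phi> i \<in> borel_measurable torus \<and> (\<forall>x. norm (\<phi> i x) \<le> 1) \<and> weak_L2_tendsto (time T) (\<alpha> i) (\<lambda>_. 0 :: real)) \<and>
        (\<forall>n. L2 (time T) (\<rho> n) \<and> L2_norm (time T) (\<rho> n :: real \<Rightarrow> real) \<le> \<eta>' \<and>
           (AE s in time T. AE x in torus. norm (vs n s x - v s x - (\<Sum>i\<in>J. \<alpha> i n s *\<^sub>R \<phi> i x)) \<le> \<rho> n s))"
      using conv[unfolded finite_mode_convergence_def, THEN conjunct2, THEN conjunct2, rule_format, OF \<eta>'(1)]
      by (elim exE) (rule that)
    note J = split[THEN conjunct1] and 1 = split[THEN conjunct2, THEN conjunct1, rule_format]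
      and 2 = split[THEN conjunct2, THEN conjunct2, rule_format]
    note \<phi> = 1[THEN conjunct1] 1[THEN conjunct2, THEN conjunct1, rule_format] and weak = 1[THEN conjunct2, THEN conjunct2]
    note \<rho> = 2[THEN conjunct1] 2[THEN conjunct2, THEN conjunct1] and rest = 2[THEN conjunct2, THEN conjunct2]
    have \<phi>': "AE x in torus. norm (\<phi> i x) \<le> 1" if "i \<in> J" for i using \<phi>(2)[OF that] by simp
    define F where "F i s = energy_class \<epsilon> (coupling G \<epsilon> \<sigma> (\<phi> i) (X s))" for i s
    have Fcont: "continuous_on {0..T} (F i)" if i: "i \<in> J" for i
      unfolding continuous_on_def
    proof
      fix t assume t: "t \<in> {0..T}"
      have le: "dist (F i s) (F i t) \<le> \<kappa> * dist (energy_class \<epsilon> (X s)) (energy_class \<epsilon> (X t))" if s: "s \<in> {0..T}" for s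
      proof -
        have es: "coupling G \<epsilon> \<sigma> (\<phi> i) (X r) \<in> energy_space" if "r \<in> {0..T}" for r
          by (rule bound(1)[OF \<phi>(1)[OF i] \<phi>'[OF i] XS(2)[OF that]])
        have "F i s - F i t = energy_class \<epsilon> (\<lambda>x. coupling G \<epsilon> \<sigma> (\<phi> i) (X s) x - coupling G \<epsilon> \<sigma> (\<phi> i) (X t) x)"
          unfolding F_def by (rule energy_class_diff[OF \<epsilon> es[OF s] es[OF t], symmetric])
        also have "\<dots> = energy_class \<epsilon> (coupling G \<epsilon> \<sigma> (\<phi> i) (\<lambda>x. X s x - X t x))"
          by (simp add: coupling_def G.diff_right scaleR_diff_right)
        also have "norm \<dots> \<le> \<kappa> * 1 * norm (energy_class \<epsilon> (\<lambda>x. X s x - X t x))"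
          by (rule bound(2)[OF \<phi>(1)[OF i] \<phi>'[OF i]]) (intro energy_space_linear XS s t)
        finally show ?thesis
          by (simp add: dist_norm energy_class_diff[OF \<epsilon> XS(2)[OF s] XS(2)[OF t]])
      qed
      have "((\<lambda>s. energy_class \<epsilon> (X s)) \<longlongrightarrow> energy_class \<epsilon> (X t)) (at t within {0..T})"
        using classes_continuous(2) t by (simp add: continuous_on_def)
      hence lim: "((\<lambda>s. \<kappa> * dist (energy_class \<epsilon> (X s)) (energy_class \<epsilon> (X t))) \<longlongrightarrow> 0) (at t within {0..T})"
        by (intro tendsto_mult_right_zero) (subst tendsto_dist_iff[symmetric])
      have "((\<lambda>s. dist (F i s) (F i t)) \<longlongrightarrow> 0) (at t within {0..T})"
      proof (rule tendsto_sandwich[OF _ _ tendsto_const lim])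
        show "\<forall>\<^sub>F s in at t within {0..T}. dist (F i s) (F i t) \<le> \<kappa> * dist (energy_class \<epsilon> (X s)) (energy_class \<epsilon> (X t))"
          unfolding eventually_at_filter by (intro always_eventually allI impI le)
      qed (auto intro: always_eventually)
      thus "(F i \<longlongrightarrow> F i t) (at t within {0..T})" by (subst tendsto_dist_iff)
    qed
    show "\<exists>(J :: ((int^'d) \<times> (complex^'d)) set) \<alpha> F \<rho>. finite J \<and>
      (\<forall>i\<in>J. weak_L2_tendsto (time T) (\<alpha> i) (\<lambda>_. 0 :: real) \<and> (\<exists>K. \<forall>n. L2_norm (time T) (\<alpha> i n) \<le> K) \<and>
        continuous_on {0..T} (F i)) \<and>
      (\<forall>n. L2 (time T) (\<rho> n) \<and> L2_norm (time T) (\<rho> n :: real \<Rightarrow> real) \<le> \<eta> \<and>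
        (AE s in time T. norm (energy_class \<epsilon> (coupling G \<epsilon> \<sigma> (vs n s) (Xs n s)) - energy_class \<epsilon> (coupling G \<epsilon> \<sigma> (v s) (X s))
            - (\<Sum>i\<in>J. \<alpha> i n s *\<^sub>R F i s)) \<le> \<kappa> * \<mu> n s * norm (energy_class \<epsilon> (Xs n s) - energy_class \<epsilon> (X s)) + \<rho> n s))"
    proof (intro exI[of _ J] exI[of _ \<alpha>] exI[of _ F] exI[of _ "\<lambda>n s. (\<kappa> * C) * \<bar>\<rho> n s\<bar>"] conjI J ballI allI)
      fix i assume i: "i \<in> J"
      show "weak_L2_tendsto (time T) (\<alpha> i) (\<lambda>_. 0)" by (rule weak[OF i])
      show "\<exists>K. \<forall>n. L2_norm (time T) (\<alpha> i n) \<le> K" by (rule weak_L2_bounded[OF weak[OF i]])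
      show "continuous_on {0..T} (F i)" by (rule Fcont[OF i])
    next
      fix n
      show "L2 (time T) (\<lambda>s. \<kappa> * C * \<bar>\<rho> n s\<bar>)"
        using L2_scaleR[OF L2_norm_fun[OF \<rho>(1)], of "\<kappa> * C" n] by simp
      have "L2_norm (time T) (\<lambda>s. \<kappa> * C * \<bar>\<rho> n s\<bar>) = \<kappa> * C * L2_norm (time T) (\<rho> n)"
        using L2_norm_scaleR[of "time T" "\<kappa> * C" "\<lambda>s. \<bar>\<rho> n s\<bar>"] L2_norm_norm[of "time T" "\<rho> n"] \<kappa> C(1) by simp
      also have "\<dots> \<le> \<kappa> * C * \<eta>'" using \<kappa> C(1) by (intro mult_left_mono \<rho>(2)) auto
      finally show "L2_norm (time T) (\<lambda>s. \<kappa> * C * \<bar>\<rho> n s\<bar>) \<le> \<eta>" using \<eta>'(2) by linarith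
      have cpl1: "AE s in time T. coupling G \<epsilon> \<sigma> (vs n s) (Xs n s) \<in> energy_space"
        by (rule coupling_in_energy_space[OF \<mu>(1) XS(1)])
      have cpl2: "AE s in time T. coupling G \<epsilon> \<sigma> (v s) (X s) \<in> energy_space"
        by (rule coupling_in_energy_space[OF \<mu>' XS(2)])
      have b1: "AE s in time T. AE x in torus. norm (vs n s x) \<le> \<mu> n s" using \<mu>(1)[of n] by (simp add: essentially_bounded_def)
      show "AE s in time T. norm (energy_class \<epsilon> (coupling G \<epsilon> \<sigma> (vs n s) (Xs n s)) - energy_class \<epsilon> (coupling G \<epsilon> \<sigma> (v s) (X s))
            - (\<Sum>i\<in>J. \<alpha> i n s *\<^sub>R F i s)) \<le> \<kappa> * \<mu> n s * norm (energy_class \<epsilon> (Xs n s) - energy_class \<epsilon> (X s)) + \<kappa> * C * \<bar>\<rho> n s\<bar>"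
        using rest[of n] b1 AE_space cpl1 cpl2
      proof eventually_elim
        case (elim s)
        have s: "s \<in> {0..T}" using elim by simp
        have meas: "vs n s \<in> borel_measurable torus" "v s \<in> borel_measurable torus"
          using \<mu>(1)[of n] \<mu>' elim by (auto intro!: coefficient_section simp: essentially_bounded_def)
        define r where "r = (\<lambda>x. vs n s x - v s x - (\<Sum>i\<in>J. \<alpha> i n s *\<^sub>R \<phi> i x))"
        have r: "r \<in> borel_measurable torus" unfolding r_def using meas \<phi>(1)
          by (intro borel_measurable_diff borel_measurable_sum borel_measurable_scaleR borel_measurable_const) auto
        define W where "W = (\<lambda>x. Xs n s x - X s x)"
        have W: "W \<in> energy_space" "energy_class \<epsilon> W = energy_class \<epsilon> (Xs n s) - energy_class \<epsilon> (X s)"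
          unfolding W_def using XS s by (auto intro: energy_space_linear simp: energy_class_diff[OF \<epsilon>])
        have c\<phi>: "coupling G \<epsilon> \<sigma> (\<phi> i) (X s) \<in> energy_space" if "i \<in> J" for i
          by (rule bound(1)[OF \<phi>(1)[OF that] \<phi>'[OF that] XS(2)[OF s]])
        have c1: "coupling G \<epsilon> \<sigma> (vs n s) W \<in> energy_space" by (rule bound(1)[OF meas(1) elim(2) W(1)])
        have r_le: "AE x in torus. norm (r x) \<le> \<rho> n s" using elim(1) by (simp add: r_def)
        have c2: "coupling G \<epsilon> \<sigma> r (X s) \<in> energy_space" by (rule bound(1)[OF r r_le XS(2)[OF s]])
        have sum_es: "(\<lambda>x. \<Sum>i\<in>J. \<alpha> i n s *\<^sub>R coupling G \<epsilon> \<sigma> (\<phi> i) (X s) x) \<in> energy_space"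
          using c\<phi> by (auto intro!: energy_spaceI L2_sum L2_scaleR dest: energy_spaceD)
        have sum_eq: "energy_class \<epsilon> (\<lambda>x. \<Sum>i\<in>J. \<alpha> i n s *\<^sub>R coupling G \<epsilon> \<sigma> (\<phi> i) (X s) x) = (\<Sum>i\<in>J. \<alpha> i n s *\<^sub>R F i s)"
          using c\<phi> by (subst energy_class_sum[OF \<epsilon>]) (auto simp: F_def energy_class_scaleR[OF \<epsilon>] intro: energy_space_linear)
        have "energy_class \<epsilon> (coupling G \<epsilon> \<sigma> (vs n s) (Xs n s)) - energy_class \<epsilon> (coupling G \<epsilon> \<sigma> (v s) (X s)) - (\<Sum>i\<in>J. \<alpha> i n s *\<^sub>R F i s)
          = energy_class \<epsilon> (\<lambda>x. coupling G \<epsilon> \<sigma> (vs n s) (Xs n s) x - coupling G \<epsilon> \<sigma> (v s) (X s) x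
              - (\<Sum>i\<in>J. \<alpha> i n s *\<^sub>R coupling G \<epsilon> \<sigma> (\<phi> i) (X s) x))"
          using elim(4,5) sum_es by (simp add: energy_class_diff[OF \<epsilon>] energy_space_linear sum_eq)
        also have "\<dots> = energy_class \<epsilon> (\<lambda>x. coupling G \<epsilon> \<sigma> (vs n s) W x + coupling G \<epsilon> \<sigma> r (X s) x)"
          unfolding coupling_decomposition[OF G] W_def r_def ..
        also have "\<dots> = energy_class \<epsilon> (coupling G \<epsilon> \<sigma> (vs n s) W) + energy_class \<epsilon> (coupling G \<epsilon> \<sigma> r (X s))"
          by (rule energy_class_add[OF \<epsilon> c1 c2])
        also have "norm \<dots> \<le> norm (energy_class \<epsilon> (coupling G \<epsilon> \<sigma> (vs n s) W)) + norm (energy_class \<epsilon> (coupling G \<epsilon> \<sigma> r (X s)))"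
          by (rule norm_triangle_ineq)
        also have "\<dots> \<le> \<kappa> * \<mu> n s * norm (energy_class \<epsilon> W) + \<kappa> * \<rho> n s * norm (energy_class \<epsilon> (X s))"
          by (intro add_mono bound(2)[OF meas(1) elim(2) W(1)] bound(2)[OF r r_le XS(2)[OF s]])
        also have "\<kappa> * \<rho> n s * norm (energy_class \<epsilon> (X s)) \<le> \<kappa> * \<bar>\<rho> n s\<bar> * C"
          using \<kappa> C(2)[OF s] by (intro mult_mono[OF mult_left_mono]) auto
        finally show ?case by (simp add: W(2) algebra_simps)
      qed
    qed
  qed
qed

end

section \<open>Weak convergence of currents and Lorentz forces\<close>

lemma L2_spacetime:
  fixes f :: "real \<times> (real^'d::finite) \<Rightarrow> 'c::euclidean_space"
  assumes f: "f \<in> borel_measurable (spacetime T)" and r: "L2 (time T) (r :: real \<Rightarrow> real)"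
    and sec: "AE s in time T. L2 torus (\<lambda>x. f (s, x)) \<and> L2_norm torus (\<lambda>x. f (s, x)) \<le> r s"
  shows "L2 (spacetime T) f" "L2_norm (spacetime T) f \<le> L2_norm (time T) r"
proof -
  have "(\<integral>\<^sup>+ z. ennreal ((norm (f z))\<^sup>2) \<partial>spacetime T) = (\<integral>\<^sup>+ s. \<integral>\<^sup>+ x. ennreal ((norm (f (s, x)))\<^sup>2) \<partial>torus \<partial>time T)"
    using f by (subst torus.nn_integral_fst) auto
  also have "\<dots> \<le> (\<integral>\<^sup>+ s. ennreal ((norm (r s))\<^sup>2) \<partial>time T)"
  proof (rule nn_integral_mono_AE, use sec in eventually_elim)
    case (elim s)
    hence "(\<integral>\<^sup>+ x. ennreal ((norm (f (s, x)))\<^sup>2) \<partial>torus) = ennreal ((L2_norm torus (\<lambda>x. f (s, x)))\<^sup>2)"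
      by (intro L2_norm_nn_integral) simp
    also have "\<dots> \<le> ennreal ((norm (r s))\<^sup>2)"
      using elim by (intro ennreal_leI power_mono) auto
    finally show ?case .
  qed
  also have "\<dots> = ennreal ((L2_norm (time T) r)\<^sup>2)" by (rule L2_norm_nn_integral[OF r])
  finally have le: "(\<integral>\<^sup>+ z. ennreal ((norm (f z))\<^sup>2) \<partial>spacetime T) \<le> ennreal ((L2_norm (time T) r)\<^sup>2)" .
  show "L2 (spacetime T) f" "L2_norm (spacetime T) f \<le> L2_norm (time T) r"
    using L2_I_nn_integral[OF f le] by simp_all
qed

lemma L2_spacetime_sections:
  fixes g :: "real \<times> (real^'d::finite) \<Rightarrow> 'c::euclidean_space"
  assumes g: "L2 (spacetime T) g"
  shows "L2 (time T) (\<lambda>s. L2_norm torus (\<lambda>x. g (s, x)))" "AE s in time T. L2 torus (\<lambda>x. g (s, x))"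
proof -
  have m [measurable]: "g \<in> borel_measurable (spacetime T)" using g by (rule L2_measurable)
  have int: "integrable (spacetime T) (\<lambda>(s, x). (norm (g (s, x)))\<^sup>2)"
    using L2_integrable[OF g] by (simp add: case_prod_beta')
  have "integrable (time T) (\<lambda>s. (L2_norm torus (\<lambda>x. g (s, x)))\<^sup>2)"
    using spacetime.integrable_fst[OF int] by (simp add: L2_norm_power2)
  moreover have "(\<lambda>s. L2_norm torus (\<lambda>x. g (s, x))) \<in> borel_measurable (time T)"
    unfolding L2_norm_def by measurable
  ultimately show "L2 (time T) (\<lambda>s. L2_norm torus (\<lambda>x. g (s, x)))" by (simp add: L2_def)
  show "AE s in time T. L2 torus (\<lambda>x. g (s, x))"
    using spacetime.AE_integrable_fst[OF int] AE_space
  proof eventually_elim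
    case (elim s)
    hence "(\<lambda>x. g (s, x)) \<in> borel_measurable torus" by simp
    with elim show ?case by (simp add: L2_def)
  qed
qed

lemma spacetime_test_bounded:
  fixes \<phi> :: "real \<times> (real^'d::finite) \<Rightarrow> 'c::euclidean_space"
  assumes "spacetime_test T \<phi>"
  shows "\<phi> \<in> borel_measurable (spacetime T)" "\<exists>C>0. \<forall>z\<in>space (spacetime T). norm (\<phi> z) \<le> C"
proof -
  have "iter_deriv [] \<phi> differentiable (at z)" for z
    using assms by (simp only: spacetime_test_def smooth_def)
  hence cont: "continuous_on UNIV \<phi>"
    by (auto intro!: continuous_at_imp_continuous_on differentiable_imp_continuous_within)
  have "(\<lambda>z. z) \<in> measurable (spacetime T) (borel \<Otimes>\<^sub>M borel)"
    by (rule measurable_pair) (auto simp: time_def torus_def comp_def intro!: measurable_restrict_space1 measurable_compose[OF measurable_fst] measurable_compose[OF measurable_snd])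
  hence "(\<lambda>z. z) \<in> borel_measurable (spacetime T)" by (simp add: borel_prod)
  from measurable_compose[OF this borel_measurable_continuous_onI[OF cont]]
  show "\<phi> \<in> borel_measurable (spacetime T)" .
  have sub: "space (spacetime T) \<subseteq> cbox (0, 0) (T, \<chi> i. 2 * pi)"
    by (auto simp: space_pair_measure space_torus cbox_Pair_eq mem_box_cart less_imp_le)
  have "compact (\<phi> ` cbox (0, 0) (T, \<chi> i. 2 * pi))"
    by (intro compact_continuous_image continuous_on_subset[OF cont] compact_cbox) auto
  from compact_imp_bounded[OF this] show "\<exists>C>0. \<forall>z\<in>space (spacetime T). norm (\<phi> z) \<le> C"
    using sub unfolding bounded_pos by blast
qed

lemma state_measurable:
  assumes "energy_solution curlE curlB G T \<epsilon> \<sigma> v X"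
  shows "(\<lambda>z. X (fst z) (snd z)) \<in> borel_measurable (spacetime T)"
proof -
  have "(\<lambda>z. z) \<in> measurable (spacetime T) (restrict_space lborel {0..T} \<Otimes>\<^sub>M torus)"
  proof (rule measurable_pair)
    have "(\<lambda>s. s) \<in> measurable (time T) (restrict_space lborel {0..T})"
      unfolding time_def by (intro measurable_restrict_space2 measurable_restrict_space1) (auto simp: space_restrict_space)
    thus "fst \<circ> (\<lambda>z. z) \<in> measurable (spacetime T) (restrict_space lborel {0..T})"
      using measurable_compose[OF measurable_fst] by (force simp: comp_def)
    show "snd \<circ> (\<lambda>z. z) \<in> measurable (spacetime T) torus" by (simp add: comp_def)
  qed
  moreover have "(\<lambda>(t, x). X t x) \<in> borel_measurable (restrict_space lborel {0..T} \<Otimes>\<^sub>M torus)"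
    using assms unfolding energy_solution_def by (rule conjunct1)
  ultimately have "(\<lambda>z. (\<lambda>(t, x). X t x) z) \<in> borel_measurable (spacetime T)"
    by (rule measurable_compose)
  thus ?thesis by (simp add: case_prod_beta')
qed

lemma coefficient_measurable:
  "coefficient T v \<Longrightarrow> (\<lambda>z. v (fst z) (snd z)) \<in> borel_measurable (spacetime T)"
  by (simp add: coefficient_def case_prod_beta')

context convergent_solutions
begin

lemma current_measurable:
  assumes "coefficient T u" "(\<lambda>z. Y (fst z) (snd z)) \<in> borel_measurable (spacetime T)"
  shows "current G \<sigma> u Y \<in> borel_measurable (spacetime T)"
proof -
  have "fst \<in> borel_measurable (borel :: ((real^'d) \<times> 'b) measure)" "snd \<in> borel_measurable (borel :: ((real^'d) \<times> 'b) measure)"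
    by (intro borel_measurable_continuous_onI continuous_intros)+
  note fs = measurable_compose[OF assms(2) this(1)] measurable_compose[OF assms(2) this(2)]
  show ?thesis
    unfolding current_def case_prod_beta'
    by (intro borel_measurable_scaleR borel_measurable_const borel_measurable_add fs
        borel_measurable_bilinear[OF G coefficient_measurable[OF assms(1)] fs(2)])
qed

lemma current_section_bound:
  assumes K: "\<And>a b. norm (G a b) \<le> norm a * norm b * K" "0 \<le> K"
    and u: "u s \<in> borel_measurable torus" "AE x in torus. norm (u s x) \<le> c" and Y: "Y s \<in> energy_space"
  shows "L2 torus (\<lambda>x. current G \<sigma> u Y (s, x))"
    and "L2_norm torus (\<lambda>x. current G \<sigma> u Y (s, x)) \<le> \<sigma> * (1 / sqrt \<epsilon> + K * \<bar>c\<bar>) * norm (energy_class \<epsilon> (Y s))"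
proof -
  note Y' = energy_spaceD[OF Y]
  note b = bilinear_L2_bound[OF G K u L2_snd[OF Y']]
  show "L2 torus (\<lambda>x. current G \<sigma> u Y (s, x))"
    unfolding current_def prod.case by (intro L2_scaleR L2_add L2_fst[OF Y'] b(1))
  have "L2_norm torus (\<lambda>x. current G \<sigma> u Y (s, x)) = \<sigma> * L2_norm torus (\<lambda>x. fst (Y s x) + G (u s x) (snd (Y s x)))"
    using \<sigma> by (simp add: current_def L2_norm_scaleR)
  also have "\<dots> \<le> \<sigma> * (norm (energy_class \<epsilon> (Y s)) / sqrt \<epsilon> + K * \<bar>c\<bar> * norm (energy_class \<epsilon> (Y s)))"
  proof (rule mult_left_mono)
    have "L2_norm torus (\<lambda>x. fst (Y s x) + G (u s x) (snd (Y s x))) \<le> L2_norm torus (\<lambda>x. fst (Y s x)) + L2_norm torus (\<lambda>x. G (u s x) (snd (Y s x)))"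
      by (rule L2_norm_triangle[OF L2_fst[OF Y'] b(1)])
    also have "L2_norm torus (\<lambda>x. G (u s x) (snd (Y s x))) \<le> K * \<bar>c\<bar> * norm (energy_class \<epsilon> (Y s))"
      by (rule order_trans[OF b(2)]) (intro mult_left_mono energy_components(2)[OF \<epsilon> Y], use K(2) in simp)
    finally show "L2_norm torus (\<lambda>x. fst (Y s x) + G (u s x) (snd (Y s x)))
        \<le> norm (energy_class \<epsilon> (Y s)) / sqrt \<epsilon> + K * \<bar>c\<bar> * norm (energy_class \<epsilon> (Y s))"
      using energy_components(1)[OF \<epsilon> Y] by linarith
  qed (use \<sigma> in simp)
  finally show "L2_norm torus (\<lambda>x. current G \<sigma> u Y (s, x)) \<le> \<sigma> * (1 / sqrt \<epsilon> + K * \<bar>c\<bar>) * norm (energy_class \<epsilon> (Y s))"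
    by (simp add: algebra_simps)
qed

lemma current_L2:
  assumes K: "\<And>a b. norm (G a b) \<le> norm a * norm b * K" "0 \<le> K"
    and u: "essentially_bounded T u m" and Y: "\<And>t. t \<in> {0..T} \<Longrightarrow> Y t \<in> energy_space"
    and Ym: "(\<lambda>z. Y (fst z) (snd z)) \<in> borel_measurable (spacetime T)"
    and C: "\<And>t. t \<in> {0<..<T} \<Longrightarrow> norm (energy_class \<epsilon> (Y t)) \<le> C" "0 \<le> C"
  shows "L2 (spacetime T) (current G \<sigma> u Y)"
    and "L2_norm (spacetime T) (current G \<sigma> u Y) \<le> \<sigma> * (sqrt T / sqrt \<epsilon> + K * L2_norm (time T) m) * C"
proof -
  define r where "r s = (\<sigma> * C) *\<^sub>R (1 / sqrt \<epsilon> + K *\<^sub>R \<bar>m s\<bar>)" for s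
  have m: "L2 (time T) m" using u by (simp add: essentially_bounded_def)
  have one: "L2 (time T) (\<lambda>_. c :: real)" for c by (simp add: L2_def)
  have n1: "L2_norm (time T) (\<lambda>_. 1 / sqrt \<epsilon> :: real) = sqrt T / sqrt \<epsilon>"
    using T \<epsilon> by (simp add: L2_norm_def measure_def emeasure_time real_sqrt_divide power_divide)
  have Km: "L2 (time T) (\<lambda>s. K *\<^sub>R \<bar>m s\<bar>)" using L2_scaleR[OF L2_norm_fun[OF m], of K] by simp
  have r: "L2 (time T) r" unfolding r_def by (intro L2_scaleR L2_add one Km)
  have "L2_norm (time T) r = \<sigma> * C * L2_norm (time T) (\<lambda>s. 1 / sqrt \<epsilon> + K *\<^sub>R \<bar>m s\<bar>)"
    unfolding r_def L2_norm_scaleR using \<sigma> C(2) by simp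
  also have "\<dots> \<le> \<sigma> * C * (sqrt T / sqrt \<epsilon> + K * L2_norm (time T) m)"
  proof (rule mult_left_mono)
    have "L2_norm (time T) (\<lambda>s. K *\<^sub>R \<bar>m s\<bar>) = K * L2_norm (time T) m"
      unfolding L2_norm_scaleR using K(2) L2_norm_norm[of "time T" m] by simp
    thus "L2_norm (time T) (\<lambda>s. 1 / sqrt \<epsilon> + K *\<^sub>R \<bar>m s\<bar>) \<le> sqrt T / sqrt \<epsilon> + K * L2_norm (time T) m"
      using L2_norm_triangle[OF one[of "1 / sqrt \<epsilon>"] Km] by (simp add: n1)
  qed (use \<sigma> C(2) in simp)
  finally have r_le: "L2_norm (time T) r \<le> \<sigma> * (sqrt T / sqrt \<epsilon> + K * L2_norm (time T) m) * C" by (simp add: algebra_simps)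
  have co: "coefficient T u" and bd: "AE s in time T. AE x in torus. norm (u s x) \<le> m s"
    using u by (auto simp: essentially_bounded_def)
  have sec: "AE s in time T. L2 torus (\<lambda>x. current G \<sigma> u Y (s, x)) \<and> L2_norm torus (\<lambda>x. current G \<sigma> u Y (s, x)) \<le> r s"
    using bd AE_space
  proof eventually_elim
    case (elim s)
    have us: "u s \<in> borel_measurable torus" using elim by (intro coefficient_section[OF co]) simp
    have Ys: "Y s \<in> energy_space" using elim by (intro Y) simp
    have "\<sigma> * (1 / sqrt \<epsilon> + K * \<bar>m s\<bar>) * norm (energy_class \<epsilon> (Y s)) \<le> \<sigma> * (1 / sqrt \<epsilon> + K * \<bar>m s\<bar>) * C"
      using \<sigma> \<epsilon> K(2) C(1)[of s] elim by (intro mult_left_mono) auto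
    thus ?case
      using current_section_bound[where u = u and Y = Y and s = s, OF K us elim(1) Ys] by (simp add: r_def algebra_simps)
  qed
  note main = L2_spacetime[OF current_measurable[OF co Ym] r sec]
  show "L2 (spacetime T) (current G \<sigma> u Y)" by (rule main(1))
  show "L2_norm (spacetime T) (current G \<sigma> u Y) \<le> \<sigma> * (sqrt T / sqrt \<epsilon> + K * L2_norm (time T) m) * C"
    using main(2) r_le by linarith
qed

lemma current_decomposition:
  "current G \<sigma> u Y (s, x) - current G \<sigma> u' Y' (s, x) - (\<Sum>i\<in>J. a i *\<^sub>R (\<sigma> *\<^sub>R G (\<phi> i x) (snd (Y' s x))))
   = current G \<sigma> u (\<lambda>s x. Y s x - Y' s x) (s, x) + \<sigma> *\<^sub>R G (u s x - u' s x - (\<Sum>i\<in>J. a i *\<^sub>R \<phi> i x)) (snd (Y' s x))"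
proof -
  have "(\<Sum>i\<in>J. a i *\<^sub>R (\<sigma> *\<^sub>R G (\<phi> i x) (snd (Y' s x)))) = \<sigma> *\<^sub>R G (\<Sum>i\<in>J. a i *\<^sub>R \<phi> i x) (snd (Y' s x))"
    by (simp add: G.sum_left G.scaleR_left scaleR_sum_right mult.commute)
  thus ?thesis by (simp add: current_def G.diff_left G.diff_right algebra_simps G.add_left)
qed

lemma states_measurable:
  "(\<lambda>z. Xs n (fst z) (snd z)) \<in> borel_measurable (spacetime T)" "(\<lambda>z. X (fst z) (snd z)) \<in> borel_measurable (spacetime T)"
  by (rule state_measurable[OF sols], rule state_measurable[OF sol])

lemma class_bounded: "\<exists>C>0. \<forall>t\<in>{0..T}. norm (energy_class \<epsilon> (Xs n t)) \<le> C" "\<exists>C>0. \<forall>t\<in>{0..T}. norm (energy_class \<epsilon> (X t)) \<le> C"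
  using compact_imp_bounded[OF compact_continuous_image[OF classes_continuous(1)[of n] compact_Icc]]
    compact_imp_bounded[OF compact_continuous_image[OF classes_continuous(2) compact_Icc]]
  unfolding bounded_pos by auto

lemma currents_L2: "L2 (spacetime T) (current G \<sigma> (vs n) (Xs n))" "L2 (spacetime T) (current G \<sigma> v X)"
proof -
  obtain K where K: "\<And>a b. norm (G a b) \<le> norm a * norm b * K" "0 \<le> K" using G.nonneg_bounded by blast
  obtain m where m: "essentially_bounded T (vs n) m" using conv unfolding finite_mode_convergence_def by blast
  obtain m' where m': "essentially_bounded T v m'" using conv unfolding finite_mode_convergence_def by blast
  obtain C where C: "0 < C" "\<And>t. t \<in> {0..T} \<Longrightarrow> norm (energy_class \<epsilon> (Xs n t)) \<le> C" using class_bounded(1) by blast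
  obtain C' where C': "0 < C'" "\<And>t. t \<in> {0..T} \<Longrightarrow> norm (energy_class \<epsilon> (X t)) \<le> C'" using class_bounded(2) by blast
  show "L2 (spacetime T) (current G \<sigma> (vs n) (Xs n))"
    by (rule current_L2(1)[OF K m solution_in_energy_space(1) states_measurable(1), where C = C]) (use C in auto)
  show "L2 (spacetime T) (current G \<sigma> v X)"
    by (rule current_L2(1)[OF K m' solution_in_energy_space(2) states_measurable(2), where C = C']) (use C' in auto)
qed

lemma differences_small:
  assumes "0 < \<delta>"
  shows "\<forall>\<^sub>F n in sequentially. \<forall>t\<in>{0..T}. norm (energy_class \<epsilon> (\<lambda>x. Xs n t x - X t x)) \<le> \<delta>"
  using uniform_limitD[OF classes_uniform_limit assms]
  by eventually_elim (auto simp: dist_norm energy_class_diff[OF \<epsilon>] solution_in_energy_space less_imp_le)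

text \<open>
  The same splitting as for the states. The part with the difference of the states tends to zero in
  norm, the remainder of the coefficients is small in norm, and the modes pair with a test function
  \<open>g\<close> as \<open>\<integral> \<alpha> i n s * \<theta> i s\<close> with fixed square-integrable \<open>\<theta> i\<close>, so that weak convergence of the
  coefficients applies.
\<close>

lemma currents_weak:
  "weak_L2_tendsto (spacetime T) (\<lambda>n. current G \<sigma> (vs n) (Xs n)) (current G \<sigma> v X)"
  unfolding weak_L2_tendsto_def
proof (intro conjI allI impI currents_L2)
  fix g :: "real \<times> (real^'d) \<Rightarrow> real^'d" assume g: "L2 (spacetime T) g"
  define \<gamma> where "\<gamma> s = L2_norm torus (\<lambda>x. g (s, x))" for s
  have \<gamma>: "L2 (time T) \<gamma>" and g_sec: "AE s in time T. L2 torus (\<lambda>x. g (s, x))"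
    using L2_spacetime_sections[OF g] by (auto simp: \<gamma>_def[abs_def])
  define N where "N = L2_norm (spacetime T) g"
  have N: "0 \<le> N" by (simp add: N_def)
  obtain K where K: "\<And>a b. norm (G a b) \<le> norm a * norm b * K" "0 \<le> K" using G.nonneg_bounded by blast
  obtain \<mu> A where \<mu>: "\<And>n. essentially_bounded T (vs n) (\<mu> n)" "\<And>n. L2_norm (time T) (\<mu> n) \<le> A"
    using conv unfolding finite_mode_convergence_def by blast
  have A: "0 \<le> A" using \<mu>(2)[of 0] L2_norm_nonneg[of "time T" "\<mu> 0"] by linarith
  obtain \<mu>' where \<mu>': "essentially_bounded T v \<mu>'" using conv unfolding finite_mode_convergence_def by blast
  obtain C where C: "0 < C" "\<And>s. s \<in> {0..T} \<Longrightarrow> norm (energy_class \<epsilon> (X s)) \<le> C" using class_bounded(2) by blast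
  show "(\<lambda>n. \<integral>z. current G \<sigma> (vs n) (Xs n) z \<bullet> g z \<partial>spacetime T) \<longlonglongrightarrow> (\<integral>z. current G \<sigma> v X z \<bullet> g z \<partial>spacetime T)"
  proof (rule tendstoI)
    fix e :: real assume e: "0 < e"
    \<comment> \<open>The tolerance \<open>e\<close> is divided by three; \<open>c1\<close> and \<open>c2\<close> are the factors with which the distance \<open>\<delta>\<close> of the
      states and the size \<open>\<eta>\<close> of the remainder enter.\<close>
    define c1 c2 where "c1 = \<sigma> * (sqrt T / sqrt \<epsilon> + K * A) * N" and "c2 = \<sigma> * K * C * N"
    have c: "0 \<le> c1" "0 \<le> c2" using \<sigma> \<epsilon> T K(2) A N C(1) by (auto simp: c1_def c2_def)
    define \<delta> \<eta> where "\<delta> = (e / 3) / (c1 + 1)" and "\<eta> = (e / 3) / (c2 + 1)"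
    have cancel: "D * (x / D) = x" if "0 < D" for D x :: real using that by simp
    have frac: "0 < (e / 3) / (c + 1) \<and> c * ((e / 3) / (c + 1)) < e / 3" if "0 \<le> c" for c :: real
    proof -
      have p: "0 < (e / 3) / (c + 1)" using e that by simp
      have "c * ((e / 3) / (c + 1)) < (c + 1) * ((e / 3) / (c + 1))" using p by (intro mult_strict_right_mono) auto
      also have "\<dots> = e / 3" by (rule cancel) (use that in simp)
      finally show ?thesis using p by blast
    qed
    have \<delta>: "0 < \<delta>" "c1 * \<delta> < e / 3" and \<eta>: "0 < \<eta>" "c2 * \<eta> < e / 3"
      using frac[OF c(1)] frac[OF c(2)] by (auto simp: \<delta>_def \<eta>_def)
    obtain J :: "((int^'d) \<times> (complex^'d)) set" and \<phi> \<alpha> \<rho> where split: "finite J \<and>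
        (\<forall>i\<in>J. \<phi> i \<in> borel_measurable torus \<and> (\<forall>x. norm (\<phi> i x) \<le> 1) \<and> weak_L2_tendsto (time T) (\<alpha> i) (\<lambda>_. 0 :: real)) \<and>
        (\<forall>n. L2 (time T) (\<rho> n) \<and> L2_norm (time T) (\<rho> n :: real \<Rightarrow> real) \<le> \<eta> \<and>
           (AE s in time T. AE x in torus. norm (vs n s x - v s x - (\<Sum>i\<in>J. \<alpha> i n s *\<^sub>R \<phi> i x)) \<le> \<rho> n s))"
      using conv[unfolded finite_mode_convergence_def, THEN conjunct2, THEN conjunct2, rule_format, OF \<eta>(1)]
      by (elim exE) (rule that)
    note J = split[THEN conjunct1] and 1 = split[THEN conjunct2, THEN conjunct1, rule_format]
      and 2 = split[THEN conjunct2, THEN conjunct2, rule_format]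
    note \<phi> = 1[THEN conjunct1] 1[THEN conjunct2, THEN conjunct1, rule_format] and weak = 1[THEN conjunct2, THEN conjunct2]
    note \<rho> = 2[THEN conjunct1] 2[THEN conjunct2, THEN conjunct1] and rest = 2[THEN conjunct2, THEN conjunct2]
    have \<alpha>: "L2 (time T) (\<alpha> i n)" if "i \<in> J" for i n using weak[OF that] by (simp add: weak_L2_tendsto_def)
    define base where "base i z = \<sigma> *\<^sub>R G (\<phi> i (snd z)) (snd (X (fst z) (snd z)))" for i z
    have Bm: "(\<lambda>z. snd (X (fst z) (snd z))) \<in> borel_measurable (spacetime T)"
      by (rule measurable_compose[OF states_measurable(2)]) (intro borel_measurable_continuous_onI continuous_intros)
    have base_m: "base i \<in> borel_measurable (spacetime T)" if "i \<in> J" for i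
      unfolding base_def[abs_def]
      by (intro borel_measurable_scaleR borel_measurable_const borel_measurable_bilinear[OF G _ Bm]
          measurable_compose[OF measurable_snd \<phi>(1)[OF that]])
    have base_sec: "L2 torus (\<lambda>x. base i (s, x))" "L2_norm torus (\<lambda>x. base i (s, x)) \<le> \<sigma> * K * C"
      if i: "i \<in> J" and s: "s \<in> {0..T}" for i s
    proof -
      have Xs: "X s \<in> energy_space" by (rule solution_in_energy_space(2)[OF s])
      have "AE x in torus. norm (\<phi> i x) \<le> 1" using \<phi>(2)[OF i] by simp
      note b = bilinear_L2_bound[OF G K \<phi>(1)[OF i] this L2_snd[OF energy_spaceD[OF Xs]]]
      show "L2 torus (\<lambda>x. base i (s, x))" using L2_scaleR[OF b(1), of \<sigma>] by (simp add: base_def)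
      have "L2_norm torus (\<lambda>x. base i (s, x)) = \<sigma> * L2_norm torus (\<lambda>x. G (\<phi> i x) (snd (X s x)))"
        using \<sigma> by (simp add: base_def L2_norm_scaleR)
      also have "\<dots> \<le> \<sigma> * (K * \<bar>1\<bar> * C)"
        using \<sigma> K(2) energy_components(2)[OF \<epsilon> Xs] C(2)[OF s]
        by (intro mult_left_mono order_trans[OF b(2)]) auto
      finally show "L2_norm torus (\<lambda>x. base i (s, x)) \<le> \<sigma> * K * C" by (simp add: algebra_simps)
    qed
    have base_L2: "L2 (spacetime T) (base i)" if "i \<in> J" for i
    proof (rule L2_spacetime(1)[OF base_m[OF that]])
      show "L2 (time T) (\<lambda>_. \<sigma> * K * C)" by (simp add: L2_def)
      show "AE s in time T. L2 torus (\<lambda>x. base i (s, x)) \<and> L2_norm torus (\<lambda>x. base i (s, x)) \<le> \<sigma> * K * C"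
        using base_sec[OF that] by (intro AE_I2) auto
    qed
    define \<theta> where "\<theta> i s = (\<integral>x. base i (s, x) \<bullet> g (s, x) \<partial>torus)" for i s
    have \<theta>: "L2 (time T) (\<theta> i)" if i: "i \<in> J" for i
    proof (rule L2_bound[OF L2_scaleR[OF \<gamma>, of "\<sigma> * K * C"]])
      have "(\<lambda>z. base i z \<bullet> g z) \<in> borel_measurable (spacetime T)"
        using base_m[OF i] L2_measurable[OF g] by measurable
      thus "\<theta> i \<in> borel_measurable (time T)"
        unfolding \<theta>_def[abs_def] by measurable
      show "AE s in time T. norm (\<theta> i s) \<le> norm ((\<sigma> * K * C) *\<^sub>R \<gamma> s)"
        using g_sec AE_space
      proof eventually_elim
        case (elim s)
        have s: "s \<in> {0..T}" using elim by simp
        have "\<bar>\<theta> i s\<bar> \<le> L2_norm torus (\<lambda>x. base i (s, x)) * \<gamma> s"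
          unfolding \<theta>_def \<gamma>_def by (rule L2_Cauchy_Schwarz[OF base_sec(1)[OF i s] elim(1)])
        also have "\<dots> \<le> \<sigma> * K * C * \<gamma> s" by (intro mult_right_mono base_sec(2)[OF i s]) (simp add: \<gamma>_def)
        also have "\<dots> \<le> \<bar>\<sigma> * K * C * \<gamma> s\<bar>" by simp
        finally show ?case by (simp only: real_norm_def real_scaleR_def)
      qed
    qed
    have modes_L2: "L2 (spacetime T) (\<lambda>z. \<alpha> i n (fst z) *\<^sub>R base i z)" if i: "i \<in> J" for i n
    proof (rule L2_spacetime(1))
      show "(\<lambda>z. \<alpha> i n (fst z) *\<^sub>R base i z) \<in> borel_measurable (spacetime T)"
        by (intro borel_measurable_scaleR base_m[OF i] measurable_compose[OF measurable_fst L2_measurable[OF \<alpha>[OF i]]])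
      show "L2 (time T) (\<lambda>s. (\<sigma> * K * C) *\<^sub>R norm (\<alpha> i n s))" by (intro L2_scaleR L2_norm_fun \<alpha>[OF i])
      show "AE s in time T. L2 torus (\<lambda>x. \<alpha> i n (fst (s, x)) *\<^sub>R base i (s, x)) \<and>
          L2_norm torus (\<lambda>x. \<alpha> i n (fst (s, x)) *\<^sub>R base i (s, x)) \<le> (\<sigma> * K * C) *\<^sub>R norm (\<alpha> i n s)"
      proof (rule AE_I2, rule conjI)
        fix s assume "s \<in> space (time T)"
        hence s: "s \<in> {0..T}" by simp
        show "L2 torus (\<lambda>x. \<alpha> i n (fst (s, x)) *\<^sub>R base i (s, x))" using base_sec(1)[OF i s] by (simp add: L2_scaleR)
        show "L2_norm torus (\<lambda>x. \<alpha> i n (fst (s, x)) *\<^sub>R base i (s, x)) \<le> (\<sigma> * K * C) *\<^sub>R norm (\<alpha> i n s)"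
          using mult_left_mono[OF base_sec(2)[OF i s] abs_ge_zero[of "\<alpha> i n s"]] by (simp add: L2_norm_scaleR mult.commute)
      qed
    qed
    have modes_int: "(\<integral>z. (\<alpha> i n (fst z) *\<^sub>R base i z) \<bullet> g z \<partial>spacetime T) = (\<integral>s. \<alpha> i n s * \<theta> i s \<partial>time T)" if i: "i \<in> J" for i n
    proof -
      have "integrable (spacetime T) (\<lambda>(s, x). (\<alpha> i n s *\<^sub>R base i (s, x)) \<bullet> g (s, x))"
        using L2_inner_integrable[OF modes_L2[OF i] g, of n] by (simp add: case_prod_beta')
      from spacetime.integral_fst[OF this] show ?thesis
        by (simp add: \<theta>_def case_prod_beta')
    qed
    have "(\<lambda>n. \<Sum>i\<in>J. \<integral>s. \<alpha> i n s * \<theta> i s \<partial>time T) \<longlonglongrightarrow> (\<Sum>i\<in>J. 0)"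
    proof (rule tendsto_sum)
      fix i assume i: "i \<in> J"
      show "(\<lambda>n. \<integral>s. \<alpha> i n s * \<theta> i s \<partial>time T) \<longlonglongrightarrow> 0"
        using weak[OF i] \<theta>[OF i] by (simp add: weak_L2_tendsto_def)
    qed
    hence "\<forall>\<^sub>F n in sequentially. dist (\<Sum>i\<in>J. \<integral>s. \<alpha> i n s * \<theta> i s \<partial>time T) 0 < e / 3"
      using e by (intro tendstoD) auto
    with differences_small[OF \<delta>(1)]
    show "\<forall>\<^sub>F n in sequentially. dist (\<integral>z. current G \<sigma> (vs n) (Xs n) z \<bullet> g z \<partial>spacetime T) (\<integral>z. current G \<sigma> v X z \<bullet> g z \<partial>spacetime T) < e"
    proof eventually_elim
      case (elim n)
      define W where "W s = (\<lambda>x. Xs n s x - X s x)" for s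
      define f1 where "f1 = current G \<sigma> (vs n) W"
      define f2 where "f2 z = \<sigma> *\<^sub>R G (vs n (fst z) (snd z) - v (fst z) (snd z) - (\<Sum>i\<in>J. \<alpha> i n (fst z) *\<^sub>R \<phi> i (snd z))) (snd (X (fst z) (snd z)))" for z
      have Wes: "W t \<in> energy_space" if "t \<in> {0..T}" for t
        unfolding W_def by (intro energy_space_linear solution_in_energy_space that)
      have Wm: "(\<lambda>z. W (fst z) (snd z)) \<in> borel_measurable (spacetime T)"
        unfolding W_def by (intro borel_measurable_diff states_measurable)
      have W_le: "norm (energy_class \<epsilon> (W t)) \<le> \<delta>" if "t \<in> {0<..<T}" for t using elim(1) that by (simp add: W_def)
      have W_eq: "W = (\<lambda>s x. Xs n s x - X s x)" by (simp add: W_def fun_eq_iff)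
      note f1 = current_L2[OF K \<mu>(1)[of n] Wes Wm W_le less_imp_le[OF \<delta>(1)], folded f1_def]
      have f1_le: "L2_norm (spacetime T) f1 \<le> \<sigma> * (sqrt T / sqrt \<epsilon> + K * A) * \<delta>"
      proof -
        have "\<sigma> * (sqrt T / sqrt \<epsilon> + K * L2_norm (time T) (\<mu> n)) * \<delta> \<le> \<sigma> * (sqrt T / sqrt \<epsilon> + K * A) * \<delta>"
          using \<sigma> \<delta>(1) K(2) \<mu>(2)[of n] by (intro mult_right_mono mult_left_mono add_left_mono) auto
        thus ?thesis using f1(2) by linarith
      qed
      have co: "coefficient T (vs n)" "coefficient T v" using \<mu>(1)[of n] \<mu>' by (auto simp: essentially_bounded_def)
      have f2m: "f2 \<in> borel_measurable (spacetime T)"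
        unfolding f2_def[abs_def]
        by (intro borel_measurable_scaleR borel_measurable_const borel_measurable_bilinear[OF G _ Bm] borel_measurable_diff
            coefficient_measurable co borel_measurable_sum measurable_compose[OF measurable_snd \<phi>(1)]
            measurable_compose[OF measurable_fst L2_measurable[OF \<alpha>]])
      have f2r: "L2 (time T) (\<lambda>s. (\<sigma> * K * C) *\<^sub>R norm (\<rho> n s))" by (intro L2_scaleR L2_norm_fun \<rho>)
      have f2sec: "AE s in time T. L2 torus (\<lambda>x. f2 (s, x)) \<and> L2_norm torus (\<lambda>x. f2 (s, x)) \<le> (\<sigma> * K * C) *\<^sub>R norm (\<rho> n s)"
        using rest[of n] AE_space
      proof eventually_elim
        case (elim s)
        have s: "s \<in> {0..T}" "s \<in> {0<..<T}" using elim by auto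
        have Xs: "X s \<in> energy_space" by (rule solution_in_energy_space(2)[OF s(1)])
        have rm: "(\<lambda>x. vs n s x - v s x - (\<Sum>i\<in>J. \<alpha> i n s *\<^sub>R \<phi> i x)) \<in> borel_measurable torus"
          by (intro borel_measurable_diff borel_measurable_sum borel_measurable_scaleR borel_measurable_const \<phi>(1)
              coefficient_section[OF co(1) s(2)] coefficient_section[OF co(2) s(2)])
        note b = bilinear_L2_bound[OF G K rm elim(1) L2_snd[OF energy_spaceD[OF Xs]]]
        have eq: "(\<lambda>x. f2 (s, x)) = (\<lambda>x. \<sigma> *\<^sub>R G (vs n s x - v s x - (\<Sum>i\<in>J. \<alpha> i n s *\<^sub>R \<phi> i x)) (snd (X s x)))"
          by (simp add: f2_def)
        have "L2_norm torus (\<lambda>x. f2 (s, x)) \<le> \<sigma> * (K * \<bar>\<rho> n s\<bar> * C)"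
        proof -
          have "K * \<bar>\<rho> n s\<bar> * L2_norm torus (\<lambda>x. snd (X s x)) \<le> K * \<bar>\<rho> n s\<bar> * C"
            using K(2) energy_components(2)[OF \<epsilon> Xs] C(2)[OF s(1)] by (intro mult_left_mono) auto
          thus ?thesis unfolding eq L2_norm_scaleR using \<sigma> b(2) by (auto intro!: mult_left_mono)
        qed
        thus ?case using L2_scaleR[OF b(1), of \<sigma>] by (simp add: eq algebra_simps)
      qed
      note f2 = L2_spacetime[OF f2m f2r f2sec]
      have f2_le: "L2_norm (spacetime T) f2 \<le> \<sigma> * K * C * \<eta>"
      proof -
        have "L2_norm (time T) (\<lambda>s. (\<sigma> * K * C) *\<^sub>R norm (\<rho> n s)) = \<sigma> * K * C * L2_norm (time T) (\<rho> n)"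
          unfolding L2_norm_scaleR L2_norm_norm using \<sigma> K(2) C(1) by simp
        also have "\<dots> \<le> \<sigma> * K * C * \<eta>" using \<sigma> K(2) C(1) by (intro mult_left_mono \<rho>(2)) auto
        finally show ?thesis using f2(2) by linarith
      qed
      have decomp: "current G \<sigma> (vs n) (Xs n) z - current G \<sigma> v X z = f1 z + f2 z + (\<Sum>i\<in>J. \<alpha> i n (fst z) *\<^sub>R base i z)" for z
        using current_decomposition[of "vs n" "Xs n" "fst z" "snd z" v X "\<lambda>i. \<alpha> i n (fst z)" \<phi> J]
        by (simp add: f1_def f2_def W_eq base_def algebra_simps)
      have int: "integrable (spacetime T) (\<lambda>z. f1 z \<bullet> g z)" "integrable (spacetime T) (\<lambda>z. f2 z \<bullet> g z)"
          "\<And>i. i \<in> J \<Longrightarrow> integrable (spacetime T) (\<lambda>z. (\<alpha> i n (fst z) *\<^sub>R base i z) \<bullet> g z)"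
        using L2_inner_integrable[OF f1(1) g] L2_inner_integrable[OF f2(1) g] L2_inner_integrable[OF modes_L2 g] by auto
      have "(\<integral>z. current G \<sigma> (vs n) (Xs n) z \<bullet> g z \<partial>spacetime T) - (\<integral>z. current G \<sigma> v X z \<bullet> g z \<partial>spacetime T)
          = (\<integral>z. current G \<sigma> (vs n) (Xs n) z \<bullet> g z - current G \<sigma> v X z \<bullet> g z \<partial>spacetime T)"
        by (rule Bochner_Integration.integral_diff[symmetric]) (intro L2_inner_integrable currents_L2 g)+
      also have "\<dots> = (\<integral>z. f1 z \<bullet> g z + f2 z \<bullet> g z + (\<Sum>i\<in>J. (\<alpha> i n (fst z) *\<^sub>R base i z) \<bullet> g z) \<partial>spacetime T)"
        unfolding inner_diff_left[symmetric] decomp by (simp add: inner_add_left inner_sum_left)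
      also have "\<dots> = (\<integral>z. f1 z \<bullet> g z \<partial>spacetime T) + (\<integral>z. f2 z \<bullet> g z \<partial>spacetime T) + (\<Sum>i\<in>J. \<integral>s. \<alpha> i n s * \<theta> i s \<partial>time T)"
        using int by (simp add: Bochner_Integration.integral_sum modes_int del: inner_scaleR_left)
      finally have eq: "(\<integral>z. current G \<sigma> (vs n) (Xs n) z \<bullet> g z \<partial>spacetime T) - (\<integral>z. current G \<sigma> v X z \<bullet> g z \<partial>spacetime T)
        = (\<integral>z. f1 z \<bullet> g z \<partial>spacetime T) + (\<integral>z. f2 z \<bullet> g z \<partial>spacetime T) + (\<Sum>i\<in>J. \<integral>s. \<alpha> i n s * \<theta> i s \<partial>time T)" .
      have e1: "\<bar>\<integral>z. f1 z \<bullet> g z \<partial>spacetime T\<bar> < e / 3"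
      proof -
        have "\<bar>\<integral>z. f1 z \<bullet> g z \<partial>spacetime T\<bar> \<le> L2_norm (spacetime T) f1 * N"
          unfolding N_def by (rule L2_Cauchy_Schwarz[OF f1(1) g])
        also have "\<dots> \<le> \<sigma> * (sqrt T / sqrt \<epsilon> + K * A) * \<delta> * N" by (intro mult_right_mono f1_le N)
        also have "\<dots> = c1 * \<delta>" by (simp add: c1_def algebra_simps)
        finally show ?thesis using \<delta>(2) by linarith
      qed
      have e2: "\<bar>\<integral>z. f2 z \<bullet> g z \<partial>spacetime T\<bar> < e / 3"
      proof -
        have "\<bar>\<integral>z. f2 z \<bullet> g z \<partial>spacetime T\<bar> \<le> L2_norm (spacetime T) f2 * N"
          unfolding N_def by (rule L2_Cauchy_Schwarz[OF f2(1) g])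
        also have "\<dots> \<le> \<sigma> * K * C * \<eta> * N" by (intro mult_right_mono f2_le N)
        also have "\<dots> = c2 * \<eta>" by (simp add: c2_def algebra_simps)
        finally show ?thesis using \<eta>(2) by linarith
      qed
      show ?case unfolding dist_real_def eq using e1 e2 elim(2) by (simp add: dist_real_def)
    qed
  qed
qed

text \<open>
  A bilinear expression in a weakly convergent factor (the currents) and a strongly convergent one
  (the magnetic fields). Replacing the magnetic field by its limit costs little, because weakly
  convergent currents are bounded. What remains is linear in the current and can be written as a
  pairing with a fixed square-integrable function.
\<close>

lemma force_distr_tendsto:
  fixes L :: "real^'d \<Rightarrow> 'b \<Rightarrow> 'e::euclidean_space"
  assumes L: "bounded_bilinear L"
  shows "distr_tendsto T (\<lambda>n z. L (current G \<sigma> (vs n) (Xs n) z) (snd (Xs n (fst z) (snd z))))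
    (\<lambda>z. L (current G \<sigma> v X z) (snd (X (fst z) (snd z))))"
  unfolding distr_tendsto_def
proof (intro allI impI)
  interpret L: bounded_bilinear L by (rule L)
  fix \<phi> :: "real \<times> (real^'d) \<Rightarrow> 'e" assume \<phi>: "spacetime_test T \<phi>"
  note \<phi>m = spacetime_test_bounded(1)[OF \<phi>]
  obtain \<Phi> where \<Phi>: "0 < \<Phi>" "\<And>z. z \<in> space (spacetime T) \<Longrightarrow> norm (\<phi> z) \<le> \<Phi>" using spacetime_test_bounded(2)[OF \<phi>] by blast
  obtain K where K: "\<And>a b. norm (L a b) \<le> norm a * norm b * K" "0 \<le> K" using L.nonneg_bounded by blast
  define j where "j n = current G \<sigma> (vs n) (Xs n)" for n
  define j0 where "j0 = current G \<sigma> v X"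
  define B where "B n z = snd (Xs n (fst z) (snd z))" for n z
  define B0 where "B0 z = snd (X (fst z) (snd z))" for z
  have j: "L2 (spacetime T) (j n)" "L2 (spacetime T) j0" for n using currents_L2 by (auto simp: j_def j0_def)
  have weak: "weak_L2_tendsto (spacetime T) j j0" unfolding j_def[abs_def] j0_def by (rule currents_weak)
  have snd_L2: "L2 (spacetime T) (\<lambda>z. snd (Y (fst z) (snd z)))" "L2_norm (spacetime T) (\<lambda>z. snd (Y (fst z) (snd z))) \<le> sqrt T * C"
    if "(\<lambda>z. Y (fst z) (snd z)) \<in> borel_measurable (spacetime T)" "\<And>t. t \<in> {0..T} \<Longrightarrow> Y t \<in> energy_space"
      "\<And>t. t \<in> {0..T} \<Longrightarrow> norm (energy_class \<epsilon> (Y t)) \<le> C" "0 \<le> C" for Y :: "real \<Rightarrow> ('d, 'b) state" and C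
  proof -
    have m: "(\<lambda>z. snd (Y (fst z) (snd z))) \<in> borel_measurable (spacetime T)"
      by (rule measurable_compose[OF that(1)]) (intro borel_measurable_continuous_onI continuous_intros)
    have c: "L2 (time T) (\<lambda>_. C)" "L2_norm (time T) (\<lambda>_. C) = sqrt T * C"
      using T that(4) by (simp_all add: L2_def L2_norm_def measure_def emeasure_time real_sqrt_mult)
    have sec: "AE s in time T. L2 torus (\<lambda>x. snd (Y (fst (s, x)) (snd (s, x)))) \<and> L2_norm torus (\<lambda>x. snd (Y (fst (s, x)) (snd (s, x)))) \<le> C"
    proof (rule AE_I2)
      fix s assume "s \<in> space (time T)"
      hence s: "s \<in> {0..T}" by simp
      show "L2 torus (\<lambda>x. snd (Y (fst (s, x)) (snd (s, x)))) \<and> L2_norm torus (\<lambda>x. snd (Y (fst (s, x)) (snd (s, x)))) \<le> C"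
        using L2_snd[OF energy_spaceD[OF that(2)[OF s]]] energy_components(2)[OF \<epsilon> that(2)[OF s]] that(3)[OF s] by simp
    qed
    show "L2 (spacetime T) (\<lambda>z. snd (Y (fst z) (snd z)))" "L2_norm (spacetime T) (\<lambda>z. snd (Y (fst z) (snd z))) \<le> sqrt T * C"
      using L2_spacetime[OF m c(1) sec] c(2) by simp_all
  qed
  have B: "L2 (spacetime T) (B n)" for n
    using class_bounded(1)[of n] snd_L2(1)[OF states_measurable(1)[of n] solution_in_energy_space(1)] unfolding B_def[abs_def] by (meson less_imp_le)
  have B0: "L2 (spacetime T) B0"
    using class_bounded(2) snd_L2(1)[OF states_measurable(2) solution_in_energy_space(2)] unfolding B0_def[abs_def] by (meson less_imp_le)
  have LB: "integrable (spacetime T) (\<lambda>z. L (a z) (b z) \<bullet> \<phi> z)" "\<bar>\<integral>z. L (a z) (b z) \<bullet> \<phi> z \<partial>spacetime T\<bar> \<le> K * \<Phi> * (L2_norm (spacetime T) a * L2_norm (spacetime T) b)"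
    if a: "L2 (spacetime T) a" and b: "L2 (spacetime T) b" for a b
  proof -
    have maj: "integrable (spacetime T) (\<lambda>z. K * \<Phi> * (norm (a z) * norm (b z)))"
      by (intro integrable_mult_right L2_mult_integrable a b)
    have le: "\<bar>L (a z) (b z) \<bullet> \<phi> z\<bar> \<le> K * \<Phi> * (norm (a z) * norm (b z))" if "z \<in> space (spacetime T)" for z
    proof -
      have "\<bar>L (a z) (b z) \<bullet> \<phi> z\<bar> \<le> norm (L (a z) (b z)) * norm (\<phi> z)" by (rule Cauchy_Schwarz_ineq2)
      also have "\<dots> \<le> (norm (a z) * norm (b z) * K) * \<Phi>" using K(2) by (intro mult_mono K \<Phi>(2)[OF that]) auto
      finally show ?thesis by (simp add: algebra_simps)
    qed
    have m: "(\<lambda>z. L (a z) (b z) \<bullet> \<phi> z) \<in> borel_measurable (spacetime T)"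
      by (intro borel_measurable_inner borel_measurable_bilinear[OF L] L2_measurable a b \<phi>m)
    show int: "integrable (spacetime T) (\<lambda>z. L (a z) (b z) \<bullet> \<phi> z)"
      by (rule Bochner_Integration.integrable_bound[OF maj m]) (use le \<Phi>(1) K(2) in \<open>auto intro!: AE_I2 order_trans[OF le]\<close>)
    have "\<bar>\<integral>z. L (a z) (b z) \<bullet> \<phi> z \<partial>spacetime T\<bar> \<le> (\<integral>z. K * \<Phi> * (norm (a z) * norm (b z)) \<partial>spacetime T)"
      by (rule integral_abs_bound[THEN order_trans], rule integral_mono) (use int maj le in auto)
    also have "\<dots> = K * \<Phi> * (\<integral>z. norm (a z) * norm (b z) \<partial>spacetime T)" by simp
    also have "\<dots> \<le> K * \<Phi> * (L2_norm (spacetime T) a * L2_norm (spacetime T) b)"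
      using K(2) \<Phi>(1) by (intro mult_left_mono L2_mult_Cauchy_Schwarz a b) auto
    finally show "\<bar>\<integral>z. L (a z) (b z) \<bullet> \<phi> z \<partial>spacetime T\<bar> \<le> K * \<Phi> * (L2_norm (spacetime T) a * L2_norm (spacetime T) b)" .
  qed
  obtain Q where Q: "\<And>n. L2_norm (spacetime T) (j n) \<le> Q" using weak_L2_bounded[OF weak] by blast
  have BB: "L2 (spacetime T) (\<lambda>z. B n z - B0 z)" for n by (intro L2_diff B B0)
  have lim1: "(\<lambda>n. \<integral>z. L (j n z) (B n z - B0 z) \<bullet> \<phi> z \<partial>spacetime T) \<longlonglongrightarrow> 0"
  proof -
    have "(\<lambda>n. L2_norm (spacetime T) (\<lambda>z. B n z - B0 z)) \<longlonglongrightarrow> 0"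
    proof (rule tendstoI)
      fix e :: real assume e: "0 < e"
      define \<delta> where "\<delta> = e / (2 * sqrt T)"
      have \<delta>: "0 < \<delta>" "sqrt T * \<delta> < e" using e T by (simp_all add: \<delta>_def)
      show "\<forall>\<^sub>F n in sequentially. dist (L2_norm (spacetime T) (\<lambda>z. B n z - B0 z)) 0 < e"
        using differences_small[OF \<delta>(1)]
      proof eventually_elim
        case (elim n)
        have "L2_norm (spacetime T) (\<lambda>z. snd (Xs n (fst z) (snd z) - X (fst z) (snd z))) \<le> sqrt T * \<delta>"
          by (rule snd_L2(2)[where Y = "\<lambda>t x. Xs n t x - X t x"])
             (use elim \<delta>(1) in \<open>auto intro!: borel_measurable_diff states_measurable energy_space_linear solution_in_energy_space\<close>)
        thus ?case using \<delta>(2) by (simp add: B_def B0_def)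
      qed
    qed
    hence "(\<lambda>n. K * \<Phi> * (Q * L2_norm (spacetime T) (\<lambda>z. B n z - B0 z))) \<longlonglongrightarrow> K * \<Phi> * (Q * 0)" by (intro tendsto_intros)
    hence lim: "(\<lambda>n. K * \<Phi> * (Q * L2_norm (spacetime T) (\<lambda>z. B n z - B0 z))) \<longlonglongrightarrow> 0" by simp
    show ?thesis
    proof (rule Lim_null_comparison[OF _ lim], intro always_eventually allI)
      fix n
      have "K * \<Phi> * (L2_norm (spacetime T) (j n) * L2_norm (spacetime T) (\<lambda>z. B n z - B0 z)) \<le> K * \<Phi> * (Q * L2_norm (spacetime T) (\<lambda>z. B n z - B0 z))"
        using K(2) \<Phi>(1) by (intro mult_left_mono mult_right_mono Q) auto
      with LB(2)[OF j(1) BB, of n n] show "norm (\<integral>z. L (j n z) (B n z - B0 z) \<bullet> \<phi> z \<partial>spacetime T) \<le> K * \<Phi> * (Q * L2_norm (spacetime T) (\<lambda>z. B n z - B0 z))" by simp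
    qed
  qed
  \<comment> \<open>The adjoint of \<open>a \<mapsto> L a (B0 z)\<close>, applied to \<open>\<phi> z\<close>.\<close>
  define g where "g z = (\<Sum>e\<in>Basis. (L e (B0 z) \<bullet> \<phi> z) *\<^sub>R e)" for z
  have adj: "L a (B0 z) \<bullet> \<phi> z = a \<bullet> g z" for a z
  proof -
    have "L a (B0 z) = L (\<Sum>e\<in>Basis. (a \<bullet> e) *\<^sub>R e) (B0 z)" by (simp add: euclidean_representation)
    thus ?thesis by (simp add: g_def L.sum_left L.scaleR_left inner_sum_left inner_sum_right mult.commute)
  qed
  have g: "L2 (spacetime T) g"
    unfolding g_def[abs_def]
  proof (rule L2_sum)
    fix e :: "real^'d" assume e: "e \<in> Basis"
    show "L2 (spacetime T) (\<lambda>z. (L e (B0 z) \<bullet> \<phi> z) *\<^sub>R e)"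
    proof (rule L2_bound[OF L2_scaleR[OF B0, of "K * \<Phi>"]])
      show "(\<lambda>z. (L e (B0 z) \<bullet> \<phi> z) *\<^sub>R e) \<in> borel_measurable (spacetime T)"
        by (intro borel_measurable_scaleR borel_measurable_const borel_measurable_inner borel_measurable_bilinear[OF L] L2_measurable B0 \<phi>m)
      show "AE z in spacetime T. norm ((L e (B0 z) \<bullet> \<phi> z) *\<^sub>R e) \<le> norm ((K * \<Phi>) *\<^sub>R B0 z)"
      proof (rule AE_I2)
        fix z :: "real \<times> (real^'d)" assume z: "z \<in> space (spacetime T)"
        have "\<bar>L e (B0 z) \<bullet> \<phi> z\<bar> \<le> norm (L e (B0 z)) * norm (\<phi> z)" by (rule Cauchy_Schwarz_ineq2)
        also have "\<dots> \<le> (norm e * norm (B0 z) * K) * \<Phi>" using K(2) by (intro mult_mono K \<Phi>(2)[OF z]) auto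
        finally show "norm ((L e (B0 z) \<bullet> \<phi> z) *\<^sub>R e) \<le> norm ((K * \<Phi>) *\<^sub>R B0 z)"
          using e K(2) \<Phi>(1) by (simp add: algebra_simps)
      qed
    qed
  qed
  have lim2: "(\<lambda>n. \<integral>z. L (j n z) (B0 z) \<bullet> \<phi> z \<partial>spacetime T) \<longlonglongrightarrow> (\<integral>z. L (j0 z) (B0 z) \<bullet> \<phi> z \<partial>spacetime T)"
    unfolding adj using weak g by (simp add: weak_L2_tendsto_def)
  have "(\<integral>z. L (j n z) (B n z) \<bullet> \<phi> z \<partial>spacetime T) = (\<integral>z. L (j n z) (B n z - B0 z) \<bullet> \<phi> z \<partial>spacetime T) + (\<integral>z. L (j n z) (B0 z) \<bullet> \<phi> z \<partial>spacetime T)" for n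
    using Bochner_Integration.integral_add[OF LB(1)[OF j(1) BB] LB(1)[OF j(1) B0], of n n n]
    by (simp add: inner_add_left[symmetric] L.add_right[symmetric])
  hence "(\<lambda>n. \<integral>z. L (j n z) (B n z) \<bullet> \<phi> z \<partial>spacetime T) \<longlonglongrightarrow> 0 + (\<integral>z. L (j0 z) (B0 z) \<bullet> \<phi> z \<partial>spacetime T)"
    using tendsto_add[OF lim1 lim2] by simp
  thus "(\<forall>n. integrable (spacetime T) (\<lambda>z. L (current G \<sigma> (vs n) (Xs n) z) (snd (Xs n (fst z) (snd z))) \<bullet> \<phi> z)) \<and>
      integrable (spacetime T) (\<lambda>z. L (current G \<sigma> v X z) (snd (X (fst z) (snd z))) \<bullet> \<phi> z) \<and>
      (\<lambda>n. \<integral>z. L (current G \<sigma> (vs n) (Xs n) z) (snd (Xs n (fst z) (snd z))) \<bullet> \<phi> z \<partial>spacetime T) \<longlonglongrightarrow>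
        (\<integral>z. L (current G \<sigma> v X z) (snd (X (fst z) (snd z))) \<bullet> \<phi> z \<partial>spacetime T)"
    using LB(1)[OF j(1) B] LB(1)[OF j(2) B0] by (simp add: j_def j0_def B_def B0_def)
qed

end

section \<open>From spectral convergence to finitely many modes\<close>

lemma norm_smult_complex: "norm (c *s (z :: complex^'n)) = norm c * norm z"
  by (simp add: norm_vec_def norm_mult L2_set_right_distrib)

lemma bounded_bilinear_smult: "bounded_bilinear (\<lambda>c (z :: complex^'n). c *s z)"
proof
  fix c c' :: complex and z z' :: "complex^'n" and r :: real
  show "(c + c') *s z = c *s z + c' *s z" by (simp add: vec_eq_iff algebra_simps)
  show "c *s (z + z') = c *s z + c *s z'" by (simp add: vec_eq_iff algebra_simps)
  show "(r *\<^sub>R c) *s z = r *\<^sub>R (c *s z)" by (simp add: vec_eq_iff)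
  show "c *s (r *\<^sub>R z) = r *\<^sub>R (c *s z)" by (simp add: vec_eq_iff)
  show "\<exists>K. \<forall>c (z :: complex^'n). norm (c *s z) \<le> norm c * norm z * K"
    by (intro exI[of _ 1]) (simp add: norm_smult_complex)
qed

lemma norm_cvec [simp]: "norm (cvec x) = norm x"
  by (simp add: norm_vec_def cvec_def)

lemma bounded_linear_cvec: "bounded_linear (cvec :: real^'n \<Rightarrow> complex^'n)"
proof (rule bounded_linear_intro[of _ 1])
  show "norm (cvec x) \<le> norm x * 1" for x :: "real^'n" by simp
  have "of_real (r * a) = r *\<^sub>R (of_real a :: complex)" for r a by (simp add: scaleR_conv_of_real)
  thus "cvec (r *\<^sub>R x) = r *\<^sub>R cvec x" for r and x :: "real^'n" by (simp add: cvec_def vec_eq_iff)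
qed (simp add: cvec_def vec_eq_iff)

definition re_vec :: "complex^'n \<Rightarrow> real^'n" where
  "re_vec z = (\<chi> i. Re (z $ i))"

lemma norm_re_vec_le: "norm (re_vec z) \<le> norm z"
  unfolding norm_vec_def re_vec_def by (intro L2_set_mono) (auto simp: abs_Re_le_cmod)

lemma bounded_linear_re_vec: "bounded_linear (re_vec :: complex^'n \<Rightarrow> real^'n)"
proof (rule bounded_linear_intro[of _ 1])
  show "norm (re_vec z) \<le> norm z * 1" for z :: "complex^'n" by (simp add: norm_re_vec_le)
qed (simp_all add: re_vec_def vec_eq_iff)

lemma re_vec_cvec [simp]: "re_vec (cvec x) = x"
  by (simp add: re_vec_def cvec_def)

lemma bounded_linear_borel: "bounded_linear h \<Longrightarrow> h \<in> borel_measurable borel"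
  by (simp add: borel_measurable_continuous_onI linear_continuous_on)

lemma cis_freq_measurable: "(\<lambda>x. cis (c * (freq k \<bullet> x))) \<in> borel_measurable borel"
  by (intro borel_measurable_continuous_onI continuous_intros)

lemma fourier_measurable:
  fixes v :: "real \<Rightarrow> real^'d::finite \<Rightarrow> real^'d"
  assumes "coefficient T v"
  shows "(\<lambda>t. fourier (v t) k) \<in> borel_measurable (time T)"
proof -
  have c: "(\<lambda>z. cis (- (freq k \<bullet> snd z))) \<in> borel_measurable (spacetime T)"
    by (rule measurable_compose[OF measurable_snd measurable_torusI]) (use cis_freq_measurable[of "-1" k] in simp)
  have "(\<lambda>z. cis (- (freq k \<bullet> snd z)) *s cvec (v (fst z) (snd z))) \<in> borel_measurable (spacetime T)"
    by (rule borel_measurable_bilinear[OF bounded_bilinear_smult c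
        measurable_compose[OF coefficient_measurable[OF assms] bounded_linear_borel[OF bounded_linear_cvec]]])
  hence "(\<lambda>t. \<integral>x. cis (- (freq k \<bullet> x)) *s cvec (v t x) \<partial>torus) \<in> borel_measurable (time T)"
    by (intro torus.borel_measurable_lebesgue_integral) (simp add: case_prod_beta')
  thus ?thesis unfolding fourier_def by (intro borel_measurable_scaleR borel_measurable_const)
qed

lemma fourier_tail_measurable:
  fixes v :: "real \<Rightarrow> real^'d::finite \<Rightarrow> real^'d"
  assumes "coefficient T v"
  shows "(\<lambda>z. fourier_tail M (v (fst z)) (snd z)) \<in> borel_measurable (spacetime T)"
proof -
  have c: "(\<lambda>z. cis (freq k \<bullet> snd z)) \<in> borel_measurable (spacetime T)" for k
    by (rule measurable_compose[OF measurable_snd measurable_torusI]) (use cis_freq_measurable[of 1 k] in simp)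
  have "(\<lambda>z. cis (freq k \<bullet> snd z) *s fourier (v (fst z)) k) \<in> borel_measurable (spacetime T)" for k
    by (rule borel_measurable_bilinear[OF bounded_bilinear_smult c
        measurable_compose[OF measurable_fst fourier_measurable[OF assms]]])
  thus ?thesis
    unfolding fourier_tail_def fourier_proj_def
    by (intro borel_measurable_diff borel_measurable_sum
        measurable_compose[OF coefficient_measurable[OF assms] bounded_linear_borel[OF bounded_linear_cvec]])
qed

text \<open>
  The essential supremum of a section is at most \<open>c\<close> iff the section of a measurable set is null,
  and measures of sections depend measurably on the parameter.
\<close>

lemma esssup_measurable:
  fixes f :: "real \<Rightarrow> real^'d::finite \<Rightarrow> 'c::euclidean_space"
  assumes f: "(\<lambda>z. f (fst z) (snd z)) \<in> borel_measurable (spacetime T)"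
  shows "(\<lambda>t. esssup torus (\<lambda>x. ennreal (norm (f t x)))) \<in> borel_measurable (time T)"
proof (rule borel_measurableI_le)
  fix c :: ennreal
  define Q where "Q = {z \<in> space (spacetime T). c < ennreal (norm (f (fst z) (snd z)))}"
  have Q: "Q \<in> sets (spacetime T)" unfolding Q_def using f by measurable
  have sec: "Pair t -` Q = {x \<in> space torus. \<not> ennreal (norm (f t x)) \<le> c}" if "t \<in> space (time T)" for t
    using that by (auto simp: Q_def space_pair_measure not_le)
  have iff: "esssup torus (\<lambda>x. ennreal (norm (f t x))) \<le> c \<longleftrightarrow> emeasure torus (Pair t -` Q) = 0"
    if t: "t \<in> space (time T)" for t
  proof -
    have ft: "f t \<in> borel_measurable torus"
      using measurable_compose[OF measurable_Pair1'[OF t, of torus] f] by simp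
    have "esssup torus (\<lambda>x. ennreal (norm (f t x))) \<le> c \<longleftrightarrow> (AE x in torus. ennreal (norm (f t x)) \<le> c)"
    proof
      assume "esssup torus (\<lambda>x. ennreal (norm (f t x))) \<le> c"
      thus "AE x in torus. ennreal (norm (f t x)) \<le> c"
        using esssup_AE[of "\<lambda>x. ennreal (norm (f t x))" torus] by (auto elim!: eventually_mono)
    next
      assume "AE x in torus. ennreal (norm (f t x)) \<le> c"
      thus "esssup torus (\<lambda>x. ennreal (norm (f t x))) \<le> c"
        using ft by (intro esssup_I) auto
    qed
    also have "\<dots> \<longleftrightarrow> emeasure torus (Pair t -` Q) = 0"
      unfolding sec[OF t] by (rule AE_iff_measurable[OF _ refl]) (use sets_Pair1[OF Q, of t] in \<open>simp add: sec[OF t]\<close>)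
    finally show ?thesis .
  qed
  have "(\<lambda>t. emeasure torus (Pair t -` Q)) \<in> borel_measurable (time T)"
    by (rule torus.measurable_emeasure_Pair[OF Q])
  hence "{t \<in> space (time T). emeasure torus (Pair t -` Q) = 0} \<in> sets (time T)" by measurable
  also have "{t \<in> space (time T). emeasure torus (Pair t -` Q) = 0} = {t \<in> space (time T). esssup torus (\<lambda>x. ennreal (norm (f t x))) \<le> c}"
    using iff by auto
  finally show "{t \<in> space (time T). esssup torus (\<lambda>x. ennreal (norm (f t x))) \<le> c} \<in> sets (time T)" .
qed

text \<open>
  The essential supremum as a function of time is the majorant. It is finite almost everywhere; on
  the exceptional null set \<open>enn2real\<close> returns \<open>0\<close>.
\<close>

lemma L2Linf_majorant:
  fixes f :: "real \<Rightarrow> real^'d::finite \<Rightarrow> 'c::euclidean_space"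
  assumes f: "(\<lambda>z. f (fst z) (snd z)) \<in> borel_measurable (spacetime T)"
    and le: "L2Linf_norm T f \<le> ennreal c" and c: "0 \<le> c"
  shows "\<exists>m. L2 (time T) m \<and> L2_norm (time T) m \<le> c \<and> (AE t in time T. AE x in torus. norm (f t x) \<le> m t)"
proof -
  define e where "e t = esssup torus (\<lambda>x. ennreal (norm (f t x)))" for t
  have e [measurable]: "e \<in> borel_measurable (time T)" unfolding e_def[abs_def] by (rule esssup_measurable[OF f])
  define I where "I = (\<integral>\<^sup>+ t. (e t)\<^sup>2 \<partial>time T)"
  have norm_eq: "L2Linf_norm T f = ennreal_sqrt I" unfolding L2Linf_norm_def I_def e_def ..
  have I: "I \<le> ennreal (c\<^sup>2)"
  proof (cases "I = \<infinity>")
    case True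
    with le show ?thesis unfolding norm_eq ennreal_sqrt_def by (simp add: top_unique)
  next
    case False
    hence "ennreal (sqrt (enn2real I)) \<le> ennreal c" using le unfolding norm_eq ennreal_sqrt_def by simp
    hence "sqrt (enn2real I) \<le> c" using c by simp
    hence "enn2real I \<le> c\<^sup>2" by (rule sqrt_le_D)
    hence "ennreal (enn2real I) \<le> ennreal (c\<^sup>2)" by (rule ennreal_leI)
    thus ?thesis using False by (simp add: ennreal_enn2real_if)
  qed
  have "AE t in time T. (e t)\<^sup>2 \<noteq> \<infinity>"
  proof (rule nn_integral_noteq_infinite)
    show "(\<lambda>t. (e t)\<^sup>2) \<in> borel_measurable (time T)" by measurable
    show "(\<integral>\<^sup>+ t. (e t)\<^sup>2 \<partial>time T) \<noteq> \<infinity>"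
      using le_less_trans[OF I ennreal_less_top] unfolding I_def[symmetric] by simp
  qed
  hence fin: "AE t in time T. e t \<noteq> \<infinity>"
  proof eventually_elim
    case (elim t)
    thus ?case by (cases "e t = \<infinity>") (simp_all add: power2_eq_square)
  qed
  define m where "m t = enn2real (e t)" for t
  have m: "m \<in> borel_measurable (time T)" unfolding m_def[abs_def] by measurable
  have em: "ennreal (m t) = e t" if "e t \<noteq> \<infinity>" for t
    unfolding m_def by (rule ennreal_enn2real) (use that in \<open>simp add: less_top\<close>)
  have m0: "0 \<le> m t" for t by (simp add: m_def)
  have "(\<integral>\<^sup>+ t. ennreal ((norm (m t))\<^sup>2) \<partial>time T) \<le> (\<integral>\<^sup>+ t. (e t)\<^sup>2 \<partial>time T)"
  proof (rule nn_integral_mono_AE)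
    show "AE t in time T. ennreal ((norm (m t))\<^sup>2) \<le> (e t)\<^sup>2"
      using fin
    proof eventually_elim
      case (elim t)
      have "ennreal ((norm (m t))\<^sup>2) = (ennreal (m t))\<^sup>2" using m0[of t] by (simp add: ennreal_power)
      also have "\<dots> = (e t)\<^sup>2" by (simp only: em[OF elim])
      finally show ?case by simp
    qed
  qed
  also have "\<dots> \<le> ennreal (c\<^sup>2)" using I by (simp only: I_def)
  finally have le2: "(\<integral>\<^sup>+ t. ennreal ((norm (m t))\<^sup>2) \<partial>time T) \<le> ennreal (c\<^sup>2)" .
  have bd: "AE t in time T. AE x in torus. norm (f t x) \<le> m t"
    using fin
  proof eventually_elim
    case (elim t)
    note em_t = em[OF elim]
    have "AE x in torus. ennreal (norm (f t x)) \<le> e t" unfolding e_def by (rule esssup_AE)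
    thus ?case
    proof (rule eventually_mono)
      fix x assume "ennreal (norm (f t x)) \<le> e t"
      thus "norm (f t x) \<le> m t" using m0[of t] by (simp only: em_t[symmetric] ennreal_le_iff)
    qed
  qed
  show ?thesis by (intro exI[of _ m] conjI L2_I_nn_integral[OF m le2 c] bd)
qed

lemma finite_low_frequencies: "finite {k :: int^'d::finite. norm (freq k) \<le> M}"
proof -
  have "finite (PiE (UNIV :: 'd set) (\<lambda>_. {- \<lceil>\<bar>M\<bar>\<rceil>..\<lceil>\<bar>M\<bar>\<rceil>}))" by (rule finite_PiE) auto
  moreover have "vec_nth ` {k :: int^'d. norm (freq k) \<le> M} \<subseteq> PiE UNIV (\<lambda>_. {- \<lceil>\<bar>M\<bar>\<rceil>..\<lceil>\<bar>M\<bar>\<rceil>})"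
  proof (clarsimp simp: PiE_iff)
    fix k :: "int^'d" and i assume "norm (freq k) \<le> M"
    hence "\<bar>real_of_int (k $ i)\<bar> \<le> \<bar>M\<bar>" using component_le_norm_cart[of "freq k" i] by (simp add: freq_def)
    hence "real_of_int \<bar>k $ i\<bar> \<le> real_of_int \<lceil>\<bar>M\<bar>\<rceil>" using le_of_int_ceiling[of "\<bar>M\<bar>"] by linarith
    hence "\<bar>k $ i\<bar> \<le> \<lceil>\<bar>M\<bar>\<rceil>" by (simp only: of_int_le_iff)
    thus "- \<lceil>\<bar>M\<bar>\<rceil> \<le> k $ i \<and> k $ i \<le> \<lceil>\<bar>M\<bar>\<rceil>" by linarith
  qed
  ultimately have "finite (vec_nth ` {k :: int^'d. norm (freq k) \<le> M})" by (rule rev_finite_subset)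
  thus ?thesis by (rule finite_imageD) (auto intro: inj_onI simp: vec_nth_inject)
qed

text \<open>
  Real coefficients of these modes reproduce the real part of a Fourier polynomial: \<open>b\<close> runs through
  the real basis of the complex coefficient space.
\<close>

definition mode :: "(int^'d) \<times> (complex^'d) \<Rightarrow> real^'d::finite \<Rightarrow> real^'d" where
  "mode = (\<lambda>(k, b) x. re_vec (cis (freq k \<bullet> x) *s b))"

lemma mode_measurable: "mode i \<in> borel_measurable torus"
proof -
  have "(\<lambda>x. cis (freq (fst i) \<bullet> x) *s snd i) \<in> borel_measurable borel"
    by (rule borel_measurable_bilinear[OF bounded_bilinear_smult _ borel_measurable_const])
       (use cis_freq_measurable[of 1 "fst i"] in simp)
  from measurable_compose[OF this bounded_linear_borel[OF bounded_linear_re_vec]]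
  show ?thesis by (intro measurable_torusI) (simp add: mode_def case_prod_beta')
qed

lemma norm_mode_le: "norm (mode (k, b) x) \<le> norm b"
  unfolding mode_def prod.case by (rule order_trans[OF norm_re_vec_le]) (simp add: norm_smult_complex)

lemma tail_decomposition:
  fixes f :: "real^'d::finite \<Rightarrow> real^'d"
  shows "f x = re_vec (fourier_tail M f x) + (\<Sum>(k, b)\<in>{k. norm (freq k) \<le> M} \<times> Basis. (fourier f k \<bullet> b) *\<^sub>R mode (k, b) x)"
proof -
  interpret re_vec: bounded_linear re_vec by (rule bounded_linear_re_vec)
  interpret sm: bounded_bilinear "\<lambda>c (z :: complex^'d). c *s z" by (rule bounded_bilinear_smult)
  have "re_vec (cis (freq k \<bullet> x) *s fourier f k) = (\<Sum>b\<in>Basis. (fourier f k \<bullet> b) *\<^sub>R mode (k, b) x)" for k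
  proof -
    have "cis (freq k \<bullet> x) *s fourier f k = cis (freq k \<bullet> x) *s (\<Sum>b\<in>Basis. (fourier f k \<bullet> b) *\<^sub>R b)"
      by (simp only: euclidean_representation)
    thus ?thesis by (simp add: sm.sum_right sm.scaleR_right re_vec.sum re_vec.scaleR mode_def)
  qed
  hence "re_vec (fourier_proj M f x) = (\<Sum>(k, b)\<in>{k. norm (freq k) \<le> M} \<times> Basis. (fourier f k \<bullet> b) *\<^sub>R mode (k, b) x)"
    unfolding fourier_proj_def re_vec.sum by (simp add: sum.cartesian_product)
  thus ?thesis unfolding fourier_tail_def re_vec.diff re_vec_cvec by simp
qed

lemma weak_L2_component_null:
  assumes weak: "weak_L2_tendsto M fs f"
  shows "weak_L2_tendsto M (\<lambda>n s. (fs n s - f s) \<bullet> b) (\<lambda>_. 0)"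
proof -
  note parts = weak[unfolded weak_L2_tendsto_def]
  have fs: "L2 M (fs n)" for n by (rule parts[THEN conjunct1, rule_format])
  have f: "L2 M f" by (rule parts[THEN conjunct2, THEN conjunct1])
  have "L2 M (\<lambda>s. (fs n s - f s) \<bullet> b)" for n
    by (rule L2_bounded_linear[OF bounded_linear_inner_left L2_diff[OF fs f]])
  moreover have "(\<lambda>n. \<integral>s. ((fs n s - f s) \<bullet> b) \<bullet> g s \<partial>M) \<longlonglongrightarrow> (\<integral>s. 0 \<bullet> g s \<partial>M)"
    if g: "L2 M g" for g :: "'a \<Rightarrow> real"
  proof -
    have gb: "L2 M (\<lambda>s. g s *\<^sub>R b)"
      by (rule L2_bounded_linear[OF bounded_linear_scaleR_left g])
    have "((fs n s - f s) \<bullet> b) \<bullet> g s = fs n s \<bullet> (g s *\<^sub>R b) - f s \<bullet> (g s *\<^sub>R b)" for n s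
      by (simp add: inner_diff_left algebra_simps)
    hence eq: "(\<integral>s. ((fs n s - f s) \<bullet> b) \<bullet> g s \<partial>M) = (\<integral>s. fs n s \<bullet> (g s *\<^sub>R b) \<partial>M) - (\<integral>s. f s \<bullet> (g s *\<^sub>R b) \<partial>M)" for n
      using Bochner_Integration.integral_diff[OF L2_inner_integrable[OF fs gb] L2_inner_integrable[OF f gb], of n]
      by (simp only:)
    show ?thesis
      unfolding eq using LIM_zero[OF parts[THEN conjunct2, THEN conjunct2, rule_format, OF gb]] by simp
  qed
  ultimately show ?thesis unfolding weak_L2_tendsto_def by simp
qed

text \<open>
  The low frequencies of \<open>vs n - v\<close> form the finite sum, since there are finitely many of them and
  their coefficients converge weakly. The two Fourier tails form the remainder.
\<close>

lemma spectral_imp_finite_mode_convergence: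
  fixes vs :: "nat \<Rightarrow> real \<Rightarrow> real^'d::finite \<Rightarrow> real^'d"
  assumes spec: "spectral_convergence T vs v"
  shows "finite_mode_convergence T vs v"
proof -
  have co: "coefficient T (vs n)" "coefficient T v" for n using spec by (auto simp: spectral_convergence_def)
  note com = coefficient_measurable[OF co(1)] coefficient_measurable[OF co(2)]
  have bdd: "(SUP n. L2Linf_norm T (vs n)) + L2Linf_norm T v < \<infinity>" using spec by (simp add: spectral_convergence_def)
  have lim: "(\<lambda>M::nat. (SUP n. L2Linf_norm T (\<lambda>t. fourier_tail (real M) (vs n t))) +
               L2Linf_norm T (\<lambda>t. fourier_tail (real M) (v t))) \<longlonglongrightarrow> 0"
    using spec by (simp add: spectral_convergence_def)
  have weak: "weak_L2_tendsto (time T) (\<lambda>n t. fourier (vs n t) k) (\<lambda>t. fourier (v t) k)" for k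
    using spec by (simp add: spectral_convergence_def)
  define A where "A = enn2real (SUP n. L2Linf_norm T (vs n))"
  have "(SUP n. L2Linf_norm T (vs n)) < top" using le_less_trans[OF _ bdd] by simp
  hence A: "(SUP n. L2Linf_norm T (vs n)) = ennreal A" "0 \<le> A"
    unfolding A_def by (simp_all only: ennreal_enn2real enn2real_nonneg)
  have "\<exists>m. essentially_bounded T (vs n) m \<and> L2_norm (time T) m \<le> A" for n
  proof -
    have "L2Linf_norm T (vs n) \<le> ennreal A" unfolding A(1)[symmetric] by (rule SUP_upper) simp
    from L2Linf_majorant[OF com(1) this A(2)] obtain m where
      "L2 (time T) m" "L2_norm (time T) m \<le> A" "AE t in time T. AE x in torus. norm (vs n t x) \<le> m t"
      by (elim exE conjE)
    thus ?thesis unfolding essentially_bounded_def by (intro exI[of _ m] conjI co)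
  qed
  hence "\<forall>n. \<exists>m. essentially_bounded T (vs n) m \<and> L2_norm (time T) m \<le> A" by (intro allI)
  from choice[OF this] obtain m
    where m: "\<forall>n. essentially_bounded T (vs n) (m n) \<and> L2_norm (time T) (m n) \<le> A" by (elim exE)
  have b1: "\<exists>m A. \<forall>n. essentially_bounded T (vs n) (m n) \<and> L2_norm (time T) (m n) \<le> A"
    by (intro exI) (rule m)
  have b2: "\<exists>m. essentially_bounded T v m"
  proof -
    have "L2Linf_norm T v < top" using le_less_trans[OF _ bdd] by simp
    hence "L2Linf_norm T v \<le> ennreal (enn2real (L2Linf_norm T v))" by simp
    from L2Linf_majorant[OF com(2) this enn2real_nonneg] obtain m where
      "L2 (time T) m" "AE t in time T. AE x in torus. norm (v t x) \<le> m t"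
      by (elim exE conjE)
    thus ?thesis unfolding essentially_bounded_def by (intro exI[of _ m] conjI co)
  qed
  have split: "\<exists>(J :: ((int^'d) \<times> (complex^'d)) set) \<phi> \<alpha> \<rho>. finite J \<and>
        (\<forall>i\<in>J. \<phi> i \<in> borel_measurable torus \<and> (\<forall>x. norm (\<phi> i x) \<le> 1) \<and> weak_L2_tendsto (time T) (\<alpha> i) (\<lambda>_. 0 :: real)) \<and>
        (\<forall>n. L2 (time T) (\<rho> n) \<and> L2_norm (time T) (\<rho> n :: real \<Rightarrow> real) \<le> \<eta> \<and>
           (AE s in time T. AE x in torus. norm (vs n s x - v s x - (\<Sum>i\<in>J. \<alpha> i n s *\<^sub>R \<phi> i x)) \<le> \<rho> n s))"
    if \<eta>: "0 < \<eta>" for \<eta>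
  proof -
    have "0 < ennreal (\<eta> / 2)" using \<eta> by simp
    from eventually_happens'[OF sequentially_bot order_tendstoD(2)[OF lim this]] obtain M :: nat where
      M: "(SUP n. L2Linf_norm T (\<lambda>t. fourier_tail (real M) (vs n t))) + L2Linf_norm T (\<lambda>t. fourier_tail (real M) (v t)) < ennreal (\<eta> / 2)"
      by (elim exE)
    have t1: "L2Linf_norm T (\<lambda>t. fourier_tail (real M) (vs n t)) \<le> ennreal (\<eta> / 2)" for n
    proof -
      have "L2Linf_norm T (\<lambda>t. fourier_tail (real M) (vs n t)) \<le> (SUP n. L2Linf_norm T (\<lambda>t. fourier_tail (real M) (vs n t)))"
        by (rule SUP_upper) simp
      also have "\<dots> \<le> (SUP n. L2Linf_norm T (\<lambda>t. fourier_tail (real M) (vs n t))) + L2Linf_norm T (\<lambda>t. fourier_tail (real M) (v t))"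
        by (rule add_increasing2[OF zero_le order_refl])
      also have "\<dots> \<le> ennreal (\<eta> / 2)" using M by (rule less_imp_le)
      finally show ?thesis .
    qed
    have t2: "L2Linf_norm T (\<lambda>t. fourier_tail (real M) (v t)) \<le> ennreal (\<eta> / 2)"
    proof -
      have "L2Linf_norm T (\<lambda>t. fourier_tail (real M) (v t)) \<le> (SUP n. L2Linf_norm T (\<lambda>t. fourier_tail (real M) (vs n t))) + L2Linf_norm T (\<lambda>t. fourier_tail (real M) (v t))"
        by (rule add_increasing[OF zero_le order_refl])
      also have "\<dots> \<le> ennreal (\<eta> / 2)" using M by (rule less_imp_le)
      finally show ?thesis .
    qed
    have \<eta>2: "0 \<le> \<eta> / 2" using \<eta> by simp
    have "\<forall>n. \<exists>m. L2 (time T) m \<and> L2_norm (time T) m \<le> \<eta> / 2 \<and> (AE t in time T. AE x in torus. norm (fourier_tail (real M) (vs n t) x) \<le> m t)"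
      by (intro allI L2Linf_majorant[OF fourier_tail_measurable[OF co(1)] t1 \<eta>2])
    from choice[OF this] obtain m where mn: "\<forall>n. L2 (time T) (m n) \<and> L2_norm (time T) (m n) \<le> \<eta> / 2 \<and>
        (AE t in time T. AE x in torus. norm (fourier_tail (real M) (vs n t) x) \<le> m n t)" by (elim exE)
    have m: "L2 (time T) (m n)" "L2_norm (time T) (m n) \<le> \<eta> / 2"
        "AE t in time T. AE x in torus. norm (fourier_tail (real M) (vs n t) x) \<le> m n t" for n
      using mn[rule_format, of n] by simp_all
    obtain m' where m': "L2 (time T) m'" "L2_norm (time T) m' \<le> \<eta> / 2"
        "AE t in time T. AE x in torus. norm (fourier_tail (real M) (v t) x) \<le> m' t"
      using L2Linf_majorant[OF fourier_tail_measurable[OF co(2)] t2 \<eta>2] by (elim exE conjE)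
    define J where "J = {k :: int^'d. norm (freq k) \<le> real M} \<times> (Basis :: (complex^'d) set)"
    define \<alpha> where "\<alpha> i n s = (fourier (vs n s) (fst i) - fourier (v s) (fst i)) \<bullet> snd i" for i :: "(int^'d) \<times> (complex^'d)" and n s
    have pointwise: "norm (vs n s x - v s x - (\<Sum>i\<in>J. \<alpha> i n s *\<^sub>R mode i x))
        \<le> norm (fourier_tail (real M) (vs n s) x) + norm (fourier_tail (real M) (v s) x)" for n s x
    proof -
      have *: "(\<Sum>i\<in>J. \<alpha> i n s *\<^sub>R mode i x)
          = (\<Sum>i\<in>J. (fourier (vs n s) (fst i) \<bullet> snd i) *\<^sub>R mode i x) - (\<Sum>i\<in>J. (fourier (v s) (fst i) \<bullet> snd i) *\<^sub>R mode i x)"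
        by (simp add: \<alpha>_def inner_diff_left scaleR_diff_left sum_subtractf)
      have eq: "vs n s x - v s x - (\<Sum>i\<in>J. \<alpha> i n s *\<^sub>R mode i x)
          = re_vec (fourier_tail (real M) (vs n s) x) - re_vec (fourier_tail (real M) (v s) x)"
        using tail_decomposition[of "vs n s" x "real M"] tail_decomposition[of "v s" x "real M"]
        unfolding * J_def[symmetric] case_prod_beta' prod.collapse by (simp add: algebra_simps)
      show ?thesis
        unfolding eq using norm_triangle_ineq4[of "re_vec (fourier_tail (real M) (vs n s) x)" "re_vec (fourier_tail (real M) (v s) x)"]
          norm_re_vec_le[of "fourier_tail (real M) (vs n s) x"] norm_re_vec_le[of "fourier_tail (real M) (v s) x"] by linarith
    qed
    have rest: "AE s in time T. AE x in torus. norm (vs n s x - v s x - (\<Sum>i\<in>J. \<alpha> i n s *\<^sub>R mode i x)) \<le> m n s + m' s" for n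
      using m(3)[of n] m'(3)
    proof eventually_elim
      case (elim s)
      note t = elim
      show ?case
        using t(1) t(2)
      proof eventually_elim
        case (elim x)
        thus ?case using pointwise[of n s x] by linarith
      qed
    qed
    have J: "finite J" unfolding J_def by (intro finite_cartesian_product finite_low_frequencies finite_Basis)
    have weak\<alpha>: "weak_L2_tendsto (time T) (\<alpha> i) (\<lambda>_. 0)" for i
    proof -
      have "\<alpha> i = (\<lambda>n s. (fourier (vs n s) (fst i) - fourier (v s) (fst i)) \<bullet> snd i)"
        unfolding \<alpha>_def ..
      thus ?thesis by (simp only: weak_L2_component_null[OF weak])
    qed
    have norm1: "norm (mode i x) \<le> 1" if "i \<in> J" for i x
      using norm_mode_le[of "fst i" "snd i" x] that by (auto simp: J_def)
    have modes: "\<forall>i\<in>J. mode i \<in> borel_measurable torus \<and> (\<forall>x. norm (mode i x) \<le> 1) \<and> weak_L2_tendsto (time T) (\<alpha> i) (\<lambda>_. 0)"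
      using mode_measurable norm1 weak\<alpha> by blast
    have tails: "\<forall>n. L2 (time T) (\<lambda>s. m n s + m' s) \<and> L2_norm (time T) (\<lambda>s. m n s + m' s) \<le> \<eta> \<and>
        (AE s in time T. AE x in torus. norm (vs n s x - v s x - (\<Sum>i\<in>J. \<alpha> i n s *\<^sub>R mode i x)) \<le> m n s + m' s)"
    proof (rule allI)
      fix n
      have "L2_norm (time T) (\<lambda>s. m n s + m' s) \<le> \<eta>"
        using L2_norm_triangle[OF m(1)[of n] m'(1)] m(2)[of n] m'(2) by linarith
      with L2_add[OF m(1)[of n] m'(1)] rest[of n]
      show "L2 (time T) (\<lambda>s. m n s + m' s) \<and> L2_norm (time T) (\<lambda>s. m n s + m' s) \<le> \<eta> \<and>
        (AE s in time T. AE x in torus. norm (vs n s x - v s x - (\<Sum>i\<in>J. \<alpha> i n s *\<^sub>R mode i x)) \<le> m n s + m' s)"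
        by (intro conjI)
    qed
    show ?thesis
      by (rule exI[of _ J], rule exI[of _ mode], rule exI[of _ \<alpha>], rule exI[of _ "\<lambda>n s. m n s + m' s"])
         (rule conjI[OF J conjI[OF modes tails]])
  qed
  show ?thesis unfolding finite_mode_convergence_def by (intro conjI allI impI b1 b2 split)
qed

section \<open>Uniqueness of Fourier coefficients on the torus\<close>

text \<open>
  Fubini's theorem for products. It is obtained from the representation of Lebesgue measure as the
  image of a product measure indexed by the standard basis.
\<close>

lemma torus_integral_prod:
  fixes f :: "'d::finite \<Rightarrow> real \<Rightarrow> complex"
  assumes f: "\<And>i. integrable lborel (\<lambda>t. indicator {0..<2*pi} t *\<^sub>R f i t)"
  shows "(\<integral>x. (\<Prod>i\<in>UNIV. f i (x $ i)) \<partial>(torus :: (real^'d) measure)) = (\<Prod>i\<in>UNIV. \<integral>t. indicator {0..<2*pi} t *\<^sub>R f i t \<partial>lborel)"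
proof -
  interpret product_sigma_finite "\<lambda>_ :: real^'d. lborel :: real measure" ..
  define F where "F i t = indicator {0..<2*pi} t *\<^sub>R f i t" for i t
  have F: "F i \<in> borel_measurable borel" for i using borel_measurable_integrable[OF f[of i]] by (simp add: F_def[abs_def])
  have ind: "indicator {x :: real^'d. \<forall>i. 0 \<le> x $ i \<and> x $ i < 2 * pi} x *\<^sub>R (\<Prod>i\<in>UNIV. f i (x $ i)) = (\<Prod>i\<in>UNIV. F i (x $ i))" for x
  proof (cases "\<forall>i. 0 \<le> x $ i \<and> x $ i < 2 * pi")
    case True then show ?thesis by (simp add: F_def indicator_def)
  next
    case False
    then obtain i where "\<not> (0 \<le> x $ i \<and> x $ i < 2 * pi)" by blast
    hence "F i (x $ i) = 0" by (simp add: F_def indicator_def)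
    hence "(\<Prod>i\<in>UNIV. F i (x $ i)) = 0" by (intro prod_zero) auto
    moreover have "indicator {x :: real^'d. \<forall>i. 0 \<le> x $ i \<and> x $ i < 2 * pi} x = (0 :: real)"
      using False by (auto simp: indicator_def)
    ultimately show ?thesis by (simp only: scaleR_zero_left)
  qed
  have G: "(\<lambda>x :: real^'d. \<Prod>i\<in>UNIV. F i (x $ i)) \<in> borel_measurable borel"
    by (intro borel_measurable_prod measurable_compose[OF _ F]) simp
  have Basis: "(Basis :: (real^'d) set) = range (\<lambda>i. axis i 1)" by (auto simp: Basis_vec_def)
  have inj: "inj (\<lambda>i :: 'd. axis i (1::real))" by (auto intro: injI simp: axis_eq_axis)
  have comp: "(\<Sum>b\<in>Basis. h b *\<^sub>R b) $ i = h (axis i 1)" for h :: "real^'d \<Rightarrow> real" and i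
    unfolding Basis sum.reindex[OF inj] o_def by (simp add: axis_def if_distrib[where f = "\<lambda>y. _ * y"] cong: if_cong)
  have reindex: "(\<Prod>i\<in>UNIV. F i (h (axis i 1))) = (\<Prod>b\<in>Basis. F (axis_index b) (h b))" for h :: "real^'d \<Rightarrow> real"
    unfolding Basis prod.reindex[OF inj] o_def by simp
  have "(\<integral>x. (\<Prod>i\<in>UNIV. f i (x $ i)) \<partial>(torus :: (real^'d) measure)) = (\<integral>x. (\<Prod>i\<in>UNIV. F i (x $ i)) \<partial>(lborel :: (real^'d) measure))"
    unfolding torus_def using borel_torus_set by (subst integral_restrict_space) (auto simp: ind)
  also have "\<dots> = (\<integral>h. (\<Prod>i\<in>UNIV. F i ((\<Sum>b\<in>Basis. h b *\<^sub>R b) $ i)) \<partial>(\<Pi>\<^sub>M b\<in>(Basis :: (real^'d) set). lborel))"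
    unfolding lborel_eq[where 'a = "real^'d"] by (rule integral_distr) (auto intro: G)
  also have "\<dots> = (\<integral>h. (\<Prod>b\<in>Basis. F (axis_index b) (h b)) \<partial>(\<Pi>\<^sub>M b\<in>(Basis :: (real^'d) set). lborel))"
    by (simp only: comp reindex)
  also have "\<dots> = (\<Prod>b\<in>(Basis :: (real^'d) set). \<integral>t. F (axis_index b) t \<partial>lborel)"
    using f by (intro product_integral_prod) (auto simp: F_def)
  also have "\<dots> = (\<Prod>i\<in>UNIV. \<integral>t. F i t \<partial>lborel)"
    unfolding Basis prod.reindex[OF inj] o_def by simp
  finally show ?thesis by (simp add: F_def)
qed

lemma integral_cis_period:
  "integrable lborel (\<lambda>t. indicator {0..<2*pi} t *\<^sub>R cis (of_int m * t))"
  "(\<integral>t. indicator {0..<2*pi} t *\<^sub>R cis (of_int m * t) \<partial>lborel) = complex_of_real (if m = 0 then 2 * pi else 0)"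
proof -
  have cont: "continuous_on A (\<lambda>t. cis (of_int m * t))" for A by (intro continuous_intros)
  have "set_integrable lborel {0..2*pi} (\<lambda>t. cis (of_int m * t))" by (rule borel_integrable_atLeastAtMost'[OF cont])
  hence "set_integrable lborel {0..<2*pi} (\<lambda>t. cis (of_int m * t))" by (rule set_integrable_subset) auto
  thus "integrable lborel (\<lambda>t. indicator {0..<2*pi} t *\<^sub>R cis (of_int m * t))" by (simp add: set_integrable_def)
  have "(\<integral>t. indicator {0..<2*pi} t *\<^sub>R cis (of_int m * t) \<partial>lborel) = (\<integral>t. indicator {0..2*pi} t *\<^sub>R cis (of_int m * t) \<partial>lborel)"
  proof (rule integral_cong_AE)
    show "AE t in lborel. indicator {0..<2*pi} t *\<^sub>R cis (of_int m * t) = indicator {0..2*pi} t *\<^sub>R cis (of_int m * t)"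
      using AE_lborel_singleton[of "2*pi"] by eventually_elim (auto simp: indicator_def)
    have "(\<lambda>t. cis (of_int m * t)) \<in> borel_measurable lborel"
      using borel_measurable_continuous_onI[OF cont] by simp
    thus "(\<lambda>t. indicator {0..<2*pi} t *\<^sub>R cis (of_int m * t)) \<in> borel_measurable lborel"
      "(\<lambda>t. indicator {0..2*pi} t *\<^sub>R cis (of_int m * t)) \<in> borel_measurable lborel"
      by (auto intro!: borel_measurable_scaleR)
  qed
  also have "\<dots> = complex_of_real (if m = 0 then 2 * pi else 0)"
  proof (cases "m = 0")
    case True
    have "(\<integral>t. indicator {0..2*pi} t *\<^sub>R (1::complex) \<partial>lborel) = complex_of_real (2*pi) - complex_of_real 0"
      by (rule integral_FTC_atLeastAtMost) (auto intro!: derivative_eq_intros continuous_intros simp: has_vector_derivative_def scaleR_conv_of_real)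
    thus ?thesis using True by simp
  next
    case False
    have "(\<integral>t. indicator {0..2*pi} t *\<^sub>R cis (of_int m * t) \<partial>lborel) = cis (of_int m * (2*pi)) / (\<i> * of_int m) - cis (of_int m * 0) / (\<i> * of_int m)"
    proof (rule integral_FTC_atLeastAtMost)
      fix t :: real
      have "((\<lambda>z. exp (\<i> * of_int m * z) / (\<i> * of_int m)) has_field_derivative exp (\<i> * of_int m * of_real t)) (at (of_real t))"
        using False by (auto intro!: derivative_eq_intros)
      from has_vector_derivative_real_field[OF this]
      show "((\<lambda>t. cis (of_int m * t) / (\<i> * of_int m)) has_vector_derivative cis (of_int m * t)) (at t within {0..2*pi})"
        by (simp add: cis_conv_exp mult.assoc has_vector_derivative_at_within)
    qed (auto intro: cont)
    also have "cis (of_int m * (2*pi)) = 1" using cis_multiple_2pi[of "of_int m"] by (simp add: mult.commute)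
    finally show ?thesis using False by simp
  qed
  finally show "(\<integral>t. indicator {0..<2*pi} t *\<^sub>R cis (of_int m * t) \<partial>lborel) = complex_of_real (if m = 0 then 2 * pi else 0)" .
qed

lemma cis_freq_prod: "cis (freq k \<bullet> x) = (\<Prod>i\<in>UNIV. cis (of_int (k $ i) * x $ i))"
proof -
  have "cis (\<Sum>i\<in>A. a i) = (\<Prod>i\<in>A. cis (a i))" if "finite A" for A and a :: "'a \<Rightarrow> real"
    using that by (induction A rule: finite_induct) (simp_all add: cis_mult[symmetric])
  thus ?thesis by (simp add: inner_vec_def freq_def)
qed

lemma torus_orthogonality:
  "(\<integral>x. cis (freq k \<bullet> x) \<partial>(torus :: (real^'d::finite) measure)) = (if k = 0 then of_real ((2 * pi) ^ CARD('d)) else 0)"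
proof -
  have "(\<integral>x. cis (freq k \<bullet> x) \<partial>(torus :: (real^'d) measure)) = (\<Prod>i\<in>UNIV. complex_of_real (if k $ i = 0 then 2 * pi else 0))"
    unfolding cis_freq_prod by (subst torus_integral_prod) (simp_all add: integral_cis_period if_distrib cong: if_cong)
  also have "\<dots> = (if k = 0 then of_real ((2 * pi) ^ CARD('d)) else 0)"
  proof (cases "k = 0")
    case False
    then obtain i where "k $ i \<noteq> 0" by (auto simp: vec_eq_iff)
    thus ?thesis using False by (auto intro!: prod_zero)
  qed simp
  finally show ?thesis .
qed

lemma freq_add: "freq (k + l) = freq k + freq l" and freq_diff: "freq (k - l) = freq k - freq l"
  and freq_minus: "freq (- k) = - freq k" and freq_zero [simp]: "freq 0 = 0"
  by (simp_all add: freq_def vec_eq_iff)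

lemma freq_axis: "freq (axis i m) \<bullet> x = of_int m * x $ i"
proof -
  have "freq (axis i m) = axis i (of_int m)" by (simp add: freq_def axis_def vec_eq_iff)
  thus ?thesis by (simp add: inner_axis' )
qed

lemma cis_freq_measurable_torus: "(\<lambda>x. cis (freq k \<bullet> x)) \<in> borel_measurable torus"
  using measurable_torusI[OF cis_freq_measurable[of 1 k]] by simp

text \<open>
  The functions with vanishing Fourier coefficients. They are closed under multiplication by
  characters, so by trigonometric polynomials, and eventually by bounded Borel functions.
\<close>

definition annihilates_characters :: "(real^'d::finite \<Rightarrow> complex) \<Rightarrow> bool" where
  "annihilates_characters f \<longleftrightarrow> integrable torus f \<and> (\<forall>k. (\<integral>x. cis (freq k \<bullet> x) * f x \<partial>torus) = 0)"

lemma bounded_mult_integrable: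
  fixes f g :: "'a \<Rightarrow> complex"
  assumes "integrable M f" "g \<in> borel_measurable M" "\<And>x. norm (g x) \<le> B"
  shows "integrable M (\<lambda>x. g x * f x)"
proof (rule Bochner_Integration.integrable_bound)
  show "integrable M (\<lambda>x. B * norm (f x))" using assms(1) by simp
  show "(\<lambda>x. g x * f x) \<in> borel_measurable M" using assms by measurable
  have "norm (g x * f x) \<le> B * norm (f x)" for x by (simp add: norm_mult mult_right_mono assms(3))
  thus "AE x in M. norm (g x * f x) \<le> norm (B * norm (f x))"
    by (intro AE_I2) (simp only: real_norm_def, rule order_trans[OF _ abs_ge_self])
qed

lemma annihilates_add:
  assumes "annihilates_characters f" "annihilates_characters g"
  shows "annihilates_characters (\<lambda>x. f x + g x)"
proof -
  have "integrable torus (\<lambda>x. cis (freq k \<bullet> x) * f x)" "integrable torus (\<lambda>x. cis (freq k \<bullet> x) * g x)" for k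
    using assms by (auto intro!: bounded_mult_integrable[where B = 1] cis_freq_measurable_torus simp: annihilates_characters_def)
  thus ?thesis using assms by (auto simp: annihilates_characters_def distrib_left)
qed

lemma annihilates_cmult:
  assumes "annihilates_characters f" shows "annihilates_characters (\<lambda>x. c * f x)"
  using assms by (auto simp: annihilates_characters_def mult.left_commute)

lemma annihilates_character_mult:
  assumes "annihilates_characters f" shows "annihilates_characters (\<lambda>x. cis (freq l \<bullet> x) * f x)"
  unfolding annihilates_characters_def
proof (intro conjI allI)
  show "integrable torus (\<lambda>x. cis (freq l \<bullet> x) * f x)"
    using assms by (auto intro!: bounded_mult_integrable[where B = 1] cis_freq_measurable_torus simp: annihilates_characters_def)
  fix k
  have "(\<integral>x. cis (freq k \<bullet> x) * (cis (freq l \<bullet> x) * f x) \<partial>torus) = (\<integral>x. cis (freq (k + l) \<bullet> x) * f x \<partial>torus)"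
    by (simp add: freq_add inner_add_left cis_mult[symmetric] mult.assoc)
  thus "(\<integral>x. cis (freq k \<bullet> x) * (cis (freq l \<bullet> x) * f x) \<partial>torus) = 0"
    using assms by (simp add: annihilates_characters_def)
qed

lemma annihilates_sum:
  assumes "finite A" "\<And>i. i \<in> A \<Longrightarrow> annihilates_characters (f i)"
  shows "annihilates_characters (\<lambda>x. \<Sum>i\<in>A. f i x)"
  using assms
proof (induction A rule: finite_induct)
  case empty
  then show ?case by (simp add: annihilates_characters_def)
next
  case (insert i A)
  then show ?case using annihilates_add[of "f i" "\<lambda>x. \<Sum>i\<in>A. f i x"] by simp
qed

definition torus_embedding :: "real^'d::finite \<Rightarrow> complex^'d" where
  "torus_embedding x = (\<chi> i. cis (x $ i))"

lemma continuous_torus_embedding: "continuous_on A torus_embedding"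
  unfolding torus_embedding_def by (intro continuous_on_vec_lambda continuous_intros)

text \<open>
  Real polynomials on the product of circles are trigonometric polynomials. In the induction only
  linear functionals need work: cosine and sine are combinations of the characters of frequency
  \<open>\<plusminus> 1\<close> in one coordinate.
\<close>

lemma annihilates_polynomial_mult:
  assumes "real_polynomial_function p"
  shows "annihilates_characters f \<Longrightarrow> annihilates_characters (\<lambda>x. of_real (p (torus_embedding x)) * f x)"
  using assms
proof (induction p arbitrary: f rule: real_polynomial_function.induct)
  case (linear h)
  interpret h: bounded_linear h by fact
  define a where "a i = (of_real (h (axis i 1)) - \<i> * of_real (h (axis i \<i>))) / 2" for i
  define b where "b i = (of_real (h (axis i 1)) + \<i> * of_real (h (axis i \<i>))) / 2" for i
  have "of_real (h (torus_embedding x)) = (\<Sum>i\<in>UNIV. a i * cis (freq (axis i 1) \<bullet> x) + b i * cis (freq (axis i (-1)) \<bullet> x))" for x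
  proof -
    have "torus_embedding x = (\<Sum>i\<in>UNIV. cos (x $ i) *\<^sub>R axis i 1 + sin (x $ i) *\<^sub>R axis i \<i>)"
      by (simp add: torus_embedding_def vec_eq_iff axis_def if_distrib[where f = "\<lambda>y. _ *\<^sub>R y"] sum.distrib complex_eq_iff cong: if_cong)
    hence "h (torus_embedding x) = (\<Sum>i\<in>UNIV. cos (x $ i) * h (axis i 1) + sin (x $ i) * h (axis i \<i>))"
      by (simp add: h.sum h.add h.scaleR)
    moreover have "complex_of_real (cos t * p + sin t * q) = (of_real p - \<i> * of_real q) / 2 * cis t + (of_real p + \<i> * of_real q) / 2 * cis (- t)" for p q t
      by (simp add: complex_eq_iff field_simps)
    ultimately show ?thesis by (simp add: a_def b_def freq_axis)
  qed
  hence "(\<lambda>x. of_real (h (torus_embedding x)) * f x)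
    = (\<lambda>x. \<Sum>i\<in>UNIV. a i * (cis (freq (axis i 1) \<bullet> x) * f x) + b i * (cis (freq (axis i (-1)) \<bullet> x) * f x))"
    by (simp add: sum_distrib_right distrib_right mult.assoc)
  moreover have "annihilates_characters (\<lambda>x. \<Sum>i\<in>UNIV. a i * (cis (freq (axis i 1) \<bullet> x) * f x) + b i * (cis (freq (axis i (-1)) \<bullet> x) * f x))"
    by (intro annihilates_sum annihilates_add annihilates_cmult annihilates_character_mult linear) simp
  ultimately show ?case by simp
next
  case (const c)
  then show ?case by (intro annihilates_cmult)
next
  case (add p q)
  then show ?case using annihilates_add[OF add.IH(1) add.IH(2)] by (simp add: distrib_right)
next
  case (mult p q)
  then show ?case using mult.IH(1)[OF mult.IH(2)] by (simp add: mult.assoc)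
qed

text \<open>
  The Stone--Weierstrass theorem on a ball that contains the image of the torus.
\<close>

lemma annihilates_continuous:
  fixes g :: "complex^'d::finite \<Rightarrow> real"
  assumes f: "annihilates_characters f" and g: "continuous_on UNIV g"
  shows "(\<integral>x. of_real (g (torus_embedding x)) * f x \<partial>torus) = 0"
proof -
  have int: "integrable torus f" using f by (simp add: annihilates_characters_def)
  define K where "K = {z :: complex^'d. norm z \<le> real CARD('d)}"
  have K: "compact K" using compact_cball[of "0 :: complex^'d" "real CARD('d)"] by (simp add: K_def cball_def dist_norm)
  have eK: "torus_embedding x \<in> K" for x :: "real^'d"
  proof -
    have "norm (torus_embedding x) \<le> (\<Sum>i\<in>UNIV. norm (torus_embedding x $ i))" unfolding norm_vec_def by (rule L2_set_le_sum) simp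
    thus ?thesis by (simp add: K_def torus_embedding_def)
  qed
  have em: "(\<lambda>x. complex_of_real (p (torus_embedding x))) \<in> borel_measurable torus" if "continuous_on UNIV p" for p :: "complex^'d \<Rightarrow> real"
    by (intro measurable_torusI borel_measurable_continuous_onI continuous_intros continuous_on_compose2[OF that continuous_torus_embedding]) auto
  have "norm (\<integral>x. of_real (g (torus_embedding x)) * f x \<partial>torus) \<le> 0 + e" if e: "0 < e" for e
  proof -
    define e' where "e' = e / ((\<integral>x. norm (f x) \<partial>torus) + 1)"
    have I: "0 \<le> (\<integral>x. norm (f x) \<partial>torus)" by simp
    have e': "0 < e'" "e' * (\<integral>x. norm (f x) \<partial>torus) \<le> e"
    proof -
      show p: "0 < e'" using e I by (simp add: e'_def add_nonneg_pos)
      have "e' * (\<integral>x. norm (f x) \<partial>torus) \<le> e' * ((\<integral>x. norm (f x) \<partial>torus) + 1)" using p by simp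
      also have "\<dots> = e" using I by (simp add: e'_def add_nonneg_eq_0_iff)
      finally show "e' * (\<integral>x. norm (f x) \<partial>torus) \<le> e" .
    qed
    obtain p where p: "real_polynomial_function p" "\<And>z. z \<in> K \<Longrightarrow> \<bar>g z - p z\<bar> < e'"
      using Stone_Weierstrass_real_polynomial_function[OF K continuous_on_subset[OF g] e'(1)] by auto
    have pc: "continuous_on UNIV p"
      using p(1) by (simp add: real_polynomial_function_eq continuous_on_polymonial_function)
    have P: "annihilates_characters (\<lambda>x. of_real (p (torus_embedding x)) * f x)" by (rule annihilates_polynomial_mult[OF p(1) f])
    have P0: "(\<integral>x. of_real (p (torus_embedding x)) * f x \<partial>torus) = 0" "integrable torus (\<lambda>x. of_real (p (torus_embedding x)) * f x)"
    proof -
      have "(\<integral>x. cis (freq 0 \<bullet> x) * (of_real (p (torus_embedding x)) * f x) \<partial>torus) = 0"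
        using P unfolding annihilates_characters_def by blast
      thus "(\<integral>x. of_real (p (torus_embedding x)) * f x \<partial>torus) = 0" by simp
      show "integrable torus (\<lambda>x. of_real (p (torus_embedding x)) * f x)" using P by (simp add: annihilates_characters_def)
    qed
    have ptw: "norm (of_real (g (torus_embedding x)) * f x - of_real (p (torus_embedding x)) * f x) \<le> e' * norm (f x)" for x
    proof -
      have "norm (of_real (g (torus_embedding x)) * f x - of_real (p (torus_embedding x)) * f x)
          = \<bar>g (torus_embedding x) - p (torus_embedding x)\<bar> * norm (f x)"
        by (simp only: left_diff_distrib[symmetric] of_real_diff[symmetric] norm_mult norm_of_real)
      also have "\<dots> \<le> e' * norm (f x)" using p(2)[OF eK, of x] by (intro mult_right_mono) auto
      finally show ?thesis .
    qed
    have dint: "integrable torus (\<lambda>x. of_real (g (torus_embedding x)) * f x - of_real (p (torus_embedding x)) * f x)"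
    proof (rule Bochner_Integration.integrable_bound)
      show "integrable torus (\<lambda>x. e' * norm (f x))" using int by simp
      show "AE x in torus. norm (of_real (g (torus_embedding x)) * f x - of_real (p (torus_embedding x)) * f x) \<le> norm (e' * norm (f x))"
        using ptw e'(1) by (intro AE_I2) (auto intro: order_trans)
      show "(\<lambda>x. of_real (g (torus_embedding x)) * f x - of_real (p (torus_embedding x)) * f x) \<in> borel_measurable torus"
        by (intro borel_measurable_diff borel_measurable_times em g pc borel_measurable_integrable[OF int])
    qed
    have "(\<integral>x. of_real (g (torus_embedding x)) * f x \<partial>torus) = (\<integral>x. (of_real (g (torus_embedding x)) * f x - of_real (p (torus_embedding x)) * f x) + of_real (p (torus_embedding x)) * f x \<partial>torus)"
      by simp
    also have "\<dots> = (\<integral>x. of_real (g (torus_embedding x)) * f x - of_real (p (torus_embedding x)) * f x \<partial>torus)"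
      by (subst Bochner_Integration.integral_add[OF dint P0(2)]) (simp add: P0(1))
    also have "norm \<dots> \<le> (\<integral>x. e' * norm (f x) \<partial>torus)"
      by (rule integral_norm_bound[THEN order_trans], rule integral_mono) (use dint int ptw in auto)
    also have "\<dots> \<le> e" using e'(2) by simp
    finally show ?thesis by simp
  qed
  hence "norm (\<integral>x. of_real (g (torus_embedding x)) * f x \<partial>torus) \<le> 0" by (rule field_le_epsilon)
  thus ?thesis by simp
qed

text \<open>
  Closed sets come first, as limits of continuous functions of the distance. The sets with the
  property form a Dynkin system, and closed sets are stable under intersection.
\<close>

lemma annihilates_borel:
  fixes B :: "(complex^'d::finite) set"
  assumes f: "annihilates_characters f" and B: "B \<in> sets borel"
  shows "(\<integral>x. indicator B (torus_embedding x) * f x \<partial>torus) = 0"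
proof -
  have int: "integrable torus f" using f by (simp add: annihilates_characters_def)
  have e_meas: "torus_embedding \<in> borel_measurable torus"
    by (intro measurable_torusI borel_measurable_continuous_onI continuous_torus_embedding)
  have ind_meas: "(\<lambda>x. indicator A (torus_embedding x) :: complex) \<in> borel_measurable torus" if "A \<in> sets borel" for A
    by (rule measurable_compose[OF e_meas]) (use that in simp)
  have ind_int: "integrable torus (\<lambda>x. indicator A (torus_embedding x) * f x)" if "A \<in> sets borel" for A
    by (rule bounded_mult_integrable[OF int ind_meas[OF that], where B = 1]) (simp add: indicator_def)
  have closed: "(\<integral>x. indicator A (torus_embedding x) * f x \<partial>torus) = 0" if A: "closed A" for A
  proof (cases "A = {}")
    case False
    define g where "g n z = max 0 (1 - real n * infdist z A)" for n z
    have gc: "continuous_on UNIV (g n)" for n unfolding g_def by (intro continuous_intros)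
    have "(\<lambda>n. g n z) \<longlonglongrightarrow> indicator A z" for z
    proof (cases "z \<in> A")
      case True thus ?thesis by (simp add: g_def)
    next
      case out: False
      hence d: "0 < infdist z A" using in_closed_iff_infdist_zero[OF A False, of z] infdist_nonneg[of z A] by auto
      obtain N where N: "1 / infdist z A < real N" using reals_Archimedean2 by blast
      have "g n z = 0" if "N \<le> n" for n
      proof -
        have "1 / infdist z A < real n" using N that by linarith
        hence "1 < real n * infdist z A" using d by (simp add: pos_divide_less_eq)
        thus ?thesis by (simp add: g_def)
      qed
      hence "\<forall>\<^sub>F n in sequentially. g n z = indicator A z" using out by (auto simp: eventually_sequentially)
      thus ?thesis by (rule tendsto_eventually)
    qed
    hence lim: "(\<lambda>n. complex_of_real (g n (torus_embedding x)) * f x) \<longlonglongrightarrow> indicator A (torus_embedding x) * f x" for x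
      by (intro tendsto_mult tendsto_const) (metis of_real_indicator tendsto_of_real)
    have "(\<lambda>n. \<integral>x. of_real (g n (torus_embedding x)) * f x \<partial>torus) \<longlonglongrightarrow> (\<integral>x. indicator A (torus_embedding x) * f x \<partial>torus)"
    proof (rule integral_dominated_convergence[where w = "\<lambda>x. norm (f x)"])
      show "AE x in torus. norm (of_real (g n (torus_embedding x)) * f x) \<le> norm (f x)" for n
        by (intro AE_I2) (auto simp: norm_mult g_def infdist_nonneg intro!: mult_left_le_one_le)
      show "(\<lambda>x. of_real (g n (torus_embedding x)) * f x) \<in> borel_measurable torus" for n
        by (intro borel_measurable_times borel_measurable_integrable[OF int] measurable_torusI borel_measurable_continuous_onI
            continuous_intros continuous_on_compose2[OF gc continuous_torus_embedding]) auto
      show "(\<lambda>x. indicator A (torus_embedding x) * f x) \<in> borel_measurable torus"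
        by (intro borel_measurable_integrable ind_int borel_closed A)
    qed (use int lim in auto)
    thus ?thesis unfolding annihilates_continuous[OF f gc] by (simp add: LIMSEQ_const_iff)
  qed simp
  have stable: "Int_stable (Collect closed :: (complex^'d) set set)" by (auto simp: Int_stable_def)
  have sub: "Collect closed \<subseteq> Pow (UNIV :: (complex^'d) set)" by simp
  have "B \<in> sigma_sets UNIV (Collect closed)" using B by (simp add: borel_eq_closed)
  with stable sub show ?thesis
  proof (induction rule: sigma_sets_induct_disjoint)
    case (basic A) thus ?case using closed by simp
  next
    case (compl A)
    hence A: "A \<in> sets borel" by (simp add: borel_eq_closed)
    have "(\<integral>x. indicator (UNIV - A) (torus_embedding x) * f x \<partial>torus)
        = (\<integral>x. indicator UNIV (torus_embedding x) * f x - indicator A (torus_embedding x) * f x \<partial>torus)"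
      by (intro Bochner_Integration.integral_cong) (auto simp: indicator_def)
    also have "\<dots> = 0" using closed[of UNIV] compl ind_int[OF A] ind_int[of UNIV] by simp
    finally show ?case .
  next
    case (union A)
    have A: "A i \<in> sets borel" for i using union(2) by (auto simp: borel_eq_closed)
    have "(\<integral>x. (\<Sum>i<n. indicator (A i) (torus_embedding x) * f x) \<partial>torus) = 0" for n
      by (simp only: Bochner_Integration.integral_sum[OF ind_int[OF A]] union(3) sum.neutral_const)
    moreover have "(\<lambda>n. \<integral>x. (\<Sum>i<n. indicator (A i) (torus_embedding x) * f x) \<partial>torus) \<longlonglongrightarrow> (\<integral>x. indicator (\<Union>i. A i) (torus_embedding x) * f x \<partial>torus)"
    proof (rule integral_dominated_convergence[where w = "\<lambda>x. norm (f x)"])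
      have sum_ind: "(\<Sum>i<n. indicator (A i) z :: complex) = indicator (\<Union>i<n. A i) z" for n z
        by (rule indicator_UN_disjoint[symmetric]) (use union(1) in \<open>auto simp: disjoint_family_on_def\<close>)
      show "AE x in torus. norm (\<Sum>i<n. indicator (A i) (torus_embedding x) * f x) \<le> norm (f x)" for n
        unfolding sum_distrib_right[symmetric] sum_ind by (intro AE_I2) (simp add: norm_mult indicator_def)
      show "AE x in torus. (\<lambda>n. \<Sum>i<n. indicator (A i) (torus_embedding x) * f x) \<longlonglongrightarrow> indicator (\<Union>i. A i) (torus_embedding x) * f x"
        unfolding sum_distrib_right[symmetric] sum_ind
      proof (intro AE_I2 tendsto_mult tendsto_const tendsto_eventually)
        fix x
        show "\<forall>\<^sub>F n in sequentially. (indicator (\<Union>i<n. A i) (torus_embedding x) :: complex) = indicator (\<Union>i. A i) (torus_embedding x)"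
        proof (cases "torus_embedding x \<in> (\<Union>i. A i)")
          case True
          then obtain i where "torus_embedding x \<in> A i" by blast
          hence "\<forall>n\<ge>Suc i. torus_embedding x \<in> (\<Union>i<n. A i)" by auto
          thus ?thesis using True by (auto simp: eventually_sequentially intro!: exI[of _ "Suc i"])
        qed (simp add: indicator_def)
      qed
      show "(\<lambda>x. \<Sum>i<n. indicator (A i) (torus_embedding x) * f x) \<in> borel_measurable torus" for n
        by (intro borel_measurable_sum borel_measurable_integrable ind_int A)
      show "(\<lambda>x. indicator (\<Union>i. A i) (torus_embedding x) * f x) \<in> borel_measurable torus"
        by (intro borel_measurable_integrable ind_int) (use A in auto)
    qed (use int in auto)
    ultimately show ?case by (simp add: LIMSEQ_const_iff)
  qed (simp_all add: borel_eq_closed)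
qed

text \<open>
  The argument is continuous off the nonnegative reals and vanishes on them.
\<close>

lemma measurable_Arg2pi: "Arg2pi \<in> borel_measurable borel"
proof -
  have "(\<lambda>z. if z \<in> \<real>\<^sub>\<ge>\<^sub>0 then 0 else Arg2pi z) \<in> borel_measurable borel"
  proof (rule borel_measurable_continuous_on_if)
    show "\<real>\<^sub>\<ge>\<^sub>0 \<in> sets (borel :: complex measure)" by (intro borel_closed closed_nonneg_Reals_complex)
    show "continuous_on (- \<real>\<^sub>\<ge>\<^sub>0) Arg2pi" by (intro continuous_at_imp_continuous_on ballI continuous_at_Arg2pi) simp
  qed simp
  moreover have "(\<lambda>z. if z \<in> \<real>\<^sub>\<ge>\<^sub>0 then 0 else Arg2pi z) = Arg2pi"
    using Arg2pi_eq_0 by (auto simp: fun_eq_iff complex_nonneg_Reals_iff complex_is_Real_iff)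
  ultimately show ?thesis by simp
qed

lemma Arg2pi_cis: "0 \<le> t \<Longrightarrow> t < 2 * pi \<Longrightarrow> Arg2pi (cis t) = t"
  by (rule Arg2pi_unique[of 1]) (simp_all add: cis_conv_exp)

lemma borel_measurable_vec_nth: "(\<lambda>x :: 'a::topological_space^'n. x $ i) \<in> borel_measurable borel"
  by (intro borel_measurable_continuous_onI continuous_intros)

text \<open>
  The embedding of the fundamental cube has a Borel measurable inverse, built from the argument
  function. Every Borel set of the cube is therefore the preimage of a Borel set, so the integral of
  the function over each Borel set vanishes.
\<close>

theorem fourier_uniqueness:
  fixes f :: "real^'d::finite \<Rightarrow> complex"
  assumes f: "annihilates_characters f"
  shows "AE x in torus. f x = 0"
proof -
  have int: "integrable torus f" using f by (simp add: annihilates_characters_def)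
  define \<psi> where "\<psi> z = (\<chi> i. Arg2pi (z $ i))" for z :: "complex^'d"
  have \<psi>m: "\<psi> \<in> borel_measurable borel"
    by (subst borel_measurable_euclidean_space)
       (auto simp: Basis_vec_def inner_axis \<psi>_def
             intro!: measurable_compose[OF _ measurable_Arg2pi] borel_measurable_vec_nth)
  have \<psi>: "\<psi> (torus_embedding x) = x" if "x \<in> space torus" for x
    using that by (simp add: \<psi>_def torus_embedding_def space_torus vec_eq_iff Arg2pi_cis)
  have zero: "(\<integral>x. indicator A x * f x \<partial>torus) = 0" if A: "A \<in> sets (torus :: (real^'d) measure)" for A
  proof -
    have "A \<in> sets borel" using A borel_torus_set[where 'd = 'd] by (auto simp: torus_def sets_restrict_space)
    hence "\<psi> -` A \<in> sets borel" using measurable_sets[OF \<psi>m, of A] by simp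
    from annihilates_borel[OF f this]
    have "(\<integral>x. indicator (\<psi> -` A) (torus_embedding x) * f x \<partial>torus) = 0" .
    also have "(\<integral>x. indicator (\<psi> -` A) (torus_embedding x) * f x \<partial>torus) = (\<integral>x. indicator A x * f x \<partial>torus)"
      by (intro Bochner_Integration.integral_cong) (auto simp: indicator_def \<psi>)
    finally show ?thesis .
  qed
  \<comment> \<open>Integrating over the set where \<open>r (f x)\<close> is positive shows that this set is null. The functionals \<open>r\<close> are
    the real and imaginary part and their negatives.\<close>
  have half: "AE x in torus. r (f x) \<le> 0" if r: "bounded_linear r" and rm: "\<And>A x. r (indicator A x * f x) = indicator A x * r (f x)"
    for r :: "complex \<Rightarrow> real"
  proof -
    have rint: "integrable torus (\<lambda>x. r (f x))" by (rule integrable_bounded_linear[OF r int])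
    define A where "A = {x \<in> space torus. 0 < r (f x)}"
    have A: "A \<in> sets torus" unfolding A_def using borel_measurable_integrable[OF rint] by measurable
    have fA: "integrable torus (\<lambda>x. indicator A x * f x)"
      by (rule bounded_mult_integrable[OF int, where B = 1]) (use A in \<open>auto simp: indicator_def\<close>)
    have "(\<integral>x. indicator A x * r (f x) \<partial>torus) = r (\<integral>x. indicator A x * f x \<partial>torus)"
      using integral_bounded_linear[OF r fA] by (simp add: rm)
    also have "\<dots> = 0" using zero[OF A] bounded_linear.axioms(1)[OF r] by (simp add: linear_0)
    finally have "(\<integral>x. indicator A x * r (f x) \<partial>torus) = 0" .
    moreover have "integrable torus (\<lambda>x. indicator A x * r (f x))"
      using integrable_bounded_linear[OF r fA] by (simp add: rm)
    moreover have "AE x in torus. 0 \<le> indicator A x * r (f x)" by (intro AE_I2) (auto simp: A_def indicator_def)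
    ultimately have "AE x in torus. indicator A x * r (f x) = 0" by (subst (asm) integral_nonneg_eq_0_iff_AE) auto
    thus ?thesis using AE_space by eventually_elim (auto simp: A_def indicator_def split: if_splits)
  qed
  have "AE x in torus. Re (f x) \<le> 0" by (rule half) (auto intro: bounded_linear_Re simp: indicator_def)
  moreover have "AE x in torus. - Re (f x) \<le> 0" by (rule half) (auto intro: bounded_linear_minus bounded_linear_Re simp: indicator_def)
  moreover have "AE x in torus. Im (f x) \<le> 0" by (rule half) (auto intro: bounded_linear_Im simp: indicator_def)
  moreover have "AE x in torus. - Im (f x) \<le> 0" by (rule half) (auto intro: bounded_linear_minus bounded_linear_Im simp: indicator_def)
  ultimately show ?thesis by eventually_elim (simp add: complex_eq_iff)
qed

section \<open>Fourier synthesis and inversion\<close>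

interpretation freqs: sigma_finite_measure "count_space (UNIV :: (int^'d::finite) set)"
  by (rule sigma_finite_measure_count_space)

lemma measurable_pair_count_space:
  fixes f :: "'a \<times> 'k::countable \<Rightarrow> 'c::topological_space"
  assumes "\<And>k. (\<lambda>x. f (x, k)) \<in> borel_measurable N"
  shows "f \<in> borel_measurable (N \<Otimes>\<^sub>M count_space UNIV)"
  by (subst measurable_pair_swap_iff, rule measurable_pair_measure_countable1) (auto intro: assms)

text \<open>
  Both sides are suprema of finite partial sums. For the integral this is monotone convergence along
  the exhaustion given by an enumeration.
\<close>

lemma nn_integral_count_space_eq_infsum:
  fixes f :: "'k::countable \<Rightarrow> ennreal"
  shows "(\<integral>\<^sup>+ k. f k \<partial>count_space UNIV) = (\<Sum>\<^sub>\<infinity>k. f k)"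
proof -
  have fin: "(\<integral>\<^sup>+ k. f k * indicator F k \<partial>count_space UNIV) = sum f F" if "finite F" for F
    using that by (subst nn_integral_indicator_finite) auto
  have inf: "(\<Sum>\<^sub>\<infinity>k. f k) = (SUP F\<in>{F. finite F \<and> F \<subseteq> UNIV}. sum f F)"
    by (rule nonneg_infsum_complete) simp
  define E where "E n = {k :: 'k. to_nat k < n}" for n :: nat
  have E: "finite (E n)" for n
    by (rule finite_imageD[of to_nat]) (auto simp: E_def intro!: finite_subset[of _ "{..<n}"] inj_on_subset[OF inj_to_nat])
  have "(SUP n. f k * indicator (E n) k) = f k" for k
  proof (rule antisym)
    show "(SUP n. f k * indicator (E n) k) \<le> f k" by (rule SUP_least) (simp add: indicator_def)
    have "f k * indicator (E (Suc (to_nat k))) k \<le> (SUP n. f k * indicator (E n) k)" by (rule SUP_upper) simp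
    thus "f k \<le> (SUP n. f k * indicator (E n) k)" by (simp add: E_def)
  qed
  hence "(\<integral>\<^sup>+ k. f k \<partial>count_space UNIV) = (\<integral>\<^sup>+ k. (SUP n. f k * indicator (E n) k) \<partial>count_space UNIV)" by simp
  also have "\<dots> = (SUP n. \<integral>\<^sup>+ k. f k * indicator (E n) k \<partial>count_space UNIV)"
    by (rule nn_integral_monotone_convergence_SUP)
       (auto simp: incseq_def le_fun_def E_def intro!: mult_left_mono split: split_indicator)
  also have "\<dots> = (SUP n. sum f (E n))" by (simp only: fin[OF E])
  finally have eq: "(\<integral>\<^sup>+ k. f k \<partial>count_space UNIV) = (SUP n. sum f (E n))" .
  show ?thesis
  proof (rule antisym)
    show "(\<integral>\<^sup>+ k. f k \<partial>count_space UNIV) \<le> (\<Sum>\<^sub>\<infinity>k. f k)"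
      unfolding eq inf by (rule SUP_least, rule SUP_upper) (use E in auto)
    show "(\<Sum>\<^sub>\<infinity>k. f k) \<le> (\<integral>\<^sup>+ k. f k \<partial>count_space UNIV)"
      unfolding inf
    proof (rule SUP_least)
      fix F :: "'k set" assume "F \<in> {F. finite F \<and> F \<subseteq> UNIV}"
      hence "sum f F = (\<integral>\<^sup>+ k. f k * indicator F k \<partial>count_space UNIV)" by (simp add: fin)
      also have "\<dots> \<le> (\<integral>\<^sup>+ k. f k \<partial>count_space UNIV)"
        by (rule nn_integral_mono) (simp add: indicator_def)
      finally show "sum f F \<le> (\<integral>\<^sup>+ k. f k \<partial>count_space UNIV)" .
    qed
  qed
qed

text \<open>
  For real summands unconditional and absolute summability agree, and both sides are \<open>0\<close> when it
  fails. So infinite sums inherit measurability in a parameter from integrals.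
\<close>

lemma integral_count_space_eq_infsum:
  fixes f :: "'k \<Rightarrow> real"
  shows "(\<Sum>\<^sub>\<infinity>k. f k) = (\<integral>k. f k \<partial>count_space UNIV)"
proof (cases "integrable (count_space UNIV) f")
  case True
  thus ?thesis using infsetsum_infsum[of f UNIV] by (simp add: infsetsum_def abs_summable_on_def)
next
  case False
  hence "\<not> f summable_on UNIV"
    using summable_on_iff_abs_summable_on_real[of f UNIV] abs_summable_equivalent[of f UNIV] by (simp add: abs_summable_on_def)
  thus ?thesis using False by (simp add: infsum_not_exists not_integrable_integral_eq)
qed

definition synthesis :: "(int^'d::finite \<Rightarrow> complex^'d) \<Rightarrow> real^'d \<Rightarrow> complex^'d" where
  "synthesis c x = (\<integral>k. cis (freq k \<bullet> x) *s c k \<partial>count_space UNIV)"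

lemma smult_assoc: "(a :: complex) *s (b *s (z :: complex^'n)) = (a * b) *s z"
  by (simp add: vec_eq_iff mult.assoc)

lemma smult_of_real: "complex_of_real r *s (z :: complex^'n) = r *\<^sub>R z"
  by (simp add: vec_eq_iff) (simp add: scaleR_conv_of_real)

lemma integrable_synthesis:
  assumes "integrable (count_space UNIV) c"
  shows "integrable (count_space UNIV) (\<lambda>k. cis (a k) *s c k)"
  by (rule Bochner_Integration.integrable_bound[OF assms]) (auto simp: norm_smult_complex)

lemma norm_synthesis_le:
  assumes "integrable (count_space UNIV) c"
  shows "norm (synthesis c x) \<le> (\<integral>k. norm (c k) \<partial>count_space UNIV)"
  unfolding synthesis_def by (rule integral_norm_bound[THEN order_trans]) (simp add: norm_smult_complex)

lemma synthesis_measurable: "synthesis c \<in> borel_measurable torus"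
proof -
  have "(\<lambda>(x, k). cis (freq k \<bullet> x) *s c k) \<in> borel_measurable (torus \<Otimes>\<^sub>M count_space UNIV)"
    by (rule measurable_pair_count_space)
       (simp, rule borel_measurable_bilinear[OF bounded_bilinear_smult cis_freq_measurable_torus borel_measurable_const])
  thus ?thesis unfolding synthesis_def[abs_def] by (rule freqs.borel_measurable_lebesgue_integral)
qed

lemma bounded_measurable_L2_torus:
  assumes "f \<in> borel_measurable torus" "\<And>x. norm (f x) \<le> B"
  shows "L2 torus f"
  by (rule L2_bound[of torus "\<lambda>_. B"]) (auto simp: assms L2_def intro: order_trans[OF assms(2) abs_ge_self])

lemma L2_torus_integrable: "L2 torus f \<Longrightarrow> integrable torus f"
  using L2_mult_integrable[of torus f "\<lambda>_. 1 :: real"]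
  by (subst integrable_norm_iff[symmetric]) (auto simp: L2_def)

lemma synthesis_coefficient:
  assumes c: "integrable (count_space UNIV) c"
  shows "(1 / (2 * pi) ^ CARD('d)) *\<^sub>R (\<integral>x. cis (- (freq j \<bullet> x)) *s synthesis c x \<partial>(torus :: (real^'d::finite) measure)) = c j"
proof -
  interpret P: pair_sigma_finite "torus :: (real^'d) measure" "count_space (UNIV :: (int^'d) set)" ..
  define F where "F = (\<lambda>(x, k). cis (freq (k - j) \<bullet> x) *s c k)"
  have cj: "cis (- (freq j \<bullet> x)) *s synthesis c x = (\<integral>k. F (x, k) \<partial>count_space UNIV)" for x
  proof -
    have "cis (- (freq j \<bullet> x)) *s synthesis c x = (\<integral>k. cis (- (freq j \<bullet> x)) *s (cis (freq k \<bullet> x) *s c k) \<partial>count_space UNIV)"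
      unfolding synthesis_def
      by (rule integral_bounded_linear[symmetric, OF bounded_bilinear.bounded_linear_right[OF bounded_bilinear_smult] integrable_synthesis[OF c]])
    thus ?thesis by (simp add: F_def smult_assoc cis_mult freq_diff inner_diff_left algebra_simps)
  qed
  have Fm: "F \<in> borel_measurable (torus \<Otimes>\<^sub>M count_space UNIV)"
    unfolding F_def by (rule measurable_pair_count_space)
       (simp, rule borel_measurable_bilinear[OF bounded_bilinear_smult cis_freq_measurable_torus borel_measurable_const])
  have Fn: "norm (F (x, k)) = norm (c k)" for x k by (simp add: F_def norm_smult_complex)
  have Fint: "integrable (torus \<Otimes>\<^sub>M count_space UNIV) F"
  proof (rule P.Fubini_integrable[OF Fm])
    show "integrable torus (\<lambda>x. \<integral>k. norm (F (x, k)) \<partial>count_space UNIV)" unfolding Fn by simp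
    show "AE x in torus. integrable (count_space UNIV) (\<lambda>k. F (x, k))"
      unfolding F_def prod.case by (intro AE_I2 integrable_synthesis[OF c])
  qed
  have inner: "(\<integral>x. F (x, k) \<partial>torus) = indicator {j} k *\<^sub>R ((2 * pi) ^ CARD('d) *\<^sub>R c j)" for k
  proof -
    have "(\<integral>x. F (x, k) \<partial>torus) = (\<integral>x. cis (freq (k - j) \<bullet> x) \<partial>torus) *s c k"
      unfolding F_def prod.case
      by (rule integral_bounded_linear[OF bounded_bilinear.bounded_linear_left[OF bounded_bilinear_smult]])
         (intro torus.integrable_const_bound[of _ 1] cis_freq_measurable_torus, simp)
    also have "\<dots> = indicator {j} k *\<^sub>R ((2 * pi) ^ CARD('d) *\<^sub>R c j)"
      unfolding torus_orthogonality by (cases "k = j") (simp_all add: smult_of_real del: of_real_power of_real_mult)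
    finally show ?thesis .
  qed
  have "(\<integral>x. cis (- (freq j \<bullet> x)) *s synthesis c x \<partial>torus) = (\<integral>k. (\<integral>x. F (x, k) \<partial>torus) \<partial>count_space UNIV)"
    unfolding cj using P.Fubini_integral[of "\<lambda>x k. F (x, k)"] Fint by simp
  also have "\<dots> = (2 * pi) ^ CARD('d) *\<^sub>R c j"
    unfolding inner by (subst Bochner_Integration.integral_scaleR_left) (auto simp: measure_count_space)
  finally show ?thesis by simp
qed

text \<open>
  The Fourier series converges absolutely to a bounded function with the same Fourier coefficients,
  so the difference annihilates all characters.
\<close>

lemma fourier_inversion:
  fixes f :: "real^'d::finite \<Rightarrow> real^'d"
  assumes f: "L2 torus f" and c: "integrable (count_space UNIV) (fourier f)"
  shows "AE x in torus. cvec (f x) = synthesis (fourier f) x"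
proof -
  have fint: "integrable torus (\<lambda>x. cvec (f x))" by (rule integrable_bounded_linear[OF bounded_linear_cvec L2_torus_integrable[OF f]])
  have sint: "integrable torus (synthesis (fourier f))"
    by (rule L2_torus_integrable[OF bounded_measurable_L2_torus[OF synthesis_measurable norm_synthesis_le[OF c]]])
  define D where "D x = cvec (f x) - synthesis (fourier f) x" for x
  have Dint: "integrable torus D" unfolding D_def using fint sint by simp
  have cint: "integrable torus (\<lambda>x. cis (a x) *s g x)" if "integrable torus g" "(\<lambda>x. cis (a x)) \<in> borel_measurable torus" for g :: "real^'d \<Rightarrow> complex^'d" and a
    by (rule Bochner_Integration.integrable_bound[OF that(1)])
       (auto simp: norm_smult_complex intro!: borel_measurable_bilinear[OF bounded_bilinear_smult] that borel_measurable_integrable[OF that(1)])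
  have cm: "(\<lambda>x. cis (- (freq j \<bullet> x))) \<in> borel_measurable torus" for j
    using cis_freq_measurable_torus[of "- j"] by (simp add: freq_minus)
  have D0: "(\<integral>x. cis (- (freq j \<bullet> x)) *s D x \<partial>torus) = 0" for j
  proof -
    have "cis (- (freq j \<bullet> x)) *s D x = cis (- (freq j \<bullet> x)) *s cvec (f x) - cis (- (freq j \<bullet> x)) *s synthesis (fourier f) x" for x
      by (simp add: D_def vec_eq_iff right_diff_distrib)
    hence "(\<integral>x. cis (- (freq j \<bullet> x)) *s D x \<partial>torus)
        = (\<integral>x. cis (- (freq j \<bullet> x)) *s cvec (f x) \<partial>torus) - (\<integral>x. cis (- (freq j \<bullet> x)) *s synthesis (fourier f) x \<partial>torus)"
      using cint[OF fint cm] cint[OF sint cm] by simp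
    moreover have "(1 / (2 * pi) ^ CARD('d)) *\<^sub>R \<dots> = 0"
      unfolding scaleR_diff_right synthesis_coefficient[OF c] by (simp add: fourier_def)
    ultimately show ?thesis by simp
  qed
  have comp: "AE x in torus. D x $ i = 0" for i
  proof (rule fourier_uniqueness)
    have nth: "bounded_linear (\<lambda>z :: complex^'d. z $ i)" by (rule bounded_linear_vec_nth)
    show "annihilates_characters (\<lambda>x. D x $ i)"
      unfolding annihilates_characters_def
    proof (intro conjI allI)
      show "integrable torus (\<lambda>x. D x $ i)" by (rule integrable_bounded_linear[OF nth Dint])
      fix k
      have "(\<integral>x. (cis (- (freq (- k) \<bullet> x)) *s D x) $ i \<partial>torus) = (\<integral>x. cis (- (freq (- k) \<bullet> x)) *s D x \<partial>torus) $ i"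
        by (rule integral_bounded_linear[OF nth cint[OF Dint cm]])
      thus "(\<integral>x. cis (freq k \<bullet> x) * D x $ i \<partial>torus) = 0" using D0[of "- k"] by (simp add: freq_minus)
    qed
  qed
  have "AE x in torus. \<forall>i\<in>UNIV. D x $ i = 0" using comp by (intro AE_finite_allI) auto
  thus ?thesis by eventually_elim (simp add: D_def vec_eq_iff)
qed

definition cnj_vec :: "complex^'n \<Rightarrow> complex^'n" where
  "cnj_vec z = (\<chi> i. cnj (z $ i))"

lemma bounded_linear_cnj_vec: "bounded_linear (cnj_vec :: complex^'n \<Rightarrow> complex^'n)"
proof (rule bounded_linear_intro[of _ 1])
  show "norm (cnj_vec z) \<le> norm z * 1" for z :: "complex^'n" by (simp add: cnj_vec_def norm_vec_def)
qed (simp_all add: cnj_vec_def vec_eq_iff)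

lemma norm_cnj_vec [simp]: "norm (cnj_vec z) = norm z"
  by (simp add: cnj_vec_def norm_vec_def)

lemma inner_cnj_vec: "u \<bullet> cnj_vec z = cnj_vec u \<bullet> z"
  by (simp add: cnj_vec_def inner_vec_def inner_complex_def)

lemma cvec_re_vec: "cvec (re_vec z) = (1 / 2) *\<^sub>R (z + cnj_vec z)"
  by (simp add: cvec_def re_vec_def cnj_vec_def vec_eq_iff complex_eq_iff)

lemma fourier_minus: "L2 torus f \<Longrightarrow> fourier f (- k) = cnj_vec (fourier f k)"
proof -
  assume f: "L2 torus f"
  interpret cnj: bounded_linear "cnj_vec :: complex^'a \<Rightarrow> complex^'a" by (rule bounded_linear_cnj_vec)
  have m: "(\<lambda>x. cis (- (freq k \<bullet> x))) \<in> borel_measurable torus"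
    using cis_freq_measurable_torus[of "- k"] by (simp add: freq_minus)
  have fint: "integrable torus (\<lambda>x. cvec (f x))" by (rule integrable_bounded_linear[OF bounded_linear_cvec L2_torus_integrable[OF f]])
  have "integrable torus (\<lambda>x. cis (- (freq k \<bullet> x)) *s cvec (f x))"
    by (rule Bochner_Integration.integrable_bound[OF fint])
       (auto simp: norm_smult_complex intro!: borel_measurable_bilinear[OF bounded_bilinear_smult] m borel_measurable_integrable[OF fint])
  from integral_bounded_linear[OF bounded_linear_cnj_vec this]
  have "cnj_vec (\<integral>x. cis (- (freq k \<bullet> x)) *s cvec (f x) \<partial>torus) = (\<integral>x. cnj_vec (cis (- (freq k \<bullet> x)) *s cvec (f x)) \<partial>torus)" by simp
  also have "\<dots> = (\<integral>x. cis (- (freq (- k) \<bullet> x)) *s cvec (f x) \<partial>torus)"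
    by (intro Bochner_Integration.integral_cong) (auto simp: cnj_vec_def cvec_def vec_eq_iff freq_minus cis_cnj)
  finally show ?thesis by (simp add: fourier_def cnj.scaleR)
qed

lemma integral_count_space_reflect:
  fixes f :: "int^'d \<Rightarrow> 'c::{banach, second_countable_topology}"
  shows
  "(\<integral>k. f (- k) \<partial>count_space (UNIV :: (int^'d) set)) = (\<integral>k. f k \<partial>count_space UNIV)"
  by (rule integral_bij_count_space) (rule bij_uminus)

lemma integrable_count_space_reflect:
  fixes f :: "int^'d \<Rightarrow> 'c::{banach, second_countable_topology}"
  assumes "integrable (count_space (UNIV :: (int^'d) set)) f"
  shows "integrable (count_space UNIV) (\<lambda>k. f (- k))"
  using integrable_bij_count_space[OF bij_uminus, of f] assms by simp

text \<open>
  Conjugation reflects the frequencies, so taking the real part of a series symmetrizes its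
  coefficients.
\<close>

lemma fourier_re_synthesis:
  fixes h :: "int^'d::finite \<Rightarrow> complex^'d"
  assumes h: "integrable (count_space UNIV) h"
  shows "fourier (\<lambda>x. re_vec (synthesis h x)) k = (1 / 2) *\<^sub>R (h k + cnj_vec (h (- k)))"
proof -
  define h' where "h' k = (1 / 2) *\<^sub>R (h k + cnj_vec (h (- k)))" for k
  have hc: "integrable (count_space UNIV) (\<lambda>k. cnj_vec (h (- k)))"
    by (rule integrable_bounded_linear[OF bounded_linear_cnj_vec integrable_count_space_reflect[OF h]])
  have h': "integrable (count_space UNIV) h'" unfolding h'_def using h hc by simp
  have "cvec (re_vec (synthesis h x)) = synthesis h' x" for x
  proof -
    have "cnj_vec (synthesis h x) = (\<integral>k. cnj_vec (cis (freq k \<bullet> x) *s h k) \<partial>count_space UNIV)"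
      unfolding synthesis_def by (rule integral_bounded_linear[symmetric, OF bounded_linear_cnj_vec integrable_synthesis[OF h]])
    also have "\<dots> = (\<integral>k. cis (freq (- k) \<bullet> x) *s cnj_vec (h k) \<partial>count_space UNIV)"
      by (intro Bochner_Integration.integral_cong) (auto simp: cnj_vec_def vec_eq_iff freq_minus cis_cnj)
    also have "\<dots> = (\<integral>k. cis (freq k \<bullet> x) *s cnj_vec (h (- k)) \<partial>count_space UNIV)"
      using integral_count_space_reflect[of "\<lambda>k. cis (freq k \<bullet> x) *s cnj_vec (h (- k))"] by simp
    finally have "cvec (re_vec (synthesis h x)) = (1 / 2) *\<^sub>R ((\<integral>k. cis (freq k \<bullet> x) *s h k \<partial>count_space UNIV) + (\<integral>k. cis (freq k \<bullet> x) *s cnj_vec (h (- k)) \<partial>count_space UNIV))"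
      by (simp add: cvec_re_vec synthesis_def)
    also have "\<dots> = (\<integral>k. (1 / 2) *\<^sub>R (cis (freq k \<bullet> x) *s h k + cis (freq k \<bullet> x) *s cnj_vec (h (- k))) \<partial>count_space UNIV)"
      using integrable_synthesis[OF h] integrable_synthesis[OF hc] by simp
    also have "\<dots> = synthesis h' x"
      unfolding synthesis_def by (intro Bochner_Integration.integral_cong) (auto simp: h'_def vec_eq_iff algebra_simps)
    finally show ?thesis .
  qed
  thus ?thesis unfolding fourier_def using synthesis_coefficient[OF h', of k] by (simp add: h'_def)
qed

section \<open>Summability of Sobolev weights\<close>

lemma integrable_int_even:
  fixes g :: "int \<Rightarrow> real"
  assumes "summable (\<lambda>n. g (int n))" "\<And>k. 0 \<le> g k" "\<And>k. g (- k) = g k"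
  shows "integrable (count_space UNIV) g"
proof -
  have nat: "integrable (count_space UNIV) (\<lambda>n. g (int n))"
    using assms by (simp add: integrable_count_space_nat_iff)
  have pos: "integrable (count_space (range int)) g"
    using integrable_bij_count_space[of int UNIV "range int" g] nat by (simp add: inj_on_imp_bij_betw)
  have neg: "integrable (count_space (range (\<lambda>n. - int n))) g"
    using integrable_bij_count_space[of "\<lambda>n. - int n" UNIV "range (\<lambda>n. - int n)" g] nat
    by (simp add: inj_on_imp_bij_betw inj_on_def assms(3))
  have "range int \<union> range (\<lambda>n. - int n) = UNIV"
  proof (intro equalityI subsetI)
    fix k :: int
    show "k \<in> range int \<union> range (\<lambda>n. - int n)" by (cases k rule: int_cases2) auto
  qed simp
  thus ?thesis
    using abs_summable_on_union[of g "range int" "range (\<lambda>n. - int n)"] pos neg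
    by (simp add: Infinite_Set_Sum.abs_summable_on_def)
qed

lemma weight_summable_1d:
  assumes "1 / 2 < (p :: real)"
  shows "integrable (count_space UNIV) (\<lambda>k :: int. (1 + (real_of_int k)\<^sup>2) powr (- p))"
proof (rule integrable_int_even)
  have "summable (\<lambda>n. real n powr (- 2 * p))" using assms by (subst summable_real_powr_iff) simp
  moreover have "norm ((1 + (real_of_int (int n))\<^sup>2) powr (- p)) \<le> real n powr (- 2 * p)" if "n \<ge> 1" for n
  proof -
    have "(1 + (real n)\<^sup>2) powr (- p) \<le> (real n ^ 2) powr (- p)"
      using assms that by (intro powr_mono2') auto
    also have "\<dots> = (real n powr 2) powr (- p)" using that by (subst powr_numeral) auto
    also have "\<dots> = real n powr (- 2 * p)" by (simp only: powr_powr) simp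
    finally show ?thesis by simp
  qed
  ultimately show "summable (\<lambda>n. (1 + (real_of_int (int n))\<^sup>2) powr (- p))"
    by (rule summable_comparison_test'[where N = 1])
qed auto

definition weight :: "int^'d \<Rightarrow> real" where
  "weight k = 1 + (norm (freq k))\<^sup>2"

lemma weight_ge_1: "1 \<le> weight k"
  by (simp add: weight_def)

lemma weight_pos [simp]: "0 < weight k"
  using weight_ge_1[of k] by linarith

lemma weight_nonzero [simp]: "weight k \<noteq> 0"
  using weight_pos[of k] by linarith

lemma weight_minus [simp]: "weight (- k) = weight k"
  by (simp add: weight_def freq_minus)

text \<open>
  Each of the \<open>d\<close> factors \<open>1 + (k $ i)\<^sup>2\<close> is at most the weight, so \<open>weight k powr (- s)\<close> is dominated by a
  product of functions of one coordinate with exponent \<open>s / d > 1 / 2\<close>, and the sum factorizes.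
\<close>

lemma weight_summable:
  assumes s: "real CARD('d::finite) / 2 < s"
  shows "integrable (count_space UNIV) (\<lambda>k :: int^'d. weight k powr (- s))"
proof -
  define p where "p = s / CARD('d)"
  have p: "1 / 2 < p" using s by (simp add: p_def field_simps)
  have prod: "integrable (count_space (PiE UNIV (\<lambda>_. UNIV))) (\<lambda>g. \<Prod>i\<in>(UNIV :: 'd set). (1 + (real_of_int (g i))\<^sup>2) powr (- p))"
    using abs_summable_on_prod_PiE[of "UNIV :: 'd set" "\<lambda>_. UNIV" "\<lambda>_ k. (1 + (real_of_int k)\<^sup>2) powr (- p)"]
      weight_summable_1d[OF p] by (simp add: Infinite_Set_Sum.abs_summable_on_def)
  have bij: "bij_betw (\<lambda>k :: int^'d. \<lambda>i. k $ i) UNIV (PiE UNIV (\<lambda>_. UNIV))"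
    by (rule bij_betwI[of _ _ _ vec_lambda]) (auto simp: vec_lambda_eta)
  have "integrable (count_space UNIV) (\<lambda>k :: int^'d. \<Prod>i\<in>UNIV. (1 + (real_of_int (k $ i))\<^sup>2) powr (- p))"
    using integrable_bij_count_space[OF bij, of "\<lambda>g. \<Prod>i\<in>UNIV. (1 + (real_of_int (g i))\<^sup>2) powr (- p)"] prod by simp
  thus ?thesis
  proof (rule Bochner_Integration.integrable_bound)
    show "AE k in count_space UNIV. norm (weight k powr (- s)) \<le> norm (\<Prod>i\<in>(UNIV :: 'd set). (1 + (real_of_int (k $ i))\<^sup>2) powr (- p))"
    proof (rule AE_I2)
      fix k :: "int^'d"
      have "weight k powr (- s) = (\<Prod>i\<in>(UNIV :: 'd set). weight k powr (- p))"
        unfolding prod_constant using s by (subst powr_power) (auto simp: p_def)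
      also have "\<dots> \<le> (\<Prod>i\<in>(UNIV :: 'd set). (1 + (real_of_int (k $ i))\<^sup>2) powr (- p))"
      proof (intro prod_mono conjI powr_mono2')
        fix i
        have "\<bar>real_of_int (k $ i)\<bar> \<le> norm (freq k)" using component_le_norm_cart[of "freq k" i] by (simp add: freq_def)
        from power_mono[OF this, of 2] show "1 + (real_of_int (k $ i))\<^sup>2 \<le> weight k" by (simp add: weight_def)
      qed (use p in \<open>auto simp: add_pos_nonneg\<close>)
      finally show "norm (weight k powr (- s)) \<le> norm (\<Prod>i\<in>(UNIV :: 'd set). (1 + (real_of_int (k $ i))\<^sup>2) powr (- p))"
        by (simp add: abs_prod)
    qed
  qed simp
qed

definition weight_tail :: "'d::finite itself \<Rightarrow> real \<Rightarrow> real \<Rightarrow> real" where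
  "weight_tail d s M = (\<integral>k. indicator {k. M < norm (freq k)} k * weight (k :: int^'d) powr (- s) \<partial>count_space UNIV)"

lemma weight_tail_tendsto:
  assumes s: "real CARD('d::finite) / 2 < s"
  shows "(\<lambda>M::nat. weight_tail TYPE('d) s (real M)) \<longlonglongrightarrow> 0"
proof -
  have "(\<lambda>M::nat. weight_tail TYPE('d) s (real M)) \<longlonglongrightarrow> (\<integral>k. 0 \<partial>count_space (UNIV :: (int^'d) set))"
    unfolding weight_tail_def
  proof (rule integral_dominated_convergence[where w = "\<lambda>k. weight k powr (- s)"])
    show "AE k in count_space (UNIV :: (int^'d) set). (\<lambda>M::nat. indicator {k. real M < norm (freq k)} k * weight k powr (- s)) \<longlonglongrightarrow> 0"
    proof (rule AE_I2)
      fix k :: "int^'d"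
      have "\<forall>\<^sub>F M::nat in sequentially. norm (freq k) \<le> real M"
        using filterlim_real_sequentially by (simp add: filterlim_at_top)
      hence "\<forall>\<^sub>F M::nat in sequentially. indicator {k. real M < norm (freq k)} k * weight k powr (- s) = 0"
        by eventually_elim (simp add: indicator_def)
      thus "(\<lambda>M::nat. indicator {k. real M < norm (freq k)} k * weight k powr (- s)) \<longlonglongrightarrow> 0" by (rule tendsto_eventually)
    qed
    show "integrable (count_space UNIV) (\<lambda>k :: int^'d. weight k powr (- s))" by (rule weight_summable[OF s])
    show "AE k in count_space (UNIV :: (int^'d) set). norm (indicator {k. real M < norm (freq k)} k * weight k powr (- s)) \<le> weight k powr (- s)" for M
      by (intro AE_I2) (simp split: split_indicator)
  qed simp_all
  thus ?thesis by simp
qed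

section \<open>Sobolev embedding by Fourier series\<close>

text \<open>
  The isometry from \<open>H\<^sup>s\<close> to square-summable functions of the frequency.
\<close>

definition sobolev :: "real \<Rightarrow> (real^'d \<Rightarrow> real^'d) \<Rightarrow> int^'d \<Rightarrow> complex^'d" where
  "sobolev s f k = weight k powr (s / 2) *\<^sub>R fourier f k"

lemma weight_powr_split:
  fixes z :: "'a::real_vector"
  shows "weight k powr (s / 2) *\<^sub>R weight k powr (- s / 2) *\<^sub>R z = z"
  "weight k powr (- s / 2) *\<^sub>R weight k powr (s / 2) *\<^sub>R z = z"
proof -
  have eq: "weight k powr (s / 2) * weight k powr (- s / 2) = 1"
    unfolding powr_add[symmetric] by simp
  show "weight k powr (s / 2) *\<^sub>R weight k powr (- s / 2) *\<^sub>R z = z"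
    by (simp only: scaleR_scaleR eq scaleR_one)
  show "weight k powr (- s / 2) *\<^sub>R weight k powr (s / 2) *\<^sub>R z = z"
    unfolding scaleR_scaleR by (subst mult.commute) (simp only: eq scaleR_one)
qed

lemma fourier_eq_sobolev: "fourier f k = weight k powr (- s / 2) *\<^sub>R sobolev s f k"
  by (simp only: sobolev_def weight_powr_split)

lemma L2_weight:
  assumes s: "real CARD('d::finite) / 2 < s"
  shows "L2 (count_space UNIV) (\<lambda>k :: int^'d. indicator A k * weight k powr (- s / 2))"
    and "L2_norm (count_space UNIV) (\<lambda>k :: int^'d. indicator {k. M < norm (freq k)} k * weight k powr (- s / 2)) = sqrt (weight_tail TYPE('d) s M)"
proof -
  have sq: "(norm (indicator A k * weight k powr (- s / 2)))\<^sup>2 = indicator A k * weight k powr (- s)" for k :: "int^'d" and A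
  proof -
    have "(weight k powr (- s / 2))\<^sup>2 = weight k powr (- s)" by (subst powr_power) auto
    thus ?thesis by (simp add: power_mult_distrib indicator_def)
  qed
  show "L2 (count_space UNIV) (\<lambda>k :: int^'d. indicator A k * weight k powr (- s / 2))"
    unfolding L2_def sq
  proof
    show "integrable (count_space UNIV) (\<lambda>k :: int^'d. indicator A k * weight k powr (- s))"
      by (rule Bochner_Integration.integrable_bound[OF weight_summable[OF s]]) (simp_all split: split_indicator)
  qed simp
  show "L2_norm (count_space UNIV) (\<lambda>k :: int^'d. indicator {k. M < norm (freq k)} k * weight k powr (- s / 2)) = sqrt (weight_tail TYPE('d) s M)"
    unfolding L2_norm_def sq weight_tail_def ..
qed

lemma fourier_proj_eq_integral:
  "fourier_proj M f x = (\<integral>k. indicator {k. norm (freq k) \<le> M} k *\<^sub>R (cis (freq k \<bullet> x) *s fourier f k) \<partial>count_space UNIV)"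
proof -
  let ?g = "\<lambda>k. indicator {k. norm (freq k) \<le> M} k *\<^sub>R (cis (freq k \<bullet> x) *s fourier f k)"
  have sub: "{k. ?g k \<noteq> 0} \<subseteq> {k. norm (freq k) \<le> M}" by (auto simp: indicator_def)
  have "(\<integral>k. ?g k \<partial>count_space UNIV) = (\<Sum>k | k \<in> UNIV \<and> ?g k \<noteq> 0. ?g k)"
    by (rule lebesgue_integral_count_space_finite_support) (use finite_subset[OF sub finite_low_frequencies] in simp)
  also have "\<dots> = (\<Sum>k | norm (freq k) \<le> M. ?g k)"
    by (rule sum.mono_neutral_left[OF finite_low_frequencies]) (use sub in auto)
  also have "\<dots> = fourier_proj M f x" unfolding fourier_proj_def by (rule sum.cong) auto
  finally show ?thesis by simp
qed

text \<open>
  The Fourier series converges, and its tail is a sum over high frequencies of products of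
  \<open>weight k powr (- s / 2)\<close> and \<open>sobolev s f k\<close>; the Cauchy--Schwarz inequality applies.
\<close>

lemma fourier_tail_bound:
  fixes f :: "real^'d::finite \<Rightarrow> real^'d"
  assumes s: "real CARD('d) / 2 < s" and f: "L2 torus f" and u: "L2 (count_space UNIV) (sobolev s f)"
  shows "AE x in torus. norm (fourier_tail M f x) \<le> sqrt (weight_tail TYPE('d) s M) * L2_norm (count_space UNIV) (sobolev s f)"
proof -
  have abs: "norm (fourier f k) = norm (indicator UNIV k * weight k powr (- s / 2)) * norm (sobolev s f k)" for k
    by (subst fourier_eq_sobolev[of f k s]) simp
  have c: "integrable (count_space UNIV) (fourier f)"
    by (rule Bochner_Integration.integrable_bound[OF L2_mult_integrable[OF L2_weight(1)[OF s, of UNIV] u]])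
       (simp_all add: abs del: indicator_UNIV)
  show ?thesis using fourier_inversion[OF f c]
  proof eventually_elim
    case (elim x)
    define F where "F k = cis (freq k \<bullet> x) *s fourier f k" for k
    have F: "integrable (count_space UNIV) F" unfolding F_def by (rule integrable_synthesis[OF c])
    have IF: "integrable (count_space UNIV) (\<lambda>k. indicator A k *\<^sub>R F k)" for A
      by (rule integrable_mult_indicator[OF _ F]) simp
    have "fourier_tail M f x = (\<integral>k. F k \<partial>count_space UNIV) - (\<integral>k. indicator {k. norm (freq k) \<le> M} k *\<^sub>R F k \<partial>count_space UNIV)"
      unfolding fourier_tail_def elim synthesis_def fourier_proj_eq_integral F_def ..
    also have "\<dots> = (\<integral>k. F k - indicator {k. norm (freq k) \<le> M} k *\<^sub>R F k \<partial>count_space UNIV)"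
      by (rule Bochner_Integration.integral_diff[OF F IF, symmetric])
    also have "\<dots> = (\<integral>k. indicator {k. M < norm (freq k)} k *\<^sub>R F k \<partial>count_space UNIV)"
      by (rule Bochner_Integration.integral_cong) (auto simp: indicator_def)
    finally have "norm (fourier_tail M f x) \<le> (\<integral>k. norm (indicator {k. M < norm (freq k)} k *\<^sub>R F k) \<partial>count_space UNIV)"
      by (simp only: integral_norm_bound)
    also have "\<dots> = (\<integral>k. norm (indicator {k. M < norm (freq k)} k * weight k powr (- s / 2)) * norm (sobolev s f k) \<partial>count_space UNIV)"
      by (rule Bochner_Integration.integral_cong) (simp_all add: F_def norm_smult_complex abs)
    also have "\<dots> \<le> L2_norm (count_space UNIV) (\<lambda>k :: int^'d. indicator {k. M < norm (freq k)} k * weight k powr (- s / 2)) * L2_norm (count_space UNIV) (sobolev s f)"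
      by (rule L2_mult_Cauchy_Schwarz[OF L2_weight(1)[OF s] u])
    finally show ?case unfolding L2_weight(2)[OF s] .
  qed
qed

text \<open>
  The tail beyond frequency \<open>-1\<close> is the whole function.
\<close>

lemma sobolev_sup_bound:
  fixes f :: "real^'d::finite \<Rightarrow> real^'d"
  assumes "real CARD('d) / 2 < s" "L2 torus f" "L2 (count_space UNIV) (sobolev s f)"
  shows "AE x in torus. norm (f x) \<le> sqrt (weight_tail TYPE('d) s (-1)) * L2_norm (count_space UNIV) (sobolev s f)"
proof -
  have "{k :: int^'d. norm (freq k) \<le> -1} = {}" by (auto simp: not_le intro: less_le_trans[OF _ norm_ge_zero])
  hence "fourier_tail (-1) f x = cvec (f x)" for x by (simp add: fourier_tail_def fourier_proj_def)
  thus ?thesis using fourier_tail_bound[OF assms, of "-1"] by simp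
qed

abbreviation freqtime :: "real \<Rightarrow> (real \<times> (int^'d::finite)) measure" where
  "freqtime T \<equiv> time T \<Otimes>\<^sub>M count_space UNIV"

lemma L2_freqtime_iff:
  fixes F :: "real \<times> (int^'d::finite) \<Rightarrow> 'c::euclidean_space"
  assumes F: "\<And>k. (\<lambda>t. F (t, k)) \<in> borel_measurable (time T)"
  shows "L2 (freqtime T) F \<longleftrightarrow> (\<integral>\<^sup>+ t. \<integral>\<^sup>+ k. ennreal ((norm (F (t, k)))\<^sup>2) \<partial>count_space UNIV \<partial>time T) < \<infinity>"
proof -
  have m [measurable]: "F \<in> borel_measurable (freqtime T)" by (rule measurable_pair_count_space[OF F])
  have "(\<integral>\<^sup>+ t. \<integral>\<^sup>+ k. ennreal ((norm (F (t, k)))\<^sup>2) \<partial>count_space UNIV \<partial>time T) = (\<integral>\<^sup>+ z. ennreal ((norm (F z))\<^sup>2) \<partial>freqtime T)"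
    by (subst freqs.nn_integral_fst) auto
  thus ?thesis by (simp add: L2_def m integrable_iff_bounded)
qed

lemma L2_freqtime_sections:
  fixes F :: "real \<times> (int^'d::finite) \<Rightarrow> 'c::euclidean_space"
  assumes F: "L2 (freqtime T) F"
  shows "(\<lambda>t. F (t, k)) \<in> borel_measurable (time T)"
    and "AE t in time T. L2 (count_space UNIV) (\<lambda>k. F (t, k))"
    and "L2 (time T) (\<lambda>t. L2_norm (count_space UNIV) (\<lambda>k. F (t, k)))"
    and "L2_norm (time T) (\<lambda>t. L2_norm (count_space UNIV) (\<lambda>k. F (t, k))) = L2_norm (freqtime T) F"
proof -
  interpret P: pair_sigma_finite "time T" "count_space (UNIV :: (int^'d) set)" ..
  have m: "F \<in> borel_measurable (freqtime T)" using F by (rule L2_measurable)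
  show "(\<lambda>t. F (t, k)) \<in> borel_measurable (time T)"
    using measurable_compose[OF measurable_Pair2'[of k "count_space UNIV" "time T"] m] by simp
  have int: "integrable (freqtime T) (\<lambda>(t, k). (norm (F (t, k)))\<^sup>2)"
    using L2_integrable[OF F] by (simp add: case_prod_beta')
  show "AE t in time T. L2 (count_space UNIV) (\<lambda>k. F (t, k))"
    using P.AE_integrable_fst[OF int] by eventually_elim (simp add: L2_def)
  have "integrable (time T) (\<lambda>t. \<integral>k. (norm (F (t, k)))\<^sup>2 \<partial>count_space UNIV)" by (rule P.integrable_fst[OF int])
  moreover have "(\<lambda>t. L2_norm (count_space UNIV) (\<lambda>k. F (t, k))) \<in> borel_measurable (time T)"
    using m unfolding L2_norm_def by measurable
  ultimately show "L2 (time T) (\<lambda>t. L2_norm (count_space UNIV) (\<lambda>k. F (t, k)))"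
    by (simp add: L2_def L2_norm_power2)
  show "L2_norm (time T) (\<lambda>t. L2_norm (count_space UNIV) (\<lambda>k. F (t, k))) = L2_norm (freqtime T) F"
    using P.integral_fst[OF int] by (simp add: L2_norm_def[of "time T"] L2_norm_power2) (simp add: L2_norm_def case_prod_beta')
qed

lemma L2_sobolev:
  fixes v :: "real \<Rightarrow> real^'d::finite \<Rightarrow> real^'d"
  assumes v: "L2Hs T s v"
  shows "L2 (freqtime T) (\<lambda>(t, k). sobolev s (v t) k)"
proof -
  note parts = v[unfolded L2Hs_def]
  have m: "(\<lambda>t. sobolev s (v t) k) \<in> borel_measurable (time T)" for k
    unfolding sobolev_def using fourier_measurable[OF parts[THEN conjunct1], of k] by simp
  have sq: "(norm (sobolev s f k))\<^sup>2 = (1 + (norm (freq k))\<^sup>2) powr s * (norm (fourier f k))\<^sup>2" for f and k :: "int^'d"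
  proof -
    have "(weight k powr (s / 2))\<^sup>2 = weight k powr s" by (subst powr_power) auto
    thus ?thesis by (simp add: sobolev_def power_mult_distrib weight_def)
  qed
  show ?thesis
    using parts[THEN conjunct2, THEN conjunct2]
    by (subst L2_freqtime_iff) (simp_all add: m sq nn_integral_count_space_eq_infsum)
qed

lemma L2Linf_norm_le:
  fixes f :: "real \<Rightarrow> real^'d::finite \<Rightarrow> 'c::euclidean_space"
  assumes f: "(\<lambda>z. f (fst z) (snd z)) \<in> borel_measurable (spacetime T)"
    and le: "AE t in time T. AE x in torus. norm (f t x) \<le> c * r t"
    and r: "L2 (time T) r" and c: "0 \<le> c"
  shows "L2Linf_norm T f \<le> ennreal (c * L2_norm (time T) r)"
proof -
  have r0: "L2 (time T) (\<lambda>t. c *\<^sub>R r t)" by (rule L2_scaleR[OF r])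
  have sec: "(\<lambda>x. f t x) \<in> borel_measurable torus" if "t \<in> space (time T)" for t
    using measurable_compose[OF measurable_Pair1'[OF that] f] by simp
  have "AE t in time T. (esssup torus (\<lambda>x. ennreal (norm (f t x))))\<^sup>2 \<le> ennreal ((norm (c *\<^sub>R r t))\<^sup>2)"
    using le AE_space
  proof eventually_elim
    case (elim t)
    have "AE x in torus. norm (f t x) \<le> \<bar>c * r t\<bar>" using elim(1) by eventually_elim linarith
    hence "esssup torus (\<lambda>x. ennreal (norm (f t x))) \<le> ennreal \<bar>c * r t\<bar>"
      using sec[OF elim(2)] by (intro esssup_I) (auto elim!: eventually_mono simp: ennreal_leI)
    from power_mono[OF this, of 2] show ?case by (simp add: ennreal_power)
  qed
  hence "(\<integral>\<^sup>+ t. (esssup torus (\<lambda>x. ennreal (norm (f t x))))\<^sup>2 \<partial>time T) \<le> (\<integral>\<^sup>+ t. ennreal ((norm (c *\<^sub>R r t))\<^sup>2) \<partial>time T)"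
    by (rule nn_integral_mono_AE)
  also have "\<dots> = ennreal ((c * L2_norm (time T) r)\<^sup>2)"
    using c by (simp only: L2_norm_nn_integral[OF r0] L2_norm_scaleR abs_of_nonneg)
  finally have le2: "(\<integral>\<^sup>+ t. (esssup torus (\<lambda>x. ennreal (norm (f t x))))\<^sup>2 \<partial>time T) \<le> ennreal ((c * L2_norm (time T) r)\<^sup>2)" .
  have "ennreal_sqrt a \<le> ennreal b" if a: "a \<le> ennreal (b\<^sup>2)" and b: "0 \<le> b" for a b
  proof -
    have "a \<noteq> \<infinity>" using a by (auto simp: top_unique)
    moreover have "sqrt (enn2real a) \<le> sqrt (b\<^sup>2)" using enn2real_mono[OF a] by (intro real_sqrt_le_mono) simp
    ultimately show ?thesis using b by (simp add: ennreal_sqrt_def ennreal_leI)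
  qed
  from this[OF le2] show ?thesis using c by (simp add: L2Linf_norm_def)
qed

lemma sobolev_embedding:
  fixes v :: "real \<Rightarrow> real^'d::finite \<Rightarrow> real^'d"
  assumes s: "real CARD('d) / 2 < s" and v: "L2Hs T s v" and K: "L2_norm (freqtime T) (\<lambda>(t, k). sobolev s (v t) k) \<le> K"
  shows "L2Linf_norm T v \<le> ennreal (sqrt (weight_tail TYPE('d) s (-1)) * K)"
    and "L2Linf_norm T (\<lambda>t. fourier_tail M (v t)) \<le> ennreal (sqrt (weight_tail TYPE('d) s M) * K)"
proof -
  note parts = v[unfolded L2Hs_def]
  have coef: "coefficient T v" by (rule parts[THEN conjunct1])
  have L2v: "AE t in time T. L2 torus (v t)" by (rule parts[THEN conjunct2, THEN conjunct1])
  note U = L2_freqtime_sections[OF L2_sobolev[OF v], unfolded prod.case]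
  have pos: "0 \<le> sqrt (weight_tail TYPE('d) s M)" for M
    unfolding weight_tail_def by (intro real_sqrt_ge_zero Bochner_Integration.integral_nonneg) simp
  have "AE t in time T. AE x in torus. norm (v t x) \<le> sqrt (weight_tail TYPE('d) s (-1)) * L2_norm (count_space UNIV) (\<lambda>k. sobolev s (v t) k)"
    using L2v U(2) by eventually_elim (rule sobolev_sup_bound[OF s])
  from L2Linf_norm_le[OF _ this U(3) pos] coef
  have "L2Linf_norm T v \<le> ennreal (sqrt (weight_tail TYPE('d) s (-1)) * L2_norm (freqtime T) (\<lambda>(t, k). sobolev s (v t) k))"
    unfolding U(4) coefficient_def by (simp add: case_prod_beta')
  also have "\<dots> \<le> ennreal (sqrt (weight_tail TYPE('d) s (-1)) * K)"
    by (intro ennreal_leI mult_left_mono K pos)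
  finally show "L2Linf_norm T v \<le> ennreal (sqrt (weight_tail TYPE('d) s (-1)) * K)" .
  have "AE t in time T. AE x in torus. norm (fourier_tail M (v t) x) \<le> sqrt (weight_tail TYPE('d) s M) * L2_norm (count_space UNIV) (\<lambda>k. sobolev s (v t) k)"
    using L2v U(2) by eventually_elim (rule fourier_tail_bound[OF s])
  from L2Linf_norm_le[OF fourier_tail_measurable[OF coef] this U(3) pos]
  have "L2Linf_norm T (\<lambda>t. fourier_tail M (v t)) \<le> ennreal (sqrt (weight_tail TYPE('d) s M) * L2_norm (freqtime T) (\<lambda>(t, k). sobolev s (v t) k))"
    unfolding U(4) .
  also have "\<dots> \<le> ennreal (sqrt (weight_tail TYPE('d) s M) * K)"
    by (intro ennreal_leI mult_left_mono K pos)
  finally show "L2Linf_norm T (\<lambda>t. fourier_tail M (v t)) \<le> ennreal (sqrt (weight_tail TYPE('d) s M) * K)" .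
qed

section \<open>Weak convergence in Sobolev spaces\<close>

text \<open>
  The projection onto the coefficient functions of real fields, which satisfy
  \<open>u (- k) = cnj_vec (u k)\<close>.
\<close>

definition even_part :: "(int^'d \<Rightarrow> complex^'d) \<Rightarrow> int^'d \<Rightarrow> complex^'d" where
  "even_part g k = (1 / 2) *\<^sub>R (g k + cnj_vec (g (- k)))"

lemma norm_even_part_le: "(norm (even_part g k))\<^sup>2 \<le> (norm (g k))\<^sup>2 + (norm (g (- k)))\<^sup>2"
proof -
  have mean: "((a + b) / 2)\<^sup>2 \<le> a\<^sup>2 + b\<^sup>2" for a b :: real
  proof -
    have eq: "((a + b) / 2)\<^sup>2 = a\<^sup>2 + b\<^sup>2 - (((a - b) / 2)\<^sup>2 + (a\<^sup>2 + b\<^sup>2) / 2)"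
      by (simp add: power2_eq_square field_simps)
    have "0 \<le> ((a - b) / 2)\<^sup>2 + (a\<^sup>2 + b\<^sup>2) / 2"
      by (intro add_nonneg_nonneg divide_nonneg_nonneg zero_le_power2) simp
    thus ?thesis by (simp only: eq diff_le_eq le_add_same_cancel1)
  qed
  have "norm (even_part g k) \<le> (norm (g k) + norm (g (- k))) / 2"
    using norm_triangle_ineq[of "g k" "cnj_vec (g (- k))"] by (simp add: even_part_def)
  from power_mono[OF this, of 2] mean show ?thesis by (rule order_trans) simp
qed

lemma nn_integral_even_part_le:
  fixes g :: "int^'d::finite \<Rightarrow> complex^'d"
  shows "(\<integral>\<^sup>+ k. ennreal ((norm (even_part g k))\<^sup>2) \<partial>count_space UNIV) \<le> 2 * (\<integral>\<^sup>+ k. ennreal ((norm (g k))\<^sup>2) \<partial>count_space UNIV)"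
proof -
  have "(\<integral>\<^sup>+ k. ennreal ((norm (even_part g k))\<^sup>2) \<partial>count_space UNIV)
      \<le> (\<integral>\<^sup>+ k. ennreal ((norm (g k))\<^sup>2) + ennreal ((norm (g (- k)))\<^sup>2) \<partial>count_space UNIV)"
    by (intro nn_integral_mono) (simp add: ennreal_plus[symmetric] norm_even_part_le del: ennreal_plus)
  also have "\<dots> = 2 * (\<integral>\<^sup>+ k. ennreal ((norm (g k))\<^sup>2) \<partial>count_space UNIV)"
    using nn_integral_bij_count_space[OF bij_uminus, of "\<lambda>k :: int^'d. ennreal ((norm (g k))\<^sup>2)"]
    by (simp add: nn_integral_add mult_2)
  finally show ?thesis .
qed

text \<open>
  The projection is self-adjoint for the real inner product and fixes the coefficients of real
  fields. Hence testing with \<open>g\<close> is the same as testing with its even part.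
\<close>

lemma inner_even_part:
  fixes u g :: "int^'d::finite \<Rightarrow> complex^'d"
  assumes u: "L2 (count_space UNIV) u" and g: "L2 (count_space UNIV) g" and sym: "\<And>k. u (- k) = cnj_vec (u k)"
  shows "(\<integral>k. u k \<bullet> even_part g k \<partial>count_space UNIV) = (\<integral>k. u k \<bullet> g k \<partial>count_space UNIV)"
proof -
  have int: "integrable (count_space UNIV) (\<lambda>k. u k \<bullet> g k)" by (rule L2_inner_integrable[OF u g])
  have "u k \<bullet> even_part g k = (u k \<bullet> g k + u (- k) \<bullet> g (- k)) / 2" for k
    by (simp add: even_part_def inner_add_right inner_cnj_vec sym)
  thus ?thesis
    using int integrable_count_space_reflect[OF int] integral_count_space_reflect[of "\<lambda>k. u k \<bullet> g k"]
    by (simp only: Bochner_Integration.integral_divide_zero Bochner_Integration.integral_add) simp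
qed

lemma sobolev_minus: "L2 torus f \<Longrightarrow> sobolev s f (- k) = cnj_vec (sobolev s f k)"
  by (simp add: sobolev_def fourier_minus linear_cmul[OF bounded_linear.linear[OF bounded_linear_cnj_vec]])

text \<open>
  Every square-integrable function of time and frequency is, up to symmetrization, the coefficient
  function of an element of \<open>L\<^sup>2(0,T;H\<^sup>s)\<close>. Since \<open>s > d / 2\<close> the unweighted coefficients \<open>h t\<close> are
  summable for almost every \<open>t\<close>, so the field is given pointwise by an absolutely convergent series.
  At the other times the integral over the frequencies still defines a function that is jointly
  measurable.
\<close>

lemma sobolev_test_function:
  fixes g :: "real \<times> (int^'d::finite) \<Rightarrow> complex^'d"
  assumes s: "real CARD('d) / 2 < s" and g: "L2 (freqtime T) g"
  obtains w where "L2Hs T s w" "AE t in time T. sobolev s (w t) = even_part (\<lambda>k. g (t, k))"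
proof -
  define h where "h t k = weight k powr (- s / 2) *\<^sub>R g (t, k)" for t k
  define w where "w t x = re_vec (synthesis (h t) x)" for t and x :: "real^'d"
  note G = L2_freqtime_sections[OF g]
  have hint: "AE t in time T. integrable (count_space UNIV) (h t)" using G(2)
  proof eventually_elim
    case (elim t)
    show ?case
      by (rule Bochner_Integration.integrable_bound[OF L2_mult_integrable[OF L2_weight(1)[OF s, of UNIV] elim]])
         (simp_all add: h_def)
  qed
  have coef: "coefficient T w"
  proof -
    have "(\<lambda>(z, k). cis (freq k \<bullet> snd z) *s h (fst z) k) \<in> borel_measurable (spacetime T \<Otimes>\<^sub>M count_space UNIV)"
    proof (rule measurable_pair_count_space, unfold prod.case)
      fix k :: "int^'d"
      have "(\<lambda>t. h t k) \<in> borel_measurable (time T)" unfolding h_def using G(1)[of k] by simp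
      from measurable_compose[OF measurable_fst this] measurable_compose[OF measurable_snd cis_freq_measurable_torus[of k]]
      show "(\<lambda>z. cis (freq k \<bullet> snd z) *s h (fst z) k) \<in> borel_measurable (spacetime T)"
        by (intro borel_measurable_bilinear[OF bounded_bilinear_smult])
    qed
    hence "(\<lambda>z. synthesis (h (fst z)) (snd z)) \<in> borel_measurable (spacetime T)"
      unfolding synthesis_def by (rule freqs.borel_measurable_lebesgue_integral)
    from measurable_compose[OF this bounded_linear_borel[OF bounded_linear_re_vec]]
    show ?thesis by (simp add: coefficient_def w_def case_prod_beta')
  qed
  have L2w: "AE t in time T. L2 torus (w t)" using hint
  proof eventually_elim
    case (elim t)
    show ?case unfolding w_def
      by (rule L2_bounded_linear[OF bounded_linear_re_vec bounded_measurable_L2_torus[OF synthesis_measurable norm_synthesis_le[OF elim]]])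
  qed
  have sob: "AE t in time T. sobolev s (w t) = even_part (\<lambda>k. g (t, k))" using hint
  proof eventually_elim
    case (elim t)
    have "fourier (w t) k = weight k powr (- s / 2) *\<^sub>R even_part (\<lambda>k. g (t, k)) k" for k
    proof -
      have "cnj_vec (h t (- k)) = weight k powr (- s / 2) *\<^sub>R cnj_vec (g (t, - k))"
        unfolding h_def using linear_cmul[OF bounded_linear.linear[OF bounded_linear_cnj_vec]] by simp
      thus ?thesis unfolding w_def fourier_re_synthesis[OF elim] even_part_def
        by (simp add: h_def scaleR_add_right)
    qed
    thus ?case by (simp only: sobolev_def weight_powr_split fun_eq_iff simp_thms)
  qed
  have sq: "ennreal ((1 + (norm (freq k))\<^sup>2) powr s * (norm (fourier f k))\<^sup>2) = ennreal ((norm (sobolev s f k))\<^sup>2)" for f and k :: "int^'d"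
  proof -
    have "(weight k powr (s / 2))\<^sup>2 = weight k powr s" by (subst powr_power) auto
    thus ?thesis by (simp add: sobolev_def power_mult_distrib weight_def)
  qed
  have "(\<integral>\<^sup>+ t. (\<Sum>\<^sub>\<infinity>k. ennreal ((1 + (norm (freq k))\<^sup>2) powr s * (norm (fourier (w t) k))\<^sup>2)) \<partial>time T)
      = (\<integral>\<^sup>+ t. \<integral>\<^sup>+ k. ennreal ((norm (even_part (\<lambda>k. g (t, k)) k))\<^sup>2) \<partial>count_space UNIV \<partial>time T)"
    unfolding sq nn_integral_count_space_eq_infsum[symmetric]
    by (rule nn_integral_cong_AE) (use sob in \<open>auto elim: eventually_mono\<close>)
  also have "\<dots> \<le> (\<integral>\<^sup>+ t. 2 * (\<integral>\<^sup>+ k. ennreal ((norm (g (t, k)))\<^sup>2) \<partial>count_space UNIV) \<partial>time T)"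
    by (intro nn_integral_mono nn_integral_even_part_le)
  also have "\<dots> = 2 * (\<integral>\<^sup>+ t. \<integral>\<^sup>+ k. ennreal ((norm (g (t, k)))\<^sup>2) \<partial>count_space UNIV \<partial>time T)"
    using L2_measurable[OF g] by (intro nn_integral_cmult freqs.borel_measurable_nn_integral) simp
  also have "\<dots> < \<infinity>"
    using g by (subst (asm) L2_freqtime_iff) (auto simp: G(1) ennreal_mult_less_top)
  finally have "L2Hs T s w" using coef L2w unfolding L2Hs_def by (intro conjI)
  thus ?thesis using sob by (rule that)
qed

text \<open>
  The inner product of \<open>H\<^sup>s\<close> is an integral over the frequencies. For real fields it does not see
  the difference between a test function and its even part, so the available test fields suffice for
  all square-integrable test functions of time and frequency.
\<close>

lemma weak_sobolev:
  fixes vs :: "nat \<Rightarrow> real \<Rightarrow> real^'d::finite \<Rightarrow> real^'d"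
  assumes weak: "weak_L2Hs_tendsto T s vs v" and s: "real CARD('d) / 2 < s"
  shows "weak_L2_tendsto (freqtime T) (\<lambda>n (t, k). sobolev s (vs n t) k) (\<lambda>(t, k). sobolev s (v t) k)"
proof -
  note parts = weak[unfolded weak_L2Hs_tendsto_def]
  have vs: "L2Hs T s (vs n)" for n by (rule parts[THEN conjunct1, rule_format])
  have v: "L2Hs T s v" by (rule parts[THEN conjunct2, THEN conjunct1])
  have lim: "(\<lambda>n. \<integral>t. Hs_inner s (vs n t) (w t) \<partial>time T) \<longlonglongrightarrow> (\<integral>t. Hs_inner s (v t) (w t) \<partial>time T)" if "L2Hs T s w" for w
    by (rule parts[THEN conjunct2, THEN conjunct2, rule_format, OF that])
  interpret P: pair_sigma_finite "time T" "count_space (UNIV :: (int^'d) set)" ..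
  have Hs: "Hs_inner s f g = (\<integral>k. sobolev s f k \<bullet> sobolev s g k \<partial>count_space UNIV)" for f g :: "real^'d \<Rightarrow> real^'d"
  proof -
    have "weight k powr s = weight k powr (s / 2) * weight k powr (s / 2)" for k :: "int^'d"
      unfolding powr_add[symmetric] by simp
    thus ?thesis unfolding Hs_inner_def integral_count_space_eq_infsum sobolev_def weight_def[symmetric] by (simp add: mult.assoc)
  qed
  show ?thesis
    unfolding weak_L2_tendsto_def
  proof (intro conjI allI impI)
    show "L2 (freqtime T) (\<lambda>(t, k). sobolev s (vs n t) k)" for n by (rule L2_sobolev[OF vs])
    show "L2 (freqtime T) (\<lambda>(t, k). sobolev s (v t) k)" by (rule L2_sobolev[OF v])
    fix g :: "real \<times> (int^'d) \<Rightarrow> complex^'d" assume g: "L2 (freqtime T) g"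
    obtain w where w: "L2Hs T s w" and sob: "AE t in time T. sobolev s (w t) = even_part (\<lambda>k. g (t, k))"
      by (rule sobolev_test_function[OF s g])
    have eq: "(\<integral>t. Hs_inner s (f t) (w t) \<partial>time T) = (\<integral>z. (case z of (t, k) \<Rightarrow> sobolev s (f t) k) \<bullet> g z \<partial>freqtime T)"
      if f: "L2Hs T s f" for f
    proof -
      note Uf = L2_sobolev[OF f] and Uw = L2_sobolev[OF w]
      have L2f: "AE t in time T. L2 torus (f t)" by (rule f[unfolded L2Hs_def, THEN conjunct2, THEN conjunct1])
      have int: "integrable (freqtime T) (\<lambda>(t, k). sobolev s (f t) k \<bullet> g (t, k))"
        using L2_inner_integrable[OF Uf g] by (simp add: case_prod_beta')
      have int': "integrable (freqtime T) (\<lambda>(t, k). sobolev s (f t) k \<bullet> sobolev s (w t) k)"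
        using L2_inner_integrable[OF Uf Uw] by (simp add: case_prod_beta')
      have "(\<integral>t. Hs_inner s (f t) (w t) \<partial>time T) = (\<integral>t. (\<integral>k. sobolev s (f t) k \<bullet> g (t, k) \<partial>count_space UNIV) \<partial>time T)"
      proof (rule integral_cong_AE)
        show "(\<lambda>t. Hs_inner s (f t) (w t)) \<in> borel_measurable (time T)"
          unfolding Hs by (rule borel_measurable_integrable[OF P.integrable_fst[OF int']])
        show "(\<lambda>t. \<integral>k. sobolev s (f t) k \<bullet> g (t, k) \<partial>count_space UNIV) \<in> borel_measurable (time T)"
          by (rule borel_measurable_integrable[OF P.integrable_fst[OF int]])
        show "AE t in time T. Hs_inner s (f t) (w t) = (\<integral>k. sobolev s (f t) k \<bullet> g (t, k) \<partial>count_space UNIV)"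
          using sob L2f L2_freqtime_sections(2)[OF Uf] L2_freqtime_sections(2)[OF g]
        proof eventually_elim
          case (elim t)
          have "L2 (count_space UNIV) (sobolev s (f t))" using elim(3) by simp
          from inner_even_part[OF this elim(4) sobolev_minus[OF elim(2)]]
          show ?case unfolding Hs elim(1) .
        qed
      qed
      also have "\<dots> = (\<integral>z. (case z of (t, k) \<Rightarrow> sobolev s (f t) k) \<bullet> g z \<partial>freqtime T)"
        using P.integral_fst[OF int] by (simp add: case_prod_beta')
      finally show ?thesis .
    qed
    show "(\<lambda>n. \<integral>z. (case z of (t, k) \<Rightarrow> sobolev s (vs n t) k) \<bullet> g z \<partial>freqtime T)
        \<longlonglongrightarrow> (\<integral>z. (case z of (t, k) \<Rightarrow> sobolev s (v t) k) \<bullet> g z \<partial>freqtime T)"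
      using lim[OF w] unfolding eq[OF vs] eq[OF v] .
  qed
qed

text \<open>
  Test functions concentrated at the single frequency \<open>k\<close> give the claim.
\<close>

lemma weak_L2_freqtime_component:
  fixes Fs :: "nat \<Rightarrow> real \<times> (int^'d::finite) \<Rightarrow> 'c::euclidean_space"
  assumes weak: "weak_L2_tendsto (freqtime T) Fs F"
  shows "weak_L2_tendsto (time T) (\<lambda>n t. Fs n (t, k)) (\<lambda>t. F (t, k))"
proof -
  note parts = weak[unfolded weak_L2_tendsto_def]
  have Fs: "L2 (freqtime T) (Fs n)" for n by (rule parts[THEN conjunct1, rule_format])
  have F: "L2 (freqtime T) F" by (rule parts[THEN conjunct2, THEN conjunct1])
  interpret P: pair_sigma_finite "time T" "count_space (UNIV :: (int^'d) set)" ..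
  have comp: "L2 (time T) (\<lambda>t. U (t, k))" if U: "L2 (freqtime T) U" for U :: "real \<times> (int^'d) \<Rightarrow> 'c"
  proof (rule L2_bound[OF L2_freqtime_sections(3)[OF U] L2_freqtime_sections(1)[OF U]])
    show "AE t in time T. norm (U (t, k)) \<le> norm (L2_norm (count_space UNIV) (\<lambda>j. U (t, j)))"
      using L2_freqtime_sections(2)[OF U]
    proof eventually_elim
      case (elim t)
      have "ennreal ((norm (U (t, k)))\<^sup>2) \<le> (\<integral>\<^sup>+ j. ennreal ((norm (U (t, j)))\<^sup>2) \<partial>count_space UNIV)"
        by (rule nn_integral_ge_point) simp
      hence "(norm (U (t, k)))\<^sup>2 \<le> (L2_norm (count_space UNIV) (\<lambda>j. U (t, j)))\<^sup>2"
        by (simp add: L2_norm_nn_integral[OF elim])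
      thus ?case using power2_le_imp_le by fastforce
    qed
  qed
  show ?thesis
    unfolding weak_L2_tendsto_def
  proof (intro conjI allI impI)
    show "L2 (time T) (\<lambda>t. Fs n (t, k))" for n by (rule comp[OF Fs])
    show "L2 (time T) (\<lambda>t. F (t, k))" by (rule comp[OF F])
    fix \<gamma> :: "real \<Rightarrow> 'c" assume \<gamma>: "L2 (time T) \<gamma>"
    define g where "g z = indicator {k} (snd z) *\<^sub>R \<gamma> (fst z)" for z :: "real \<times> (int^'d)"
    have point: "(\<integral>j. indicator {k} j * (c :: real) \<partial>count_space UNIV) = c" for c
      by (subst Bochner_Integration.integral_mult_left) (auto simp: measure_count_space)
    have "(\<integral>\<^sup>+ t. \<integral>\<^sup>+ j. ennreal ((norm (g (t, j)))\<^sup>2) \<partial>count_space UNIV \<partial>time T) = (\<integral>\<^sup>+ t. ennreal ((norm (\<gamma> t))\<^sup>2) \<partial>time T)"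
    proof (rule nn_integral_cong)
      fix t
      have "ennreal ((norm (g (t, j)))\<^sup>2) = ennreal ((norm (\<gamma> t))\<^sup>2) * indicator {k} j" for j
        by (simp add: g_def split: split_indicator)
      thus "(\<integral>\<^sup>+ j. ennreal ((norm (g (t, j)))\<^sup>2) \<partial>count_space UNIV) = ennreal ((norm (\<gamma> t))\<^sup>2)"
        by (simp add: nn_integral_cmult_indicator)
    qed
    also have "\<dots> < \<infinity>" by (simp add: L2_norm_nn_integral[OF \<gamma>])
    finally have g: "L2 (freqtime T) g"
      by (subst L2_freqtime_iff) (auto simp: g_def intro!: borel_measurable_scaleR L2_measurable[OF \<gamma>])
    have eq: "(\<integral>z. U z \<bullet> g z \<partial>freqtime T) = (\<integral>t. U (t, k) \<bullet> \<gamma> t \<partial>time T)" if U: "L2 (freqtime T) U" for U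
    proof -
      have int: "integrable (freqtime T) (\<lambda>(t, j). U (t, j) \<bullet> g (t, j))"
        using L2_inner_integrable[OF U g] by (simp add: case_prod_beta')
      have "U (t, j) \<bullet> g (t, j) = indicator {k} j * (U (t, k) \<bullet> \<gamma> t)" for t j
        by (simp add: g_def split: split_indicator)
      hence "(\<integral>j. U (t, j) \<bullet> g (t, j) \<partial>count_space UNIV) = U (t, k) \<bullet> \<gamma> t" for t by (simp only: point)
      thus ?thesis using P.integral_fst[OF int] by (simp add: case_prod_beta')
    qed
    show "(\<lambda>n. \<integral>t. Fs n (t, k) \<bullet> \<gamma> t \<partial>time T) \<longlonglongrightarrow> (\<integral>t. F (t, k) \<bullet> \<gamma> t \<partial>time T)"
      using parts[THEN conjunct2, THEN conjunct2, rule_format, OF g] unfolding eq[OF Fs] eq[OF F] .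
  qed
qed

lemma weak_L2_scaleR:
  assumes weak: "weak_L2_tendsto M fs f"
  shows "weak_L2_tendsto M (\<lambda>n x. c *\<^sub>R fs n x) (\<lambda>x. c *\<^sub>R f x)"
proof -
  note parts = weak[unfolded weak_L2_tendsto_def]
  have "(\<lambda>n. c * (\<integral>x. fs n x \<bullet> g x \<partial>M)) \<longlonglongrightarrow> c * (\<integral>x. f x \<bullet> g x \<partial>M)" if "L2 M g" for g
    by (intro tendsto_mult_left parts[THEN conjunct2, THEN conjunct2, rule_format, OF that])
  thus ?thesis
    unfolding weak_L2_tendsto_def
    using L2_scaleR[OF parts[THEN conjunct1, rule_format], of c] L2_scaleR[OF parts[THEN conjunct2, THEN conjunct1], of c] by simp
qed

text \<open>
  Boundedness of the weakly convergent sequence gives one constant \<open>K\<close> for all \<open>n\<close>, and the Sobolev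
  embedding bounds the tails by \<open>K\<close> times a factor that tends to zero with the cutoff.
\<close>

theorem weak_Sobolev_imp_spectral_convergence:
  fixes vs :: "nat \<Rightarrow> real \<Rightarrow> real^'d::finite \<Rightarrow> real^'d"
  assumes weak: "weak_L2Hs_tendsto T s vs v" and s: "real CARD('d) / 2 < s"
  shows "spectral_convergence T vs v"
proof -
  note parts = weak[unfolded weak_L2Hs_tendsto_def]
  have vs: "L2Hs T s (vs n)" for n by (rule parts[THEN conjunct1, rule_format])
  have v: "L2Hs T s v" by (rule parts[THEN conjunct2, THEN conjunct1])
  note U = weak_sobolev[OF weak s]
  obtain K where "\<forall>n. L2_norm (freqtime T) (\<lambda>(t, k). sobolev s (vs n t) k) \<le> K"
    using weak_L2_bounded[OF U] by (elim exE)
  note K = this[rule_format]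
  define K' where "K' = L2_norm (freqtime T) (\<lambda>(t, k). sobolev s (v t) k)"
  define z where "z M = sqrt (weight_tail TYPE('d) s M)" for M
  have z0: "0 \<le> z M" for M
    unfolding z_def weight_tail_def by (intro real_sqrt_ge_zero Bochner_Integration.integral_nonneg) simp
  have K0: "0 \<le> K" using K[of 0] L2_norm_nonneg order_trans by blast
  have K'0: "0 \<le> K'" by (simp add: K'_def)
  note bs = sobolev_embedding[OF s vs K, folded z_def] and b = sobolev_embedding[OF s v order_refl, folded z_def K'_def]
  have sup: "(SUP n. L2Linf_norm T (vs n)) + L2Linf_norm T v \<le> ennreal (z (-1) * K) + ennreal (z (-1) * K')"
    by (intro add_mono SUP_least bs(1) b(1))
  have tail: "(SUP n. L2Linf_norm T (\<lambda>t. fourier_tail M (vs n t))) + L2Linf_norm T (\<lambda>t. fourier_tail M (v t)) \<le> ennreal (z M * (K + K'))" for M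
  proof -
    have "(SUP n. L2Linf_norm T (\<lambda>t. fourier_tail M (vs n t))) + L2Linf_norm T (\<lambda>t. fourier_tail M (v t)) \<le> ennreal (z M * K) + ennreal (z M * K')"
      by (intro add_mono SUP_least bs(2) b(2))
    thus ?thesis using z0 K0 K'0 by (simp add: ennreal_plus[symmetric] distrib_left del: ennreal_plus)
  qed
  have "(\<lambda>M::nat. ennreal (z (real M) * (K + K'))) \<longlonglongrightarrow> ennreal (sqrt 0 * (K + K'))"
    unfolding z_def by (intro tendsto_intros weight_tail_tendsto[OF s])
  hence zlim: "(\<lambda>M::nat. ennreal (z (real M) * (K + K'))) \<longlonglongrightarrow> 0" by simp
  show ?thesis
    unfolding spectral_convergence_def
  proof (intro conjI allI)
    show "coefficient T (vs n)" for n by (rule vs[unfolded L2Hs_def, THEN conjunct1])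
    show "coefficient T v" by (rule v[unfolded L2Hs_def, THEN conjunct1])
    show "(SUP n. L2Linf_norm T (vs n)) + L2Linf_norm T v < \<infinity>" by (rule le_less_trans[OF sup]) simp
    show "(\<lambda>M::nat. (SUP n. L2Linf_norm T (\<lambda>t. fourier_tail (real M) (vs n t))) + L2Linf_norm T (\<lambda>t. fourier_tail (real M) (v t))) \<longlonglongrightarrow> 0"
      by (rule tendsto_sandwich[OF _ _ tendsto_const zlim]) (simp_all add: tail)
    show "weak_L2_tendsto (time T) (\<lambda>n t. fourier (vs n t) k) (\<lambda>t. fourier (v t) k)" for k
      using weak_L2_scaleR[OF weak_L2_freqtime_component[OF U, of k], of "weight k powr (- s / 2)"]
      by (simp only: prod.case fourier_eq_sobolev[symmetric])
  qed
qed

section \<open>The two Maxwell--Ohm systems\<close>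

lemma (in convergent_solutions) energy_dist_uniform_limit:
  "uniform_limit {0..T} (\<lambda>n t. energy_dist \<epsilon> (Xs n t) (X t)) (\<lambda>t. 0) sequentially"
proof (rule uniform_limitI)
  fix e :: real assume "0 < e"
  from uniform_limitD[OF classes_uniform_limit this]
  show "\<forall>\<^sub>F n in sequentially. \<forall>t\<in>{0..T}. dist (energy_dist \<epsilon> (Xs n t) (X t)) 0 < e"
    by eventually_elim (simp add: energy_dist_eq_dist[OF \<epsilon>] solution_in_energy_space)
qed

lemma bounded_linear_rot: "bounded_linear rot"
proof (rule bounded_linear_intro[of _ 1])
  show "norm (rot z) \<le> norm z * 1" for z :: "real^2"
    by (simp add: rot_def norm_vec_def L2_set_def UNIV_2 add.commute)
qed (simp_all add: rot_def vec_eq_iff forall_2)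

lemma bounded_bilinear_G2: "bounded_bilinear G2"
  using bounded_bilinear.comp1[OF bounded_bilinear.flip[OF bounded_bilinear_scaleR] bounded_linear_rot]
  by (simp add: G2_def[abs_def])

lemma bounded_bilinear_cross3: "bounded_bilinear cross3"
  using bilinear_cross by (simp add: bilinear_conv_bounded_bilinear)

lemma bounded_bilinear_G3: "bounded_bilinear G3"
  using bounded_bilinear_cross3 by (simp add: G3_def[abs_def])

lemma bounded_bilinear_lorentz2: "bounded_bilinear (\<lambda>j (b :: real). b *\<^sub>R rot j)"
  using bounded_bilinear_G2 by (simp add: G2_def[abs_def])

lemma convergence_cases:
  fixes vs :: "nat \<Rightarrow> real \<Rightarrow> real^'d::finite \<Rightarrow> real^'d"
  assumes "spectral_convergence T vs v \<or> (\<exists>s > real CARD('d) / 2. weak_L2Hs_tendsto T s vs v)"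
  shows "finite_mode_convergence T vs v"
  using assms
proof (elim disjE exE conjE)
  assume "spectral_convergence T vs v"
  thus ?thesis by (rule spectral_imp_finite_mode_convergence)
next
  fix s assume "real CARD('d) / 2 < s" "weak_L2Hs_tendsto T s vs v"
  thus ?thesis by (intro spectral_imp_finite_mode_convergence weak_Sobolev_imp_spectral_convergence)
qed

text \<open>
  In two dimensions \<open>G2\<close> and the Lorentz force are the same bilinear map, a rotation times a scalar; in
  three dimensions both are cross products.
\<close>

theorem theorem1p1:
  fixes T \<epsilon> \<sigma> :: real
  assumes "T > 0" and "\<epsilon> > 0" and "\<sigma> > 0"
  shows
    "(\<forall>(vs :: nat \<Rightarrow> real \<Rightarrow> real^2 \<Rightarrow> real^2) v Xs X.
        (spectral_convergence T vs v \<or> (\<exists>s > 2 / 2. weak_L2Hs_tendsto T s vs v)) \<and>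
        (\<forall>n. energy_solution2 T \<epsilon> \<sigma> (vs n) (Xs n)) \<and> energy_solution2 T \<epsilon> \<sigma> v X \<and>
        (\<lambda>n. energy_dist \<epsilon> (Xs n 0) (X 0)) \<longlonglongrightarrow> 0 \<longrightarrow>
          uniform_limit {0..T} (\<lambda>n t. energy_dist \<epsilon> (Xs n t) (X t)) (\<lambda>t. 0) sequentially \<and>
          weak_L2_tendsto (spacetime T) (\<lambda>n. current G2 \<sigma> (vs n) (Xs n)) (current G2 \<sigma> v X) \<and>
          distr_tendsto T (\<lambda>n. lorentz2 \<sigma> (vs n) (Xs n)) (lorentz2 \<sigma> v X)) \<and>
     (\<forall>(vs :: nat \<Rightarrow> real \<Rightarrow> real^3 \<Rightarrow> real^3) v Xs X.
        (spectral_convergence T vs v \<or> (\<exists>s > 3 / 2. weak_L2Hs_tendsto T s vs v)) \<and>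
        (\<forall>n. energy_solution3 T \<epsilon> \<sigma> (vs n) (Xs n)) \<and> energy_solution3 T \<epsilon> \<sigma> v X \<and>
        (\<lambda>n. energy_dist \<epsilon> (Xs n 0) (X 0)) \<longlonglongrightarrow> 0 \<longrightarrow>
          uniform_limit {0..T} (\<lambda>n t. energy_dist \<epsilon> (Xs n t) (X t)) (\<lambda>t. 0) sequentially \<and>
          weak_L2_tendsto (spacetime T) (\<lambda>n. current G3 \<sigma> (vs n) (Xs n)) (current G3 \<sigma> v X) \<and>
          distr_tendsto T (\<lambda>n. lorentz3 \<sigma> (vs n) (Xs n)) (lorentz3 \<sigma> v X))"
proof ((intro conjI; intro allI impI; elim conjE), goal_cases)
  case (1 vs v Xs X)
  interpret convergent_solutions curl_planar curl_scalar G2 T \<epsilon> \<sigma> vs v Xs X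
    by (intro convergent_solutions.intro assms bounded_bilinear_G2 convergence_cases) (use 1 in simp_all)
  have "lorentz2 \<sigma> v X = (\<lambda>z. snd (X (fst z) (snd z)) *\<^sub>R rot (current G2 \<sigma> v X z))" for v X
    by (simp add: lorentz2_def fun_eq_iff)
  with force_distr_tendsto[OF bounded_bilinear_lorentz2] energy_dist_uniform_limit currents_weak
  show ?case by (simp only: simp_thms)
next
  case (2 vs v Xs X)
  interpret convergent_solutions curl3 curl3 G3 T \<epsilon> \<sigma> vs v Xs X
    by (intro convergent_solutions.intro assms bounded_bilinear_G3 convergence_cases) (use 2 in simp_all)
  have "lorentz3 \<sigma> v X = (\<lambda>z. cross3 (current G3 \<sigma> v X z) (snd (X (fst z) (snd z))))" for v X
    by (simp add: lorentz3_def fun_eq_iff)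
  with force_distr_tendsto[OF bounded_bilinear_cross3] energy_dist_uniform_limit currents_weak
  show ?case by (simp only: simp_thms)
qed

end
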